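(* Let $d\in\mathbb{N}$, $\frac{2d}{d+1}<p<\infty$, $0<q\le\infty$, $b>-1/q$, and $\xi\in\mathbb{R}$. Then $$\mathbf{B}^{0,b}_{p,q}(\mathbb{R}^d)=B^{0,\xi}_{p,q}(\mathbb{R}^d)\quad\text{if and only if}\quad p=q=2\ \text{ and }\ \xi=b+1/2 .$$
   Context: Convention: $1/\infty=0$. Equality of spaces is with equivalence of quasi-norms. $\mathbf{B}^{0,b}_{p,q}(\mathbb{R}^d)$ is the set of $f\in L_p(\mathbb{R}^d)$ with finite quasi-norm $\|f\|_{L_p(\mathbb{R}^d)}+\left(\int_0^1((1-\log t)^b\omega_k(f,t)_p)^q\frac{dt}{t}\right)^{1/q}$ (supremum over $0<t<1$ if $q=\infty$), where $k\in\mathbb{N}$ is fixed (different $k$ give equivalent quasi-norms), $\omega_k(f,t)_p=\sup_{|h|\le t}\|\Delta_h^kf\|_{L_p(\mathbb{R}^d)}$, $\Delta^1_hf(x)=f(x+h)-f(x)$, $\Delta_h^{k+1}=\Delta_h^1\Delta_h^k$. Let $\varphi_0\in\mathcal{S}(\mathbb{R}^d)$ with $\operatorname{supp}\varphi_0\subset\{|x|\le2\}$, $\varphi_0(x)=1$ if $|x|\le1$, and $\varphi_j(x)=\varphi_0(2^{-j}x)-\varphi_0(2^{-j+1}x)$ for $j\in\mathbb{N}$. $B^{s,b}_{p,q}(\mathbb{R}^d)$ ($s,b\in\mathbb{R}$) is the set of tempered distributions $f$ with $\|f\|_{B^{s,b}_{p,q}(\mathbb{R}^d)}=\left(\sum_{j=0}^\infty(2^{js}(1+j)^b\|(\varphi_j\widehat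 f)^\vee\|_{L_p(\mathbb{R}^d)})^q\right)^{1/q}<\infty$ (supremum if $q=\infty$); it does not depend on $\varphi_0$, up to equivalent quasi-norms. *)

theory Defs
  imports "HOL-Analysis.Analysis"
begin

definition partial_deriv :: "'a::euclidean_space \<Rightarrow> ('a \<Rightarrow> complex) \<Rightarrow> 'a \<Rightarrow> complex" where
  "partial_deriv v f = (\<lambda>x. frechet_derivative f (at x) v)"

text \<open>A list of basis vectors plays the role of a multi-index.\<close>

definition iter_partial :: "'a::euclidean_space list \<Rightarrow> ('a \<Rightarrow> complex) \<Rightarrow> 'a \<Rightarrow> complex" where
  "iter_partial vs f = foldr partial_deriv vs f"

definition smooth :: "('a::euclidean_space \<Rightarrow> complex) \<Rightarrow> bool" where
  "smooth f \<longleftrightarrow> (\<forall>vs x. set vs \<subseteq> Basis \<longrightarrow> iter_partial vs f differentiable (at x))"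

definition schwartz :: "('a::euclidean_space \<Rightarrow> complex) set" where
  "schwartz = {f. smooth f \<and>
     (\<forall>vs N. set vs \<subseteq> Basis \<longrightarrow>
        bounded (range (\<lambda>x. (1 + norm x) ^ N *\<^sub>R iter_partial vs f x)))}"

text \<open>These seminorms generate the usual Frechet topology of the Schwartz space.\<close>

definition schwartz_seminorm :: "nat \<Rightarrow> ('a::euclidean_space \<Rightarrow> complex) \<Rightarrow> real" where
  "schwartz_seminorm N \<phi> =
     (SUP (vs, x) \<in> {vs. set vs \<subseteq> Basis \<and> length vs \<le> N} \<times> UNIV.
        (1 + norm x) ^ N * norm (iter_partial vs \<phi> x))"

text \<open>
  A tempered distribution is a continuous complex-linear functional on the Schwartz space.
  It is represented by a function that is \<open>undefined\<close> off the Schwartz space, so that equality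
  in HOL is equality of functionals.
\<close>

type_synonym 'a distr = "('a \<Rightarrow> complex) \<Rightarrow> complex"

definition tempered_distr :: "'a::euclidean_space distr set" where
  "tempered_distr = {u \<in> extensional schwartz.
     (\<forall>\<phi>\<in>schwartz. \<forall>\<psi>\<in>schwartz. u (\<lambda>x. \<phi> x + \<psi> x) = u \<phi> + u \<psi>) \<and>
     (\<forall>\<phi>\<in>schwartz. \<forall>c. u (\<lambda>x. c * \<phi> x) = c * u \<phi>) \<and>
     (\<exists>N C. \<forall>\<phi>\<in>schwartz. norm (u \<phi>) \<le> C * schwartz_seminorm N \<phi>)}"

definition regular_distr :: "('a::euclidean_space \<Rightarrow> complex) \<Rightarrow> 'a distr" where
  "regular_distr f = (\<lambda>\<phi>\<in>schwartz. \<integral>x. f x * \<phi> x \<partial>lborel)"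

definition mult_distr :: "('a::euclidean_space \<Rightarrow> complex) \<Rightarrow> 'a distr \<Rightarrow> 'a distr" where
  "mult_distr g u = (\<lambda>\<phi>\<in>schwartz. u (\<lambda>x. g x * \<phi> x))"

text \<open>Unitary normalisation; the Besov spaces below do not depend on this choice.\<close>

definition fourier :: "('a::euclidean_space \<Rightarrow> complex) \<Rightarrow> 'a \<Rightarrow> complex" where
  "fourier f \<xi> = of_real ((2 * pi) powr (- real DIM('a) / 2)) *
     (\<integral>x. cis (- (x \<bullet> \<xi>)) * f x \<partial>lborel)"

definition inv_fourier :: "('a::euclidean_space \<Rightarrow> complex) \<Rightarrow> 'a \<Rightarrow> complex" where
  "inv_fourier f x = of_real ((2 * pi) powr (- real DIM('a) / 2)) *
     (\<integral>\<xi>. cis (x \<bullet> \<xi>) * f \<xi> \<partial>lborel)"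

definition fourier_distr :: "'a::euclidean_space distr \<Rightarrow> 'a distr" where
  "fourier_distr u = (\<lambda>\<phi>\<in>schwartz. u (fourier \<phi>))"

definition inv_fourier_distr :: "'a::euclidean_space distr \<Rightarrow> 'a distr" where
  "inv_fourier_distr u = (\<lambda>\<phi>\<in>schwartz. u (inv_fourier \<phi>))"

text \<open>Real powers of extended nonnegative reals; only used with positive exponent.\<close>

definition epowr :: "ennreal \<Rightarrow> real \<Rightarrow> ennreal" where
  "epowr x r = (if x = \<infinity> then \<infinity> else ennreal (enn2real x powr r))"

definition Lp_norm :: "real \<Rightarrow> ('a::euclidean_space \<Rightarrow> complex) \<Rightarrow> ennreal" where
  "Lp_norm p f = epowr (\<integral>\<^sup>+x. ennreal (norm (f x) powr p) \<partial>lborel) (1 / p)"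

definition Lp :: "real \<Rightarrow> ('a::euclidean_space \<Rightarrow> complex) set" where
  "Lp p = {f \<in> borel_measurable lborel. Lp_norm p f < \<infinity>}"

text \<open>
  The quasi-norm of a distribution in \<open>L\<^sub>p\<close>; it is infinite if the distribution is not given by
  an \<open>L\<^sub>p\<close> function.  Representing functions agree almost everywhere, so the infimum only
  selects their common value.
\<close>

definition distr_Lp_norm :: "real \<Rightarrow> 'a::euclidean_space distr \<Rightarrow> ennreal" where
  "distr_Lp_norm p u = (INF f \<in> {f \<in> Lp p. regular_distr f = u}. Lp_norm p f)"

definition difference :: "'a::euclidean_space \<Rightarrow> ('a \<Rightarrow> complex) \<Rightarrow> 'a \<Rightarrow> complex" where
  "difference h f = (\<lambda>x. f (x + h) - f x)"

definition modulus :: "nat \<Rightarrow> real \<Rightarrow> ('a::euclidean_space \<Rightarrow> complex) \<Rightarrow> real \<Rightarrow> ennreal" where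
  "modulus k p f t = (SUP h \<in> {h. norm h \<le> t}. Lp_norm p ((difference h ^^ k) f))"

definition diff_besov_norm ::
    "nat \<Rightarrow> real \<Rightarrow> real \<Rightarrow> ereal \<Rightarrow> ('a::euclidean_space \<Rightarrow> complex) \<Rightarrow> ennreal" where
  "diff_besov_norm k b p q f = Lp_norm p f +
     (if q = \<infinity> then SUP t \<in> {0<..<1}. ennreal ((1 - ln t) powr b) * modulus k p f t
      else epowr
        (\<integral>\<^sup>+t \<in> {0<..<1}.
           epowr (ennreal ((1 - ln t) powr b) * modulus k p f t) (real_of_ereal q) *
           ennreal (1 / t) \<partial>lborel)
        (1 / real_of_ereal q))"

definition diff_besov ::
    "nat \<Rightarrow> real \<Rightarrow> real \<Rightarrow> ereal \<Rightarrow> ('a::euclidean_space \<Rightarrow> complex) set" where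
  "diff_besov k b p q = {f \<in> Lp p. diff_besov_norm k b p q f < \<infinity>}"

definition lp_cutoff :: "('a::euclidean_space \<Rightarrow> complex) \<Rightarrow> bool" where
  "lp_cutoff \<phi>0 \<longleftrightarrow> \<phi>0 \<in> schwartz \<and> closure {x. \<phi>0 x \<noteq> 0} \<subseteq> {x. norm x \<le> 2} \<and>
     (\<forall>x. norm x \<le> 1 \<longrightarrow> \<phi>0 x = 1)"

definition dyadic :: "('a::euclidean_space \<Rightarrow> complex) \<Rightarrow> nat \<Rightarrow> 'a \<Rightarrow> complex" where
  "dyadic \<phi>0 j = (if j = 0 then \<phi>0
     else (\<lambda>x. \<phi>0 ((2 powr (- real j)) *\<^sub>R x) - \<phi>0 ((2 powr (- real j + 1)) *\<^sub>R x)))"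

definition lp_block :: "('a::euclidean_space \<Rightarrow> complex) \<Rightarrow> nat \<Rightarrow> 'a distr \<Rightarrow> 'a distr" where
  "lp_block \<phi>0 j u = inv_fourier_distr (mult_distr (dyadic \<phi>0 j) (fourier_distr u))"

definition besov_norm ::
    "('a::euclidean_space \<Rightarrow> complex) \<Rightarrow> real \<Rightarrow> real \<Rightarrow> real \<Rightarrow> ereal \<Rightarrow> 'a distr \<Rightarrow> ennreal" where
  "besov_norm \<phi>0 s b p q u =
     (let a = (\<lambda>j. ennreal (2 powr (real j * s) * (1 + real j) powr b) *
                    distr_Lp_norm p (lp_block \<phi>0 j u))
      in if q = \<infinity> then SUP j. a j
         else epowr (\<Sum>j. epowr (a j) (real_of_ereal q)) (1 / real_of_ereal q))"

definition besov ::
    "('a::euclidean_space \<Rightarrow> complex) \<Rightarrow> real \<Rightarrow> real \<Rightarrow> real \<Rightarrow> ereal \<Rightarrow> 'a distr set" where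
  "besov \<phi>0 s b p q = {u \<in> tempered_distr. besov_norm \<phi>0 s b p q u < \<infinity>}"

text \<open>
  Functions are identified with the regular distributions they define, which in particular
  identifies functions that agree almost everywhere.  Equality includes the equivalence of
  the quasi-norms.
\<close>

definition spaces_eq ::
    "('a::euclidean_space \<Rightarrow> complex) set \<Rightarrow> (('a \<Rightarrow> complex) \<Rightarrow> ennreal) \<Rightarrow>
     'a distr set \<Rightarrow> ('a distr \<Rightarrow> ennreal) \<Rightarrow> bool" where
  "spaces_eq X nX Y nY \<longleftrightarrow> regular_distr ` X = Y \<and>
     (\<exists>c C :: real. 0 < c \<and> 0 < C \<and>
        (\<forall>f\<in>X. ennreal c * nX f \<le> nY (regular_distr f) \<and>
               nY (regular_distr f) \<le> ennreal C * nX f))"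

end

theory Submission
  imports Defs "HOL-Probability.Probability" "HOL-Real_Asymp.Real_Asymp"
begin

text \<open>
  For \<open>p = q = 2\<close> Plancherel turns both quasi-norms into weighted \<open>L\<^sub>2\<close> norms of the Fourier
  transform, with weight \<open>(1 + j) powr (2 * b + 1)\<close> at frequencies of size \<open>2 ^ j\<close>.

  Conversely, both are tested on a sum \<open>f\<close> of \<open>m \<le> N\<close> translates of one band-limited function,
  modulated to frequencies in distinct dyadic annuli of index between \<open>N\<close> and \<open>3 * N + 1\<close>.  The Besov
  norm of \<open>f\<close> is of order \<open>N powr \<xi> * m powr (1/q)\<close>.  The frequencies are odd multiples of \<open>2 ^ N\<close>,
  so a step of length \<open>pi / 2 ^ N\<close> almost changes the sign of \<open>f\<close>, and the other norm is of order
  \<open>N powr (b + 1/q)\<close> times the \<open>L\<^sub>p\<close> norm of \<open>f\<close>.  The latter is of order \<open>m powr (1/2)\<close> if the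
  translates coincide and \<open>m powr (1/p)\<close> if they are spread out (one bound each is needed, and
  follows by duality from orthogonality).  Comparing \<open>m = 1\<close> and \<open>m = N\<close> forces \<open>p = q = 2\<close>.
\<close>

subsection \<open>Iterated partial derivatives\<close>

text \<open>Membership in the Besov space only supplies a tempered distribution. The case
  \<open>p = q = 2\<close> therefore needs the L_2 Fourier transform, built here by Gaussian damping
  and truncation, and a proof that such a distribution is an L_2 function. For the modulus of
  smoothness the obstacle is that a single step may annihilate a frequency; averaging over steps
  along each axis repairs this. Conversely, the Besov bounds for packets do not depend on the
  positions of the translates, whereas the L_p norm does, so each inequality may use the arrangement
  that suits it. For \<open>p \<le> 2\<close> coinciding translates give 1/q \<le> 1/2 and spread
  ones give 1/p \<le> 1/q; for \<open>2 \<le> p\<close> the arrangements exchange roles. The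
  restriction \<open>m \<le> N\<close> keeps the weights of all occupied blocks comparable to
  \<open>N powr \<xi>\<close> and makes the error in the change of sign, of order m / 2 ^ N,
  negligible. Orthogonality gives only L_2 norms; the centred L_r bound for r < 2 comes from
  multiplying by a polynomial weight, which does not enlarge the spectrum.\<close>

lemma partial_deriv_eq: "(f has_derivative f') (at x) \<Longrightarrow> partial_deriv v f x = f' v"
  using frechet_derivative_at[of f f' x] by (simp add: partial_deriv_def)

lemma has_derivative_partial:
  "f differentiable (at x) \<Longrightarrow> (f has_derivative (\<lambda>v. partial_deriv v f x)) (at x)"
  by (simp add: partial_deriv_def frechet_derivative_works)

lemma iter_partial_Nil [simp]: "iter_partial [] f = f"
  by (simp add: iter_partial_def)

lemma iter_partial_Cons [simp]: "iter_partial (v # vs) f = partial_deriv v (iter_partial vs f)"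
  by (simp add: iter_partial_def)

lemma iter_partial_append: "iter_partial (vs @ ws) f = iter_partial vs (iter_partial ws f)"
  by (simp add: iter_partial_def)

lemma smooth_iter_differentiable:
  "smooth f \<Longrightarrow> set vs \<subseteq> Basis \<Longrightarrow> iter_partial vs f differentiable (at x)"
  by (simp add: smooth_def)

lemma smooth_differentiable: "smooth f \<Longrightarrow> f differentiable (at x)"
  using smooth_iter_differentiable[of f "[]"] by simp

lemma smooth_iter_partial: "smooth f \<Longrightarrow> set ws \<subseteq> Basis \<Longrightarrow> smooth (iter_partial ws f)"
  unfolding smooth_def by (auto simp flip: iter_partial_append)

lemma smooth_partial_deriv: "smooth f \<Longrightarrow> b \<in> Basis \<Longrightarrow> smooth (partial_deriv b f)"
  using smooth_iter_partial[of f "[b]"] by simp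

lemma smooth_continuous_on: "smooth f \<Longrightarrow> continuous_on S f"
  by (meson continuous_at_imp_continuous_on differentiable_imp_continuous_within smooth_differentiable)

lemma smooth_measurable [measurable_dest]: "smooth f \<Longrightarrow> f \<in> borel_measurable borel"
  by (simp add: borel_measurable_continuous_onI smooth_continuous_on)

text \<open>Exhibiting a class of differentiable functions that is closed under basis derivatives
  replaces an induction over derivative lists in each application; a typical class consists of all
  multiples of one function.\<close>

lemma smooth_coinduct:
  assumes "P f"
    and diff: "\<And>f x. P f \<Longrightarrow> f differentiable (at x)"
    and step: "\<And>f b. P f \<Longrightarrow> b \<in> Basis \<Longrightarrow> P (partial_deriv b f)"
  shows "smooth f"
proof -
  have "P (iter_partial vs f)" if "set vs \<subseteq> Basis" for vs
    using that by (induction vs) (auto simp: assms)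
  then show ?thesis by (simp add: smooth_def diff)
qed

lemma partial_deriv_add:
  "f differentiable (at x) \<Longrightarrow> g differentiable (at x) \<Longrightarrow>
    partial_deriv v (\<lambda>x. f x + g x) x = partial_deriv v f x + partial_deriv v g x"
  by (rule partial_deriv_eq[of _ "\<lambda>v. partial_deriv v f x + partial_deriv v g x", simplified])
     (intro has_derivative_add has_derivative_partial)

lemma partial_deriv_mult:
  "f differentiable (at x) \<Longrightarrow> g differentiable (at x) \<Longrightarrow>
    partial_deriv v (\<lambda>x. f x * g x) x = partial_deriv v f x * g x + f x * partial_deriv v g x"
  by (rule partial_deriv_eq[of _ "\<lambda>v. partial_deriv v f x * g x + f x * partial_deriv v g x", simplified])
     (auto intro!: derivative_eq_intros has_derivative_partial)

lemma partial_deriv_const [simp]: "partial_deriv v (\<lambda>x. c) = (\<lambda>x. 0)"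
  by (rule ext, rule partial_deriv_eq[of _ "\<lambda>v. 0", simplified]) simp

text \<open>Closing the smooth functions under sums and products only serves as the invariant
  that makes coinduction work for both operations at once.\<close>

inductive_set smooth_alg :: "('a::euclidean_space \<Rightarrow> complex) set" where
  base: "smooth f \<Longrightarrow> f \<in> smooth_alg"
| add: "f \<in> smooth_alg \<Longrightarrow> g \<in> smooth_alg \<Longrightarrow> (\<lambda>x. f x + g x) \<in> smooth_alg"
| mult: "f \<in> smooth_alg \<Longrightarrow> g \<in> smooth_alg \<Longrightarrow> (\<lambda>x. f x * g x) \<in> smooth_alg"

lemma smooth_alg_differentiable: "f \<in> smooth_alg \<Longrightarrow> f differentiable (at x)"
  by (induction rule: smooth_alg.induct) (auto simp: smooth_differentiable)

lemma smooth_alg_imp_smooth: "f \<in> smooth_alg \<Longrightarrow> smooth f"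
proof (erule smooth_coinduct, erule smooth_alg_differentiable)
  fix f :: "'a \<Rightarrow> complex" and b :: 'a
  assume "f \<in> smooth_alg" and b: "b \<in> Basis"
  then show "partial_deriv b f \<in> smooth_alg"
  proof (induction rule: smooth_alg.induct)
    case (base f)
    then show ?case by (simp add: smooth_partial_deriv smooth_alg.base b)
  next
    case (add f g)
    have "partial_deriv b (\<lambda>x. f x + g x) = (\<lambda>x. partial_deriv b f x + partial_deriv b g x)"
      by (rule ext, rule partial_deriv_add) (auto intro: smooth_alg_differentiable add)
    then show ?case by (auto intro: smooth_alg.add add)
  next
    case (mult f g)
    have "partial_deriv b (\<lambda>x. f x * g x) = (\<lambda>x. partial_deriv b f x * g x + f x * partial_deriv b g x)"
      by (rule ext, rule partial_deriv_mult) (auto intro: smooth_alg_differentiable mult)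
    then show ?case
      by (simp add: smooth_alg.add smooth_alg.mult mult)
  qed
qed

lemma smooth_add: "smooth f \<Longrightarrow> smooth g \<Longrightarrow> smooth (\<lambda>x. f x + g x)"
  and smooth_mult: "smooth f \<Longrightarrow> smooth g \<Longrightarrow> smooth (\<lambda>x. f x * g x)"
  by (rule smooth_alg_imp_smooth, simp add: smooth_alg.intros)+

lemma smooth_const [simp]: "smooth (\<lambda>x. c)"
  by (rule smooth_coinduct[where P = "\<lambda>f. \<exists>c. f = (\<lambda>x. c)"]) auto

lemma iter_partial_add:
  assumes "smooth f" "smooth g" "set vs \<subseteq> Basis"
  shows "iter_partial vs (\<lambda>x. f x + g x) = (\<lambda>x. iter_partial vs f x + iter_partial vs g x)"
  using assms(3)
proof (induction vs)
  case (Cons b vs)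
  then show ?case
    by (auto intro!: ext partial_deriv_add smooth_iter_differentiable assms)
qed simp

lemma iter_partial_cmult:
  assumes "smooth f" "set vs \<subseteq> Basis"
  shows "iter_partial vs (\<lambda>x. c * f x) = (\<lambda>x. c * iter_partial vs f x)"
  using assms(2)
proof (induction vs)
  case (Cons b vs)
  then show ?case
    by (auto intro!: ext simp: partial_deriv_mult smooth_iter_differentiable assms)
qed simp

lemma iter_partial_const: "vs \<noteq> [] \<Longrightarrow> iter_partial vs (\<lambda>x. c) = (\<lambda>x. 0)"
proof (induction vs)
  case (Cons b vs)
  then show ?case by (cases "vs = []") auto
qed simp

lemma partial_deriv_affine:
  assumes "f differentiable (at (s *\<^sub>R x + y))"
  shows "partial_deriv v (\<lambda>x. f (s *\<^sub>R x + y)) x = of_real s * partial_deriv v f (s *\<^sub>R x + y)"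
proof -
  have "((\<lambda>x. f (s *\<^sub>R x + y)) has_derivative (\<lambda>v. partial_deriv (s *\<^sub>R v) f (s *\<^sub>R x + y))) (at x)"
    by (rule has_derivative_compose[of "\<lambda>x. s *\<^sub>R x + y" "\<lambda>v. s *\<^sub>R v" x UNIV f, simplified])
       (auto intro!: derivative_eq_intros has_derivative_partial assms)
  then have "partial_deriv v (\<lambda>x. f (s *\<^sub>R x + y)) x = partial_deriv (s *\<^sub>R v) f (s *\<^sub>R x + y)"
    by (rule partial_deriv_eq)
  also have "\<dots> = s *\<^sub>R partial_deriv v f (s *\<^sub>R x + y)"
    using linear_scale[OF has_derivative_linear[OF has_derivative_partial[OF assms]]] by simp
  finally show ?thesis by (simp add: scaleR_conv_of_real)
qed

lemma smooth_affine: "smooth f \<Longrightarrow> smooth (\<lambda>x. f (s *\<^sub>R x + y))"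
\<comment> \<open>The invariant carries a constant \<open>c\<close> because every derivative
  contributes a factor \<open>s\<close>.\<close>
proof (rule smooth_coinduct[where P = "\<lambda>h. \<exists>c f. smooth f \<and> h = (\<lambda>x. c * f (s *\<^sub>R x + y))"])
  show "smooth f \<Longrightarrow> \<exists>c f'. smooth f' \<and> (\<lambda>x. f (s *\<^sub>R x + y)) = (\<lambda>x. c * f' (s *\<^sub>R x + y))"
    by (rule exI[of _ 1]) auto
next
  fix h :: "'a \<Rightarrow> complex" and x
  assume "\<exists>c f. smooth f \<and> h = (\<lambda>x. c * f (s *\<^sub>R x + y))"
  then obtain c f where f: "smooth f" "h = (\<lambda>x. c * f (s *\<^sub>R x + y))" by blast
  have d: "(\<lambda>x. f (s *\<^sub>R x + y)) differentiable (at x)" for x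
    by (rule differentiable_compose[of f "\<lambda>x. s *\<^sub>R x + y"]) (auto simp: smooth_differentiable f)
  then show "h differentiable (at x)" by (auto simp: f)
  fix b :: 'a assume b: "b \<in> Basis"
  have "partial_deriv b h = (\<lambda>x. (c * of_real s) * partial_deriv b f (s *\<^sub>R x + y))"
    using d by (auto simp: f partial_deriv_mult partial_deriv_affine smooth_differentiable)
  with smooth_partial_deriv[OF f(1) b]
  show "\<exists>c f. smooth f \<and> partial_deriv b h = (\<lambda>x. c * f (s *\<^sub>R x + y))" by blast
qed

lemma iter_partial_affine:
  assumes "smooth f" "set vs \<subseteq> Basis"
  shows "iter_partial vs (\<lambda>x. f (s *\<^sub>R x + y)) =
    (\<lambda>x. of_real s ^ length vs * iter_partial vs f (s *\<^sub>R x + y))"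
  using assms(2)
proof (induction vs)
  case (Cons b vs)
  have sm: "smooth (iter_partial vs f)" using Cons assms by (simp add: smooth_iter_partial)
  show ?case using Cons
    by (auto intro!: ext simp: partial_deriv_mult partial_deriv_affine smooth_differentiable sm
        smooth_affine[OF sm])
qed simp

text \<open>Each derivative splits a product into two, whence the factor 2 ^ n. The innermost
  derivative is removed first: the product rule then leaves two products of smooth functions, to
  which the induction hypothesis, general in \<open>f\<close> and \<open>g\<close>, applies.\<close>

lemma leibniz_bound:
  fixes f g :: "'a::euclidean_space \<Rightarrow> complex"
  assumes "smooth f" "smooth g" "set vs \<subseteq> Basis" "length vs \<le> n"
    and "\<And>ws. set ws \<subseteq> Basis \<Longrightarrow> length ws \<le> n \<Longrightarrow> norm (iter_partial ws f x) \<le> A"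
    and "\<And>ws. set ws \<subseteq> Basis \<Longrightarrow> length ws \<le> n \<Longrightarrow> norm (iter_partial ws g x) \<le> B"
  shows "norm (iter_partial vs (\<lambda>x. f x * g x) x) \<le> 2 ^ n * (A * B)"
  using assms
proof (induction n arbitrary: f g vs)
  case 0
  have "norm (f x) \<le> A" "norm (g x) \<le> B" using 0(5)[of "[]"] 0(6)[of "[]"] by auto
  then have "norm (f x) * norm (g x) \<le> A * B"
    by (intro mult_mono) (auto intro: order_trans[OF norm_ge_zero])
  with 0 show ?case by (simp add: norm_mult)
next
  case (Suc n)
  have fg: "norm (f x) \<le> A" "norm (g x) \<le> B" using Suc(6)[of "[]"] Suc(7)[of "[]"] by auto
  then have pos: "0 \<le> A * B" and AB: "norm (f x) * norm (g x) \<le> A * B"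
    by (auto intro!: mult_mono mult_nonneg_nonneg intro: order_trans[OF norm_ge_zero])
  show ?case
  proof (cases vs rule: rev_cases)
    case Nil
    have "1 * (A * B) \<le> 2 ^ Suc n * (A * B)"
      by (rule mult_right_mono[OF one_le_power pos]) simp
    with Nil AB show ?thesis by (simp add: norm_mult)
  next
    case (snoc ws b)
    then have b: "b \<in> Basis" and ws: "set ws \<subseteq> Basis" "length ws \<le> n" using Suc by auto
    note sm = Suc(2,3) smooth_partial_deriv[OF Suc(2) b] smooth_partial_deriv[OF Suc(3) b]
    have bd: "norm (iter_partial us f x) \<le> A" "norm (iter_partial us g x) \<le> B"
      "norm (iter_partial us (partial_deriv b f) x) \<le> A"
      "norm (iter_partial us (partial_deriv b g) x) \<le> B"
      if "set us \<subseteq> Basis" "length us \<le> n" for us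
      using that Suc(6)[of us] Suc(7)[of us] Suc(6)[of "us @ [b]"] Suc(7)[of "us @ [b]"] b
      by (auto simp: iter_partial_append)
    have "partial_deriv b (\<lambda>x. f x * g x) = (\<lambda>x. partial_deriv b f x * g x + f x * partial_deriv b g x)"
      by (rule ext, rule partial_deriv_mult) (auto simp: smooth_differentiable Suc)
    then have "iter_partial vs (\<lambda>x. f x * g x) x =
        iter_partial ws (\<lambda>x. partial_deriv b f x * g x) x + iter_partial ws (\<lambda>x. f x * partial_deriv b g x) x"
      by (simp add: snoc iter_partial_append iter_partial_add smooth_mult sm ws)
    moreover have "norm (iter_partial ws (\<lambda>x. partial_deriv b f x * g x) x) \<le> 2 ^ n * (A * B)"
      by (rule Suc.IH) (use sm ws bd in auto)
    moreover have "norm (iter_partial ws (\<lambda>x. f x * partial_deriv b g x) x) \<le> 2 ^ n * (A * B)"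
      by (rule Suc.IH) (use sm ws bd in auto)
    ultimately show ?thesis
      using norm_triangle_ineq[of "iter_partial ws (\<lambda>x. partial_deriv b f x * g x) x"
          "iter_partial ws (\<lambda>x. f x * partial_deriv b g x) x"] by simp
  qed
qed

subsection \<open>Bounded sets of Schwartz functions and of slowly increasing functions\<close>

text \<open>Bounded subsets of the Schwartz space, with a single index for the weight and for the
  order of differentiation. Families are treated instead of single functions because later constants
  must be uniform over dyadic scales and over frequencies.\<close>

definition sbdd :: "('a::euclidean_space \<Rightarrow> complex) set \<Rightarrow> bool" where
  "sbdd B \<longleftrightarrow> (\<forall>f\<in>B. smooth f) \<and>
     (\<forall>N. \<exists>C. \<forall>f\<in>B. \<forall>vs x. set vs \<subseteq> Basis \<longrightarrow> length vs \<le> N \<longrightarrow>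
        (1 + norm x) ^ N * norm (iter_partial vs f x) \<le> C)"

text \<open>Uniform families of multipliers. The growth exponent may depend on the order
  \<open>n\<close> but not on the member, so that multiplication maps bounded sets of Schwartz
  functions to bounded sets.\<close>

definition slow :: "('a::euclidean_space \<Rightarrow> complex) set \<Rightarrow> bool" where
  "slow A \<longleftrightarrow> (\<forall>f\<in>A. smooth f) \<and>
     (\<forall>n. \<exists>C N. \<forall>f\<in>A. \<forall>vs x. set vs \<subseteq> Basis \<longrightarrow> length vs \<le> n \<longrightarrow>
        norm (iter_partial vs f x) \<le> C * (1 + norm x) ^ N)"

lemma sbdd_subset: "sbdd B \<Longrightarrow> A \<subseteq> B \<Longrightarrow> sbdd A"
  unfolding sbdd_def by (meson subsetD)

lemma slow_subset: "slow B \<Longrightarrow> A \<subseteq> B \<Longrightarrow> slow A"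
  unfolding slow_def by (meson subsetD)

lemma sbddD:
  assumes "sbdd B"
  obtains C where "0 \<le> C" "\<And>f vs x. f \<in> B \<Longrightarrow> set vs \<subseteq> Basis \<Longrightarrow> length vs \<le> N \<Longrightarrow>
    norm (iter_partial vs f x) \<le> C / (1 + norm x) ^ N"
proof -
  obtain C where C: "\<And>f vs x. f \<in> B \<Longrightarrow> set vs \<subseteq> Basis \<Longrightarrow> length vs \<le> N \<Longrightarrow>
        (1 + norm x) ^ N * norm (iter_partial vs f x) \<le> C"
    using assms unfolding sbdd_def by meson
  have "norm (iter_partial vs f x) \<le> max C 0 / (1 + norm x) ^ N"
    if "f \<in> B" "set vs \<subseteq> Basis" "length vs \<le> N" for f vs x
  proof -
    have "0 < (1 + norm x) ^ N" by (intro zero_less_power add_pos_nonneg) auto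
    then show ?thesis using C[OF that, of x] by (simp add: field_simps max_def)
  qed
  then show ?thesis using that[of "max C 0"] by auto
qed

lemma sbddI:
  assumes "\<And>f. f \<in> B \<Longrightarrow> smooth f"
    and "\<And>N. \<exists>C. \<forall>f\<in>B. \<forall>vs x. set vs \<subseteq> Basis \<longrightarrow> length vs \<le> N \<longrightarrow>
        norm (iter_partial vs f x) \<le> C / (1 + norm x) ^ N"
  shows "sbdd B"
proof -
  have pos: "0 < (1 + norm x) ^ N" for x :: 'a and N
    by (intro zero_less_power add_pos_nonneg) auto
  show ?thesis unfolding sbdd_def using assms
    by (simp add: pos_le_divide_eq[OF pos] mult.commute)
qed

lemma sbdd_smooth: "sbdd B \<Longrightarrow> f \<in> B \<Longrightarrow> smooth f" and slow_smooth: "slow B \<Longrightarrow> f \<in> B \<Longrightarrow> smooth f"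
  by (auto simp: sbdd_def slow_def)

lemma sbdd_mult:
  assumes A: "slow A" and B: "sbdd B"
  shows "sbdd {\<lambda>x. f x * g x |f g. f \<in> A \<and> g \<in> B}"
proof (rule sbddI)
  show "smooth h" if "h \<in> {\<lambda>x. f x * g x |f g. f \<in> A \<and> g \<in> B}" for h
    using that sbdd_smooth[OF B] slow_smooth[OF A] by (auto intro: smooth_mult)
  fix N
  obtain C M where C: "\<And>f vs x. f \<in> A \<Longrightarrow> set vs \<subseteq> Basis \<Longrightarrow> length vs \<le> N \<Longrightarrow>
        norm (iter_partial vs f x) \<le> C * (1 + norm x) ^ M"
    using A unfolding slow_def by meson
  \<comment> \<open>Decay of order \<open>N + M\<close> pays for the growth of order
    \<open>M\<close> of the multiplier.\<close>
  obtain D where D: "0 \<le> D" "\<And>f vs x. f \<in> B \<Longrightarrow> set vs \<subseteq> Basis \<Longrightarrow> length vs \<le> N + M \<Longrightarrow>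
      norm (iter_partial vs f x) \<le> D / (1 + norm x) ^ (N + M)"
    using sbddD[OF B, of "N + M"] by blast
  have "norm (iter_partial vs (\<lambda>x. f x * g x) x) \<le> 2 ^ N * (C * D) / (1 + norm x) ^ N"
    if "f \<in> A" "g \<in> B" "set vs \<subseteq> Basis" "length vs \<le> N" for f g vs and x :: 'a
  proof -
    have "norm (iter_partial vs (\<lambda>x. f x * g x) x) \<le>
        2 ^ N * ((C * (1 + norm x) ^ M) * (D / (1 + norm x) ^ (N + M)))"
      using that C D sbdd_smooth[OF B] slow_smooth[OF A] by (intro leibniz_bound) auto
    also have "\<dots> = 2 ^ N * (C * D) / (1 + norm x) ^ N"
      using add_pos_nonneg[OF zero_less_one norm_ge_zero[of x]] by (simp add: power_add field_simps)
    finally show ?thesis .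
  qed
  then show "\<exists>C. \<forall>h\<in>{\<lambda>x. f x * g x |f g. f \<in> A \<and> g \<in> B}. \<forall>vs x. set vs \<subseteq> Basis \<longrightarrow>
      length vs \<le> N \<longrightarrow> norm (iter_partial vs h x) \<le> C / (1 + norm x) ^ N"
    by blast
qed

lemma slow_mult:
  assumes A: "slow A" and B: "slow B"
  shows "slow {\<lambda>x. f x * g x |f g. f \<in> A \<and> g \<in> B}"
  unfolding slow_def
proof (intro conjI allI)
  show "\<forall>h\<in>{\<lambda>x. f x * g x |f g. f \<in> A \<and> g \<in> B}. smooth h"
    using slow_smooth[OF A] slow_smooth[OF B] by (auto intro: smooth_mult)
  fix n
  obtain C M where C: "\<And>f vs x. f \<in> A \<Longrightarrow> set vs \<subseteq> Basis \<Longrightarrow> length vs \<le> n \<Longrightarrow>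
        norm (iter_partial vs f x) \<le> C * (1 + norm x) ^ M"
    using A unfolding slow_def by meson
  obtain D K where D: "\<And>f vs x. f \<in> B \<Longrightarrow> set vs \<subseteq> Basis \<Longrightarrow> length vs \<le> n \<Longrightarrow>
        norm (iter_partial vs f x) \<le> D * (1 + norm x) ^ K"
    using B unfolding slow_def by meson
  have "norm (iter_partial vs (\<lambda>x. f x * g x) x) \<le> 2 ^ n * (C * D) * (1 + norm x) ^ (M + K)"
    if "f \<in> A" "g \<in> B" "set vs \<subseteq> Basis" "length vs \<le> n" for f g vs and x :: 'a
  proof -
    have "norm (iter_partial vs (\<lambda>x. f x * g x) x) \<le>
        2 ^ n * ((C * (1 + norm x) ^ M) * (D * (1 + norm x) ^ K))"
      using that C D slow_smooth[OF B] slow_smooth[OF A] by (intro leibniz_bound) auto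
    then show ?thesis by (simp add: power_add mult_ac)
  qed
  then show "\<exists>C N. \<forall>h\<in>{\<lambda>x. f x * g x |f g. f \<in> A \<and> g \<in> B}. \<forall>vs x. set vs \<subseteq> Basis \<longrightarrow>
      length vs \<le> n \<longrightarrow> norm (iter_partial vs h x) \<le> C * (1 + norm x) ^ N"
    by blast
qed

lemma slow_add:
  assumes A: "slow A" and B: "slow B"
  shows "slow {\<lambda>x. f x + g x |f g. f \<in> A \<and> g \<in> B}"
  unfolding slow_def
proof (intro conjI allI)
  show "\<forall>h\<in>{\<lambda>x. f x + g x |f g. f \<in> A \<and> g \<in> B}. smooth h"
    using slow_smooth[OF A] slow_smooth[OF B] by (auto intro: smooth_add)
  fix n
  obtain C M where C: "\<And>f vs x. f \<in> A \<Longrightarrow> set vs \<subseteq> Basis \<Longrightarrow> length vs \<le> n \<Longrightarrow>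
        norm (iter_partial vs f x) \<le> C * (1 + norm x) ^ M"
    using A unfolding slow_def by meson
  obtain D K where D: "\<And>f vs x. f \<in> B \<Longrightarrow> set vs \<subseteq> Basis \<Longrightarrow> length vs \<le> n \<Longrightarrow>
        norm (iter_partial vs f x) \<le> D * (1 + norm x) ^ K"
    using B unfolding slow_def by meson
  have "norm (iter_partial vs (\<lambda>x. f x + g x) x) \<le> (\<bar>C\<bar> + \<bar>D\<bar>) * (1 + norm x) ^ (M + K)"
    if h: "f \<in> A" "g \<in> B" "set vs \<subseteq> Basis" "length vs \<le> n" for f g vs and x :: 'a
  proof -
    have "norm (iter_partial vs (\<lambda>x. f x + g x) x) \<le> C * (1 + norm x) ^ M + D * (1 + norm x) ^ K"
      using h C[OF h(1,3,4), of x] D[OF h(2,3,4), of x] slow_smooth[OF B] slow_smooth[OF A]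
      by (auto simp: iter_partial_add intro!: norm_triangle_le)
    also have "\<dots> \<le> \<bar>C\<bar> * (1 + norm x) ^ (M + K) + \<bar>D\<bar> * (1 + norm x) ^ (M + K)"
      by (intro add_mono mult_mono power_increasing) auto
    finally show ?thesis by (simp add: algebra_simps)
  qed
  then show "\<exists>C N. \<forall>h\<in>{\<lambda>x. f x + g x |f g. f \<in> A \<and> g \<in> B}. \<forall>vs x. set vs \<subseteq> Basis \<longrightarrow>
      length vs \<le> n \<longrightarrow> norm (iter_partial vs h x) \<le> C * (1 + norm x) ^ N"
    by blast
qed

lemma sbdd_add:
  assumes A: "sbdd A" and B: "sbdd B"
  shows "sbdd {\<lambda>x. f x + g x |f g. f \<in> A \<and> g \<in> B}"
proof (rule sbddI)
  show "smooth h" if "h \<in> {\<lambda>x. f x + g x |f g. f \<in> A \<and> g \<in> B}" for h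
    using that sbdd_smooth[OF B] sbdd_smooth[OF A] by (auto intro: smooth_add)
  fix N
  obtain C where C: "\<And>f vs x. f \<in> A \<Longrightarrow> set vs \<subseteq> Basis \<Longrightarrow> length vs \<le> N \<Longrightarrow>
      norm (iter_partial vs f x) \<le> C / (1 + norm x) ^ N"
    using sbddD[OF A, of N] by metis
  obtain D where D: "\<And>f vs x. f \<in> B \<Longrightarrow> set vs \<subseteq> Basis \<Longrightarrow> length vs \<le> N \<Longrightarrow>
      norm (iter_partial vs f x) \<le> D / (1 + norm x) ^ N"
    using sbddD[OF B, of N] by metis
  have "norm (iter_partial vs (\<lambda>x. f x + g x) x) \<le> (C + D) / (1 + norm x) ^ N"
    if h: "f \<in> A" "g \<in> B" "set vs \<subseteq> Basis" "length vs \<le> N" for f g vs and x :: 'a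
    using h C[OF h(1,3,4), of x] D[OF h(2,3,4), of x] sbdd_smooth[OF B] sbdd_smooth[OF A]
      by (auto simp: iter_partial_add add_divide_distrib intro!: norm_triangle_le)
  then show "\<exists>C. \<forall>h\<in>{\<lambda>x. f x + g x |f g. f \<in> A \<and> g \<in> B}. \<forall>vs x. set vs \<subseteq> Basis \<longrightarrow>
      length vs \<le> N \<longrightarrow> norm (iter_partial vs h x) \<le> C / (1 + norm x) ^ N"
    by blast
qed

lemma sbdd_iter_partial:
  assumes B: "sbdd B" and vs: "set vs \<subseteq> Basis"
  shows "sbdd (iter_partial vs ` B)"
proof (rule sbddI)
  show "smooth h" if "h \<in> iter_partial vs ` B" for h
    using that sbdd_smooth[OF B] vs by (auto intro: smooth_iter_partial)
  fix N
  obtain C where C: "0 \<le> C" "\<And>f ws x. f \<in> B \<Longrightarrow> set ws \<subseteq> Basis \<Longrightarrow> length ws \<le> N + length vs \<Longrightarrow>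
      norm (iter_partial ws f x) \<le> C / (1 + norm x) ^ (N + length vs)"
    using sbddD[OF B, of "N + length vs"] by metis
  have "norm (iter_partial ws (iter_partial vs f) x) \<le> C / (1 + norm x) ^ N"
    if h: "f \<in> B" "set ws \<subseteq> Basis" "length ws \<le> N" for f ws and x :: 'a
  proof -
    have "norm (iter_partial (ws @ vs) f x) \<le> C / (1 + norm x) ^ (N + length vs)"
      using h vs by (intro C) auto
    also have "\<dots> \<le> C / (1 + norm x) ^ N"
      by (intro divide_left_mono power_increasing mult_pos_pos zero_less_power C add_pos_nonneg) auto
    finally show ?thesis by (simp add: iter_partial_append)
  qed
  then show "\<exists>C. \<forall>h\<in>iter_partial vs ` B. \<forall>vs x. set vs \<subseteq> Basis \<longrightarrow>
      length vs \<le> N \<longrightarrow> norm (iter_partial vs h x) \<le> C / (1 + norm x) ^ N"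
    by blast
qed

text \<open>The definition of \<open>schwartz\<close> bounds each derivative separately. Only
  finitely many lists over \<open>Basis\<close> have length at most \<open>N\<close>, so the sum of
  their individual constants serves all of them at once.\<close>

lemma schwartz_iff: "f \<in> schwartz \<longleftrightarrow> sbdd {f}"
proof
  assume f: "f \<in> schwartz"
  show "sbdd {f}" unfolding sbdd_def
  proof (intro conjI allI)
    show "\<forall>f\<in>{f}. smooth f" using f by (auto simp: schwartz_def)
    fix N
    let ?V = "{vs::'a list. set vs \<subseteq> Basis \<and> length vs \<le> N}"
    have fin: "finite ?V" by (rule finite_lists_length_le) simp
    have "\<forall>vs\<in>?V. \<exists>C. \<forall>x. (1 + norm x) ^ N * norm (iter_partial vs f x) \<le> C"
    proof
      fix vs assume "vs \<in> ?V"
      then have "bounded (range (\<lambda>x. (1 + norm x) ^ N *\<^sub>R iter_partial vs f x))"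
        using f by (auto simp: schwartz_def)
      then show "\<exists>C. \<forall>x. (1 + norm x) ^ N * norm (iter_partial vs f x) \<le> C"
        by (auto simp: bounded_iff)
    qed
    then obtain C where C: "\<And>vs x. vs \<in> ?V \<Longrightarrow> (1 + norm x) ^ N * norm (iter_partial vs f x) \<le> C vs"
      by metis
    have "(1 + norm x) ^ N * norm (iter_partial vs f x) \<le> (\<Sum>vs\<in>?V. \<bar>C vs\<bar>)" if "vs \<in> ?V" for vs x
      using C[OF that, of x] member_le_sum[OF that, of "\<lambda>vs. \<bar>C vs\<bar>"] fin by auto
    then show "\<exists>C. \<forall>f\<in>{f}. \<forall>vs x. set vs \<subseteq> Basis \<longrightarrow> length vs \<le> N \<longrightarrow>
        (1 + norm x) ^ N * norm (iter_partial vs f x) \<le> C" by auto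
  qed
next
  assume f: "sbdd {f}"
  have "bounded (range (\<lambda>x. (1 + norm x) ^ N *\<^sub>R iter_partial vs f x))" if vs: "set vs \<subseteq> Basis" for vs N
  proof -
    \<comment> \<open>Since \<open>sbdd\<close> couples weight and order, the index has to dominate
      both.\<close>
    let ?M = "max N (length vs)"
    obtain C where C: "\<And>x. (1 + norm x) ^ ?M * norm (iter_partial vs f x) \<le> C"
      using f vs unfolding sbdd_def by (metis max.cobounded2 singletonI)
    have "(1 + norm x) ^ N * norm (iter_partial vs f x) \<le> C" for x
      by (rule order_trans[OF _ C[of x]]) (intro mult_right_mono power_increasing, auto)
    then show ?thesis by (auto simp: bounded_iff)
  qed
  then show "f \<in> schwartz" using f by (auto simp: schwartz_def sbdd_def)
qed

lemma sbdd_imp_schwartz: "sbdd B \<Longrightarrow> f \<in> B \<Longrightarrow> f \<in> schwartz"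
  by (auto simp: schwartz_iff intro: sbdd_subset)

lemma schwartz_smooth: "f \<in> schwartz \<Longrightarrow> smooth f"
  by (simp add: schwartz_def)

lemma schwartz_measurable [measurable_dest]: "f \<in> schwartz \<Longrightarrow> f \<in> borel_measurable borel"
  by (simp add: schwartz_smooth smooth_measurable)

lemma schwartz_mult: "slow {f} \<Longrightarrow> g \<in> schwartz \<Longrightarrow> (\<lambda>x. f x * g x) \<in> schwartz"
  using sbdd_mult[of "{f}" "{g}"] by (auto simp: schwartz_iff)

lemma schwartz_add: "f \<in> schwartz \<Longrightarrow> g \<in> schwartz \<Longrightarrow> (\<lambda>x. f x + g x) \<in> schwartz"
  using sbdd_add[of "{f}" "{g}"] by (auto simp: schwartz_iff)

lemma schwartz_iter_partial: "f \<in> schwartz \<Longrightarrow> set vs \<subseteq> Basis \<Longrightarrow> iter_partial vs f \<in> schwartz"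
  using sbdd_iter_partial[of "{f}" vs] by (auto simp: schwartz_iff)

lemma schwartz_partial_deriv: "f \<in> schwartz \<Longrightarrow> b \<in> Basis \<Longrightarrow> partial_deriv b f \<in> schwartz"
  using schwartz_iter_partial[of f "[b]"] by simp

lemma slow_const: "slow {\<lambda>x. c}"
  unfolding slow_def
proof (intro conjI allI)
  fix n :: nat
  have "norm (iter_partial vs (\<lambda>x::'a. c) x) \<le> norm c * (1 + norm x) ^ 0" for vs x
    by (cases "vs = []") (auto simp: iter_partial_const)
  then show "\<exists>C N. \<forall>f\<in>{\<lambda>x::'a. c}. \<forall>vs x. set vs \<subseteq> Basis \<longrightarrow> length vs \<le> n \<longrightarrow>
       norm (iter_partial vs f x) \<le> C * (1 + norm x) ^ N" by blast
qed simp

lemma schwartz_cmult: "f \<in> schwartz \<Longrightarrow> (\<lambda>x. c * f x) \<in> schwartz"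
  by (rule schwartz_mult[OF slow_const])

lemma schwartz_zero: "(\<lambda>x. 0) \<in> schwartz"
  unfolding schwartz_iff
proof (rule sbddI)
  fix N
  have "norm (iter_partial vs (\<lambda>x::'a. 0::complex) x) \<le> 0 / (1 + norm x) ^ N" for vs x
    by (cases "vs = []") (auto simp: iter_partial_const)
  then show "\<exists>C. \<forall>f\<in>{\<lambda>x::'a. 0}. \<forall>vs x. set vs \<subseteq> Basis \<longrightarrow> length vs \<le> N \<longrightarrow>
       norm (iter_partial vs f x) \<le> C / (1 + norm x) ^ N" by blast
qed simp

lemma schwartz_diff: "f \<in> schwartz \<Longrightarrow> g \<in> schwartz \<Longrightarrow> (\<lambda>x. f x - g x) \<in> schwartz"
  using schwartz_add[of f "\<lambda>x. (-1) * g x"] schwartz_cmult[of g "-1"] by simp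

lemma schwartz_sum: "(\<And>i. i \<in> I \<Longrightarrow> f i \<in> schwartz) \<Longrightarrow> (\<lambda>x. \<Sum>i\<in>I. f i x) \<in> schwartz"
  by (induction I rule: infinite_finite_induct) (auto intro: schwartz_add schwartz_zero)

lemma slow_mult1: "slow {f} \<Longrightarrow> slow {g} \<Longrightarrow> slow {\<lambda>x. f x * g x}"
  using slow_mult[of "{f}" "{g}"] by auto

lemma slow_add1: "slow {f} \<Longrightarrow> slow {g} \<Longrightarrow> slow {\<lambda>x. f x + g x}"
  using slow_add[of "{f}" "{g}"] by auto

lemma partial_deriv_inner: "partial_deriv v (\<lambda>x. of_real (x \<bullet> y)) = (\<lambda>x. of_real (v \<bullet> y))"
  by (rule ext, rule partial_deriv_eq) (auto intro!: derivative_eq_intros)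

lemma slow_inner: "slow {\<lambda>x. of_real (x \<bullet> y)}"
  unfolding slow_def
proof (intro conjI allI)
  have "smooth (\<lambda>x. of_real (x \<bullet> y))"
    by (rule smooth_coinduct[where P = "\<lambda>f. f = (\<lambda>x. of_real (x \<bullet> y)) \<or> (\<exists>c. f = (\<lambda>x. c))"])
       (auto simp: partial_deriv_inner intro!: bounded_linear_imp_differentiable[OF
          bounded_linear_compose[OF bounded_linear_of_real bounded_linear_inner_left]])
  then show "\<forall>f\<in>{\<lambda>x. of_real (x \<bullet> y)}. smooth f" by simp
  fix n :: nat
  have "norm (iter_partial vs (\<lambda>x. of_real (x \<bullet> y)) x) \<le> norm y * (1 + norm x) ^ 1"
    if "set vs \<subseteq> Basis" for vs x
  proof (cases vs rule: rev_cases)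
    case Nil
    then show ?thesis using Cauchy_Schwarz_ineq2[of x y]
      by (auto simp: algebra_simps intro: add_increasing)
  next
    case (snoc ws b)
    then have "norm b = 1" using that by auto
    then have "\<bar>b \<bullet> y\<bar> \<le> norm y" using Cauchy_Schwarz_ineq2[of b y] by simp
    moreover have "norm y \<le> norm y * (1 + norm x)" by (simp add: algebra_simps)
    ultimately show ?thesis using snoc
      by (cases "ws = []") (auto simp: iter_partial_append partial_deriv_inner iter_partial_const)
  qed
  then show "\<exists>C N. \<forall>f\<in>{\<lambda>x. of_real (x \<bullet> y)}. \<forall>vs x. set vs \<subseteq> Basis \<longrightarrow> length vs \<le> n \<longrightarrow>
       norm (iter_partial vs f x) \<le> C * (1 + norm x) ^ N" by blast
qed

lemma has_derivative_cis:
  "((\<lambda>x. cis (a * (x \<bullet> y))) has_derivative (\<lambda>v. \<i> * of_real (a * (v \<bullet> y)) * cis (a * (x \<bullet> y)))) (at x)"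
proof -
  have "((\<lambda>x. exp (\<i> * of_real (a * (x \<bullet> y)))) has_derivative
      (\<lambda>v. exp (\<i> * of_real (a * (x \<bullet> y))) * (\<i> * of_real (a * (v \<bullet> y))))) (at x)"
    by (rule has_derivative_compose[OF _ DERIV_exp[unfolded has_field_derivative_def], of _ _ _ UNIV, simplified])
       (auto intro!: derivative_eq_intros)
  then show ?thesis by (simp add: cis_conv_exp mult_ac)
qed

lemma slow_cis: "slow {\<lambda>x. cis (a * (x \<bullet> y))}"
  unfolding slow_def
proof (intro conjI allI)
  have d: "partial_deriv v (\<lambda>x. cis (a * (x \<bullet> y))) = (\<lambda>x. \<i> * of_real (a * (v \<bullet> y)) * cis (a * (x \<bullet> y)))" for v
    by (rule ext, rule partial_deriv_eq[OF has_derivative_cis])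
  have df: "(\<lambda>x. cis (a * (x \<bullet> y))) differentiable (at x)" for x
    using has_derivative_cis differentiable_def by blast
  have dc: "partial_deriv v (\<lambda>x. c * cis (a * (x \<bullet> y))) = (\<lambda>x. (c * (\<i> * of_real (a * (v \<bullet> y)))) * cis (a * (x \<bullet> y)))" for v c
    by (rule ext) (simp add: partial_deriv_mult df d)
  have "smooth (\<lambda>x. cis (a * (x \<bullet> y)))"
    by (rule smooth_coinduct[where P = "\<lambda>f. \<exists>c. f = (\<lambda>x. c * cis (a * (x \<bullet> y)))"])
       (force simp: dc df intro: exI[of _ 1])+
  then show "\<forall>f\<in>{\<lambda>x. cis (a * (x \<bullet> y))}. smooth f" by simp
  fix n :: nat
  \<comment> \<open>Every derivative of a character is a constant multiple of it, and each basis
    derivative costs at most a factor \<open>\<bar>a\<bar> * norm y\<close>; hence all derivatives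
    are bounded and the growth exponent 0 suffices.\<close>
  have *: "\<exists>c. norm c \<le> (\<bar>a\<bar> * norm y) ^ length vs \<and>
      iter_partial vs (\<lambda>x. cis (a * (x \<bullet> y))) = (\<lambda>x. c * cis (a * (x \<bullet> y)))"
    if "set vs \<subseteq> Basis" for vs
    using that
  proof (induction vs)
    case Nil
    show ?case by (auto intro!: exI[of _ 1])
  next
    case (Cons b vs)
    then obtain c where c: "norm c \<le> (\<bar>a\<bar> * norm y) ^ length vs"
      "iter_partial vs (\<lambda>x. cis (a * (x \<bullet> y))) = (\<lambda>x. c * cis (a * (x \<bullet> y)))" by auto
    have "\<bar>b \<bullet> y\<bar> \<le> norm y" using Cauchy_Schwarz_ineq2[of b y] Cons by auto
    then have "norm (c * (\<i> * of_real (a * (b \<bullet> y)))) \<le> (\<bar>a\<bar> * norm y) ^ length vs * (\<bar>a\<bar> * norm y)"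
      using c by (simp add: norm_mult abs_mult) (intro mult_mono, auto)
    then show ?case by (intro exI[of _ "c * (\<i> * of_real (a * (b \<bullet> y)))"]) (simp add: c dc mult_ac)
  qed
  have "norm (iter_partial vs (\<lambda>x. cis (a * (x \<bullet> y))) x) \<le> (1 + \<bar>a\<bar> * norm y) ^ n * (1 + norm x) ^ 0"
    if h: "set vs \<subseteq> Basis" "length vs \<le> n" for vs x
  proof -
    obtain c where c: "norm c \<le> (\<bar>a\<bar> * norm y) ^ length vs"
      "iter_partial vs (\<lambda>x. cis (a * (x \<bullet> y))) = (\<lambda>x. c * cis (a * (x \<bullet> y)))" using *[OF h(1)] by auto
    note c(1)
    also have "(\<bar>a\<bar> * norm y) ^ length vs \<le> (1 + \<bar>a\<bar> * norm y) ^ length vs"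
      by (intro power_mono) auto
    also have "\<dots> \<le> (1 + \<bar>a\<bar> * norm y) ^ n" by (intro power_increasing h) auto
    finally show ?thesis by (simp add: c norm_mult)
  qed
  then show "\<exists>C N. \<forall>f\<in>{\<lambda>x. cis (a * (x \<bullet> y))}. \<forall>vs x. set vs \<subseteq> Basis \<longrightarrow> length vs \<le> n \<longrightarrow>
       norm (iter_partial vs f x) \<le> C * (1 + norm x) ^ N" by blast
qed

subsection \<open>Integrals of rapidly decreasing functions\<close>

lemma integrable_inverse_square_real: "integrable lborel (\<lambda>x::real. inverse (1 + x\<^sup>2))"
  using integrable_inverse_1_plus_square by (simp add: set_integrable_def)

lemma one_plus_norm_pos: "0 < 1 + norm x"
  by (simp add: add_pos_nonneg)

text \<open>For every basis vector \<open>b\<close>, (1 + norm x)^2 dominates 1 + (x \<bullet> b)^2.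
  Hence 2 d powers dominate a product of d one-dimensional functions, each with an integrable
  reciprocal.\<close>

lemma integrable_decay:
  assumes N: "2 * DIM('a) \<le> N"
  shows "integrable lborel (\<lambda>x::'a::euclidean_space. 1 / (1 + norm x) ^ N)"
proof (rule integrableI_bounded)
  let ?I = "nn_integral lborel (\<lambda>x::real. ennreal (inverse (1 + x\<^sup>2)))"
  have bd: "ennreal (norm (1 / (1 + norm x) ^ N)) \<le> (\<Prod>b\<in>Basis. ennreal (inverse (1 + (x \<bullet> b)\<^sup>2)))"
    for x :: 'a
  proof -
    have "(\<Prod>b\<in>(Basis::'a set). 1 + (x \<bullet> b)\<^sup>2) \<le> (\<Prod>b\<in>(Basis::'a set). (1 + norm x)\<^sup>2)"
    proof (rule prod_mono)
      fix b :: 'a assume "b \<in> Basis"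
      then have "(x \<bullet> b)\<^sup>2 \<le> (norm x)\<^sup>2"
        using Basis_le_norm[of b x] by (metis abs_ge_zero power2_abs power_mono)
      then show "0 \<le> 1 + (x \<bullet> b)\<^sup>2 \<and> 1 + (x \<bullet> b)\<^sup>2 \<le> (1 + norm x)\<^sup>2"
        by (auto simp: power2_sum intro: add_increasing2)
    qed
    also have "\<dots> = (1 + norm x) ^ (2 * DIM('a))" by (simp add: power_mult)
    also have "\<dots> \<le> (1 + norm x) ^ N" by (intro power_increasing N) auto
    finally have "inverse ((1 + norm x) ^ N) \<le> inverse (\<Prod>b\<in>(Basis::'a set). 1 + (x \<bullet> b)\<^sup>2)"
      by (intro le_imp_inverse_le prod_pos) (auto intro: add_pos_nonneg)
    then show ?thesis
      using one_plus_norm_pos[of x]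
      by (subst prod_ennreal) (auto simp: prod_inversef[symmetric] inverse_eq_divide[symmetric] o_def
          intro!: ennreal_leI)
  qed
  have "(\<integral>\<^sup>+x. ennreal (norm (1 / (1 + norm (x::'a)) ^ N)) \<partial>lborel) \<le>
      (\<integral>\<^sup>+x. (\<Prod>b\<in>(Basis::'a set). ennreal (inverse (1 + (x \<bullet> b)\<^sup>2))) \<partial>lborel)"
    by (intro nn_integral_mono bd)
  also have "\<dots> = (\<Prod>b\<in>(Basis::'a set). ?I)"
    by (rule nn_integral_lborel_prod) auto
  also have "\<dots> < \<infinity>"
    using integrable_inverse_square_real
    by (auto simp: integrable_iff_bounded ennreal_prod_eq_top less_top[symmetric] abs_of_nonneg
        power_eq_top_ennreal)
  finally show "(\<integral>\<^sup>+x. ennreal (norm (1 / (1 + norm (x::'a)) ^ N)) \<partial>lborel) < \<infinity>" .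
qed auto

lemma schwartz_decay:
  assumes "f \<in> schwartz"
  obtains C where "0 \<le> C" "\<And>x. norm (f x) \<le> C / (1 + norm x) ^ N"
proof -
  obtain C where C: "0 \<le> C" "\<And>vs x. set vs \<subseteq> Basis \<Longrightarrow> length vs \<le> N \<Longrightarrow>
      norm (iter_partial vs f x) \<le> C / (1 + norm x) ^ N"
    using sbddD[of "{f}" N] assms unfolding schwartz_iff by (metis singletonI)
  then show ?thesis using C(2)[of "[]"] that by simp
qed

lemma schwartz_integrable: "f \<in> schwartz \<Longrightarrow> integrable lborel f"
proof -
  assume f: "f \<in> schwartz"
  obtain C where C: "0 \<le> C" "\<And>x. norm (f x) \<le> C / (1 + norm x) ^ (2 * DIM('a))"
    using schwartz_decay[OF f] by blast
  show "integrable lborel f"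
  proof (rule Bochner_Integration.integrable_bound)
    show "integrable lborel (\<lambda>x. C * (1 / (1 + norm (x::'a)) ^ (2 * DIM('a))))"
      by (intro integrable_mult_right integrable_decay) simp
    show "f \<in> borel_measurable lborel" using f by measurable
    show "AE x in lborel. norm (f x) \<le> norm (C * (1 / (1 + norm x) ^ (2 * DIM('a))))"
      using C by (auto intro!: AE_I2 order_trans[OF C(2)] simp: abs_mult)
  qed
qed

lemma lborel_integral_translate:
  fixes f :: "'a::euclidean_space \<Rightarrow> 'b::{banach, second_countable_topology}"
  assumes "f \<in> borel_measurable borel"
  shows "(\<integral>x. f (x + y) \<partial>lborel) = (\<integral>x. f x \<partial>lborel)"
  using integral_distr[of "(+) y" lborel borel f] assms
  by (simp add: lborel_distr_plus add.commute)

lemma lborel_nn_integral_translate: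
  fixes f :: "'a::euclidean_space \<Rightarrow> ennreal"
  assumes "f \<in> borel_measurable borel"
  shows "(\<integral>\<^sup>+x. f (x + y) \<partial>lborel) = (\<integral>\<^sup>+x. f x \<partial>lborel)"
  using nn_integral_distr[of "(+) y" lborel borel f] assms
  by (simp add: lborel_distr_plus add.commute)

lemma lborel_integrable_translate:
  fixes f :: "'a::euclidean_space \<Rightarrow> 'b::{banach, second_countable_topology}"
  assumes "integrable lborel f"
  shows "integrable lborel (\<lambda>x. f (x + y))"
proof -
  have "f \<in> borel_measurable borel" using assms by auto
  then show ?thesis
    using assms integrable_distr_eq[of "(+) y" lborel borel f]
    by (simp add: lborel_distr_plus add.commute)
qed

lemma lborel_integral_affine:
  fixes f :: "'a::euclidean_space \<Rightarrow> 'b::{banach, second_countable_topology}"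
  assumes f: "f \<in> borel_measurable borel" and c: "c \<noteq> 0"
  shows "(\<integral>x. f x \<partial>lborel) = \<bar>c\<bar> ^ DIM('a) *\<^sub>R (\<integral>x. f (t + c *\<^sub>R x) \<partial>lborel)"
  using f by (subst lborel_affine[OF c, of t]) (simp add: integral_density integral_distr)

lemma lborel_nn_integral_affine:
  fixes f :: "'a::euclidean_space \<Rightarrow> ennreal"
  assumes f: "f \<in> borel_measurable borel" and c: "c \<noteq> 0"
  shows "(\<integral>\<^sup>+x. f x \<partial>lborel) = ennreal (\<bar>c\<bar> ^ DIM('a)) * (\<integral>\<^sup>+x. f (t + c *\<^sub>R x) \<partial>lborel)"
  using f by (subst lborel_affine[OF c, of t])
    (simp add: nn_integral_density nn_integral_distr nn_integral_cmult)

lemma lborel_integral_uminus: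
  fixes f :: "'a::euclidean_space \<Rightarrow> 'b::{banach, second_countable_topology}"
  assumes f: "f \<in> borel_measurable borel"
  shows "(\<integral>x. f (- x) \<partial>lborel) = (\<integral>x. f x \<partial>lborel)"
  using lborel_integral_affine[OF f, of "-1" 0] by simp

lemma inverse_power_le_aux:
  fixes a c :: real
  assumes "a ^ n \<le> 2 ^ n * c ^ n" "0 < a" "0 < c"
  shows "1 / c ^ n \<le> 2 ^ n / a ^ n"
  using assms by (simp add: field_simps)

text \<open>Mean value inequality on the unit ball about \<open>x\<close>, where
  \<open>1 + norm x \<le> 2 * (1 + norm z)\<close>; this gives the factor 2 ^ (N + 1), while the
  dimension comes from expanding the direction in the basis. The bound dominates difference
  quotients and later controls differences in L_p.\<close>

lemma schwartz_shift_decay: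
  fixes f :: "'a::euclidean_space \<Rightarrow> complex"
  assumes f: "f \<in> schwartz"
  obtains C where "0 \<le> C"
    "\<And>x h. norm h \<le> 1 \<Longrightarrow> norm (f (x + h) - f x) \<le> C * norm h / (1 + norm x) ^ N"
proof -
  obtain C where C: "0 \<le> C" "\<And>vs x. set vs \<subseteq> Basis \<Longrightarrow> length vs \<le> N + 1 \<Longrightarrow>
      norm (iter_partial vs f x) \<le> C / (1 + norm x) ^ (N + 1)"
    using sbddD[of "{f}" "N + 1"] f unfolding schwartz_iff by (metis singletonI)
  have "norm (f (x + h) - f x) \<le> (DIM('a) * C * 2 ^ (N + 1)) * norm h / (1 + norm x) ^ N"
    if h: "norm h \<le> 1" for x h :: 'a
  proof -
    have seg: "x + t *\<^sub>R h \<in> cball x 1" if "t \<in> {0..1}" for t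
      proof -
        have "\<bar>t\<bar> * norm h \<le> 1 * 1" using that h by (intro mult_mono) auto
        then show ?thesis by (simp add: dist_norm)
      qed
    have onb: "onorm (\<lambda>v. partial_deriv v f z) \<le> DIM('a) * (C * 2 ^ (N + 1) / (1 + norm x) ^ N)"
      if z: "z \<in> cball x 1" for z
    proof -
      have d: "(f has_derivative (\<lambda>v. partial_deriv v f z)) (at z)"
        by (rule has_derivative_partial[OF smooth_differentiable[OF schwartz_smooth[OF f]]])
      have "norm x \<le> norm z + 1" using z norm_triangle_sub[of x z] by (simp add: dist_norm)
      then have "1 + norm x \<le> 2 * (1 + norm z)" using norm_ge_zero[of z] by (simp only: distrib_left)
      then have "(1 + norm x) ^ (N + 1) \<le> (2 * (1 + norm z)) ^ (N + 1)"
        by (intro power_mono) auto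
      then have zx: "1 / (1 + norm z) ^ (N + 1) \<le> 2 ^ (N + 1) / (1 + norm x) ^ (N + 1)"
        by (intro inverse_power_le_aux one_plus_norm_pos) (simp only: power_mult_distrib)
      also have "\<dots> \<le> 2 ^ (N + 1) / (1 + norm x) ^ N"
        by (intro divide_left_mono power_increasing mult_pos_pos zero_less_power one_plus_norm_pos) auto
      finally have zx: "C / (1 + norm z) ^ (N + 1) \<le> C * 2 ^ (N + 1) / (1 + norm x) ^ N"
        using mult_left_mono[OF _ C(1)] by fastforce
      have pb: "norm (partial_deriv b f z) \<le> C * 2 ^ (N + 1) / (1 + norm x) ^ N" if "b \<in> Basis" for b
        using C(2)[of "[b]" z] zx that by auto
      show "onorm (\<lambda>v. partial_deriv v f z) \<le> DIM('a) * (C * 2 ^ (N + 1) / (1 + norm x) ^ N)"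
      proof (rule onorm_le)
        fix v :: 'a
        have lin: "linear (\<lambda>v. partial_deriv v f z)" using d by (rule has_derivative_linear)
        have "partial_deriv v f z = (\<Sum>b\<in>Basis. (v \<bullet> b) *\<^sub>R partial_deriv b f z)"
          by (subst euclidean_representation[of v, symmetric])
             (simp add: linear_sum[OF lin] linear_scale[OF lin])
        also have "norm \<dots> \<le> (\<Sum>b\<in>(Basis::'a set). norm v * (C * 2 ^ (N + 1) / (1 + norm x) ^ N))"
        proof (intro sum_norm_le)
          fix b :: 'a assume "b \<in> Basis"
          then show "norm ((v \<bullet> b) *\<^sub>R partial_deriv b f z) \<le> norm v * (C * 2 ^ (N + 1) / (1 + norm x) ^ N)"
            unfolding norm_scaleR by (intro mult_mono pb Basis_le_norm) auto
        qed
        finally have "norm (partial_deriv v f z) \<le> DIM('a) * (norm v * (C * 2 ^ (N + 1) / (1 + norm x) ^ N))"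
          by simp
        then show "norm (partial_deriv v f z) \<le> DIM('a) * (C * 2 ^ (N + 1) / (1 + norm x) ^ N) * norm v"
          by (simp only: mult.commute[of "norm v"] mult.assoc)
      qed
    qed
    have "norm (f (x + h) - f x) \<le> norm h * (DIM('a) * (C * 2 ^ (N + 1) / (1 + norm x) ^ N))"
      by (rule differentiable_bound_segment[where G = "cball x 1" and f' = "\<lambda>z v. partial_deriv v f z"])
         (erule seg onb[OF seg] | rule has_derivative_at_withinI[OF has_derivative_partial[OF
            smooth_differentiable[OF schwartz_smooth[OF f]]]])+
    then show ?thesis by (simp add: mult_ac)
  qed
  then show ?thesis using that C(1) by (metis mult_nonneg_nonneg of_nat_0_le_iff zero_le_numeral zero_le_power)
qed

text \<open>By translation invariance every difference quotient has integral zero;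
  \<open>schwartz_shift_decay\<close> provides the majorant for passing to the limit along the steps
  1 / (n + 1).\<close>

lemma integral_partial_deriv:
  fixes f :: "'a::euclidean_space \<Rightarrow> complex"
  assumes f: "f \<in> schwartz" and b: "b \<in> Basis"
  shows "(\<integral>x. partial_deriv b f x \<partial>lborel) = 0"
proof -
  let ?h = "\<lambda>n. (1 / real (Suc n)) *\<^sub>R b"
  let ?D = "\<lambda>n x. of_nat (Suc n) * (f (x + ?h n) - f x)"
  obtain C where C: "0 \<le> C" "\<And>x h. norm h \<le> 1 \<Longrightarrow>
      norm (f (x + h) - f x) \<le> C * norm h / (1 + norm x) ^ (2 * DIM('a))"
    using schwartz_shift_decay[OF f] by metis
  have [measurable]: "f \<in> borel_measurable borel" using f by measurable
  have "(\<lambda>n. \<integral>x. ?D n x \<partial>lborel) \<longlonglongrightarrow> (\<integral>x. partial_deriv b f x \<partial>lborel)"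
  proof (rule integral_dominated_convergence[where w = "\<lambda>x. C * (1 / (1 + norm x) ^ (2 * DIM('a)))"])
    show "partial_deriv b f \<in> borel_measurable lborel"
      using schwartz_measurable[OF schwartz_partial_deriv[OF f b]] by simp
    show "integrable lborel (\<lambda>x. C * (1 / (1 + norm (x::'a)) ^ (2 * DIM('a))))"
      by (intro integrable_mult_right integrable_decay) simp
    show "AE x in lborel. (\<lambda>n. ?D n x) \<longlonglongrightarrow> partial_deriv b f x"
    proof (rule AE_I2)
      fix x
      have d: "(f has_derivative (\<lambda>v. partial_deriv v f x)) (at x)"
        by (rule has_derivative_partial[OF smooth_differentiable[OF schwartz_smooth[OF f]]])
      have lin: "linear (\<lambda>v. partial_deriv v f x)" using d by (rule has_derivative_linear)
      have "?h \<longlonglongrightarrow> 0 *\<^sub>R b"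
        by (intro tendsto_scaleR tendsto_const LIMSEQ_Suc[OF lim_1_over_n])
      then have "filterlim ?h (at 0) sequentially"
        using b by (auto simp: filterlim_at nonzero_Basis)
      from filterlim_compose[OF conjunct2[OF d[unfolded has_derivative_at]] this]
      have "(\<lambda>n. norm (f (x + ?h n) - f x - partial_deriv (?h n) f x) / norm (?h n)) \<longlonglongrightarrow> 0" .
      moreover have "norm (f (x + ?h n) - f x - partial_deriv (?h n) f x) / norm (?h n) =
          norm (?D n x - partial_deriv b f x)" for n
      proof -
        have "?D n x - partial_deriv b f x =
            of_nat (Suc n) * (f (x + ?h n) - f x - partial_deriv (?h n) f x)"
          by (simp add: linear_scale[OF lin] scaleR_conv_of_real field_simps del: of_nat_Suc)
        then show ?thesis using b by (simp add: norm_mult del: of_nat_Suc)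
      qed
      ultimately show "(\<lambda>n. ?D n x) \<longlonglongrightarrow> partial_deriv b f x"
        by (simp add: tendsto_norm_zero_iff LIM_zero_iff del: of_nat_Suc)
    qed
    fix n
    have "norm (?D n x) \<le> C * (1 / (1 + norm x) ^ (2 * DIM('a)))" for x
    proof -
      have "norm (?h n) = 1 / real (Suc n)" using b by simp
      then have "norm (f (x + ?h n) - f x) \<le> C * (1 / real (Suc n)) / (1 + norm x) ^ (2 * DIM('a))"
        using C(2)[of "?h n" x] by simp
      from mult_left_mono[OF this, of "real (Suc n)"]
      show ?thesis by (simp add: norm_mult del: of_nat_Suc)
    qed
    then show "AE x in lborel. norm (?D n x) \<le> C * (1 / (1 + norm x) ^ (2 * DIM('a)))" by simp
  qed simp
  moreover have "(\<integral>x. ?D n x \<partial>lborel) = 0" for n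
    using lborel_integrable_translate[OF schwartz_integrable[OF f], of "?h n"] schwartz_integrable[OF f]
    by (simp add: Bochner_Integration.integral_diff lborel_integral_translate)
  ultimately show ?thesis using LIMSEQ_unique tendsto_const by (metis (no_types, lifting) ext)
qed

subsection \<open>The Fourier transform on the Schwartz space\<close>

abbreviation fc :: "'a::euclidean_space itself \<Rightarrow> real" where
  "fc T \<equiv> (2 * pi) powr (- real DIM('a) / 2)"

lemma integrable_bounded_mult:
  fixes f g :: "'a::euclidean_space \<Rightarrow> complex"
  assumes f: "integrable lborel f" and g: "g \<in> borel_measurable borel" "\<And>x. norm (g x) \<le> C"
  shows "integrable lborel (\<lambda>x. g x * f x)"
proof (rule Bochner_Integration.integrable_bound[where f = "\<lambda>x. C * norm (f x)"])
  show "integrable lborel (\<lambda>x. C * norm (f x))" using f by simp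
  show "(\<lambda>x. g x * f x) \<in> borel_measurable lborel" using f g by auto
  have "norm (g x * f x) \<le> norm (C * norm (f x))" for x
    using g(2)[of x] by (auto simp: norm_mult abs_mult intro!: mult_right_mono)
  then show "AE x in lborel. norm (g x * f x) \<le> norm (C * norm (f x))" by simp
qed

lemma cis_inner_measurable [measurable]:
  "(\<lambda>x::'a::euclidean_space. cis (a * (x \<bullet> y))) \<in> borel_measurable borel"
  "(\<lambda>x::'a::euclidean_space. cis (x \<bullet> y)) \<in> borel_measurable borel"
  "(\<lambda>x::'a::euclidean_space. cis (- (x \<bullet> y))) \<in> borel_measurable borel"
  by (auto intro!: borel_measurable_continuous_onI continuous_intros simp: cis_conv_exp)

lemma integrable_cis_mult:
  fixes f :: "'a::euclidean_space \<Rightarrow> complex"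
  assumes f: "integrable lborel f"
  shows "integrable lborel (\<lambda>x. cis (- (x \<bullet> y)) * f x)" "integrable lborel (\<lambda>x. cis (x \<bullet> y) * f x)"
  by (rule integrable_bounded_mult[OF f, of _ 1]; simp)+

lemma inv_fourier_eq: "inv_fourier f x = fourier f (- x)"
  by (simp add: inv_fourier_def fourier_def inner_commute)

lemma fourier_uminus:
  fixes f :: "'a::euclidean_space \<Rightarrow> complex"
  assumes f: "f \<in> borel_measurable borel"
  shows "fourier (\<lambda>x. f (- x)) \<xi> = fourier f (- \<xi>)"
proof -
  have "(\<lambda>x. cis (x \<bullet> \<xi>) * f x) \<in> borel_measurable borel" using f by simp
  from lborel_integral_uminus[OF this] show ?thesis by (simp add: fourier_def)
qed

lemma norm_fourier_le: "norm (fourier f \<xi>) \<le> fc TYPE('a) * (\<integral>x. norm (f x) \<partial>lborel)"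
  for f :: "'a::euclidean_space \<Rightarrow> complex"
proof -
  have "norm (\<integral>x. cis (- (x \<bullet> \<xi>)) * f x \<partial>lborel) \<le> (\<integral>x. norm (cis (- (x \<bullet> \<xi>)) * f x) \<partial>lborel)"
    by (rule integral_norm_bound)
  then show ?thesis by (simp add: fourier_def norm_mult mult_left_mono)
qed

lemma fourier_add:
  "integrable lborel f \<Longrightarrow> integrable lborel g \<Longrightarrow> fourier (\<lambda>x. f x + g x) \<xi> = fourier f \<xi> + fourier g \<xi>"
  by (simp add: fourier_def distrib_left integrable_cis_mult)

lemma fourier_cmult: "fourier (\<lambda>x. c * f x) \<xi> = c * fourier f \<xi>"
proof -
  have "(\<lambda>x. cis (- (x \<bullet> \<xi>)) * (c * f x)) = (\<lambda>x. c * (cis (- (x \<bullet> \<xi>)) * f x))" by (simp add: mult_ac)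
  then show ?thesis by (simp only: fourier_def) simp
qed

lemma fourier_sum:
  "(\<And>i. i \<in> I \<Longrightarrow> integrable lborel (f i)) \<Longrightarrow> fourier (\<lambda>x. \<Sum>i\<in>I. f i x) \<xi> = (\<Sum>i\<in>I. fourier (f i) \<xi>)"
  by (simp add: fourier_def sum_distrib_left integrable_cis_mult)

lemma schwartz_mult_cis: "f \<in> schwartz \<Longrightarrow> (\<lambda>x. cis (a * (x \<bullet> y)) * f x) \<in> schwartz"
  by (rule schwartz_mult[OF slow_cis])

lemma slow_neg_i_inner: "slow {\<lambda>x. - \<i> * of_real (x \<bullet> y)}"
  by (rule slow_mult1[OF slow_const slow_inner])

lemma schwartz_mult_inner: "f \<in> schwartz \<Longrightarrow> (\<lambda>x. - \<i> * of_real (x \<bullet> y) * f x) \<in> schwartz"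
  by (rule schwartz_mult[OF slow_neg_i_inner])

text \<open>Integration by parts without boundary terms: the derivative of the product of
  \<open>f\<close> with the character has integral zero, and the product rule separates the two
  contributions.\<close>

lemma fourier_partial_deriv:
  fixes f :: "'a::euclidean_space \<Rightarrow> complex"
  assumes f: "f \<in> schwartz" and b: "b \<in> Basis"
  shows "fourier (partial_deriv b f) \<xi> = \<i> * of_real (\<xi> \<bullet> b) * fourier f \<xi>"
proof -
  let ?c = "\<lambda>x. cis ((-1) * (x \<bullet> \<xi>))"
  have df: "f differentiable (at x)" "?c differentiable (at x)" for x
    using smooth_differentiable[OF schwartz_smooth[OF f]] has_derivative_cis differentiable_def by blast+
  have dc: "partial_deriv b ?c x = \<i> * of_real ((-1) * (b \<bullet> \<xi>)) * ?c x" for x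
    by (rule partial_deriv_eq[OF has_derivative_cis])
  have i1: "integrable lborel (\<lambda>x. ?c x * f x)" and i2: "integrable lborel (\<lambda>x. ?c x * partial_deriv b f x)"
    by (intro schwartz_integrable schwartz_mult_cis f schwartz_partial_deriv b)+
  have "0 = (\<integral>x. partial_deriv b (\<lambda>x. ?c x * f x) x \<partial>lborel)"
    by (rule integral_partial_deriv[OF schwartz_mult_cis[OF f] b, symmetric])
  also have "\<dots> = (\<integral>x. (- \<i> * of_real (\<xi> \<bullet> b)) * (?c x * f x) + ?c x * partial_deriv b f x \<partial>lborel)"
    unfolding partial_deriv_mult[OF df(2) df(1)] dc
    by (intro Bochner_Integration.integral_cong refl) (simp add: inner_commute algebra_simps)
  also have "\<dots> = (- \<i> * of_real (\<xi> \<bullet> b)) * (\<integral>x. ?c x * f x \<partial>lborel) + (\<integral>x. ?c x * partial_deriv b f x \<partial>lborel)"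
    using i1 i2 by (subst Bochner_Integration.integral_add) (auto simp del: mult_minus_left)
  finally show ?thesis by (simp add: fourier_def algebra_simps)
qed

lemma cis_remainder: "norm (cis t - 1 - \<i> * of_real t) \<le> t\<^sup>2"
proof -
  have "norm (iexp t - (\<Sum>k\<le>1. (\<i> * of_real t) ^ k / fact k)) \<le> \<bar>t\<bar> ^ (Suc 1) / fact (Suc 1)"
    by (rule iexp_approx1)
  moreover have "(\<Sum>k\<le>1. (\<i> * of_real t) ^ k / fact k) = 1 + \<i> * of_real t" by simp
  ultimately have "norm (cis t - (1 + \<i> * of_real t)) \<le> \<bar>t\<bar> ^ 2 / 2"
    by (simp only: cis_conv_exp) (simp add: numeral_2_eq_2)
  then show ?thesis using norm_ge_zero[of "cis t - (1 + \<i> * of_real t)"]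
    by (simp add: diff_diff_eq del: norm_ge_zero)
qed

lemma power_cancel_aux: "0 < a \<Longrightarrow> (a\<^sup>2 * b) * (C / a ^ (n + 2)) = (C * (1 / a ^ n)) * b" for a :: real
  by (simp add: power_add power2_eq_square)

text \<open>The first-order Taylor remainder of the exponential is at most (x \<bullet> h)^2, so the
  remainder of the transform is bounded by a constant times (norm h)^2.\<close>

lemma fourier_has_derivative:
  fixes f :: "'a::euclidean_space \<Rightarrow> complex"
  assumes f: "f \<in> schwartz"
  shows "(fourier f has_derivative (\<lambda>v. fourier (\<lambda>x. - \<i> * of_real (x \<bullet> v) * f x) \<xi>)) (at \<xi>)"
  unfolding has_derivative_at
proof
  have li: "linear (\<lambda>v. fourier (\<lambda>x. - \<i> * of_real (x \<bullet> v) * f x) \<xi>)"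
  proof
    fix v w
    have "(\<lambda>x. - \<i> * of_real (x \<bullet> (v + w)) * f x) =
        (\<lambda>x. - \<i> * of_real (x \<bullet> v) * f x + - \<i> * of_real (x \<bullet> w) * f x)"
      by (simp add: inner_add_right algebra_simps)
    then show "fourier (\<lambda>x. - \<i> * of_real (x \<bullet> (v + w)) * f x) \<xi> =
        fourier (\<lambda>x. - \<i> * of_real (x \<bullet> v) * f x) \<xi> + fourier (\<lambda>x. - \<i> * of_real (x \<bullet> w) * f x) \<xi>"
      using fourier_add[OF schwartz_integrable[OF schwartz_mult_inner[OF f]]
          schwartz_integrable[OF schwartz_mult_inner[OF f]]] by simp
  next
    fix r :: real and v
    have "(\<lambda>x. - \<i> * of_real (x \<bullet> (r *\<^sub>R v)) * f x) = (\<lambda>x. of_real r * (- \<i> * of_real (x \<bullet> v) * f x))"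
      by (simp add: algebra_simps)
    then show "fourier (\<lambda>x. - \<i> * of_real (x \<bullet> (r *\<^sub>R v)) * f x) \<xi> =
        r *\<^sub>R fourier (\<lambda>x. - \<i> * of_real (x \<bullet> v) * f x) \<xi>"
      by (simp only: fourier_cmult scaleR_conv_of_real)
  qed
  then show "bounded_linear (\<lambda>v. fourier (\<lambda>x. - \<i> * of_real (x \<bullet> v) * f x) \<xi>)"
    by (simp add: linear_conv_bounded_linear)
  \<comment> \<open>Two powers of decay beyond integrability absorb the square of
    \<open>norm x\<close> in the Taylor remainder.\<close>
  obtain C where C: "0 \<le> C" "\<And>x. norm (f x) \<le> C / (1 + norm x) ^ (2 * DIM('a) + 2)"
    using schwartz_decay[OF f] by blast
  let ?K = "fc TYPE('a) * (\<integral>x. C * (1 / (1 + norm (x::'a)) ^ (2 * DIM('a))) \<partial>lborel)"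
  let ?dq = "\<lambda>h. fourier f (\<xi> + h) - fourier f \<xi> - fourier (\<lambda>x. - \<i> * of_real (x \<bullet> h) * f x) \<xi>"
  have bd: "norm (?dq h)
      \<le> ?K * (norm h)\<^sup>2" for h
  proof -
    let ?A = "\<lambda>x. cis (- (x \<bullet> (\<xi> + h))) * f x" and ?B = "\<lambda>x. cis (- (x \<bullet> \<xi>)) * f x"
      and ?D = "\<lambda>x. cis (- (x \<bullet> \<xi>)) * (- \<i> * of_real (x \<bullet> h) * f x)"
    have i: "integrable lborel ?A" "integrable lborel ?B" "integrable lborel ?D"
      by (intro integrable_cis_mult schwartz_integrable schwartz_mult_inner f)+
    have "norm (?A x - ?B x - ?D x) \<le> (C * (1 / (1 + norm x) ^ (2 * DIM('a)))) * (norm h)\<^sup>2" for x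
    proof -
      have "?A x - ?B x - ?D x = cis (- (x \<bullet> \<xi>)) * ((cis (- (x \<bullet> h)) - 1 - \<i> * of_real (- (x \<bullet> h))) * f x)"
      proof -
        have "cis (- (x \<bullet> (\<xi> + h))) = cis (- (x \<bullet> \<xi>)) * cis (- (x \<bullet> h))"
          by (simp add: cis_mult inner_add_right)
        then show ?thesis by (simp add: algebra_simps)
      qed
      then have nm: "norm (?A x - ?B x - ?D x) = norm (cis (- (x \<bullet> h)) - 1 - \<i> * of_real (- (x \<bullet> h))) * norm (f x)"
        by (simp only: norm_mult norm_cis mult_1)
      have "(x \<bullet> h)\<^sup>2 \<le> (norm x)\<^sup>2 * (norm h)\<^sup>2"
        using Cauchy_Schwarz_ineq2[of x h] by (metis abs_ge_zero power2_abs power_mono power_mult_distrib)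
      also have "\<dots> \<le> (1 + norm x)\<^sup>2 * (norm h)\<^sup>2"
        by (intro mult_right_mono power_mono) auto
      finally have "norm (cis (- (x \<bullet> h)) - 1 - \<i> * of_real (- (x \<bullet> h))) \<le> (1 + norm x)\<^sup>2 * (norm h)\<^sup>2"
        using cis_remainder[of "- (x \<bullet> h)"] by simp
      then have "norm (?A x - ?B x - ?D x)
          \<le> ((1 + norm x)\<^sup>2 * (norm h)\<^sup>2) * (C / (1 + norm x) ^ (2 * DIM('a) + 2))"
        unfolding nm by (intro mult_mono C) auto
      also have "\<dots> = (C * (1 / (1 + norm x) ^ (2 * DIM('a)))) * (norm h)\<^sup>2"
        by (rule power_cancel_aux[OF one_plus_norm_pos])
      finally show ?thesis .
    qed
    then have "norm (\<integral>x. ?A x - ?B x - ?D x \<partial>lborel)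
        \<le> (\<integral>x. (C * (1 / (1 + norm (x::'a)) ^ (2 * DIM('a)))) * (norm h)\<^sup>2 \<partial>lborel)"
      by (intro Bochner_Integration.integral_norm_bound_integral Bochner_Integration.integrable_diff i
          integrable_mult_left integrable_mult_right integrable_decay) auto
    moreover have "?dq h =
        of_real (fc TYPE('a)) * (\<integral>x. ?A x - ?B x - ?D x \<partial>lborel)"
      by (simp only: fourier_def right_diff_distrib Bochner_Integration.integral_diff
          Bochner_Integration.integrable_diff i)
    ultimately have "norm (?dq h)
        \<le> fc TYPE('a) * (\<integral>x. (C * (1 / (1 + norm (x::'a)) ^ (2 * DIM('a)))) * (norm h)\<^sup>2 \<partial>lborel)"
      by (simp only: norm_mult norm_of_real) (simp add: mult_left_mono)
    also have "\<dots> = ?K * (norm h)\<^sup>2" by (subst integral_mult_left_zero) (simp only: mult.assoc)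
    finally show ?thesis .
  qed
  show "(\<lambda>h. norm (?dq h) / norm h) \<midarrow>0\<rightarrow> 0"
  proof (rule Lim_null_comparison[where g = "\<lambda>h. ?K * norm h"])
    show "\<forall>\<^sub>F h in at 0. norm (norm (?dq h) / norm h)
        \<le> ?K * norm h"
    proof (rule eventually_at_ball[of 1, THEN eventually_mono])
      fix h show "norm (norm (?dq h) / norm h)
        \<le> ?K * norm h"
        using bd[of h] by (cases "h = 0") (simp_all add: divide_le_eq power2_eq_square mult_ac)
    qed simp
    show "(\<lambda>h. ?K * norm h) \<midarrow>0\<rightarrow> 0"
      by (rule tendsto_eq_intros refl | simp)+
  qed
qed

section \<open>The Fourier transform preserves bounded sets of Schwartz functions\<close>

lemma partial_deriv_fourier:
  assumes f: "f \<in> schwartz"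
  shows "partial_deriv b (fourier f) = fourier (\<lambda>x. - \<i> * of_real (x \<bullet> b) * f x)"
  by (rule ext, rule partial_deriv_eq[OF fourier_has_derivative[OF f]])

text \<open>The counterpart of \<open>iter_partial\<close> under the Fourier transform:
  differentiating a transform means multiplying by - i (x \<bullet> b) before transforming.\<close>

primrec fmono :: "'a::euclidean_space list \<Rightarrow> ('a \<Rightarrow> complex) \<Rightarrow> 'a \<Rightarrow> complex" where
  "fmono [] f = f"
| "fmono (b # vs) f = (\<lambda>x. - \<i> * of_real (x \<bullet> b) * fmono vs f x)"

lemma fmono_schwartz: "f \<in> schwartz \<Longrightarrow> fmono vs f \<in> schwartz"
  by (induction vs) (simp_all only: fmono.simps schwartz_mult_inner)

lemma iter_partial_fourier:
  assumes f: "f \<in> schwartz"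
  shows "iter_partial vs (fourier f) = fourier (fmono vs f)"
  by (induction vs) (simp_all add: partial_deriv_fourier[OF fmono_schwartz[OF f]])

lemma smooth_fourier: "f \<in> schwartz \<Longrightarrow> smooth (fourier f)"
  unfolding smooth_def iter_partial_fourier
  using fourier_has_derivative[OF fmono_schwartz] by (auto simp: iter_partial_fourier differentiable_def)

lemma sbdd_Un: "sbdd A \<Longrightarrow> sbdd B \<Longrightarrow> sbdd (A \<union> B)"
proof (rule sbddI)
  fix N assume A: "sbdd A" and B: "sbdd B"
  obtain C where C: "\<And>f vs x. f \<in> A \<Longrightarrow> set vs \<subseteq> Basis \<Longrightarrow> length vs \<le> N \<Longrightarrow>
      norm (iter_partial vs f x) \<le> C / (1 + norm x) ^ N"
    using sbddD[OF A, of N] by metis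
  obtain D where D: "\<And>f vs x. f \<in> B \<Longrightarrow> set vs \<subseteq> Basis \<Longrightarrow> length vs \<le> N \<Longrightarrow>
      norm (iter_partial vs f x) \<le> D / (1 + norm x) ^ N"
    using sbddD[OF B, of N] by metis
  have m: "C / (1 + norm x) ^ N \<le> max C D / (1 + norm x) ^ N" "D / (1 + norm x) ^ N \<le> max C D / (1 + norm x) ^ N"
    for x :: 'a
    by (intro divide_right_mono; simp)+
  show "\<exists>C. \<forall>f\<in>A \<union> B. \<forall>vs x. set vs \<subseteq> Basis \<longrightarrow> length vs \<le> N \<longrightarrow>
      norm (iter_partial vs f x) \<le> C / (1 + norm x) ^ N"
    using order_trans[OF C m(1)] order_trans[OF D m(2)] by (intro exI[of _ "max C D"]) blast
qed (auto simp: sbdd_smooth)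

lemma sbdd_empty: "sbdd {}"
  by (simp add: sbdd_def)

lemma sbdd_UN: "finite I \<Longrightarrow> (\<And>i. i \<in> I \<Longrightarrow> sbdd (B i)) \<Longrightarrow> sbdd (\<Union>i\<in>I. B i)"
  by (induction I rule: finite_induct) (auto intro: sbdd_Un sbdd_empty)

lemma sbdd_fmono: "sbdd B \<Longrightarrow> sbdd (fmono vs ` B)"
proof (induction vs)
  case (Cons b vs)
  have "sbdd {\<lambda>x. f x * g x |f g. f \<in> {\<lambda>x. - \<i> * of_real (x \<bullet> b)} \<and> g \<in> fmono vs ` B}"
    by (rule sbdd_mult[OF slow_neg_i_inner Cons.IH[OF Cons.prems]])
  then show ?case by (rule sbdd_subset) auto
qed simp

text \<open>One power of \<open>norm x\<close> is at most the sum of the coordinates in absolute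
  value, and each coordinate is traded for a derivative of \<open>f\<close>. The induction enlarges
  the family by first derivatives, so it must be general in \<open>B\<close>.\<close>

lemma fourier_decay_sbdd:
  fixes B :: "('a::euclidean_space \<Rightarrow> complex) set"
  assumes "sbdd B"
  shows "\<exists>C. \<forall>f\<in>B. \<forall>x. (1 + norm x) ^ N * norm (fourier f x) \<le> C"
  using assms
proof (induction N arbitrary: B)
  case 0
  then obtain C where C: "0 \<le> C" "\<And>f vs x. f \<in> B \<Longrightarrow> set vs \<subseteq> Basis \<Longrightarrow> length vs \<le> 2 * DIM('a) \<Longrightarrow>
      norm (iter_partial vs f x) \<le> C / (1 + norm x) ^ (2 * DIM('a))"
    using sbddD[OF 0, of "2 * DIM('a)"] by blast
  have "norm (fourier f x) \<le> fc TYPE('a) * (\<integral>x. C * (1 / (1 + norm (x::'a)) ^ (2 * DIM('a))) \<partial>lborel)"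
    if f: "f \<in> B" for f x
  proof -
    have "(\<integral>x. norm (f x) \<partial>lborel) \<le> (\<integral>x. C * (1 / (1 + norm (x::'a)) ^ (2 * DIM('a))) \<partial>lborel)"
      using C(2)[of f "[]"] f 0
      by (intro integral_mono integrable_norm schwartz_integrable sbdd_imp_schwartz[OF 0 f]
          integrable_mult_right integrable_decay) auto
    then show ?thesis using norm_fourier_le[of f x] by (smt (verit) mult_left_mono powr_ge_zero)
  qed
  then show ?case by auto
next
  case (Suc N)
  let ?B = "B \<union> (\<Union>b\<in>Basis. iter_partial [b] ` B)"
  have "sbdd ?B"
    by (intro sbdd_Un sbdd_UN sbdd_iter_partial Suc.prems) auto
  then obtain C where C: "\<And>f x. f \<in> ?B \<Longrightarrow> (1 + norm x) ^ N * norm (fourier f x) \<le> C"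
    using Suc.IH by blast
  have "(1 + norm x) ^ Suc N * norm (fourier f x) \<le> C + DIM('a) * C" if f: "f \<in> B" for f x
  proof -
    have "norm x * norm (fourier f x) \<le> (\<Sum>b\<in>Basis. \<bar>x \<bullet> b\<bar>) * norm (fourier f x)"
      by (intro mult_right_mono norm_le_l1) auto
    also have "\<dots> = (\<Sum>b\<in>Basis. norm (fourier (partial_deriv b f) x))"
      using sbdd_imp_schwartz[OF Suc.prems f]
      by (simp add: sum_distrib_right fourier_partial_deriv norm_mult)
    finally have "(1 + norm x) ^ N * (norm (fourier f x) + norm x * norm (fourier f x)) \<le>
        (1 + norm x) ^ N * (norm (fourier f x) + (\<Sum>b\<in>Basis. norm (fourier (partial_deriv b f) x)))"
      by (intro mult_left_mono) auto
    also have "\<dots> = (1 + norm x) ^ N * norm (fourier f x) +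
        (\<Sum>b\<in>Basis. (1 + norm x) ^ N * norm (fourier (partial_deriv b f) x))"
      by (simp add: distrib_left sum_distrib_left)
    also have "\<dots> \<le> C + (\<Sum>b\<in>(Basis::'a set). C)"
      using f by (intro add_mono sum_mono C) auto
    finally show ?thesis by (simp add: algebra_simps)
  qed
  then show ?case by blast
qed

lemma sbdd_fourier:
  fixes B :: "('a::euclidean_space \<Rightarrow> complex) set"
  assumes B: "sbdd B"
  shows "sbdd (fourier ` B)"
  unfolding sbdd_def
proof (intro conjI allI)
  show "\<forall>f\<in>fourier ` B. smooth f" using smooth_fourier sbdd_imp_schwartz[OF B] by blast
  fix N
  let ?V = "{vs::'a list. set vs \<subseteq> Basis \<and> length vs \<le> N}"
  have "sbdd (\<Union>vs\<in>?V. fmono vs ` B)"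
    by (intro sbdd_UN finite_lists_length_le sbdd_fmono B) simp
  from fourier_decay_sbdd[OF this, of N] obtain C where
    C: "\<And>f vs x. f \<in> B \<Longrightarrow> vs \<in> ?V \<Longrightarrow> (1 + norm x) ^ N * norm (fourier (fmono vs f) x) \<le> C"
    by blast
  then show "\<exists>C. \<forall>f\<in>fourier ` B. \<forall>vs x. set vs \<subseteq> Basis \<longrightarrow> length vs \<le> N \<longrightarrow>
      (1 + norm x) ^ N * norm (iter_partial vs f x) \<le> C"
    using sbdd_imp_schwartz[OF B] by (auto simp: iter_partial_fourier intro!: exI[of _ C])
qed

lemma fourier_schwartz: "f \<in> schwartz \<Longrightarrow> fourier f \<in> schwartz"
  using sbdd_fourier[of "{f}"] by (simp add: schwartz_iff)

section \<open>Affine substitutions and the inverse transform\<close>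

lemma sbdd_affine:
  assumes B: "sbdd B" and s: "s \<noteq> 0"
  shows "sbdd ((\<lambda>f x. f (s *\<^sub>R x + y)) ` B)"
proof (rule sbddI)
  show "f \<in> (\<lambda>f x. f (s *\<^sub>R x + y)) ` B \<Longrightarrow> smooth f" for f
    using sbdd_smooth[OF B] by (auto intro: smooth_affine)
  fix N
  obtain C where C: "0 \<le> C" "\<And>f vs x. f \<in> B \<Longrightarrow> set vs \<subseteq> Basis \<Longrightarrow> length vs \<le> N \<Longrightarrow>
      norm (iter_partial vs f x) \<le> C / (1 + norm x) ^ N"
    using sbddD[OF B, of N] by metis
  \<comment> \<open>The first factor bounds the powers of \<open>s\<close> from the chain rule; the
    last compares the weight at \<open>x\<close> with the weight at
    \<open>s *\<^sub>R x + y\<close>.\<close>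
  define K where "K = (1 + \<bar>s\<bar>) ^ N * C * ((1 + norm y) * (1 + 1 / \<bar>s\<bar>)) ^ N"
  have "norm (iter_partial vs (\<lambda>x. f (s *\<^sub>R x + y)) x) \<le> K / (1 + norm x) ^ N"
    if f: "f \<in> B" "set vs \<subseteq> Basis" "length vs \<le> N" for f vs x
  proof -
    let ?z = "s *\<^sub>R x + y"
    have "\<bar>s\<bar> * norm x \<le> norm ?z + norm y" using norm_triangle_ineq4[of ?z y] by simp
    then have "norm x \<le> (norm ?z + norm y) / \<bar>s\<bar>" using s by (simp add: field_simps)
    also have "\<dots> \<le> (1 + norm ?z) * (1 + norm y) / \<bar>s\<bar>"
      by (intro divide_right_mono) (simp_all add: algebra_simps add_increasing2)
    finally have "1 + norm x \<le> (1 + norm ?z) * (1 + norm y) + (1 + norm ?z) * (1 + norm y) / \<bar>s\<bar>"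
      by (intro add_mono) (auto simp: algebra_simps intro!: add_nonneg_nonneg)
    then have "1 + norm x \<le> (1 + norm ?z) * ((1 + norm y) * (1 + 1 / \<bar>s\<bar>))"
      by (simp add: distrib_left mult.assoc)
    then have "(1 + norm x) ^ N \<le> (1 + norm ?z) ^ N * ((1 + norm y) * (1 + 1 / \<bar>s\<bar>)) ^ N"
      unfolding power_mult_distrib[of "1 + norm ?z", symmetric] by (intro power_mono) auto
    then have zx: "1 / (1 + norm ?z) ^ N \<le> ((1 + norm y) * (1 + 1 / \<bar>s\<bar>)) ^ N / (1 + norm x) ^ N"
      using zero_less_power[OF one_plus_norm_pos[of x], of N] zero_less_power[OF one_plus_norm_pos[of ?z], of N]
      by (simp add: field_simps)
    have "\<bar>s\<bar> ^ length vs \<le> (1 + \<bar>s\<bar>) ^ length vs" by (intro power_mono) auto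
    also have "\<dots> \<le> (1 + \<bar>s\<bar>) ^ N" by (intro power_increasing f) auto
    finally have "\<bar>s\<bar> ^ length vs * norm (iter_partial vs f ?z) \<le> (1 + \<bar>s\<bar>) ^ N * (C * (1 / (1 + norm ?z) ^ N))"
      using C(2)[OF f, of ?z] by (intro mult_mono) auto
    also have "\<dots> \<le> (1 + \<bar>s\<bar>) ^ N * (C * (((1 + norm y) * (1 + 1 / \<bar>s\<bar>)) ^ N / (1 + norm x) ^ N))"
      by (intro mult_left_mono zx C) auto
    finally show ?thesis
      using f by (simp add: iter_partial_affine sbdd_smooth[OF B] norm_mult norm_power K_def)
  qed
  then show "\<exists>C. \<forall>f\<in>(\<lambda>f x. f (s *\<^sub>R x + y)) ` B. \<forall>vs x. set vs \<subseteq> Basis \<longrightarrow> length vs \<le> N \<longrightarrow>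
      norm (iter_partial vs f x) \<le> C / (1 + norm x) ^ N"
    by blast
qed

lemma schwartz_affine: "f \<in> schwartz \<Longrightarrow> s \<noteq> 0 \<Longrightarrow> (\<lambda>x. f (s *\<^sub>R x + y)) \<in> schwartz"
  using sbdd_affine[of "{f}" s y] by (simp add: schwartz_iff)

lemma schwartz_translate: "f \<in> schwartz \<Longrightarrow> (\<lambda>x. f (x + y)) \<in> schwartz"
  using schwartz_affine[of f 1 y] by simp

lemma inv_fourier_conv: "inv_fourier f = (\<lambda>x. fourier f ((-1) *\<^sub>R x + 0))"
  by (simp add: fun_eq_iff inv_fourier_eq)

lemma inv_fourier_schwartz: "f \<in> schwartz \<Longrightarrow> inv_fourier f \<in> schwartz"
  unfolding inv_fourier_conv by (intro schwartz_affine fourier_schwartz) auto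

lemma sbdd_inv_fourier:
  assumes "sbdd B" shows "sbdd (inv_fourier ` B)"
proof -
  have "inv_fourier ` B = (\<lambda>f x. f ((-1) *\<^sub>R x + 0)) ` (fourier ` B)"
    unfolding image_image by (rule image_cong) (simp_all only: inv_fourier_conv)
  then show ?thesis using sbdd_affine[OF sbdd_fourier[OF assms], of "-1" 0] by simp
qed

text \<open>For dilations with \<open>\<bar>s\<bar> \<le> 1\<close> the chain rule only produces
  factors of modulus at most 1. The bounds are therefore uniform over all such dilations and all
  translations, as required for shifted dyadic cutoffs.\<close>

lemma slow_scaled_schwartz:
  assumes f: "f \<in> schwartz"
  shows "slow {\<lambda>x. f (s *\<^sub>R x + y) |s y. \<bar>s\<bar> \<le> 1}"
  unfolding slow_def
proof (intro conjI allI)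
  show "\<forall>h\<in>{\<lambda>x. f (s *\<^sub>R x + y) |s y. \<bar>s\<bar> \<le> 1}. smooth h"
    using schwartz_smooth[OF f] by (auto intro: smooth_affine)
  fix n
  obtain C where C: "0 \<le> C" "\<And>vs x. set vs \<subseteq> Basis \<Longrightarrow> length vs \<le> n \<Longrightarrow>
      norm (iter_partial vs f x) \<le> C / (1 + norm x) ^ n"
    using sbddD[of "{f}" n] f unfolding schwartz_iff by (metis singletonI)
  have "norm (iter_partial vs (\<lambda>x. f (s *\<^sub>R x + y)) x) \<le> C * (1 + norm x) ^ 0"
    if "\<bar>s\<bar> \<le> 1" "set vs \<subseteq> Basis" "length vs \<le> n" for s y vs x
  proof -
    have "\<bar>s\<bar> ^ length vs * norm (iter_partial vs f (s *\<^sub>R x + y)) \<le> 1 * (C / (1 + norm (s *\<^sub>R x + y)) ^ n)"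
      using that by (intro mult_mono power_le_one C) auto
    also have "\<dots> \<le> C / 1"
      unfolding mult_1 by (intro divide_left_mono C one_le_power) (auto simp: one_plus_norm_pos)
    finally show ?thesis
      using that by (simp add: iter_partial_affine schwartz_smooth[OF f] norm_mult norm_power)
  qed
  then show "\<exists>C N. \<forall>h\<in>{\<lambda>x. f (s *\<^sub>R x + y) |s y. \<bar>s\<bar> \<le> 1}. \<forall>vs x. set vs \<subseteq> Basis \<longrightarrow> length vs \<le> n \<longrightarrow>
       norm (iter_partial vs h x) \<le> C * (1 + norm x) ^ N" by blast
qed

lemma slow_schwartz: "f \<in> schwartz \<Longrightarrow> slow {f}"
proof (rule slow_subset[OF slow_scaled_schwartz])
  have "f = (\<lambda>x. f (1 *\<^sub>R x + 0)) \<and> \<bar>1::real\<bar> \<le> 1" by simp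
  then show "{f} \<subseteq> {\<lambda>x. f (s *\<^sub>R x + y) |s y. \<bar>s\<bar> \<le> 1}" by blast
qed

subsection \<open>Gaussians and Fourier inversion\<close>

definition gauss :: "'a::euclidean_space \<Rightarrow> real" where
  "gauss x = exp (- (x \<bullet> x) / 2)"

lemma gauss_pos: "0 < gauss x" and gauss_le_1: "gauss x \<le> 1" and gauss_uminus [simp]: "gauss (- x) = gauss x"
  and gauss_0 [simp]: "gauss 0 = 1"
  by (auto simp: gauss_def)

lemma gauss_measurable [measurable]: "gauss \<in> borel_measurable borel"
  unfolding gauss_def[abs_def] by measurable

lemma continuous_gauss [continuous_intros]: "continuous_on A gauss"
  unfolding gauss_def by (intro continuous_intros) auto

lemma gauss_decay: "\<exists>C. \<forall>x::'a::euclidean_space. (1 + norm x) ^ N * gauss x \<le> C"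
proof -
  have "((\<lambda>t::real. (1 + t) ^ N * exp (- (t\<^sup>2) / 2)) \<longlongrightarrow> 0) at_top"
    by real_asymp
  then have "\<forall>\<^sub>F t in at_top. (1 + t) ^ N * exp (- (t\<^sup>2) / 2) < (1::real)"
    by (rule order_tendstoD) simp
  then obtain T where T: "\<And>t. T \<le> t \<Longrightarrow> (1 + t) ^ N * exp (- (t\<^sup>2) / 2) < (1::real)"
    by (auto simp: eventually_at_top_linorder)
  have "(1 + norm x) ^ N * gauss x \<le> max 1 ((1 + \<bar>T\<bar>) ^ N)" for x :: 'a
  proof (cases "T \<le> norm x")
    case True
    then have "(1 + norm x) ^ N * gauss x < 1" using T[of "norm x"]
      by (simp add: gauss_def power2_norm_eq_inner)
    then show ?thesis using max.cobounded1[of 1 "(1 + \<bar>T\<bar>) ^ N"] by linarith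
  next
    case False
    then have "(1 + norm x) ^ N * gauss x \<le> (1 + \<bar>T\<bar>) ^ N * 1"
      by (intro mult_mono power_mono gauss_le_1) (auto simp: less_imp_le[OF gauss_pos])
    then show ?thesis by simp
  qed
  then show ?thesis by blast
qed

lemma gauss_has_derivative:
  "((\<lambda>x. complex_of_real (gauss x)) has_derivative (\<lambda>v. - of_real (x \<bullet> v) * of_real (gauss x))) (at x)"
proof -
  have "(gauss has_derivative (\<lambda>v. - (x \<bullet> v) * gauss x)) (at x)"
    unfolding gauss_def[abs_def]
    by (auto intro!: derivative_eq_intros ext simp: inner_commute)
  from has_derivative_of_real[OF this] show ?thesis by simp
qed

text \<open>Every derivative is a slowly increasing function times the Gaussian. Keeping that
  function abstract, as a member of \<open>slow\<close>, spares the explicit Hermite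
  polynomials.\<close>

lemma gauss_schwartz: "(\<lambda>x::'a::euclidean_space. complex_of_real (gauss x)) \<in> schwartz"
proof -
  let ?g = "\<lambda>x::'a. complex_of_real (gauss x)"
  have dg: "?g differentiable (at x)" "partial_deriv v ?g x = - of_real (x \<bullet> v) * ?g x" for x v
    using gauss_has_derivative partial_deriv_eq[OF gauss_has_derivative] differentiable_def by blast+
  have *: "\<exists>p. slow {p} \<and> iter_partial vs ?g = (\<lambda>x. p x * ?g x)" if "set vs \<subseteq> Basis" for vs :: "'a list"
    using that
  proof (induction vs)
    case Nil
    show ?case by (intro exI[of _ "\<lambda>x. 1"]) (auto intro: slow_const)
  next
    case (Cons b vs)
    then obtain p where p: "slow {p}" "iter_partial vs ?g = (\<lambda>x. p x * ?g x)" by auto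
    have sp: "smooth p" using slow_smooth[OF p(1)] by simp
    have "slow (iter_partial [b] ` {p})"
      unfolding slow_def
    proof (intro conjI allI)
      show "\<forall>f\<in>iter_partial [b] ` {p}. smooth f" using sp Cons by (auto intro: smooth_partial_deriv)
      fix n
      obtain C M where C: "\<And>vs x. set vs \<subseteq> Basis \<Longrightarrow> length vs \<le> n + 1 \<Longrightarrow>
          norm (iter_partial vs p x) \<le> C * (1 + norm x) ^ M"
        using p(1) unfolding slow_def by (meson singletonI)
      have "norm (iter_partial vs (partial_deriv b p) x) \<le> C * (1 + norm x) ^ M"
        if "set vs \<subseteq> Basis" "length vs \<le> n" for vs x
        using C[of "vs @ [b]" x] that Cons by (auto simp: iter_partial_append)
      then show "\<exists>C N. \<forall>f\<in>iter_partial [b] ` {p}. \<forall>vs x. set vs \<subseteq> Basis \<longrightarrow> length vs \<le> n \<longrightarrow>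
          norm (iter_partial vs f x) \<le> C * (1 + norm x) ^ N"
        by (intro exI[of _ C] exI[of _ M]) auto
    qed
    then have sl: "slow {\<lambda>x. partial_deriv b p x + p x * ((-1) * of_real (x \<bullet> b))}"
      by (intro slow_add1 slow_mult1 p slow_const slow_inner) simp
    have "partial_deriv b (\<lambda>x. p x * ?g x) = (\<lambda>x. (partial_deriv b p x + p x * ((-1) * of_real (x \<bullet> b))) * ?g x)"
      by (rule ext) (simp add: partial_deriv_mult smooth_differentiable[OF sp] dg algebra_simps)
    with sl show ?case by (auto simp: p(2))
  qed
  have sm: "smooth ?g" unfolding smooth_def
  proof (intro allI impI)
    fix vs :: "'a list" and x assume "set vs \<subseteq> Basis"
    then obtain p where p: "slow {p}" "iter_partial vs ?g = (\<lambda>x. p x * ?g x)" using * by blast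
    then show "iter_partial vs ?g differentiable at x"
      unfolding p(2) by (intro differentiable_mult smooth_differentiable dg) (use slow_smooth[OF p(1)] in auto)
  qed
  have "bounded (range (\<lambda>x. (1 + norm x) ^ N *\<^sub>R iter_partial vs ?g x))" if vs: "set vs \<subseteq> Basis" for vs N
  proof -
    obtain p where p: "slow {p}" "iter_partial vs ?g = (\<lambda>x. p x * ?g x)" using *[OF vs] by blast
    obtain C M where C: "\<And>x. norm (p x) \<le> C * (1 + norm x) ^ M"
      using p(1) unfolding slow_def by (metis iter_partial_Nil empty_set empty_subsetI le0 list.size(3) singletonI)
    obtain D where D: "\<And>x::'a. (1 + norm x) ^ (N + M) * gauss x \<le> D" using gauss_decay by blast
    have C0: "0 \<le> C" using order_trans[OF norm_ge_zero C[of 0]] by simp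
    have "norm ((1 + norm x) ^ N *\<^sub>R iter_partial vs ?g x) \<le> C * D" for x
    proof -
      have "norm ((1 + norm x) ^ N *\<^sub>R iter_partial vs ?g x) = (1 + norm x) ^ N * (norm (p x) * gauss x)"
        by (simp add: p norm_mult gauss_pos less_imp_le abs_of_nonneg)
      also have "\<dots> \<le> (1 + norm x) ^ N * (C * (1 + norm x) ^ M * gauss x)"
        by (intro mult_left_mono mult_right_mono C) (auto simp: less_imp_le[OF gauss_pos])
      also have "\<dots> = C * ((1 + norm x) ^ (N + M) * gauss x)" by (simp add: power_add)
      also have "\<dots> \<le> C * D" by (intro mult_left_mono D C0)
      finally show ?thesis .
    qed
    then show ?thesis by (auto simp: bounded_iff)
  qed
  then show ?thesis using sm by (simp add: schwartz_def)
qed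

lemma lborel_integral_prod:
  fixes f :: "'a::euclidean_space \<Rightarrow> real \<Rightarrow> complex"
  assumes "\<And>b. b \<in> Basis \<Longrightarrow> integrable lborel (f b)"
  shows "(\<integral>x. (\<Prod>b\<in>Basis. f b (x \<bullet> b)) \<partial>lborel) = (\<Prod>b\<in>Basis. \<integral>t. f b t \<partial>lborel)"
proof -
  interpret product_sigma_finite "\<lambda>b::'a. lborel :: real measure" ..
  have m [measurable]: "\<And>b. b \<in> Basis \<Longrightarrow> f b \<in> borel_measurable borel" using assms by auto
  have "(\<integral>x. (\<Prod>b\<in>Basis. f b (x \<bullet> b)) \<partial>(lborel :: 'a measure)) =
      (\<integral>g. (\<Prod>b\<in>Basis. f b ((\<Sum>c\<in>Basis. g c *\<^sub>R c) \<bullet> b)) \<partial>(\<Pi>\<^sub>M b\<in>(Basis::'a set). lborel))"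
    by (subst lborel_eq, rule integral_distr) measurable
  also have "\<dots> = (\<integral>g. (\<Prod>b\<in>Basis. f b (g b)) \<partial>(\<Pi>\<^sub>M b\<in>(Basis::'a set). lborel))"
    by (intro Bochner_Integration.integral_cong refl prod.cong) simp
  also have "\<dots> = (\<Prod>b\<in>Basis. \<integral>t. f b t \<partial>lborel)"
    by (rule product_integral_prod) (use assms in auto)
  finally show ?thesis .
qed

lemma gauss_prod: "gauss x = (\<Prod>b\<in>Basis. exp (- (x \<bullet> b)\<^sup>2 / 2))"
  unfolding gauss_def by (subst euclidean_inner) (simp add: exp_sum[symmetric] power2_eq_square sum_negf sum_divide_distrib)

text \<open>Up to the factor sqrt (2 pi) the integral is the characteristic function of the standard
  normal distribution.\<close>

lemma std_normal_fourier:
  "integrable lborel (\<lambda>t. cis (t * y) * complex_of_real (exp (- t\<^sup>2 / 2)))"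
  "(\<integral>t. cis (t * y) * complex_of_real (exp (- t\<^sup>2 / 2)) \<partial>lborel) =
     complex_of_real (sqrt (2 * pi) * exp (- y\<^sup>2 / 2))"
proof -
  have d: "std_normal_density t = exp (- t\<^sup>2 / 2) / sqrt (2 * pi)" for t
    by (simp add: std_normal_density_def)
  have eq: "cis (t * y) * complex_of_real (exp (- t\<^sup>2 / 2)) =
      complex_of_real (sqrt (2 * pi)) * (std_normal_density t *\<^sub>R iexp (y * t))" for t
    by (simp add: d cis_conv_exp scaleR_conv_of_real mult_ac)
  have i: "integrable lborel (\<lambda>t. std_normal_density t *\<^sub>R iexp (y * t))"
    by (rule Bochner_Integration.integrable_bound[OF integrable_normal_density[of 1 0]])
       (auto simp: norm_exp_i_times)
  then show "integrable lborel (\<lambda>t. cis (t * y) * complex_of_real (exp (- t\<^sup>2 / 2)))"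
    unfolding eq by (rule integrable_mult_right)
  have "(\<integral>t. std_normal_density t *\<^sub>R iexp (y * t) \<partial>lborel) = char std_normal_distribution y"
    unfolding char_def by (subst integral_density) (auto simp: normal_density_nonneg)
  then have I: "(\<integral>t. std_normal_density t *\<^sub>R iexp (y * t) \<partial>lborel) = complex_of_real (exp (- y\<^sup>2 / 2))"
    by (simp only: char_std_normal_distribution)
  show "(\<integral>t. cis (t * y) * complex_of_real (exp (- t\<^sup>2 / 2)) \<partial>lborel) =
     complex_of_real (sqrt (2 * pi) * exp (- y\<^sup>2 / 2))"
    unfolding eq integral_mult_right_zero I by simp
qed

lemma gauss_fourier_integral:
  fixes y :: "'a::euclidean_space"
  shows "(\<integral>x. cis (x \<bullet> y) * complex_of_real (gauss x) \<partial>lborel) = of_real ((2 * pi) powr (DIM('a) / 2) * gauss y)"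
proof -
  have "(\<integral>x. cis (x \<bullet> y) * complex_of_real (gauss x) \<partial>lborel) =
      (\<integral>x. (\<Prod>b\<in>(Basis::'a set). cis ((x \<bullet> b) * (y \<bullet> b)) * complex_of_real (exp (- (x \<bullet> b)\<^sup>2 / 2))) \<partial>lborel)"
  proof (intro Bochner_Integration.integral_cong refl)
    fix x :: 'a
    have "cis (x \<bullet> y) = (\<Prod>b\<in>Basis. cis ((x \<bullet> b) * (y \<bullet> b)))"
      by (subst euclidean_inner) (simp add: cis_conv_exp exp_sum[symmetric] sum_distrib_left)
    then show "cis (x \<bullet> y) * complex_of_real (gauss x) =
        (\<Prod>b\<in>Basis. cis ((x \<bullet> b) * (y \<bullet> b)) * complex_of_real (exp (- (x \<bullet> b)\<^sup>2 / 2)))"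
      by (simp add: gauss_prod prod.distrib)
  qed
  also have "\<dots> = (\<Prod>b\<in>(Basis::'a set). complex_of_real (sqrt (2 * pi) * exp (- (y \<bullet> b)\<^sup>2 / 2)))"
    by (subst lborel_integral_prod) (simp_all only: std_normal_fourier)
  also have "\<dots> = of_real (sqrt (2 * pi) ^ DIM('a) * gauss y)"
    by (simp add: gauss_prod prod.distrib)
  also have "sqrt (2 * pi) ^ DIM('a) = (2 * pi) powr (DIM('a) / 2)"
    by (simp add: powr_half_sqrt[symmetric] powr_powr powr_realpow[symmetric])
  finally show ?thesis .
qed

lemma integral_gauss:
  "(\<integral>x. complex_of_real (gauss (x::'a::euclidean_space)) \<partial>lborel) = of_real ((2 * pi) powr (DIM('a) / 2))"
  using gauss_fourier_integral[of "0::'a"] by simp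

lemma gauss_integrable: "integrable lborel (gauss :: 'a::euclidean_space \<Rightarrow> real)"
  using integrable_norm[OF schwartz_integrable[OF gauss_schwartz]]
  by (simp add: abs_of_nonneg gauss_pos less_imp_le)

lemma integral_gauss_real: "(\<integral>x. gauss (x::'a::euclidean_space) \<partial>lborel) = (2 * pi) powr (DIM('a) / 2)"
  using integral_gauss[where 'a = 'a] by (simp only: integral_complex_of_real of_real_eq_iff)

section \<open>The multiplication formula and Fourier inversion\<close>

lemma fubini_kernel:
  fixes f g :: "'a::euclidean_space \<Rightarrow> complex" and k :: "'a \<Rightarrow> 'a \<Rightarrow> complex"
  assumes f: "integrable lborel f" and g: "integrable lborel g"
    and k [measurable]: "(\<lambda>(x, y). k x y) \<in> borel_measurable (borel \<Otimes>\<^sub>M borel)" and kb: "\<And>x y. norm (k x y) \<le> C"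
  shows "(\<integral>x. f x * (\<integral>y. k x y * g y \<partial>lborel) \<partial>lborel) = (\<integral>y. g y * (\<integral>x. k x y * f x \<partial>lborel) \<partial>lborel)"
    and "integrable lborel (\<lambda>x. f x * (\<integral>y. k x y * g y \<partial>lborel))"
proof -
  have [measurable]: "f \<in> borel_measurable borel" "g \<in> borel_measurable borel" using f g by auto
  let ?F = "\<lambda>(x, y). f x * (k x y * g y)"
  have "integrable (lborel \<Otimes>\<^sub>M lborel) ?F"
  proof (rule Bochner_Integration.integrable_bound)
    show "integrable (lborel \<Otimes>\<^sub>M lborel) (\<lambda>(x, y). C * (norm (f x) * norm (g y)))"
    proof (rule lborel_pair.Fubini_integrable)
      show "integrable lborel (\<lambda>x. \<integral>y. norm (case (x, y) of (x, y) \<Rightarrow> C * (norm (f x) * norm (g y))) \<partial>lborel)"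
        using f g by (simp add: abs_mult)
      show "AE x in lborel. integrable lborel (\<lambda>y. case (x, y) of (x, y) \<Rightarrow> C * (norm (f x) * norm (g y)))"
        using g by simp
    qed measurable
    show "?F \<in> borel_measurable (lborel \<Otimes>\<^sub>M lborel)" by measurable
    have "norm (f x) * (norm (k x y) * norm (g y)) \<le> \<bar>C * (norm (f x) * norm (g y))\<bar>" for x y
    proof -
      have "norm (k x y) * (norm (f x) * norm (g y)) \<le> C * (norm (f x) * norm (g y))"
        by (intro mult_right_mono kb) auto
      then show ?thesis by (simp add: mult_ac)
    qed
    then show "AE x in lborel \<Otimes>\<^sub>M lborel. norm (?F x) \<le> norm (case x of (x, y) \<Rightarrow> C * (norm (f x) * norm (g y)))"
      by (auto simp: norm_mult)
  qed
  note F = this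
  have "(\<integral>x. (\<integral>y. f x * (k x y * g y) \<partial>lborel) \<partial>lborel) = (\<integral>y. (\<integral>x. f x * (k x y * g y) \<partial>lborel) \<partial>lborel)"
    using lborel_pair.Fubini_integral[OF F] by simp
  also have "\<dots> = (\<integral>y. g y * (\<integral>x. k x y * f x \<partial>lborel) \<partial>lborel)"
  proof (intro Bochner_Integration.integral_cong refl)
    fix y
    have "(\<lambda>x. f x * (k x y * g y)) = (\<lambda>x. g y * (k x y * f x))" by (simp add: mult_ac)
    then show "(\<integral>x. f x * (k x y * g y) \<partial>lborel) = g y * (\<integral>x. k x y * f x \<partial>lborel)" by simp
  qed
  finally show "(\<integral>x. f x * (\<integral>y. k x y * g y \<partial>lborel) \<partial>lborel) = (\<integral>y. g y * (\<integral>x. k x y * f x \<partial>lborel) \<partial>lborel)"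
    by simp
  show "integrable lborel (\<lambda>x. f x * (\<integral>y. k x y * g y \<partial>lborel))"
    using lborel_pair.integrable_fst'[OF F] by simp
qed

lemma cis_pair_measurable [measurable]:
  "(\<lambda>(x, y). cis (x \<bullet> y)) \<in> borel_measurable (borel \<Otimes>\<^sub>M (borel :: 'a::euclidean_space measure))"
  "(\<lambda>(x, y). cis (- (x \<bullet> y))) \<in> borel_measurable (borel \<Otimes>\<^sub>M (borel :: 'a::euclidean_space measure))"
  unfolding borel_prod
  by (auto intro!: borel_measurable_continuous_onI continuous_intros simp: cis_conv_exp case_prod_beta)

lemma fourier_mult_formula:
  fixes f g :: "'a::euclidean_space \<Rightarrow> complex"
  assumes f: "integrable lborel f" and g: "integrable lborel g"
  shows "(\<integral>x. f x * fourier g x \<partial>lborel) = (\<integral>x. fourier f x * g x \<partial>lborel)"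
proof -
  let ?c = "complex_of_real (fc TYPE('a))"
  have "(\<integral>x. f x * fourier g x \<partial>lborel) = ?c * (\<integral>x. f x * (\<integral>y. cis (- (x \<bullet> y)) * g y \<partial>lborel) \<partial>lborel)"
    unfolding fourier_def mult.left_commute[of _ ?c]
    by (simp only: integral_mult_right_zero inner_commute)
  also have "\<dots> = ?c * (\<integral>y. g y * (\<integral>x. cis (- (x \<bullet> y)) * f x \<partial>lborel) \<partial>lborel)"
    by (subst fubini_kernel(1)[OF f g, of "\<lambda>x y. cis (- (x \<bullet> y))" 1]) auto
  also have "\<dots> = (\<integral>x. fourier f x * g x \<partial>lborel)"
    unfolding fourier_def mult.assoc integral_mult_right_zero by (simp add: mult.commute)
  finally show ?thesis .
qed

lemma inv_fourier_mult_formula: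
  fixes f g :: "'a::euclidean_space \<Rightarrow> complex"
  assumes f: "integrable lborel f" and g: "integrable lborel g"
  shows "(\<integral>x. f x * inv_fourier g x \<partial>lborel) = (\<integral>x. inv_fourier f x * g x \<partial>lborel)"
proof -
  let ?c = "complex_of_real (fc TYPE('a))"
  have "(\<integral>x. f x * inv_fourier g x \<partial>lborel) = ?c * (\<integral>x. f x * (\<integral>y. cis (x \<bullet> y) * g y \<partial>lborel) \<partial>lborel)"
    unfolding inv_fourier_def mult.left_commute[of _ ?c] by (simp only: integral_mult_right_zero)
  also have "\<dots> = ?c * (\<integral>y. g y * (\<integral>x. cis (x \<bullet> y) * f x \<partial>lborel) \<partial>lborel)"
    by (subst fubini_kernel(1)[OF f g, of "\<lambda>x y. cis (x \<bullet> y)" 1]) auto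
  also have "\<dots> = (\<integral>x. inv_fourier f x * g x \<partial>lborel)"
    unfolding inv_fourier_def mult.assoc integral_mult_right_zero by (simp add: mult.commute inner_commute)
  finally show ?thesis .
qed

lemma gauss_scaled_fourier:
  fixes y :: "'a::euclidean_space"
  assumes s: "s > 0"
  shows "(\<integral>x. cis (x \<bullet> y) * complex_of_real (gauss (s *\<^sub>R x)) \<partial>lborel) =
    of_real ((2 * pi) powr (DIM('a) / 2) * (1 / s) ^ DIM('a) * gauss ((1 / s) *\<^sub>R y))"
proof -
  have "(\<integral>x. cis (x \<bullet> y) * complex_of_real (gauss (s *\<^sub>R x)) \<partial>lborel) =
      (1 / s) ^ DIM('a) *\<^sub>R (\<integral>x. cis (x \<bullet> ((1 / s) *\<^sub>R y)) * complex_of_real (gauss x) \<partial>lborel)"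
    using s by (subst lborel_integral_affine[of _ "1 / s" 0]) auto
  also have "\<dots> = (1 / s) ^ DIM('a) *\<^sub>R of_real ((2 * pi) powr (DIM('a) / 2) * gauss ((1 / s) *\<^sub>R y))"
    by (subst gauss_fourier_integral) simp
  finally show ?thesis by (simp add: scaleR_conv_of_real mult_ac)
qed

lemma schwartz_bounded:
  assumes "f \<in> schwartz" obtains C where "0 \<le> C" "\<And>x. norm (f x) \<le> C"
  using schwartz_decay[OF assms, of 0] by auto

lemma fc_cancel: "fc TYPE('a::euclidean_space) * (2 * pi) powr (DIM('a) / 2) = 1"
  by (simp add: powr_add[symmetric])

text \<open>The inverse integral is damped by a Gaussian of width 1/s. The multiplication formula
  moves the transform onto the damped character, and after the substitution y = x + s z the integral
  is an average of \<open>f\<close> near \<open>x\<close> against a fixed Gaussian. Dominated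
  convergence as s tends to 0 on both sides gives the claim.\<close>

theorem fourier_inversion:
  fixes f :: "'a::euclidean_space \<Rightarrow> complex"
  assumes f: "f \<in> schwartz"
  shows "inv_fourier (fourier f) = f"
proof
  fix x
  let ?c = "complex_of_real (fc TYPE('a))" and ?p = "(2 * pi) powr (DIM('a) / 2)"
  let ?s = "\<lambda>n. 1 / real (Suc n)"
  let ?I = "\<lambda>n. \<integral>\<xi>. (cis (x \<bullet> \<xi>) * complex_of_real (gauss (?s n *\<^sub>R \<xi>))) * fourier f \<xi> \<partial>lborel"
  have [measurable]: "f \<in> borel_measurable borel" "fourier f \<in> borel_measurable borel"
    using f fourier_schwartz[OF f] by measurable
  have s0: "?s \<longlonglongrightarrow> 0" by (rule LIMSEQ_Suc[OF lim_1_over_n])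
  have if': "integrable lborel (fourier f)" by (rule schwartz_integrable[OF fourier_schwartz[OF f]])
  have gl: "(\<lambda>n. complex_of_real (gauss (?s n *\<^sub>R \<xi>))) \<longlonglongrightarrow> of_real 1" for \<xi> :: 'a
  proof -
    have "(\<lambda>n. ?s n *\<^sub>R \<xi>) \<longlonglongrightarrow> 0 *\<^sub>R \<xi>" by (intro tendsto_scaleR s0 tendsto_const)
    from continuous_on_tendsto_compose[OF continuous_gauss[of UNIV] this]
    have "(\<lambda>n. gauss (?s n *\<^sub>R \<xi>)) \<longlonglongrightarrow> gauss (0 *\<^sub>R \<xi>)" by simp
    then show ?thesis by (intro tendsto_of_real) simp
  qed
  have "?I \<longlonglongrightarrow> (\<integral>\<xi>. cis (x \<bullet> \<xi>) * fourier f \<xi> \<partial>lborel)"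
  proof (rule Bochner_Integration.integral_dominated_convergence[where w = "\<lambda>\<xi>. norm (fourier f \<xi>)"])
    show "AE \<xi> in lborel. (\<lambda>n. (cis (x \<bullet> \<xi>) * complex_of_real (gauss (?s n *\<^sub>R \<xi>))) * fourier f \<xi>)
        \<longlonglongrightarrow> cis (x \<bullet> \<xi>) * fourier f \<xi>"
      using tendsto_mult[OF tendsto_mult[OF tendsto_const gl] tendsto_const] by fastforce
    show "AE \<xi> in lborel. norm ((cis (x \<bullet> \<xi>) * complex_of_real (gauss (?s n *\<^sub>R \<xi>))) * fourier f \<xi>) \<le> norm (fourier f \<xi>)" for n
      by (auto simp: norm_mult less_imp_le[OF gauss_pos] abs_of_nonneg intro!: mult_left_le_one_le gauss_le_1)
  qed (use if' in \<open>auto simp: inner_commute[of x]\<close>)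
  moreover have "?I n = ?c * of_real ?p * (\<integral>z. f (x + ?s n *\<^sub>R z) * complex_of_real (gauss z) \<partial>lborel)" for n
  proof -
    have s: "?s n > 0" by simp
    let ?g = "\<lambda>\<xi>. cis (x \<bullet> \<xi>) * complex_of_real (gauss (?s n *\<^sub>R \<xi>))"
    have g: "?g \<in> schwartz"
      using schwartz_mult_cis[OF schwartz_affine[OF gauss_schwartz, of "?s n" 0], of 1 x] s
      by (simp add: inner_commute)
    have "?I n = (\<integral>y. fourier ?g y * f y \<partial>lborel)"
      by (rule fourier_mult_formula[OF schwartz_integrable[OF g] schwartz_integrable[OF f]])
    also have "\<dots> = (\<integral>y. (?c * of_real ?p) * of_real ((1 / ?s n) ^ DIM('a)) *
        (complex_of_real (gauss ((1 / ?s n) *\<^sub>R (x - y))) * f y) \<partial>lborel)"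
    proof (intro Bochner_Integration.integral_cong refl)
      fix y
      have "fourier ?g y = ?c * (\<integral>\<xi>. cis (\<xi> \<bullet> (x - y)) * complex_of_real (gauss (?s n *\<^sub>R \<xi>)) \<partial>lborel)"
        unfolding fourier_def mult.assoc[symmetric] cis_mult
        by (simp add: inner_diff_right inner_commute)
      then show "fourier ?g y * f y = (?c * of_real ?p) * of_real ((1 / ?s n) ^ DIM('a)) *
        (complex_of_real (gauss ((1 / ?s n) *\<^sub>R (x - y))) * f y)"
        by (subst (asm) gauss_scaled_fourier[OF s]) (simp add: mult_ac)
    qed
    also have "\<dots> = (?c * of_real ?p) * of_real ((1 / ?s n) ^ DIM('a)) *
        (\<integral>y. complex_of_real (gauss ((1 / ?s n) *\<^sub>R (x - y))) * f y \<partial>lborel)"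
      by (rule integral_mult_right_zero)
    also have "(\<integral>y. complex_of_real (gauss ((1 / ?s n) *\<^sub>R (x - y))) * f y \<partial>lborel) =
        \<bar>?s n\<bar> ^ DIM('a) *\<^sub>R (\<integral>z. complex_of_real (gauss ((1 / ?s n) *\<^sub>R (x - (x + ?s n *\<^sub>R z)))) * f (x + ?s n *\<^sub>R z) \<partial>lborel)"
      by (rule lborel_integral_affine) (use s in auto)
    also have "(\<integral>z. complex_of_real (gauss ((1 / ?s n) *\<^sub>R (x - (x + ?s n *\<^sub>R z)))) * f (x + ?s n *\<^sub>R z) \<partial>lborel) =
        (\<integral>z. f (x + ?s n *\<^sub>R z) * complex_of_real (gauss z) \<partial>lborel)"
      using s by (intro Bochner_Integration.integral_cong refl) (simp add: mult.commute del: of_nat_Suc)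
    finally show ?thesis
      using s by (simp add: scaleR_conv_of_real power_one_over del: of_nat_Suc)
  qed
  moreover have "(\<lambda>n. ?c * of_real ?p * (\<integral>z. f (x + ?s n *\<^sub>R z) * complex_of_real (gauss z) \<partial>lborel))
      \<longlonglongrightarrow> ?c * of_real ?p * (\<integral>z. f x * complex_of_real (gauss (z::'a)) \<partial>lborel)"
  proof (intro tendsto_mult tendsto_const)
    obtain C where C: "0 \<le> C" "\<And>x. norm (f x) \<le> C" using schwartz_bounded[OF f] by blast
    show "(\<lambda>n. \<integral>z. f (x + ?s n *\<^sub>R z) * complex_of_real (gauss z) \<partial>lborel) \<longlonglongrightarrow> (\<integral>z. f x * complex_of_real (gauss (z::'a)) \<partial>lborel)"
    proof (rule Bochner_Integration.integral_dominated_convergence[where w = "\<lambda>z::'a. C * gauss z"])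
      show "AE z in lborel. (\<lambda>n. f (x + ?s n *\<^sub>R z) * complex_of_real (gauss z)) \<longlonglongrightarrow> f x * complex_of_real (gauss z)"
      proof (intro AE_I2 tendsto_mult tendsto_const)
        fix z
        have "(\<lambda>n. x + ?s n *\<^sub>R z) \<longlonglongrightarrow> x + 0 *\<^sub>R z" by (intro tendsto_intros s0)
        from continuous_on_tendsto_compose[OF smooth_continuous_on[OF schwartz_smooth[OF f], of UNIV] this]
        show "(\<lambda>n. f (x + ?s n *\<^sub>R z)) \<longlonglongrightarrow> f x" by simp
      qed
      show "AE z in lborel. norm (f (x + ?s n *\<^sub>R z) * complex_of_real (gauss z)) \<le> C * gauss z" for n
        by (auto simp: norm_mult less_imp_le[OF gauss_pos] abs_of_nonneg intro!: mult_right_mono C)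
    qed (use gauss_integrable in auto)
  qed
  ultimately have "(\<integral>\<xi>. cis (x \<bullet> \<xi>) * fourier f \<xi> \<partial>lborel) = ?c * of_real ?p * (\<integral>z. f x * complex_of_real (gauss (z::'a)) \<partial>lborel)"
    by (intro LIMSEQ_unique[of ?I]) (simp_all only:)
  also have "\<dots> = of_real ?p * f x * (?c * of_real ?p)"
    by (simp add: integral_gauss_real mult_ac)
  also have "?c * of_real ?p = 1"
    unfolding of_real_mult[symmetric] fc_cancel by simp
  finally have "inv_fourier (fourier f) x = (?c * of_real ?p) * f x"
    by (simp add: inv_fourier_def mult.assoc)
  then show "inv_fourier (fourier f) x = f x"
    unfolding of_real_mult[symmetric] fc_cancel by simp
qed

lemma fourier_inversion':
  assumes f: "f \<in> schwartz"
  shows "fourier (inv_fourier f) = f"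
proof
  fix x
  have "fourier (inv_fourier f) x = fourier (\<lambda>x. fourier f (- x)) x"
    by (simp add: inv_fourier_eq[abs_def])
  also have "\<dots> = inv_fourier (fourier f) x"
    using fourier_uminus[OF schwartz_measurable[OF fourier_schwartz[OF f]]] by (simp add: inv_fourier_eq)
  finally show "fourier (inv_fourier f) x = f x" by (simp add: fourier_inversion[OF f])
qed

section \<open>Conjugation and the Parseval identity\<close>

lemma cnj_fourier: "cnj (fourier f x) = inv_fourier (\<lambda>x. cnj (f x)) x"
proof -
  have "cnj (\<integral>y. cis (- (y \<bullet> x)) * f y \<partial>lborel) = (\<integral>y. cnj (cis (- (y \<bullet> x)) * f y) \<partial>lborel)"
    by (rule Bochner_Integration.integral_cnj[symmetric])
  then show ?thesis by (simp add: fourier_def inv_fourier_def cis_cnj inner_commute)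
qed

lemma partial_deriv_cnj:
  fixes f :: "'a::euclidean_space \<Rightarrow> complex"
  assumes "f differentiable (at x)"
  shows "partial_deriv v (\<lambda>x. cnj (f x)) x = cnj (partial_deriv v f x)"
  by (rule partial_deriv_eq[of _ "\<lambda>v. cnj (partial_deriv v f x)"])
     (rule bounded_linear.has_derivative[OF bounded_linear_cnj has_derivative_partial[OF assms]])

lemma differentiable_cnj:
  fixes f :: "'a::euclidean_space \<Rightarrow> complex"
  shows "f differentiable (at x) \<Longrightarrow> (\<lambda>x. cnj (f x)) differentiable (at x)"
  unfolding differentiable_def[of "\<lambda>x. cnj (f x)"]
  by (rule exI, rule bounded_linear.has_derivative[OF bounded_linear_cnj has_derivative_partial])

lemma schwartz_cnj:
  assumes f: "f \<in> schwartz"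
  shows "(\<lambda>x. cnj (f x)) \<in> schwartz"
proof -
  have *: "iter_partial vs (\<lambda>x. cnj (f x)) = (\<lambda>x. cnj (iter_partial vs f x))" if "set vs \<subseteq> Basis" for vs
    using that
  proof (induction vs)
    case (Cons b vs)
    then show ?case
      using smooth_iter_differentiable[OF schwartz_smooth[OF f]]
      by (auto simp: partial_deriv_cnj)
  qed simp
  have "smooth (\<lambda>x. cnj (f x))" unfolding smooth_def
    using smooth_iter_differentiable[OF schwartz_smooth[OF f]] by (auto simp: * intro: differentiable_cnj)
  moreover have "bounded (range (\<lambda>x. (1 + norm x) ^ N *\<^sub>R cnj (g x)))"
    if "bounded (range (\<lambda>x. (1 + norm x) ^ N *\<^sub>R g x))" for N and g :: "'a \<Rightarrow> complex"
    using that unfolding bounded_iff by simp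
  ultimately show ?thesis using f by (simp add: schwartz_def *)
qed

text \<open>Conjugation turns the second transform into an inverse transform, which the
  multiplication formula moves onto \<open>fourier f\<close>, where it cancels.\<close>

lemma parseval:
  assumes f: "f \<in> schwartz" and g: "g \<in> schwartz"
  shows "(\<integral>x. fourier f x * cnj (fourier g x) \<partial>lborel) = (\<integral>x. f x * cnj (g x) \<partial>lborel)"
proof -
  have "(\<integral>x. fourier f x * inv_fourier (\<lambda>x. cnj (g x)) x \<partial>lborel) =
      (\<integral>x. inv_fourier (fourier f) x * cnj (g x) \<partial>lborel)"
    by (intro inv_fourier_mult_formula schwartz_integrable fourier_schwartz f schwartz_cnj g)
  then show ?thesis by (simp add: cnj_fourier fourier_inversion[OF f])
qed

subsection \<open>Lebesgue norms\<close>

lemma epowr_top [simp]: "epowr \<infinity> r = \<infinity>" "epowr top r = top"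
  by (simp_all add: epowr_def)

lemma epowr_ennreal: "0 \<le> a \<Longrightarrow> epowr (ennreal a) r = ennreal (a powr r)"
  by (simp add: epowr_def)

lemma epowr_0 [simp]: "epowr 0 r = 0"
  by (simp add: epowr_def)

lemma epowr_mono: "x \<le> y \<Longrightarrow> 0 \<le> r \<Longrightarrow> epowr x r \<le> epowr y r"
  by (cases x; cases y) (auto simp: epowr_ennreal powr_mono2 ennreal_leI top_unique)

lemma epowr_mult: "0 < r \<Longrightarrow> epowr (x * y) r = epowr x r * epowr y r"
proof (cases x; cases y)
  fix a b :: real assume "0 \<le> a" "0 \<le> b" "x = ennreal a" "y = ennreal b" "0 < r"
  then show ?thesis by (simp add: epowr_ennreal powr_mult flip: ennreal_mult)
next
  fix a :: real assume "0 < r" "0 \<le> a" "x = ennreal a" "y = top"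
  then show ?thesis by (cases "a = 0") (auto simp: ennreal_mult_top epowr_ennreal)
next
  fix a :: real assume "0 < r" "0 \<le> a" "y = ennreal a" "x = top"
  then show ?thesis by (cases "a = 0") (auto simp: ennreal_top_mult epowr_ennreal)
qed simp

lemma epowr_epowr: "epowr (epowr x r) s = epowr x (r * s)"
  by (cases x) (auto simp: epowr_ennreal powr_powr)

lemma epowr_1 [simp]: "epowr x 1 = x"
  by (cases x) (auto simp: epowr_ennreal)

lemma epowr_inverse: "r \<noteq> 0 \<Longrightarrow> epowr (epowr x r) (1 / r) = x" "r \<noteq> 0 \<Longrightarrow> epowr (epowr x (1 / r)) r = x"
  by (simp_all add: epowr_epowr)

lemma epowr_eq_top_iff [simp]: "epowr x r = top \<longleftrightarrow> x = top"
  by (simp add: epowr_def)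

lemma epowr_less_top_iff [simp]: "epowr x r < top \<longleftrightarrow> x < top"
  by (simp add: less_top[symmetric])

lemma epowr_2: "epowr x 2 = x ^ 2"
  by (cases x) (auto simp: epowr_ennreal ennreal_power)

lemma epowr_measurable [measurable (raw)]:
  assumes [measurable]: "f \<in> borel_measurable M"
  shows "(\<lambda>x. epowr (f x) r) \<in> borel_measurable M"
  unfolding epowr_def by measurable

lemma Lp_norm_le_iff:
  assumes "0 < p" "0 \<le> A"
  shows "Lp_norm p f \<le> ennreal A \<longleftrightarrow> (\<integral>\<^sup>+x. ennreal (norm (f x) powr p) \<partial>lborel) \<le> ennreal (A powr p)"
proof
  assume "Lp_norm p f \<le> ennreal A"
  then have "epowr (Lp_norm p f) p \<le> epowr (ennreal A) p" using assms by (intro epowr_mono) auto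
  then show "(\<integral>\<^sup>+x. ennreal (norm (f x) powr p) \<partial>lborel) \<le> ennreal (A powr p)"
    using assms by (simp add: Lp_norm_def epowr_inverse epowr_ennreal)
next
  assume "(\<integral>\<^sup>+x. ennreal (norm (f x) powr p) \<partial>lborel) \<le> ennreal (A powr p)"
  then have "Lp_norm p f \<le> epowr (ennreal (A powr p)) (1 / p)"
    unfolding Lp_norm_def using assms by (intro epowr_mono) auto
  then show "Lp_norm p f \<le> ennreal A" using assms by (simp add: epowr_ennreal powr_powr)
qed

lemma Lp_norm_cong_AE: "AE x in lborel. f x = g x \<Longrightarrow> Lp_norm p f = Lp_norm p g"
  unfolding Lp_norm_def by (intro arg_cong2[of _ _ _ _ epowr] nn_integral_cong_AE refl) auto

lemma Lp_norm_cmult: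
  assumes p: "0 < p" and [measurable]: "f \<in> borel_measurable borel"
  shows "Lp_norm p (\<lambda>x. c * f x) = ennreal (norm c) * Lp_norm p f"
proof -
  have "(\<integral>\<^sup>+x. ennreal (norm (c * f x) powr p) \<partial>lborel) =
      ennreal (norm c powr p) * (\<integral>\<^sup>+x. ennreal (norm (f x) powr p) \<partial>lborel)"
    by (subst nn_integral_cmult[symmetric]) (auto simp: norm_mult powr_mult ennreal_mult)
  then show ?thesis using p
    by (simp add: Lp_norm_def epowr_mult epowr_ennreal powr_powr)
qed

lemma Lp_norm_translate:
  assumes [measurable]: "f \<in> borel_measurable borel"
  shows "Lp_norm p (\<lambda>x. f (x + y)) = Lp_norm p f"
  unfolding Lp_norm_def
  using lborel_nn_integral_translate[of "\<lambda>x. ennreal (norm (f x) powr p)" y] by simp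

text \<open>Allows Minkowski and Hoelder to normalise by strictly positive numbers slightly above
  the norms, so that functions of norm zero need no separate case.\<close>

lemma ennreal_le_ennreal_epsilon:
  assumes "\<And>e::real. 0 < e \<Longrightarrow> x \<le> ennreal ((a + e) * (b + e))" "0 \<le> a" "0 \<le> b"
  shows "x \<le> ennreal (a * b)"
proof -
  have "((\<lambda>e. ennreal ((a + e) * (b + e))) \<longlongrightarrow> ennreal ((a + 0) * (b + 0))) (at_right 0)"
    by (intro tendsto_intros tendsto_ident_at)
  then have "x \<le> ennreal ((a + 0) * (b + 0))"
    by (rule tendsto_lowerbound) (auto simp: eventually_at_filter assms)
  then show ?thesis by simp
qed

lemma powr_convex_nonneg:
  fixes x y s t p :: real
  assumes "1 \<le> p" "0 \<le> x" "0 \<le> y" "0 \<le> s" "0 \<le> t" "s + t = 1"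
  shows "(s * x + t * y) powr p \<le> s * x powr p + t * y powr p"
proof -
  \<comment> \<open>When one of the two points is 0, the claim reduces to
    \<open>u powr p \<le> u\<close> for \<open>u\<close> between 0 and 1; convexity on the open
    half-line covers the remaining case.\<close>
  have le: "(u * z) powr p \<le> u * z powr p" if "0 \<le> u" "u \<le> 1" "0 \<le> z" for u z :: real
  proof -
    have "u powr p \<le> u powr 1"
      using that assms powr_mono'[of 1 p u] by (cases "u = 0") auto
    then show ?thesis using that by (simp add: powr_mult mult_right_mono)
  qed
  consider "x = 0" | "y = 0" | "0 < x" "0 < y" using assms by linarith
  then show ?thesis
  proof cases
    case 3
    have "convex_on {0<..} (\<lambda>x. x powr p)" using assms by (simp add: powr_convex)
    from convex_onD[OF this, of t x y] assms 3 show ?thesis by (simp add: eq_diff_eq[symmetric])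
  qed (use le assms in auto)
qed

lemma ennreal_add_mult_leI:
  "z \<le> a * x + b * y \<Longrightarrow> 0 \<le> a \<Longrightarrow> 0 \<le> b \<Longrightarrow> 0 \<le> x \<Longrightarrow> 0 \<le> y \<Longrightarrow>
    ennreal z \<le> ennreal a * ennreal x + ennreal b * ennreal y"
  by (simp add: ennreal_leI flip: ennreal_mult ennreal_plus)

text \<open>Convexity of the p-th power, applied to the normalised values of \<open>f\<close> and
  \<open>g\<close> with weights a/(a+b) and b/(a+b), works directly and includes
  \<open>p = 1\<close>.\<close>

lemma minkowski:
  assumes p: "1 \<le> p" and [measurable]: "f \<in> borel_measurable borel" "g \<in> borel_measurable borel"
  shows "Lp_norm p (\<lambda>x. f x + g x) \<le> Lp_norm p f + Lp_norm p g"
proof (cases "Lp_norm p f = top \<or> Lp_norm p g = top")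
  case False
  then obtain A B where AB: "0 \<le> A" "0 \<le> B" "Lp_norm p f = ennreal A" "Lp_norm p g = ennreal B"
    by (metis ennreal_cases)
  \<comment> \<open>The artificial factor 1 + e gives the bound the product form that
    \<open>ennreal_le_ennreal_epsilon\<close> expects.\<close>
  have "Lp_norm p (\<lambda>x. f x + g x) \<le> ennreal ((1 + e) * (A + B + e))" if e: "0 < e" for e
  proof -
    define a b where "a = A + e / 2" and "b = B + e / 2"
    have ab: "0 < a" "0 < b" using AB e by (auto simp: a_def b_def)
    have If: "(\<integral>\<^sup>+x. ennreal (norm (f x) powr p) \<partial>lborel) \<le> ennreal (a powr p)"
      using Lp_norm_le_iff[of p a f] p ab AB e by (auto simp: a_def intro: ennreal_leI)
    have Ig: "(\<integral>\<^sup>+x. ennreal (norm (g x) powr p) \<partial>lborel) \<le> ennreal (b powr p)"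
      using Lp_norm_le_iff[of p b g] p ab AB e by (auto simp: b_def intro: ennreal_leI)
    let ?s = "a / (a + b)" and ?t = "b / (a + b)"
    have st: "0 \<le> ?s" "0 \<le> ?t" "?s + ?t = 1" using ab by (auto simp flip: add_divide_distrib)
    define K where "K = (a + b) powr p"
    have pw: "norm (f x + g x) powr p \<le>
        (K * ?s / a powr p) * norm (f x) powr p + (K * ?t / b powr p) * norm (g x) powr p" for x
    proof -
      have "norm (f x + g x) powr p \<le> ((a + b) * (?s * (norm (f x) / a) + ?t * (norm (g x) / b))) powr p"
      proof (rule powr_mono2)
        have "(a + b) * (?s * (norm (f x) / a) + ?t * (norm (g x) / b)) = norm (f x) + norm (g x)"
        proof -
          have "?s * (norm (f x) / a) = norm (f x) / (a + b)" "?t * (norm (g x) / b) = norm (g x) / (a + b)"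
            using ab by simp_all
          then show ?thesis using ab by (simp only: add_divide_distrib[symmetric]) simp
        qed
        then show "norm (f x + g x) \<le> (a + b) * (?s * (norm (f x) / a) + ?t * (norm (g x) / b))"
          by (simp add: norm_triangle_ineq)
      qed (use p in auto)
      also have "\<dots> = K * (?s * (norm (f x) / a) + ?t * (norm (g x) / b)) powr p"
        using ab by (simp add: K_def powr_mult)
      also have "\<dots> \<le> K * (?s * (norm (f x) / a) powr p + ?t * (norm (g x) / b) powr p)"
        using st ab p by (intro mult_left_mono powr_convex_nonneg) (auto simp: K_def)
      finally show ?thesis using ab by (simp add: powr_divide distrib_left)
    qed
    have "(\<integral>\<^sup>+x. ennreal (norm (f x + g x) powr p) \<partial>lborel) \<le>
        (\<integral>\<^sup>+x. ennreal (K * ?s / a powr p) * ennreal (norm (f x) powr p) +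
          ennreal (K * ?t / b powr p) * ennreal (norm (g x) powr p) \<partial>lborel)"
      using ab by (intro nn_integral_mono ennreal_add_mult_leI pw) (auto simp: K_def)
    also have "\<dots> = ennreal (K * ?s / a powr p) * (\<integral>\<^sup>+x. ennreal (norm (f x) powr p) \<partial>lborel) +
        ennreal (K * ?t / b powr p) * (\<integral>\<^sup>+x. ennreal (norm (g x) powr p) \<partial>lborel)"
      by (simp add: nn_integral_add nn_integral_cmult)
    also have "\<dots> \<le> ennreal (K * ?s / a powr p) * ennreal (a powr p) + ennreal (K * ?t / b powr p) * ennreal (b powr p)"
      by (intro add_mono mult_left_mono If Ig) auto
    also have "\<dots> = ennreal (K * ?s) + ennreal (K * ?t)"
      using ab by (simp add: K_def flip: ennreal_mult)
    also have "\<dots> = ennreal (K * ?s + K * ?t)"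
      using ab by (intro ennreal_plus[symmetric]) (auto simp: K_def)
    also have "K * ?s + K * ?t = K"
      unfolding distrib_left[symmetric] st by simp
    finally have "Lp_norm p (\<lambda>x. f x + g x) \<le> ennreal (a + b)"
      using ab p by (subst Lp_norm_le_iff) (auto simp: K_def)
    also have "a + b \<le> (1 + e) * (A + B + e)" using AB e by (simp add: a_def b_def distrib_right)
    finally show ?thesis using ennreal_leI by (meson order_trans)
  qed
  then have "Lp_norm p (\<lambda>x. f x + g x) \<le> ennreal (1 * (A + B))"
    by (rule ennreal_le_ennreal_epsilon) (use AB in auto)
  then show ?thesis using AB by simp
qed auto

lemma Lp_norm_zero [simp]: "Lp_norm p (\<lambda>x. 0) = 0"
  by (simp add: Lp_norm_def)

lemma minkowski_sum:
  assumes p: "1 \<le> p" and "\<And>i. i \<in> I \<Longrightarrow> f i \<in> borel_measurable borel"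
  shows "Lp_norm p (\<lambda>x. \<Sum>i\<in>I. f i x) \<le> (\<Sum>i\<in>I. Lp_norm p (f i))"
  using assms(2)
proof (induction I rule: infinite_finite_induct)
  case (insert i I)
  have "Lp_norm p (\<lambda>x. \<Sum>i\<in>insert i I. f i x) \<le> Lp_norm p (f i) + Lp_norm p (\<lambda>x. \<Sum>i\<in>I. f i x)"
    using insert by (simp add: minkowski[OF p] borel_measurable_sum)
  also have "\<dots> \<le> Lp_norm p (f i) + (\<Sum>i\<in>I. Lp_norm p (f i))"
    using insert by (intro add_left_mono) auto
  finally show ?case using insert by simp
qed auto

text \<open>Young's inequality for f / A and g / B, integrated; A and B exceed the given bounds by
  \<open>e\<close> to stay positive. Upper bounds \<open>a\<close>, \<open>b\<close> instead of the
  norms themselves keep the conclusion real-valued.\<close>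

lemma hoelder:
  assumes p: "1 < p" and q: "1 < q" and pq: "1 / p + 1 / q = 1" and ab: "0 \<le> a" "0 \<le> b"
    and [measurable]: "f \<in> borel_measurable borel" "g \<in> borel_measurable borel"
    and f: "Lp_norm p f \<le> ennreal a" and g: "Lp_norm q g \<le> ennreal b"
  shows "(\<integral>\<^sup>+x. ennreal (norm (f x * g x)) \<partial>lborel) \<le> ennreal (a * b)"
proof (rule ennreal_le_ennreal_epsilon[OF _ ab])
  fix e :: real assume e: "0 < e"
  define A B where "A = a + e" and "B = b + e"
  have AB: "0 < A" "0 < B" using ab e by (auto simp: A_def B_def)
  have f': "(\<integral>\<^sup>+x. ennreal (norm (f x) powr p) \<partial>lborel) \<le> ennreal (A powr p)"
    using Lp_norm_le_iff[of p A f] order_trans[OF f ennreal_leI[of a A]] p AB e by (auto simp: A_def)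
  have g': "(\<integral>\<^sup>+x. ennreal (norm (g x) powr q) \<partial>lborel) \<le> ennreal (B powr q)"
    using Lp_norm_le_iff[of q B g] order_trans[OF g ennreal_leI[of b B]] q AB e by (auto simp: B_def)
  have pw: "norm (f x * g x) \<le> (A * B / p / A powr p) * norm (f x) powr p + (A * B / q / B powr q) * norm (g x) powr q" for x
  proof -
    have "norm (f x) / A * (norm (g x) / B) \<le> (norm (f x) / A) powr p / p + (norm (g x) / B) powr q / q"
      using Youngs_inequality[of p q "norm (f x) / A" "norm (g x) / B"] p q pq AB by simp
    then have "A * B * (norm (f x) / A * (norm (g x) / B)) \<le> A * B * ((norm (f x) / A) powr p / p + (norm (g x) / B) powr q / q)"
      using AB by (intro mult_left_mono) auto
    then show ?thesis using AB by (simp add: norm_mult powr_divide distrib_left mult_ac)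
  qed
  have "(\<integral>\<^sup>+x. ennreal (norm (f x * g x)) \<partial>lborel) \<le>
      (\<integral>\<^sup>+x. ennreal (A * B / p / A powr p) * ennreal (norm (f x) powr p) +
        ennreal (A * B / q / B powr q) * ennreal (norm (g x) powr q) \<partial>lborel)"
    using AB p q by (intro nn_integral_mono ennreal_add_mult_leI pw) auto
  also have "\<dots> = ennreal (A * B / p / A powr p) * (\<integral>\<^sup>+x. ennreal (norm (f x) powr p) \<partial>lborel) +
      ennreal (A * B / q / B powr q) * (\<integral>\<^sup>+x. ennreal (norm (g x) powr q) \<partial>lborel)"
    by (simp add: nn_integral_add nn_integral_cmult)
  also have "\<dots> \<le> ennreal (A * B / p / A powr p) * ennreal (A powr p) + ennreal (A * B / q / B powr q) * ennreal (B powr q)"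
    by (intro add_mono mult_left_mono f' g') auto
  also have "\<dots> = ennreal (A * B * (1 / p)) + ennreal (A * B * (1 / q))"
    using AB p q by (simp flip: ennreal_mult)
  also have "\<dots> = ennreal (A * B * (1 / p) + A * B * (1 / q))"
    using AB p q by (intro ennreal_plus[symmetric]) auto
  also have "A * B * (1 / p) + A * B * (1 / q) = A * B"
    unfolding distrib_left[symmetric] pq by simp
  finally show "(\<integral>\<^sup>+x. ennreal (norm (f x * g x)) \<partial>lborel) \<le> ennreal ((a + e) * (b + e))"
    by (simp add: A_def B_def)
qed

lemma hoelder_integral:
  assumes p: "1 < p" and q: "1 < q" and pq: "1 / p + 1 / q = 1" and ab: "0 \<le> a" "0 \<le> b"
    and [measurable]: "f \<in> borel_measurable borel" "g \<in> borel_measurable borel"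
    and f: "Lp_norm p f \<le> ennreal a" and g: "Lp_norm q g \<le> ennreal b"
  shows "integrable lborel (\<lambda>x. f x * g x)" "norm (\<integral>x. f x * g x \<partial>lborel) \<le> a * b"
proof -
  note h = hoelder[OF p q pq ab assms(6,7) f g]
  show i: "integrable lborel (\<lambda>x. f x * g x)"
    by (rule integrableI_bounded) (use order_le_less_trans[OF h ennreal_less_top] in auto)
  have "ennreal (norm (\<integral>x. f x * g x \<partial>lborel)) \<le> (\<integral>\<^sup>+x. ennreal (norm (f x * g x)) \<partial>lborel)"
    using integral_norm_bound_ennreal[OF i] .
  also note h
  finally show "norm (\<integral>x. f x * g x \<partial>lborel) \<le> a * b" using ab by simp
qed

lemma Lp_measurable: "f \<in> Lp p \<Longrightarrow> f \<in> borel_measurable borel" and Lp_finite: "f \<in> Lp p \<Longrightarrow> Lp_norm p f < top"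
  by (auto simp: Lp_def)

lemma LpI: "f \<in> borel_measurable borel \<Longrightarrow> Lp_norm p f < top \<Longrightarrow> f \<in> Lp p"
  by (simp add: Lp_def)

text \<open>The decay weight is at most 1, so its p-th power is at most the weight itself. This
  makes one integral serve all \<open>p\<close> and the bound linear in \<open>C\<close>.\<close>

lemma decay_Lp_bound:
  assumes p: "1 \<le> p" and C: "0 \<le> C" "\<And>x::'a::euclidean_space. norm (f x) \<le> C / (1 + norm x) ^ (2 * DIM('a))"
  shows "Lp_norm p f \<le> ennreal (C * (\<integral>x. 1 / (1 + norm (x::'a)) ^ (2 * DIM('a)) \<partial>lborel) powr (1 / p))"
proof -
  let ?w = "\<lambda>x::'a. 1 / (1 + norm x) ^ (2 * DIM('a))"
  let ?I = "\<integral>x. ?w x \<partial>lborel"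
  have w: "0 \<le> ?w x" "?w x \<le> 1" for x :: 'a
    using one_plus_norm_pos[of x] by (auto simp: one_le_power)
  have I0: "0 \<le> ?I" by (intro integral_nonneg_AE) (use w in auto)
  have "(\<integral>\<^sup>+x. ennreal (norm (f x) powr p) \<partial>lborel) \<le> (\<integral>\<^sup>+x. ennreal (C powr p) * ennreal (?w x) \<partial>lborel)"
  proof (rule nn_integral_mono)
    fix x :: 'a
    have "norm (f x) powr p \<le> (C * ?w x) powr p"
      using C p by (intro powr_mono2) auto
    also have "\<dots> = C powr p * ?w x powr p" by (intro powr_mult C w)
    also have "\<dots> \<le> C powr p * ?w x powr 1"
      using w[of x] p one_plus_norm_pos[of x] by (intro mult_left_mono powr_mono') auto
    also have "\<dots> = C powr p * ?w x" using w(1)[of x] by simp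
    finally show "ennreal (norm (f x) powr p) \<le> ennreal (C powr p) * ennreal (?w x)"
      by (subst ennreal_mult[symmetric]) (auto intro: ennreal_leI)
  qed
  also have "\<dots> = ennreal (C powr p) * ennreal ?I"
    using w by (subst nn_integral_cmult) (auto simp: nn_integral_eq_integral integrable_decay)
  also have "\<dots> = ennreal ((C * ?I powr (1 / p)) powr p)"
    using C p I0 by (simp add: powr_mult powr_powr flip: ennreal_mult)
  finally show ?thesis using C p by (subst Lp_norm_le_iff) auto
qed

lemma sbdd_Lp_bound:
  fixes B :: "('a::euclidean_space \<Rightarrow> complex) set"
  assumes p: "1 \<le> p" and B: "sbdd B"
  obtains C where "0 \<le> C" "\<And>f. f \<in> B \<Longrightarrow> Lp_norm p f \<le> ennreal C"
proof -
  obtain C where C: "0 \<le> C" "\<And>f vs x. f \<in> B \<Longrightarrow> set vs \<subseteq> Basis \<Longrightarrow> length vs \<le> 2 * DIM('a) \<Longrightarrow>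
      norm (iter_partial vs f x) \<le> C / (1 + norm x) ^ (2 * DIM('a))"
    using sbddD[OF B, of "2 * DIM('a)"] by blast
  have "Lp_norm p f \<le> ennreal (C * (\<integral>x. 1 / (1 + norm (x::'a)) ^ (2 * DIM('a)) \<partial>lborel) powr (1 / p))"
    if "f \<in> B" for f
    by (rule decay_Lp_bound[OF p C(1)]) (use C(2)[OF that, of "[]"] in simp)
  moreover have "0 \<le> C * (\<integral>x. 1 / (1 + norm (x::'a)) ^ (2 * DIM('a)) \<partial>lborel) powr (1 / p)"
    using C(1) by simp
  ultimately show ?thesis using that by blast
qed

lemma schwartz_Lp: "1 \<le> p \<Longrightarrow> f \<in> schwartz \<Longrightarrow> f \<in> Lp p"
proof (rule LpI)
  assume p: "1 \<le> p" and f: "f \<in> schwartz"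
  obtain C where "0 \<le> C" "\<And>g. g \<in> {f} \<Longrightarrow> Lp_norm p g \<le> ennreal C"
    using sbdd_Lp_bound[OF p f[unfolded schwartz_iff]] by blast
  then show "Lp_norm p f < top" using order_le_less_trans ennreal_less_top by blast
qed (rule schwartz_measurable)

lemma Lp_norm_difference_le:
  assumes p: "1 \<le> p" and [measurable]: "f \<in> borel_measurable borel"
  shows "Lp_norm p (difference h f) \<le> 2 * Lp_norm p f"
proof -
  have "Lp_norm p (\<lambda>x. f (x + h) + (- 1) * f x) \<le> Lp_norm p (\<lambda>x. f (x + h)) + Lp_norm p (\<lambda>x. (- 1) * f x)"
    by (rule minkowski[OF p]) auto
  also have "\<dots> = 2 * Lp_norm p f"
    using p by (subst Lp_norm_cmult) (auto simp: Lp_norm_translate mult_2)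
  finally show ?thesis by (simp add: difference_def)
qed

lemma difference_measurable [measurable (raw)]:
  assumes [measurable]: "f \<in> borel_measurable borel"
  shows "difference h f \<in> borel_measurable borel"
  unfolding difference_def by measurable

lemma difference_funpow_measurable:
  "f \<in> borel_measurable borel \<Longrightarrow> (difference h ^^ k) f \<in> borel_measurable borel"
  by (induction k) auto

lemma Lp_norm_difference_power_le:
  assumes p: "1 \<le> p" and f: "f \<in> borel_measurable borel"
  shows "Lp_norm p ((difference h ^^ k) f) \<le> 2 ^ k * Lp_norm p f"
proof (induction k)
  case (Suc k)
  have "Lp_norm p ((difference h ^^ Suc k) f) \<le> 2 * Lp_norm p ((difference h ^^ k) f)"
    using Lp_norm_difference_le[OF p difference_funpow_measurable[OF f]] by simp
  also have "\<dots> \<le> 2 * (2 ^ k * Lp_norm p f)" by (intro mult_left_mono Suc) auto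
  finally show ?case by (simp add: mult_ac)
qed simp

subsection \<open>Square integrable functions\<close>

text \<open>The squared L_2 norm. Leaving out the root keeps it compatible with sums, Tonelli and
  Fatou.\<close>

definition sqint :: "('a::euclidean_space \<Rightarrow> complex) \<Rightarrow> ennreal" where
  "sqint f = (\<integral>\<^sup>+x. ennreal ((norm (f x))\<^sup>2) \<partial>lborel)"

lemma powr_2_norm: "norm z powr 2 = (norm z)\<^sup>2"
  by (cases "z = 0") auto

lemma Lp_norm_2: "Lp_norm 2 f = epowr (sqint f) (1 / 2)"
  by (simp add: Lp_norm_def sqint_def powr_2_norm)

lemma L2_iff: "f \<in> Lp 2 \<longleftrightarrow> f \<in> borel_measurable borel \<and> sqint f < top"
  by (simp add: Lp_def Lp_norm_2)

lemma L2_mult_integrable: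
  assumes f: "f \<in> Lp 2" and g: "g \<in> Lp 2"
  shows "integrable lborel (\<lambda>x. f x * g x)"
proof -
  obtain a b where "0 \<le> a" "Lp_norm 2 f = ennreal a" "0 \<le> b" "Lp_norm 2 g = ennreal b"
    using Lp_finite[OF f] Lp_finite[OF g] by (metis ennreal_cases less_irrefl)
  then show ?thesis
    using hoelder_integral(1)[of 2 2 a b f g] Lp_measurable[OF f] Lp_measurable[OF g] by auto
qed

lemma L2_mult_schwartz: "f \<in> Lp 2 \<Longrightarrow> \<phi> \<in> schwartz \<Longrightarrow> integrable lborel (\<lambda>x. f x * \<phi> x)"
  by (rule L2_mult_integrable) (auto intro: schwartz_Lp)

lemma sqint_add_le:
  assumes [measurable]: "f \<in> borel_measurable borel" "g \<in> borel_measurable borel"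
  shows "sqint (\<lambda>x. f x + g x) \<le> 2 * (sqint f + sqint g)"
proof -
  have "(norm (a + b))\<^sup>2 \<le> 2 * (norm a)\<^sup>2 + 2 * (norm b)\<^sup>2" for a b :: complex
  proof -
    have "(norm (a + b))\<^sup>2 \<le> (norm a + norm b)\<^sup>2" by (intro power_mono norm_triangle_ineq) auto
    also have "\<dots> \<le> 2 * (norm a)\<^sup>2 + 2 * (norm b)\<^sup>2"
      using zero_le_power2[of "norm a - norm b"] by (simp add: power2_sum power2_diff)
    finally show ?thesis .
  qed
  then have "sqint (\<lambda>x. f x + g x) \<le> (\<integral>\<^sup>+x. ennreal 2 * ennreal ((norm (f x))\<^sup>2) + ennreal 2 * ennreal ((norm (g x))\<^sup>2) \<partial>lborel)"
    unfolding sqint_def by (intro nn_integral_mono ennreal_add_mult_leI) auto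
  also have "\<dots> = ennreal 2 * sqint f + ennreal 2 * sqint g"
    unfolding sqint_def by (simp add: nn_integral_add nn_integral_cmult)
  finally show ?thesis by (simp add: distrib_left)
qed

lemma L2_add: "f \<in> Lp 2 \<Longrightarrow> g \<in> Lp 2 \<Longrightarrow> (\<lambda>x. f x + g x) \<in> Lp 2"
  unfolding L2_iff
  by (auto intro!: order_le_less_trans[OF sqint_add_le] simp: ennreal_mult_less_top)

lemma sqint_bounded_mult:
  assumes "0 \<le> C" "\<And>x. norm (m x) \<le> C" and [measurable]: "f \<in> borel_measurable borel"
  shows "sqint (\<lambda>x. m x * f x) \<le> ennreal (C\<^sup>2) * sqint f"
proof -
  have "sqint (\<lambda>x. m x * f x) \<le> (\<integral>\<^sup>+x. ennreal (C\<^sup>2) * ennreal ((norm (f x))\<^sup>2) \<partial>lborel)"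
    unfolding sqint_def using assms
    by (intro nn_integral_mono)
       (auto simp: norm_mult power_mult_distrib ennreal_mult[symmetric] intro!: ennreal_leI mult_right_mono power_mono)
  then show ?thesis by (simp add: sqint_def nn_integral_cmult)
qed

lemma L2_bounded_mult:
  assumes "m \<in> borel_measurable borel" "\<And>x. norm (m x) \<le> C" "f \<in> Lp 2"
  shows "(\<lambda>x. m x * f x) \<in> Lp 2"
proof -
  have "0 \<le> C" using assms(2)[of 0] norm_ge_zero order_trans by blast
  from sqint_bounded_mult[OF this assms(2) Lp_measurable[OF assms(3)]]
  have "sqint (\<lambda>x. m x * f x) < top"
    by (rule order_le_less_trans) (use assms(3) in \<open>auto simp: L2_iff ennreal_mult_less_top\<close>)
  then show ?thesis using assms by (auto simp: L2_iff)
qed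

lemma L2_cmult: "f \<in> Lp 2 \<Longrightarrow> (\<lambda>x. c * f x) \<in> Lp 2"
  by (rule L2_bounded_mult[where C = "norm c"]) auto

subsection \<open>Schwartz functions separate square integrable functions\<close>

text \<open>The Gaussian approximate identity of width \<open>s\<close>, normalised to integral
  1.\<close>

definition gk :: "real \<Rightarrow> 'a::euclidean_space \<Rightarrow> real" where
  "gk s z = fc TYPE('a) * (1 / s) ^ DIM('a) * gauss ((1 / s) *\<^sub>R z)"

lemma gk_nonneg: "0 < s \<Longrightarrow> 0 \<le> gk s z"
  by (simp add: gk_def less_imp_le[OF gauss_pos])

lemma gk_uminus [simp]: "gk s (- z) = gk s z"
  using gauss_uminus[of "(1 / s) *\<^sub>R z"] by (simp add: gk_def)

lemma gk_commute: "gk s (x - y) = gk s (y - x)"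
  using gk_uminus[of s "x - y"] by simp

lemma gk_measurable [measurable]: "gk s \<in> borel_measurable borel"
  unfolding gk_def[abs_def] by measurable

lemma gk_le: "0 < s \<Longrightarrow> gk s z \<le> fc TYPE('a) * (1 / s) ^ DIM('a)" for z :: "'a::euclidean_space"
  unfolding gk_def by (rule mult_left_le[OF gauss_le_1]) auto

lemma norm_gk_le: "0 < s \<Longrightarrow> norm (complex_of_real (gk s z)) \<le> fc TYPE('a) * (1 / s) ^ DIM('a)"
  for z :: "'a::euclidean_space"
  using gk_le[of s z] gk_nonneg[of s z] by simp

lemma gk_schwartz: "0 < s \<Longrightarrow> (\<lambda>x. complex_of_real (gk s (x - y))) \<in> schwartz"
proof -
  assume s: "0 < s"
  have "(\<lambda>x. complex_of_real (gauss ((1 / s) *\<^sub>R x + (- (1 / s)) *\<^sub>R y))) \<in> schwartz"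
    by (rule schwartz_affine[OF gauss_schwartz]) (use s in auto)
  then have "(\<lambda>x. of_real (fc TYPE('a) * (1 / s) ^ DIM('a)) * complex_of_real (gauss ((1 / s) *\<^sub>R x + (- (1 / s)) *\<^sub>R y))) \<in> schwartz"
    by (rule schwartz_cmult)
  then show ?thesis by (simp add: gk_def scaleR_diff_right)
qed

lemma gk_integrable: "0 < s \<Longrightarrow> integrable lborel (gk s)"
  using integrable_norm[OF schwartz_integrable[OF gk_schwartz[of s 0]]] by (simp add: abs_of_nonneg gk_nonneg)

lemma integral_gk: "0 < s \<Longrightarrow> (\<integral>z. gk s z \<partial>lborel) = 1"
proof -
  assume s: "0 < s"
  have "(\<integral>z. gk s (z::'a) \<partial>lborel) = s ^ DIM('a) * (\<integral>z. gk s (0 + s *\<^sub>R (z::'a)) \<partial>lborel)"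
    using s lborel_integral_affine[of "gk s :: 'a \<Rightarrow> real" s 0] by simp
  also have "\<dots> = fc TYPE('a) * (\<integral>z. gauss z \<partial>(lborel :: 'a measure))"
    using s by (simp add: gk_def power_one_over)
  finally show "(\<integral>z. gk s (z::'a) \<partial>lborel) = 1" unfolding integral_gauss_real fc_cancel .
qed

lemma nn_integral_gk:
  assumes s: "0 < s"
  shows "(\<integral>\<^sup>+z. ennreal (gk s (z - y)) \<partial>lborel) = 1" "(\<integral>\<^sup>+z. ennreal (gk s (y - z)) \<partial>lborel) = 1"
proof -
  have "(\<integral>\<^sup>+z. ennreal (gk s z) \<partial>lborel) = ennreal 1"
    using s by (subst nn_integral_eq_integral[OF gk_integrable]) (auto simp: gk_nonneg integral_gk)
  then show "(\<integral>\<^sup>+z. ennreal (gk s (z - y)) \<partial>lborel) = 1"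
    using lborel_nn_integral_translate[of "\<lambda>z. ennreal (gk s z)" "- y"] by simp
  then show "(\<integral>\<^sup>+z. ennreal (gk s (y - z)) \<partial>lborel) = 1" by (simp add: gk_commute)
qed

text \<open>The substitution y = x + s z turns the shrinking kernel into a fixed Gaussian and moves
  the scale into the argument of \<open>\<psi>\<close>, where continuity and boundedness give
  dominated convergence.\<close>

lemma mollify_tendsto:
  fixes \<psi> :: "'a::euclidean_space \<Rightarrow> complex"
  assumes \<psi>: "continuous_on UNIV \<psi>" "\<And>x. norm (\<psi> x) \<le> C"
  shows "(\<lambda>n. \<integral>y. of_real (gk (1 / real (Suc n)) (x - y)) * \<psi> y \<partial>lborel) \<longlonglongrightarrow> \<psi> x"
proof -
  let ?s = "\<lambda>n. 1 / real (Suc n)" and ?c = "complex_of_real (fc TYPE('a))"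
  have m [measurable]: "\<psi> \<in> borel_measurable borel" by (rule borel_measurable_continuous_onI[OF \<psi>(1)])
  have s0: "?s \<longlonglongrightarrow> 0" by (rule LIMSEQ_Suc[OF lim_1_over_n])
  have eq: "(\<integral>y. of_real (gk (?s n) (x - y)) * \<psi> y \<partial>lborel) =
      (\<integral>z. ?c * of_real (gauss z) * \<psi> (x + ?s n *\<^sub>R z) \<partial>lborel)" for n
  proof -
    have s: "0 < ?s n" by simp
    have "(\<integral>y. of_real (gk (?s n) (x - y)) * \<psi> y \<partial>lborel) =
        \<bar>?s n\<bar> ^ DIM('a) *\<^sub>R (\<integral>z. of_real (gk (?s n) (x - (x + ?s n *\<^sub>R z))) * \<psi> (x + ?s n *\<^sub>R z) \<partial>lborel)"
      by (rule lborel_integral_affine) (use s in auto)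
    also have "\<dots> = (\<integral>z. of_real (\<bar>?s n\<bar> ^ DIM('a)) * (of_real (gk (?s n) (x - (x + ?s n *\<^sub>R z))) * \<psi> (x + ?s n *\<^sub>R z)) \<partial>lborel)"
      unfolding scaleR_conv_of_real by (rule integral_mult_right_zero[symmetric])
    also have "\<dots> = (\<integral>z. ?c * of_real (gauss z) * \<psi> (x + ?s n *\<^sub>R z) \<partial>lborel)"
    proof (intro Bochner_Integration.integral_cong refl)
      fix z :: 'a
      have "\<bar>?s n\<bar> ^ DIM('a) * gk (?s n) (x - (x + ?s n *\<^sub>R z)) = fc TYPE('a) * gauss z"
        using s by (simp add: gk_def power_one_over del: of_nat_Suc)
      then show "of_real (\<bar>?s n\<bar> ^ DIM('a)) * (of_real (gk (?s n) (x - (x + ?s n *\<^sub>R z))) * \<psi> (x + ?s n *\<^sub>R z)) =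
          ?c * of_real (gauss z) * \<psi> (x + ?s n *\<^sub>R z)"
        unfolding mult.assoc[symmetric] of_real_mult[symmetric] by (simp only:)
    qed
    finally show ?thesis .
  qed
  have "(\<lambda>n. \<integral>z. ?c * of_real (gauss z) * \<psi> (x + ?s n *\<^sub>R z) \<partial>lborel) \<longlonglongrightarrow> (\<integral>z. ?c * of_real (gauss z) * \<psi> x \<partial>(lborel :: 'a measure))"
  proof (rule Bochner_Integration.integral_dominated_convergence[where w = "\<lambda>z::'a. (fc TYPE('a) * C) * gauss z"])
    show "AE z in lborel. (\<lambda>n. ?c * of_real (gauss z) * \<psi> (x + ?s n *\<^sub>R z)) \<longlonglongrightarrow> ?c * of_real (gauss z) * \<psi> x"
    proof (intro AE_I2 tendsto_mult tendsto_const)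
      fix z
      have "(\<lambda>n. x + ?s n *\<^sub>R z) \<longlonglongrightarrow> x + 0 *\<^sub>R z" by (intro tendsto_intros s0)
      from continuous_on_tendsto_compose[OF \<psi>(1) this]
      show "(\<lambda>n. \<psi> (x + ?s n *\<^sub>R z)) \<longlonglongrightarrow> \<psi> x" by simp
    qed
    show "AE z in lborel. norm (?c * of_real (gauss z) * \<psi> (x + ?s n *\<^sub>R z)) \<le> (fc TYPE('a) * C) * gauss z" for n
    proof (rule AE_I2)
      fix z
      have "(fc TYPE('a) * gauss z) * norm (\<psi> (x + ?s n *\<^sub>R z)) \<le> (fc TYPE('a) * gauss z) * C"
        by (intro mult_left_mono \<psi>) (auto simp: less_imp_le[OF gauss_pos])
      then show "norm (?c * of_real (gauss z) * \<psi> (x + ?s n *\<^sub>R z)) \<le> (fc TYPE('a) * C) * gauss z"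
        by (simp add: norm_mult less_imp_le[OF gauss_pos] abs_of_nonneg mult_ac)
    qed
  qed (use gauss_integrable in auto)
  also have "(\<integral>z. ?c * of_real (gauss z) * \<psi> x \<partial>(lborel :: 'a measure)) = \<psi> x"
  proof -
    have "(\<integral>z. ?c * of_real (gauss z) * \<psi> x \<partial>(lborel :: 'a measure)) = (?c * of_real ((2 * pi) powr (DIM('a) / 2))) * \<psi> x"
      by (simp add: integral_gauss_real)
    then show ?thesis unfolding of_real_mult[symmetric] fc_cancel by simp
  qed
  finally show ?thesis unfolding eq .
qed

text \<open>A mollification of \<open>\<psi>\<close> is a superposition of translated Gaussians,
  each a Schwartz function. By Fubini \<open>f\<close> annihilates the mollification, and its limit
  is \<open>\<psi>\<close>.\<close>

lemma integrable_separated_continuous: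
  fixes f :: "'a::euclidean_space \<Rightarrow> complex"
  assumes f: "integrable lborel f" and 0: "\<And>\<phi>. \<phi> \<in> schwartz \<Longrightarrow> (\<integral>x. f x * \<phi> x \<partial>lborel) = 0"
    and \<psi>: "continuous_on UNIV \<psi>" "\<And>x. norm (\<psi> x) \<le> C" "integrable lborel \<psi>"
  shows "(\<integral>x. f x * \<psi> x \<partial>lborel) = 0"
proof -
  let ?s = "\<lambda>n. 1 / real (Suc n)"
  have [measurable]: "f \<in> borel_measurable borel" using f by auto
  have m [measurable]: "\<psi> \<in> borel_measurable borel" by (rule borel_measurable_continuous_onI[OF \<psi>(1)])
  let ?m = "\<lambda>n x. \<integral>y. of_real (gk (?s n) (x - y)) * \<psi> y \<partial>lborel"
  have u0: "(\<integral>x. f x * (?m n x) \<partial>lborel) = 0" for n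
  proof -
    have s: "0 < ?s n" by simp
    have "(\<integral>x. f x * (?m n x) \<partial>lborel) =
        (\<integral>y. \<psi> y * (\<integral>x. of_real (gk (?s n) (x - y)) * f x \<partial>lborel) \<partial>lborel)"
      by (rule fubini_kernel(1)[OF f \<psi>(3), where C = "fc TYPE('a) * (1 / ?s n) ^ DIM('a)"])
         (measurable, rule norm_gk_le[OF s])
    also have "\<dots> = 0" using 0[OF gk_schwartz[OF s]] by (simp add: mult.commute)
    finally show ?thesis .
  qed
  have "(\<lambda>n. \<integral>x. f x * (?m n x) \<partial>lborel) \<longlonglongrightarrow> (\<integral>x. f x * \<psi> x \<partial>lborel)"
  proof (rule Bochner_Integration.integral_dominated_convergence[where w = "\<lambda>x. C * norm (f x)"])
    show "AE x in lborel. (\<lambda>n. f x * (?m n x)) \<longlonglongrightarrow> f x * \<psi> x"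
      by (intro AE_I2 tendsto_mult tendsto_const mollify_tendsto[OF \<psi>(1,2)])
    fix n
    have s: "0 < ?s n" by simp
    have bd: "norm (?m n x) \<le> C" for x
    proof -
      have ig: "integrable lborel (\<lambda>y. gk (?s n) (x - y))"
        unfolding gk_commute[of _ x] using lborel_integrable_translate[OF gk_integrable[OF s], of "- x"] by simp
      have "norm (?m n x) \<le> (\<integral>y. C * gk (?s n) (x - y) \<partial>lborel)"
      proof (rule Bochner_Integration.integral_norm_bound_integral)
        show "integrable lborel (\<lambda>y. C * gk (?s n) (x - y))" using ig by simp
        have "norm (of_real (gk (?s n) (x - y)) * \<psi> y) \<le> C * gk (?s n) (x - y)" for y
          using mult_right_mono[OF \<psi>(2)[of y] gk_nonneg[OF s, of "x - y"]]
          by (simp add: norm_mult abs_of_nonneg[OF gk_nonneg[OF s]] mult.commute del: of_nat_Suc)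
        then show "norm (of_real (gk (?s n) (x - y)) * \<psi> y) \<le> C * gk (?s n) (x - y)" for y .
        show "integrable lborel (\<lambda>y. of_real (gk (?s n) (x - y)) * \<psi> y)"
          by (rule integrable_bounded_mult[OF \<psi>(3), of _ "fc TYPE('a) * (1 / ?s n) ^ DIM('a)"])
             (measurable, rule norm_gk_le[OF s])
      qed
      also have "\<dots> = C"
        using lborel_integral_translate[of "gk (?s n)" "- x"] by (simp add: gk_commute[of _ x] integral_gk[OF s] del: of_nat_Suc)
      finally show ?thesis .
    qed
    show "AE x in lborel. norm (f x * (?m n x)) \<le> C * norm (f x)"
      unfolding norm_mult mult.commute[of C] by (intro AE_I2 mult_left_mono[OF bd norm_ge_zero])
  qed (use f in auto)
  then show ?thesis using u0 LIMSEQ_unique[OF _ tendsto_const] by simp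
qed

text \<open>Multiplying \<open>\<psi>\<close> by ever wider Gaussians makes it integrable without
  changing the limit; this removes the integrability assumption.\<close>

lemma integrable_separated_bounded:
  fixes f :: "'a::euclidean_space \<Rightarrow> complex"
  assumes f: "integrable lborel f" and 0: "\<And>\<phi>. \<phi> \<in> schwartz \<Longrightarrow> (\<integral>x. f x * \<phi> x \<partial>lborel) = 0"
    and \<psi>: "continuous_on UNIV \<psi>" "\<And>x. norm (\<psi> x) \<le> C"
  shows "(\<integral>x. f x * \<psi> x \<partial>lborel) = 0"
proof -
  let ?g = "\<lambda>n x. complex_of_real (gauss ((1 / real (Suc n)) *\<^sub>R x))"
  have [measurable]: "f \<in> borel_measurable borel" using f by auto
  have m [measurable]: "\<psi> \<in> borel_measurable borel" by (rule borel_measurable_continuous_onI[OF \<psi>(1)])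
  have g: "?g n \<in> schwartz" for n
    using schwartz_affine[OF gauss_schwartz, of "1 / real (Suc n)" 0] by simp
  have C: "norm (\<psi> x * ?g n x) \<le> C" for n x
  proof -
    have "norm (\<psi> x) * gauss ((1 / real (Suc n)) *\<^sub>R x) \<le> norm (\<psi> x)" by (intro mult_left_le gauss_le_1) auto
    then show ?thesis using \<psi>(2)[of x] by (simp add: norm_mult abs_of_nonneg less_imp_le[OF gauss_pos])
  qed
  have z: "(\<integral>x. f x * (\<psi> x * ?g n x) \<partial>lborel) = 0" for n
    by (rule integrable_separated_continuous[OF f 0 continuous_on_mult[OF \<psi>(1)
          smooth_continuous_on[OF schwartz_smooth[OF g]]] C
          integrable_bounded_mult[OF schwartz_integrable[OF g] m \<psi>(2)]])
  have "(\<lambda>n. \<integral>x. f x * (\<psi> x * ?g n x) \<partial>lborel) \<longlonglongrightarrow> (\<integral>x. f x * (\<psi> x * of_real 1) \<partial>lborel)"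
  proof (rule Bochner_Integration.integral_dominated_convergence[where w = "\<lambda>x. C * norm (f x)"])
    show "AE x in lborel. (\<lambda>n. f x * (\<psi> x * ?g n x)) \<longlonglongrightarrow> f x * (\<psi> x * of_real 1)"
    proof (intro AE_I2 tendsto_mult tendsto_const tendsto_of_real)
      fix x :: 'a
      have "(\<lambda>n. (1 / real (Suc n)) *\<^sub>R x) \<longlonglongrightarrow> 0 *\<^sub>R x"
        by (intro tendsto_scaleR LIMSEQ_Suc[OF lim_1_over_n] tendsto_const)
      from continuous_on_tendsto_compose[OF continuous_gauss[of UNIV] this]
      show "(\<lambda>n. gauss ((1 / real (Suc n)) *\<^sub>R x)) \<longlonglongrightarrow> 1" by simp
    qed
    show "AE x in lborel. norm (f x * (\<psi> x * ?g n x)) \<le> C * norm (f x)" for n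
    proof (rule AE_I2)
      fix x
      show "norm (f x * (\<psi> x * ?g n x)) \<le> C * norm (f x)"
        unfolding norm_mult[of "f x"] mult.commute[of C] by (rule mult_left_mono[OF C norm_ge_zero])
    qed
  qed (use f g in auto)
  then show ?thesis using z LIMSEQ_unique[OF _ tendsto_const] by simp
qed

text \<open>The indicator of a nonempty closed set is the limit of continuous tent functions of the
  distance to the set.\<close>

lemma integrable_separated_closed:
  fixes f :: "'a::euclidean_space \<Rightarrow> complex"
  assumes f: "integrable lborel f" and 0: "\<And>\<phi>. \<phi> \<in> schwartz \<Longrightarrow> (\<integral>x. f x * \<phi> x \<partial>lborel) = 0"
    and A: "closed A"
  shows "(\<integral>x. f x * indicator A x \<partial>lborel) = 0"
proof (cases "A = {}")
  case False
  have [measurable]: "f \<in> borel_measurable borel" "A \<in> sets borel" using f A by auto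
  let ?\<psi> = "\<lambda>n x. complex_of_real (max 0 (1 - real (Suc n) * infdist x A))"
  have cont: "continuous_on UNIV (?\<psi> n)" for n by (intro continuous_intros)
  then have [measurable]: "?\<psi> n \<in> borel_measurable borel" for n
    by (rule borel_measurable_continuous_onI)
  have le1: "norm (?\<psi> n x) \<le> 1" for n x by (simp add: infdist_nonneg)
  have "(\<lambda>n. \<integral>x. f x * ?\<psi> n x \<partial>lborel) \<longlonglongrightarrow> (\<integral>x. f x * indicator A x \<partial>lborel)"
  proof (rule Bochner_Integration.integral_dominated_convergence[where w = "\<lambda>x. norm (f x)"])
    show "AE x in lborel. (\<lambda>n. f x * ?\<psi> n x) \<longlonglongrightarrow> f x * indicator A x"
    proof (intro AE_I2 tendsto_mult tendsto_const)
      fix x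
      show "(\<lambda>n. ?\<psi> n x) \<longlonglongrightarrow> indicator A x"
      proof (cases "x \<in> A")
        case True
        then show ?thesis by simp
      next
        case False
        then have pos: "0 < infdist x A"
          using infdist_nonneg[of x A] in_closed_iff_infdist_zero[OF A \<open>A \<noteq> {}\<close>]
          by (metis order_le_less)
        obtain N where N: "1 / infdist x A < real N" using reals_Archimedean2 by blast
        have "?\<psi> n x = 0" if "N \<le> n" for n
        proof -
          have "1 / infdist x A \<le> real (Suc n)" using N that by linarith
          then have "1 \<le> real (Suc n) * infdist x A" using pos by (simp add: pos_divide_le_eq)
          then show ?thesis by simp
        qed
        then have "\<forall>\<^sub>F n in sequentially. ?\<psi> n x = 0" unfolding eventually_sequentially by blast
        then show ?thesis using False tendsto_eventually by fastforce
      qed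
    qed
    show "AE x in lborel. norm (f x * ?\<psi> n x) \<le> norm (f x)" for n
    proof (rule AE_I2)
      fix x
      show "norm (f x * ?\<psi> n x) \<le> norm (f x)"
        unfolding norm_mult by (rule mult_left_le[OF le1 norm_ge_zero])
    qed
  qed (use f in \<open>auto simp del: of_nat_Suc\<close>)
  then show ?thesis
    using integrable_separated_bounded[OF f 0 cont le1] LIMSEQ_unique[OF _ tendsto_const] by simp
qed simp

text \<open>Closed sets form an intersection-stable generator of the Borel sets, and the sets over
  which the integral of \<open>f\<close> vanishes are closed under complements and disjoint
  countable unions; a density with all integrals zero vanishes almost everywhere.\<close>

lemma integrable_separated:
  fixes f :: "'a::euclidean_space \<Rightarrow> complex"
  assumes f: "integrable lborel f" and 0: "\<And>\<phi>. \<phi> \<in> schwartz \<Longrightarrow> (\<integral>x. f x * \<phi> x \<partial>lborel) = 0"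
  shows "AE x in lborel. f x = 0"
proof (rule sigma_finite_measure.density_zero[OF sigma_finite_lborel f])
  have m [measurable]: "f \<in> borel_measurable borel" using f by auto
  have if': "integrable lborel (\<lambda>x. f x * indicator A x)" if A: "A \<in> sets borel" for A
    by (rule Bochner_Integration.integrable_bound[OF f]) (use A in \<open>auto simp: norm_mult indicator_def\<close>)
  have U: "(\<integral>x. f x \<partial>lborel) = 0"
    using integrable_separated_closed[OF f 0 closed_UNIV] by simp
  have "(\<integral>x. f x * indicator A x \<partial>lborel) = 0" if "A \<in> sets borel" for A
  proof -
    have sb: "sets (borel :: 'a measure) = sigma_sets UNIV (Collect closed)"
      by (simp add: borel_eq_closed)
    have Int: "Int_stable (Collect closed :: 'a set set)" by (auto simp: Int_stable_def)
    have sub: "Collect closed \<subseteq> Pow (UNIV :: 'a set)" by simp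
    have "A \<in> sigma_sets UNIV (Collect closed)" using that sb by blast
    then show ?thesis
    proof (induction rule: sigma_sets_induct_disjoint[OF Int sub, consumes 1, case_names basic empty compl union])
      case (compl A)
      then have "A \<in> sets borel" using sb by blast
      have "(\<integral>x. f x * indicator (UNIV - A) x \<partial>lborel) = (\<integral>x. f x - f x * indicator A x \<partial>lborel)"
        by (intro Bochner_Integration.integral_cong refl) (auto simp: indicator_def)
      also have "\<dots> = 0" using compl U if'[OF \<open>A \<in> sets borel\<close>] f by simp
      finally show ?case .
    next
      case (union A)
      then have A: "\<And>i. A i \<in> sets borel" using sb by blast
      have "(\<lambda>n. \<integral>x. f x * (\<Sum>i<n. indicator (A i) x) \<partial>lborel) \<longlonglongrightarrow> (\<integral>x. f x * indicator (\<Union>i. A i) x \<partial>lborel)"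
      proof (rule Bochner_Integration.integral_dominated_convergence[where w = "\<lambda>x. norm (f x)"])
        show "AE x in lborel. (\<lambda>n. f x * (\<Sum>i<n. indicator (A i) x)) \<longlonglongrightarrow> f x * indicator (\<Union>i. A i) x"
        proof (intro AE_I2 tendsto_mult tendsto_const)
          fix x
          have "(\<lambda>i. indicator (A i) x :: complex) sums indicator (\<Union>i. A i) x"
          proof (cases "x \<in> (\<Union>i. A i)")
            case True
            then obtain j where j: "x \<in> A j" by auto
            have "indicator (A i) x = (0::complex)" if "i \<noteq> j" for i
              using union(1) j that by (auto simp: disjoint_family_on_def indicator_def)
            then have "(\<lambda>i. indicator (A i) x :: complex) sums (\<Sum>i\<in>{j}. indicator (A i) x)"
              by (intro sums_finite) auto
            then show ?thesis using j by (simp add: indicator_def)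
          qed auto
          then show "(\<lambda>n. \<Sum>i<n. indicator (A i) x) \<longlonglongrightarrow> (indicator (\<Union>i. A i) x :: complex)"
            by (simp add: sums_def)
        qed
        have "norm (\<Sum>i<n. indicator (A i) x :: complex) \<le> 1" for n x
        proof -
          have "(\<Sum>i<n. indicator (A i) x :: complex) = indicator (\<Union>i<n. A i) x"
            by (rule indicator_UN_disjoint[symmetric]) (use union(1) in \<open>auto simp: disjoint_family_on_def\<close>)
          then show ?thesis by (simp add: indicator_def)
        qed
        then show "AE x in lborel. norm (f x * (\<Sum>i<n. indicator (A i) x)) \<le> norm (f x)" for n
          unfolding norm_mult by (intro AE_I2 mult_left_le norm_ge_zero)
      qed (use f A in auto)
      moreover have "(\<integral>x. f x * (\<Sum>i<n. indicator (A i) x) \<partial>lborel) = 0" for n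
        unfolding sum_distrib_left
        by (subst Bochner_Integration.integral_sum) (simp_all only: if'[OF A] union sum.neutral_const)
      ultimately show ?case using LIMSEQ_unique[OF _ tendsto_const] by simp
    qed (use integrable_separated_closed[OF f 0] in auto)
  qed
  then show "set_lebesgue_integral lborel A f = 0" if "A \<in> sets lborel" for A
    using that by (simp add: set_lebesgue_integral_def scaleR_conv_of_real mult.commute of_real_indicator)
qed

text \<open>An L_2 function need not be integrable, but its product with the Gaussian is. The
  Gaussian maps Schwartz functions to Schwartz functions and has no zeros, so nothing is
  lost.\<close>

lemma L2_separated:
  fixes f :: "'a::euclidean_space \<Rightarrow> complex"
  assumes f: "f \<in> Lp 2" and 0: "\<And>\<phi>. \<phi> \<in> schwartz \<Longrightarrow> (\<integral>x. f x * \<phi> x \<partial>lborel) = 0"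
  shows "AE x in lborel. f x = 0"
proof -
  have "AE x in lborel. f x * of_real (gauss x) = 0"
  proof (rule integrable_separated)
    show "integrable lborel (\<lambda>x. f x * of_real (gauss x))" by (rule L2_mult_schwartz[OF f gauss_schwartz])
    fix \<phi> :: "'a \<Rightarrow> complex" assume "\<phi> \<in> schwartz"
    from 0[OF schwartz_mult[OF slow_schwartz[OF gauss_schwartz] this]]
    show "(\<integral>x. f x * of_real (gauss x) * \<phi> x \<partial>lborel) = 0" by (simp add: mult.assoc)
  qed
  then show ?thesis by eventually_elim (auto simp: less_imp_neq[OF gauss_pos, symmetric])
qed

subsection \<open>The Fourier transform of square integrable functions\<close>

lemma cnj_measurable [measurable (raw)]:
  assumes "f \<in> borel_measurable M" shows "(\<lambda>x. cnj (f x)) \<in> borel_measurable M"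
  using measurable_compose[OF assms borel_measurable_continuous_onI[of cnj]] continuous_on_cnj[OF continuous_on_id]
  by simp

lemma fourier_measurable:
  assumes [measurable]: "f \<in> borel_measurable borel"
  shows "fourier f \<in> borel_measurable (borel :: 'a::euclidean_space measure)"
proof -
  have "(\<lambda>(\<xi>, x). cis (- (x \<bullet> \<xi>)) * f x) \<in> borel_measurable (borel \<Otimes>\<^sub>M lborel)"
    using measurable_compose[OF _ cis_pair_measurable(2), of "\<lambda>(\<xi>::'a, x::'a). (x, \<xi>)"]
    by (auto simp: case_prod_beta' intro!: borel_measurable_times)
  then have "(\<lambda>\<xi>. \<integral>x. cis (- (x \<bullet> \<xi>)) * f x \<partial>lborel) \<in> borel_measurable borel"
    by (rule lborel.borel_measurable_lebesgue_integral)
  then show ?thesis unfolding fourier_def[abs_def] by measurable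
qed

text \<open>Transforming the damped conjugate transform undoes it up to mollification by
  \<open>gk s\<close>. This is inversion for merely integrable functions, which have no integrable
  transform in general.\<close>

lemma fourier_gauss_damped:
  fixes h :: "'a::euclidean_space \<Rightarrow> complex"
  assumes h: "integrable lborel h" and s: "0 < s"
  defines "w \<equiv> (\<lambda>\<xi>. complex_of_real (gauss (s *\<^sub>R \<xi>)) * cnj (fourier h \<xi>))"
  shows "integrable lborel w" "fourier w x = (\<integral>y. cnj (h y) * of_real (gk s (y - x)) \<partial>lborel)"
proof -
  let ?c = "complex_of_real (fc TYPE('a))"
  have [measurable]: "h \<in> borel_measurable borel" using h by auto
  have [measurable]: "fourier h \<in> borel_measurable borel" by (rule fourier_measurable) simp
  let ?g = "\<lambda>\<xi>. complex_of_real (gauss (s *\<^sub>R \<xi>))"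
  have gi: "integrable lborel ?g"
    using schwartz_integrable[OF schwartz_affine[OF gauss_schwartz, of s 0]] s by simp
  show w: "integrable lborel w"
    unfolding w_def mult.commute[of "complex_of_real _"]
    by (rule integrable_bounded_mult[OF gi]) (auto intro: norm_fourier_le)
  let ?f = "\<lambda>\<xi>. cis (- (\<xi> \<bullet> x)) * ?g \<xi>"
  have "fourier w x = ?c * (\<integral>\<xi>. ?f \<xi> * (?c * (\<integral>y. cis (\<xi> \<bullet> y) * cnj (h y) \<partial>lborel)) \<partial>lborel)"
    unfolding fourier_def[of w x] by (simp add: w_def cnj_fourier inv_fourier_def mult.assoc)
  also have "\<dots> = ?c * (\<integral>\<xi>. ?c * (?f \<xi> * (\<integral>y. cis (\<xi> \<bullet> y) * cnj (h y) \<partial>lborel)) \<partial>lborel)"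
    by (simp only: mult.left_commute[of "_ * complex_of_real (gauss _)" ?c])
  also have "\<dots> = ?c * (?c * (\<integral>\<xi>. ?f \<xi> * (\<integral>y. cis (\<xi> \<bullet> y) * cnj (h y) \<partial>lborel) \<partial>lborel))"
    by (simp only: integral_mult_right_zero)
  also have "(\<integral>\<xi>. ?f \<xi> * (\<integral>y. cis (\<xi> \<bullet> y) * cnj (h y) \<partial>lborel) \<partial>lborel) =
      (\<integral>y. cnj (h y) * (\<integral>\<xi>. cis (\<xi> \<bullet> y) * ?f \<xi> \<partial>lborel) \<partial>lborel)"
    by (rule fubini_kernel(1)[where C = 1]) (use h integrable_cis_mult[OF gi] in auto)
  also have "\<dots> = (\<integral>y. cnj (h y) * (of_real ((2 * pi) powr (DIM('a) / 2) * (1 / s) ^ DIM('a) * gauss ((1 / s) *\<^sub>R (y - x)))) \<partial>lborel)"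
  proof (intro Bochner_Integration.integral_cong refl arg_cong2[of _ _ _ _ "(*)"])
    fix y
    have "(\<integral>\<xi>. cis (\<xi> \<bullet> y) * ?f \<xi> \<partial>lborel) = (\<integral>\<xi>. cis (\<xi> \<bullet> (y - x)) * ?g \<xi> \<partial>lborel)"
      unfolding mult.assoc[symmetric] cis_mult by (simp add: inner_diff_right)
    then show "(\<integral>\<xi>. cis (\<xi> \<bullet> y) * ?f \<xi> \<partial>lborel) =
        of_real ((2 * pi) powr (DIM('a) / 2) * (1 / s) ^ DIM('a) * gauss ((1 / s) *\<^sub>R (y - x)))"
      by (simp only: gauss_scaled_fourier[OF s])
  qed
  also have "?c * (?c * \<dots>) = (\<integral>y. cnj (h y) * of_real (gk s (y - x)) \<partial>lborel)"
    unfolding integral_mult_right_zero[symmetric]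
  proof (intro Bochner_Integration.integral_cong refl)
    fix y
    have "fc TYPE('a) * (fc TYPE('a) * ((2 * pi) powr (DIM('a) / 2) * (1 / s) ^ DIM('a) * gauss ((1 / s) *\<^sub>R (y - x)))) =
        (fc TYPE('a) * (2 * pi) powr (DIM('a) / 2)) * gk s (y - x)"
      by (simp add: gk_def mult_ac)
    then have "fc TYPE('a) * (fc TYPE('a) * ((2 * pi) powr (DIM('a) / 2) * (1 / s) ^ DIM('a) * gauss ((1 / s) *\<^sub>R (y - x)))) =
        gk s (y - x)" unfolding fc_cancel by simp
    from arg_cong[OF this, of complex_of_real]
    show "?c * (?c * (cnj (h y) * of_real ((2 * pi) powr (DIM('a) / 2) * (1 / s) ^ DIM('a) * gauss ((1 / s) *\<^sub>R (y - x))))) =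
        cnj (h y) * of_real (gk s (y - x))"
      unfolding of_real_mult by (simp add: mult_ac)
  qed
  finally show "fourier w x = (\<integral>y. cnj (h y) * of_real (gk s (y - x)) \<partial>lborel)" .
qed

text \<open>The multiplication formula rewrites the damped energy of the transform as a double
  integral of h(x), conj h(y) and the kernel. Twice a product is at most the sum of the squares, and
  the kernel has integral 1 in each variable, so Schur's argument gives the bound with constant
  1.\<close>

lemma gauss_damped_bound:
  fixes h :: "'a::euclidean_space \<Rightarrow> complex"
  assumes h: "integrable lborel h" and s: "0 < s"
  shows "(\<integral>\<^sup>+\<xi>. ennreal (gauss (s *\<^sub>R \<xi>) * (norm (fourier h \<xi>))\<^sup>2) \<partial>lborel) \<le> sqint h"
proof -
  have [measurable]: "h \<in> borel_measurable borel" using h by auto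
  have [measurable]: "fourier h \<in> borel_measurable borel" by (rule fourier_measurable) simp
  let ?w = "\<lambda>\<xi>. complex_of_real (gauss (s *\<^sub>R \<xi>)) * cnj (fourier h \<xi>)"
  note w = fourier_gauss_damped[OF h s]
  have eq: "fourier h \<xi> * ?w \<xi> = of_real (gauss (s *\<^sub>R \<xi>) * (norm (fourier h \<xi>))\<^sup>2)" for \<xi>
    unfolding of_real_mult complex_norm_square by (simp add: mult_ac)
  have i: "integrable lborel (\<lambda>\<xi>. fourier h \<xi> * ?w \<xi>)"
    by (rule integrable_bounded_mult[OF w(1)]) (auto intro: norm_fourier_le)
  have i': "integrable lborel (\<lambda>\<xi>. gauss (s *\<^sub>R \<xi>) * (norm (fourier h \<xi>))\<^sup>2)"
    using integrable_Re[OF i] unfolding eq Re_complex_of_real .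
  have "(\<integral>\<^sup>+\<xi>. ennreal (gauss (s *\<^sub>R \<xi>) * (norm (fourier h \<xi>))\<^sup>2) \<partial>lborel) =
      ennreal (\<integral>\<xi>. gauss (s *\<^sub>R \<xi>) * (norm (fourier h \<xi>))\<^sup>2 \<partial>lborel)"
    by (rule nn_integral_eq_integral[OF i']) (simp add: less_imp_le[OF gauss_pos])
  also have "\<dots> = ennreal (norm (\<integral>\<xi>. fourier h \<xi> * ?w \<xi> \<partial>lborel))"
    unfolding eq integral_complex_of_real norm_of_real
    by (intro arg_cong[of _ _ ennreal] abs_of_nonneg[symmetric] integral_nonneg_AE) (simp add: less_imp_le[OF gauss_pos])
  also have "(\<integral>\<xi>. fourier h \<xi> * ?w \<xi> \<partial>lborel) = (\<integral>x. h x * (\<integral>y. cnj (h y) * of_real (gk s (y - x)) \<partial>lborel) \<partial>lborel)"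
    by (subst fourier_mult_formula[OF h w(1), symmetric]) (simp only: w(2))
  also have "ennreal (norm \<dots>) \<le> (\<integral>\<^sup>+x. ennreal (norm (h x * (\<integral>y. cnj (h y) * of_real (gk s (y - x)) \<partial>lborel))) \<partial>lborel)"
    by (rule integral_norm_bound_ennreal)
       (unfold w(2)[symmetric], subst mult.commute, rule integrable_bounded_mult[OF h fourier_measurable norm_fourier_le], use w(1) in auto)
  also have "\<dots> \<le> (\<integral>\<^sup>+x. (\<integral>\<^sup>+y. ennreal (norm (h x) * norm (h y) * gk s (y - x)) \<partial>lborel) \<partial>lborel)"
  proof (rule nn_integral_mono)
    fix x
    have "ennreal (norm (\<integral>y. h x * (cnj (h y) * of_real (gk s (y - x))) \<partial>lborel)) \<le>
        (\<integral>\<^sup>+y. ennreal (norm (h x * (cnj (h y) * of_real (gk s (y - x))))) \<partial>lborel)"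
    proof (rule integral_norm_bound_ennreal, rule integrable_mult_right)
      have "integrable lborel (\<lambda>y. of_real (gk s (y - x)) * cnj (h y))"
        by (rule integrable_bounded_mult[OF _ _ norm_gk_le[OF s]]) (use h in auto)
      then show "integrable lborel (\<lambda>y. cnj (h y) * of_real (gk s (y - x)))" by (simp add: mult.commute)
    qed
    then show "ennreal (norm (h x * (\<integral>y. cnj (h y) * of_real (gk s (y - x)) \<partial>lborel))) \<le>
        (\<integral>\<^sup>+y. ennreal (norm (h x) * norm (h y) * gk s (y - x)) \<partial>lborel)"
      by (simp add: norm_mult gk_nonneg[OF s] abs_of_nonneg mult_ac)
  qed
  also have "\<dots> \<le> (\<integral>\<^sup>+x. (\<integral>\<^sup>+y. ennreal (1 / 2) * (ennreal ((norm (h x))\<^sup>2) * ennreal (gk s (y - x)))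
      + ennreal (1 / 2) * (ennreal ((norm (h y))\<^sup>2) * ennreal (gk s (y - x))) \<partial>lborel) \<partial>lborel)"
  proof (intro nn_integral_mono)
    fix x y
    have "norm (h x) * norm (h y) \<le> (1 / 2) * (norm (h x))\<^sup>2 + (1 / 2) * (norm (h y))\<^sup>2"
      using zero_le_power2[of "norm (h x) - norm (h y)"] by (simp add: power2_diff)
    from mult_right_mono[OF this gk_nonneg[OF s, of "y - x"]]
    have "norm (h x) * norm (h y) * gk s (y - x) \<le>
       (1 / 2) * ((norm (h x))\<^sup>2 * gk s (y - x)) + (1 / 2) * ((norm (h y))\<^sup>2 * gk s (y - x))"
      by (simp add: distrib_right)
    then have "ennreal (norm (h x) * norm (h y) * gk s (y - x)) \<le>
       ennreal (1 / 2) * ennreal ((norm (h x))\<^sup>2 * gk s (y - x)) + ennreal (1 / 2) * ennreal ((norm (h y))\<^sup>2 * gk s (y - x))"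
      by (rule ennreal_add_mult_leI) (auto simp: gk_nonneg[OF s])
    then show "ennreal (norm (h x) * norm (h y) * gk s (y - x)) \<le>
       ennreal (1 / 2) * (ennreal ((norm (h x))\<^sup>2) * ennreal (gk s (y - x)))
      + ennreal (1 / 2) * (ennreal ((norm (h y))\<^sup>2) * ennreal (gk s (y - x)))"
      by (simp add: ennreal_mult gk_nonneg[OF s])
  qed
  also have "\<dots> = ennreal (1 / 2) * (\<integral>\<^sup>+x. (\<integral>\<^sup>+y. ennreal ((norm (h x))\<^sup>2) * ennreal (gk s (y - x)) \<partial>lborel) \<partial>lborel)
      + ennreal (1 / 2) * (\<integral>\<^sup>+x. (\<integral>\<^sup>+y. ennreal ((norm (h y))\<^sup>2) * ennreal (gk s (y - x)) \<partial>lborel) \<partial>lborel)"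
    by (simp add: nn_integral_add nn_integral_cmult)
  also have "(\<integral>\<^sup>+x. (\<integral>\<^sup>+y. ennreal ((norm (h y))\<^sup>2) * ennreal (gk s (y - x)) \<partial>lborel) \<partial>lborel) =
      (\<integral>\<^sup>+y. (\<integral>\<^sup>+x. ennreal ((norm (h y))\<^sup>2) * ennreal (gk s (y - x)) \<partial>lborel) \<partial>lborel)"
    by (rule lborel_pair.Fubini') measurable
  also have "(\<integral>\<^sup>+y. (\<integral>\<^sup>+x. ennreal ((norm (h y))\<^sup>2) * ennreal (gk s (y - x)) \<partial>lborel) \<partial>lborel) = sqint h"
    by (simp add: sqint_def nn_integral_cmult nn_integral_gk[OF s])
  also have "(\<integral>\<^sup>+x. (\<integral>\<^sup>+y. ennreal ((norm (h x))\<^sup>2) * ennreal (gk s (y - x)) \<partial>lborel) \<partial>lborel) = sqint h"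
    by (simp add: sqint_def nn_integral_cmult nn_integral_gk[OF s])
  also have "ennreal (1 / 2) * sqint h + ennreal (1 / 2) * sqint h = sqint h"
    unfolding distrib_right[symmetric] by (subst ennreal_plus[symmetric]) auto
  finally show ?thesis .
qed

text \<open>Fatou's lemma as the damping is removed. Only an inequality is needed: equality will
  follow once the same bound is known for the inverse.\<close>

lemma sqint_fourier_le:
  fixes h :: "'a::euclidean_space \<Rightarrow> complex"
  assumes h: "integrable lborel h"
  shows "sqint (fourier h) \<le> sqint h"
proof -
  have [measurable]: "fourier h \<in> borel_measurable borel" by (rule fourier_measurable) (use h in auto)
  let ?u = "\<lambda>n \<xi>. ennreal (gauss ((1 / real (Suc n)) *\<^sub>R \<xi>) * (norm (fourier h \<xi>))\<^sup>2)"
  have "sqint (fourier h) = (\<integral>\<^sup>+\<xi>. liminf (\<lambda>n. ?u n \<xi>) \<partial>lborel)"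
    unfolding sqint_def
  proof (intro nn_integral_cong)
    fix \<xi> :: 'a
    have "(\<lambda>n. (1 / real (Suc n)) *\<^sub>R \<xi>) \<longlonglongrightarrow> 0 *\<^sub>R \<xi>"
      by (intro tendsto_scaleR LIMSEQ_Suc[OF lim_1_over_n] tendsto_const)
    from continuous_on_tendsto_compose[OF continuous_gauss[of UNIV] this]
    have "(\<lambda>n. gauss ((1 / real (Suc n)) *\<^sub>R \<xi>)) \<longlonglongrightarrow> 1" by simp
    then have "(\<lambda>n. ?u n \<xi>) \<longlonglongrightarrow> ennreal (1 * (norm (fourier h \<xi>))\<^sup>2)"
      by (intro tendsto_ennrealI tendsto_mult tendsto_const)
    from lim_imp_Liminf[OF _ this]
    show "ennreal ((norm (fourier h \<xi>))\<^sup>2) = liminf (\<lambda>n. ?u n \<xi>)" by simp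
  qed
  also have "\<dots> \<le> liminf (\<lambda>n. \<integral>\<^sup>+\<xi>. ?u n \<xi> \<partial>lborel)"
    by (rule nn_integral_liminf) measurable
  also have "\<dots> \<le> liminf (\<lambda>n. sqint h)"
    by (intro Liminf_mono always_eventually allI gauss_damped_bound[OF h]) simp
  also have "\<dots> = sqint h" by (simp add: Liminf_const)
  finally show ?thesis .
qed

text \<open>Truncations of \<open>f\<close> to balls are integrable, so their transforms are
  functions. With rapidly growing radii consecutive transforms differ so little in L_2 that they
  converge almost everywhere, and the limit is the transform in the weak sense.\<close>

lemma L2_fourier_exists:
  fixes f :: "'a::euclidean_space \<Rightarrow> complex"
  assumes f: "f \<in> Lp 2"
  shows "\<exists>g\<in>Lp 2. sqint g \<le> sqint f \<and> (\<forall>\<phi>\<in>schwartz. (\<integral>x. f x * fourier \<phi> x \<partial>lborel) = (\<integral>x. g x * \<phi> x \<partial>lborel))"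
proof -
  have [measurable]: "f \<in> borel_measurable borel" by (rule Lp_measurable[OF f])
  have fin: "sqint f < top" using f by (simp add: L2_iff)
  define tail where "tail n = sqint (\<lambda>x. f x * indicator {x. real n < norm x} x)" for n
  have tail0: "tail \<longlonglongrightarrow> 0"
  proof -
    have "(\<lambda>n. \<integral>\<^sup>+x. ennreal ((norm (f x * indicator {x. real n < norm x} x))\<^sup>2) \<partial>lborel) \<longlonglongrightarrow> (\<integral>\<^sup>+x. 0 \<partial>(lborel :: 'a measure))"
    proof (rule nn_integral_dominated_convergence[where w = "\<lambda>x. ennreal ((norm (f x))\<^sup>2)"])
      show "AE x in lborel. (\<lambda>n. ennreal ((norm (f x * indicator {x. real n < norm x} x))\<^sup>2)) \<longlonglongrightarrow> 0"
      proof (rule AE_I2)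
        fix x :: 'a
        obtain N where N: "norm x \<le> real N" using real_arch_simple by blast
        have "ennreal ((norm (f x * indicator {x. real n < norm x} x))\<^sup>2) = 0" if "N \<le> n" for n
          using N that by (simp add: indicator_def)
        then show "(\<lambda>n. ennreal ((norm (f x * indicator {x. real n < norm x} x))\<^sup>2)) \<longlonglongrightarrow> 0"
          by (intro tendsto_eventually) (auto simp: eventually_sequentially)
      qed
    qed (use fin in \<open>auto simp: sqint_def indicator_def\<close>)
    then show ?thesis by (simp add: tail_def[abs_def] sqint_def)
  qed
  have "\<exists>n. \<forall>m\<ge>n. tail m \<le> ennreal ((1 / 4) ^ k)" for k
  proof -
    have "\<forall>\<^sub>F n in sequentially. tail n < ennreal ((1 / 4) ^ k)"
      using tail0 by (rule order_tendstoD) simp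
    then show ?thesis unfolding eventually_sequentially by (meson less_imp_le)
  qed
  then obtain N0 where N0: "\<And>k m. N0 k \<le> m \<Longrightarrow> tail m \<le> ennreal ((1 / 4) ^ k)" by metis
  \<comment> \<open>Summing the radii makes them monotone, so the truncations are nested and each
    difference is supported outside the previous ball.\<close>
  define N where "N k = (\<Sum>i\<le>k. N0 i)" for k
  have N: "tail (N k) \<le> ennreal ((1 / 4) ^ k)" for k
    by (rule N0) (simp add: N_def member_le_sum)
  have Nmono: "N k \<le> N (Suc k)" for k by (simp add: N_def)
  define F where "F n = (\<lambda>x. f x * indicator (cball 0 (real n)) x)" for n
  have Fm [measurable]: "F n \<in> borel_measurable borel" for n unfolding F_def by (intro borel_measurable_times borel_measurable_indicator) auto
  have FL: "sqint (F n) \<le> sqint f" for n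
    unfolding sqint_def F_def by (intro nn_integral_mono ennreal_leI) (auto simp: indicator_def)
  have Fi: "integrable lborel (F n)" for n
  proof -
    have "(\<lambda>x::'a. indicator (cball 0 (real n)) x :: complex) \<in> Lp 2"
      unfolding L2_iff sqint_def
    proof
      have "(\<integral>\<^sup>+x. ennreal ((norm (indicator (cball (0::'a) (real n)) x :: complex))\<^sup>2) \<partial>lborel) =
          (\<integral>\<^sup>+x. indicator (cball (0::'a) (real n)) x \<partial>lborel)"
        by (intro nn_integral_cong) (auto simp: indicator_def)
      also have "\<dots> < top" using emeasure_bounded_finite[of "cball (0::'a) (real n)"] by simp
      finally show "(\<integral>\<^sup>+x. ennreal ((norm (indicator (cball (0::'a) (real n)) x :: complex))\<^sup>2) \<partial>lborel) < top" .
    qed (auto intro!: borel_measurable_indicator)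
    from L2_mult_integrable[OF f this] show ?thesis by (simp add: F_def)
  qed
  define G where "G k = fourier (F (N k))" for k
  have Gm [measurable]: "G k \<in> borel_measurable borel" for k unfolding G_def by (rule fourier_measurable) simp
  have GL: "sqint (G k) \<le> sqint f" for k
    unfolding G_def using sqint_fourier_le[OF Fi] FL by (rule order_trans)
  have dG: "sqint (\<lambda>\<xi>. G (Suc k) \<xi> - G k \<xi>) \<le> ennreal ((1 / 4) ^ k)" for k
  proof -
    let ?d = "\<lambda>x. F (N (Suc k)) x + (- 1) * F (N k) x"
    have i: "integrable lborel ?d" by (intro Bochner_Integration.integrable_add integrable_mult_right Fi)
    have "fourier ?d \<xi> = fourier (F (N (Suc k))) \<xi> + (- 1) * fourier (F (N k)) \<xi>" for \<xi>
      by (simp only: fourier_add Fi integrable_mult_right fourier_cmult)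
    then have "G (Suc k) \<xi> - G k \<xi> = fourier ?d \<xi>" for \<xi> by (simp only: G_def) simp
    then have "sqint (\<lambda>\<xi>. G (Suc k) \<xi> - G k \<xi>) \<le> sqint ?d" using sqint_fourier_le[OF i] by simp
    also have "\<dots> \<le> tail (N k)"
      unfolding tail_def sqint_def F_def
      using of_nat_mono[OF Nmono[of k], where 'a = real]
      by (intro nn_integral_mono ennreal_leI power_mono) (auto simp: indicator_def)
    also note N
    finally show ?thesis .
  qed
  \<comment> \<open>The factor 2 ^ k costs little against squared norms of size (1/4) ^ k, and by y
    \<le> (1/2) ^ k + 2 ^ k * y^2 finiteness of \<open>S\<close> makes the series of differences
    absolutely summable. It also yields a majorant for the whole sequence.\<close>
  define S where "S \<xi> = (\<Sum>k. ennreal (2 ^ k) * ennreal ((norm (G (Suc k) \<xi> - G k \<xi>))\<^sup>2))" for \<xi>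
  have Sm [measurable]: "S \<in> borel_measurable borel" unfolding S_def[abs_def] by measurable
  have Sint: "(\<integral>\<^sup>+\<xi>. S \<xi> \<partial>lborel) < top"
  proof -
    have "(\<integral>\<^sup>+\<xi>. S \<xi> \<partial>lborel) = (\<Sum>k. \<integral>\<^sup>+\<xi>. ennreal (2 ^ k) * ennreal ((norm (G (Suc k) \<xi> - G k \<xi>))\<^sup>2) \<partial>lborel)"
      unfolding S_def by (rule nn_integral_suminf) measurable
    also have "\<dots> = (\<Sum>k. ennreal (2 ^ k) * sqint (\<lambda>\<xi>. G (Suc k) \<xi> - G k \<xi>))"
      by (simp add: nn_integral_cmult sqint_def)
    also have "\<dots> \<le> (\<Sum>k. ennreal ((1 / 2) ^ k))"
    proof (intro suminf_le allI)
      fix k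
      have "ennreal (2 ^ k) * sqint (\<lambda>\<xi>. G (Suc k) \<xi> - G k \<xi>) \<le> ennreal (2 ^ k) * ennreal ((1 / 4) ^ k)"
        by (intro mult_left_mono dG) auto
      also have "\<dots> = ennreal ((2 * (1 / 4)) ^ k)" unfolding power_mult_distrib by (simp add: ennreal_mult)
      finally show "ennreal (2 ^ k) * sqint (\<lambda>\<xi>. G (Suc k) \<xi> - G k \<xi>) \<le> ennreal ((1 / 2) ^ k)" by simp
    qed auto
    also have "\<dots> = ennreal (\<Sum>k. (1 / 2) ^ k)"
      by (rule suminf_ennreal2) (auto intro!: summable_geometric)
    also have "\<dots> < top" by simp
    finally show ?thesis .
  qed
  then have "AE \<xi> in lborel. S \<xi> \<noteq> \<infinity>"
    by (intro nn_integral_PInf_AE) (auto simp: less_top[symmetric])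
  then have ae: "AE \<xi> in lborel. S \<xi> < top" by (simp add: less_top)
  define g where "g \<xi> = (if S \<xi> < top then lim (\<lambda>k. G k \<xi>) else 0)" for \<xi>
  have gm [measurable]: "g \<in> borel_measurable borel" unfolding g_def[abs_def] by measurable
  have main: "(\<lambda>k. G k \<xi>) \<longlonglongrightarrow> g \<xi>" "\<And>k. norm (G k \<xi>) \<le> norm (G 0 \<xi>) + 2 + enn2real (S \<xi>)"
    if Sf: "S \<xi> < top" for \<xi>
  proof -
    let ?d = "\<lambda>k. G (Suc k) \<xi> - G k \<xi>"
    have le: "norm (?d k) \<le> (1 / 2) ^ k + 2 ^ k * (norm (?d k))\<^sup>2" for k
    proof -
      have "norm (?d k) * 1 \<le> (1 / 2) ^ k * (1 + (2 ^ k * norm (?d k))\<^sup>2)"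
      proof -
        have "2 ^ k * norm (?d k) \<le> 1 + (2 ^ k * norm (?d k))\<^sup>2"
        proof -
          have "y \<le> 1 + y\<^sup>2" if "0 \<le> y" for y :: real
            using that zero_le_power2[of "y - 1"] unfolding power2_diff by simp
          then show ?thesis by simp
        qed
        from mult_left_mono[OF this, of "(1 / 2) ^ k"] show ?thesis
          by (simp add: power_one_over)
      qed
      then show ?thesis by (simp add: power_one_over distrib_left power_mult_distrib power2_eq_square mult_ac)
    qed
    have s1: "summable (\<lambda>k. 2 ^ k * (norm (?d k))\<^sup>2)" and
      s2: "(\<Sum>k. 2 ^ k * (norm (?d k))\<^sup>2) = enn2real (S \<xi>)"
    proof -
      have S: "S \<xi> = (\<Sum>k. ennreal (2 ^ k * (norm (?d k))\<^sup>2))" by (simp add: S_def ennreal_mult)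
      show sm: "summable (\<lambda>k. 2 ^ k * (norm (?d k))\<^sup>2)"
        by (rule summable_suminf_not_top) (use Sf S in auto)
      then have "S \<xi> = ennreal (\<Sum>k. 2 ^ k * (norm (?d k))\<^sup>2)"
        unfolding S by (intro suminf_ennreal2) auto
      then show "(\<Sum>k. 2 ^ k * (norm (?d k))\<^sup>2) = enn2real (S \<xi>)"
        using sm by (simp add: suminf_nonneg)
    qed
    have sg: "summable (\<lambda>k. (1 / 2) ^ k :: real)" by (simp add: summable_geometric)
    have sm: "summable (\<lambda>k. norm (?d k))"
      by (rule summable_comparison_test'[OF summable_add[OF sg s1], of 0]) (use le in auto)
    then have "summable ?d" by (rule summable_norm_cancel)
    then have "(\<lambda>k. \<Sum>i<k. ?d i) \<longlonglongrightarrow> suminf ?d" by (rule summable_LIMSEQ)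
    then have "(\<lambda>k. G k \<xi> - G 0 \<xi>) \<longlonglongrightarrow> suminf ?d" by (simp add: sum_lessThan_telescope[of "\<lambda>k. G k \<xi>"])
    then have "convergent (\<lambda>k. G k \<xi>)"
      unfolding convergent_def using tendsto_add[of "\<lambda>k. G k \<xi> - G 0 \<xi>" _ _ "\<lambda>k. G 0 \<xi>" "G 0 \<xi>"] by fastforce
    then show "(\<lambda>k. G k \<xi>) \<longlonglongrightarrow> g \<xi>" using Sf by (simp add: g_def convergent_LIMSEQ_iff)
    fix k
    have "norm (G k \<xi> - G 0 \<xi>) = norm (\<Sum>i<k. ?d i)" by (simp add: sum_lessThan_telescope[of "\<lambda>k. G k \<xi>"])
    also have "\<dots> \<le> (\<Sum>i<k. norm (?d i))" by (rule norm_sum)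
    also have "\<dots> \<le> (\<Sum>i. norm (?d i))" by (intro sum_le_suminf sm) auto
    also have "\<dots> \<le> (\<Sum>k. (1 / 2) ^ k + 2 ^ k * (norm (?d k))\<^sup>2)"
      by (intro suminf_le le sm summable_add sg s1)
    also have "\<dots> = 2 + enn2real (S \<xi>)"
      by (simp add: suminf_add[OF sg s1, symmetric] s2 suminf_geometric)
    finally show "norm (G k \<xi>) \<le> norm (G 0 \<xi>) + 2 + enn2real (S \<xi>)"
      using norm_triangle_sub[of "G k \<xi>" "G 0 \<xi>"] by simp
  qed
  have gL: "sqint g \<le> sqint f"
  proof -
    have "sqint g \<le> (\<integral>\<^sup>+\<xi>. liminf (\<lambda>k. ennreal ((norm (G k \<xi>))\<^sup>2)) \<partial>lborel)"
      unfolding sqint_def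
    proof (rule nn_integral_mono)
      fix \<xi>
      show "ennreal ((norm (g \<xi>))\<^sup>2) \<le> liminf (\<lambda>k. ennreal ((norm (G k \<xi>))\<^sup>2))"
      proof (cases "S \<xi> < top")
        case True
        have "(\<lambda>k. ennreal ((norm (G k \<xi>))\<^sup>2)) \<longlonglongrightarrow> ennreal ((norm (g \<xi>))\<^sup>2)"
          by (intro tendsto_ennrealI tendsto_power tendsto_norm main(1)[OF True])
        from lim_imp_Liminf[OF _ this] show ?thesis by simp
      qed (simp add: g_def)
    qed
    also have "\<dots> \<le> liminf (\<lambda>k. sqint (G k))"
      unfolding sqint_def by (rule nn_integral_liminf) measurable
    also have "\<dots> \<le> liminf (\<lambda>k. sqint f)" by (intro Liminf_mono always_eventually allI GL)
    finally show ?thesis by (simp add: Liminf_const)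
  qed
  moreover have "(\<integral>x. f x * fourier \<phi> x \<partial>lborel) = (\<integral>x. g x * \<phi> x \<partial>lborel)" if \<phi>: "\<phi> \<in> schwartz" for \<phi>
  proof -
    have [measurable]: "\<phi> \<in> borel_measurable borel" using \<phi> by measurable
    have [measurable]: "fourier \<phi> \<in> borel_measurable borel" using fourier_schwartz[OF \<phi>] by measurable
    have eq: "(\<integral>x. G k x * \<phi> x \<partial>lborel) = (\<integral>x. F (N k) x * fourier \<phi> x \<partial>lborel)" for k
      unfolding G_def by (rule fourier_mult_formula[OF Fi schwartz_integrable[OF \<phi>], symmetric])
    have "(\<lambda>k. \<integral>x. G k x * \<phi> x \<partial>lborel) \<longlonglongrightarrow> (\<integral>x. g x * \<phi> x \<partial>lborel)"
    proof (rule Bochner_Integration.integral_dominated_convergence[where w = "\<lambda>\<xi>. (norm (G 0 \<xi>) + 2 + enn2real (S \<xi>)) * norm (\<phi> \<xi>)"])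
      obtain C where C: "0 \<le> C" "\<And>x. norm (\<phi> x) \<le> C" using schwartz_bounded[OF \<phi>] by blast
      have i1: "integrable lborel (\<lambda>\<xi>. enn2real (S \<xi>))"
        by (rule integrableI_bounded)
           (use Sint in \<open>auto intro!: order_le_less_trans[OF nn_integral_mono Sint] ennreal_enn2real_if[THEN eq_refl, THEN order_trans] split: if_splits\<close>)
      have G0: "G 0 \<in> Lp 2" using GL[of 0] fin by (simp add: L2_iff)
      have "integrable lborel (\<lambda>\<xi>. \<phi> \<xi> * complex_of_real (enn2real (S \<xi>)))"
        by (rule integrable_bounded_mult[OF integrable_of_real[OF i1] _ C(2)]) simp
      then have i2: "integrable lborel (\<lambda>\<xi>. complex_of_real (enn2real (S \<xi>)) * \<phi> \<xi>)"
        by (simp add: mult.commute)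
      have "integrable lborel (\<lambda>\<xi>. norm (G 0 \<xi> * \<phi> \<xi>) + 2 * norm (\<phi> \<xi>) + norm (of_real (enn2real (S \<xi>)) * \<phi> \<xi>))"
        by (intro Bochner_Integration.integrable_add integrable_norm integrable_mult_right L2_mult_schwartz G0 \<phi>
            schwartz_integrable i2)
      then show "integrable lborel (\<lambda>\<xi>. (norm (G 0 \<xi>) + 2 + enn2real (S \<xi>)) * norm (\<phi> \<xi>))"
        by (simp add: norm_mult distrib_right)
      show "AE \<xi> in lborel. (\<lambda>k. G k \<xi> * \<phi> \<xi>) \<longlonglongrightarrow> g \<xi> * \<phi> \<xi>"
        using ae by eventually_elim (intro tendsto_mult tendsto_const main)
      show "AE \<xi> in lborel. norm (G k \<xi> * \<phi> \<xi>) \<le> (norm (G 0 \<xi>) + 2 + enn2real (S \<xi>)) * norm (\<phi> \<xi>)" for k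
        using ae by eventually_elim (unfold norm_mult, intro mult_right_mono main norm_ge_zero)
    qed measurable
    moreover have "(\<lambda>k. \<integral>x. F (N k) x * fourier \<phi> x \<partial>lborel) \<longlonglongrightarrow> (\<integral>x. f x * fourier \<phi> x \<partial>lborel)"
    proof -
      let ?b = "Lp_norm 2 (fourier \<phi>)"
      obtain b where b: "0 \<le> b" "?b = ennreal b"
        using Lp_finite[OF schwartz_Lp[OF _ fourier_schwartz[OF \<phi>], of 2]] by (cases ?b) auto
      have "(\<lambda>k. \<integral>x. (f x - F (N k) x) * fourier \<phi> x \<partial>lborel) \<longlonglongrightarrow> 0"
      proof (rule Lim_null_comparison)
        \<comment> \<open>The bound (1/4) ^ k on the squared tail becomes (1/2) ^ k for the norm
          used by Hoelder.\<close>
        show "\<forall>\<^sub>F k in sequentially. norm (\<integral>x. (f x - F (N k) x) * fourier \<phi> x \<partial>lborel) \<le> (1 / 2) ^ k * b"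
        proof (intro always_eventually allI)
          fix k
          have "sqint (\<lambda>x. f x - F (N k) x) \<le> tail (N k)"
            unfolding sqint_def tail_def F_def
            by (intro nn_integral_mono ennreal_leI power_mono) (auto simp: indicator_def)
          also note N
          also have "ennreal ((1 / 4) ^ k) = ennreal (((1 / 2) ^ k) powr 2)"
            by (simp add: powr_numeral power_mult_distrib[symmetric] power2_eq_square)
          finally have "Lp_norm 2 (\<lambda>x. f x - F (N k) x) \<le> ennreal ((1 / 2) ^ k)"
            by (subst Lp_norm_le_iff) (auto simp: sqint_def powr_2_norm)
          then show "norm (\<integral>x. (f x - F (N k) x) * fourier \<phi> x \<partial>lborel) \<le> (1 / 2) ^ k * b"
            using b by (intro hoelder_integral(2)[of 2 2]) auto
        qed
        have "(\<lambda>k. (1 / 2) ^ k * b) \<longlonglongrightarrow> 0 * b" by (intro tendsto_mult tendsto_const LIMSEQ_realpow_zero) auto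
        then show "(\<lambda>k. (1 / 2) ^ k * b) \<longlonglongrightarrow> 0" by simp
      qed
      moreover have FLp: "F n \<in> Lp 2" for n using FL[of n] fin by (simp add: L2_iff)
      have "(\<integral>x. (f x - F (N k) x) * fourier \<phi> x \<partial>lborel) =
          (\<integral>x. f x * fourier \<phi> x \<partial>lborel) - (\<integral>x. F (N k) x * fourier \<phi> x \<partial>lborel)" for k
        unfolding left_diff_distrib
        by (intro Bochner_Integration.integral_diff L2_mult_schwartz f FLp fourier_schwartz \<phi>)
      ultimately have "(\<lambda>k. (\<integral>x. f x * fourier \<phi> x \<partial>lborel) - (\<integral>x. F (N k) x * fourier \<phi> x \<partial>lborel)) \<longlonglongrightarrow> 0"
        by simp
      from tendsto_diff[OF tendsto_const this, of "\<integral>x. f x * fourier \<phi> x \<partial>lborel"] show ?thesis by simp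
    qed
    ultimately show ?thesis unfolding eq using LIMSEQ_unique by blast
  qed
  ultimately show ?thesis using gL fin by (intro bexI[of _ g]) (auto simp: L2_iff)
qed

text \<open>The statement that \<open>g\<close> is the L_2 Fourier transform of \<open>f\<close>,
  expressed by duality. A relation fits better than a function because each side is determined only
  almost everywhere.\<close>

definition fpair :: "('a::euclidean_space \<Rightarrow> complex) \<Rightarrow> ('a \<Rightarrow> complex) \<Rightarrow> bool" where
  "fpair f g \<longleftrightarrow> f \<in> Lp 2 \<and> g \<in> Lp 2 \<and>
    (\<forall>\<phi>\<in>schwartz. (\<integral>x. f x * fourier \<phi> x \<partial>lborel) = (\<integral>x. g x * \<phi> x \<partial>lborel))"

lemma fpair_L2: "fpair f g \<Longrightarrow> f \<in> Lp 2" "fpair f g \<Longrightarrow> g \<in> Lp 2"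
  and fpair_eq: "fpair f g \<Longrightarrow> \<phi> \<in> schwartz \<Longrightarrow> (\<integral>x. f x * fourier \<phi> x \<partial>lborel) = (\<integral>x. g x * \<phi> x \<partial>lborel)"
  by (simp_all add: fpair_def)

lemma fpair_exists: "f \<in> Lp 2 \<Longrightarrow> \<exists>g. fpair f g \<and> sqint g \<le> sqint f"
  using L2_fourier_exists unfolding fpair_def by blast

lemma fourier_fourier: "\<phi> \<in> schwartz \<Longrightarrow> fourier (fourier \<phi>) x = \<phi> (- x)"
  using fun_cong[OF fourier_inversion, of \<phi> "- x"] by (simp add: inv_fourier_eq)

lemma sqint_uminus:
  assumes [measurable]: "f \<in> borel_measurable borel"
  shows "sqint (\<lambda>x. f (- x)) = sqint f"
  unfolding sqint_def
  using lborel_nn_integral_affine[of "\<lambda>x. ennreal ((norm (f x))\<^sup>2)" "-1" 0] by simp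

text \<open>Transforming twice is a reflection, so the existence result is applied to the reflected
  function.\<close>

lemma fpair_exists_inv:
  fixes g :: "'a::euclidean_space \<Rightarrow> complex"
  assumes g: "g \<in> Lp 2"
  shows "\<exists>f. fpair f g \<and> sqint f \<le> sqint g"
proof -
  have [measurable]: "g \<in> borel_measurable borel" by (rule Lp_measurable[OF g])
  have "(\<lambda>x. g (- x)) \<in> Lp 2" using g by (simp add: L2_iff sqint_uminus)
  then obtain f where f: "f \<in> Lp 2" "sqint f \<le> sqint (\<lambda>x. g (- x))"
    "\<And>\<phi>. \<phi> \<in> schwartz \<Longrightarrow> (\<integral>x. g (- x) * fourier \<phi> x \<partial>lborel) = (\<integral>x. f x * \<phi> x \<partial>lborel)"
    using L2_fourier_exists by blast
  have "(\<integral>x. f x * fourier \<phi> x \<partial>lborel) = (\<integral>x. g x * \<phi> x \<partial>lborel)" if \<phi>: "\<phi> \<in> schwartz" for \<phi>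
  proof -
    have [measurable]: "\<phi> \<in> borel_measurable borel" using \<phi> by measurable
    have "(\<integral>x. f x * fourier \<phi> x \<partial>lborel) = (\<integral>x. g (- x) * \<phi> (- x) \<partial>lborel)"
      using f(3)[OF fourier_schwartz[OF \<phi>]] by (simp add: fourier_fourier[OF \<phi>])
    also have "\<dots> = (\<integral>x. g x * \<phi> x \<partial>lborel)"
      by (rule lborel_integral_uminus[of "\<lambda>x. g x * \<phi> x"]) measurable
    finally show ?thesis .
  qed
  then show ?thesis using f g by (auto simp: fpair_def sqint_uminus)
qed

lemma L2_eq_AE:
  assumes f: "f \<in> Lp 2" and g: "g \<in> Lp 2"
    and eq: "\<And>\<phi>. \<phi> \<in> schwartz \<Longrightarrow> (\<integral>x. f x * \<phi> x \<partial>lborel) = (\<integral>x. g x * \<phi> x \<partial>lborel)"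
  shows "AE x in lborel. f x = g x"
proof -
  have d: "(\<lambda>x. f x + (- 1) * g x) \<in> Lp 2" by (intro L2_add L2_cmult f g)
  have "(\<integral>x. (f x + (- 1) * g x) * \<phi> x \<partial>lborel) = 0" if \<phi>: "\<phi> \<in> schwartz" for \<phi>
  proof -
    have "(\<lambda>x. (f x + (- 1) * g x) * \<phi> x) = (\<lambda>x. f x * \<phi> x - g x * \<phi> x)" by (simp add: algebra_simps)
    then show ?thesis using eq[OF \<phi>] by (simp add: L2_mult_schwartz f g \<phi>)
  qed
  from L2_separated[OF d this] show ?thesis by simp
qed

lemma fpair_unique: "fpair f g \<Longrightarrow> fpair f h \<Longrightarrow> AE x in lborel. g x = h x"
  by (rule L2_eq_AE) (auto simp: fpair_def)

lemma fpair_unique_inv: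
  assumes f: "fpair f g" and h: "fpair h g" shows "AE x in lborel. f x = h x"
proof (rule L2_eq_AE)
  fix \<phi> :: "'a \<Rightarrow> complex" assume \<phi>: "\<phi> \<in> schwartz"
  then show "(\<integral>x. f x * \<phi> x \<partial>lborel) = (\<integral>x. h x * \<phi> x \<partial>lborel)"
    using fpair_eq[OF f inv_fourier_schwartz[OF \<phi>]] fpair_eq[OF h inv_fourier_schwartz[OF \<phi>]]
    by (simp add: fourier_inversion')
qed (use f h in \<open>auto simp: fpair_def\<close>)

lemma sqint_cong_AE: "AE x in lborel. f x = g x \<Longrightarrow> sqint f = sqint g"
  unfolding sqint_def by (rule nn_integral_cong_AE) auto

text \<open>Both the transform and its inverse can be chosen norm-decreasing, and uniqueness almost
  everywhere identifies these choices with the given pair.\<close>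

lemma plancherel: "fpair f g \<Longrightarrow> sqint f = sqint g"
proof (rule antisym)
  assume fg: "fpair f g"
  obtain f' where "fpair f' g" "sqint f' \<le> sqint g" using fpair_exists_inv[OF fpair_L2(2)[OF fg]] by blast
  then show "sqint f \<le> sqint g" using sqint_cong_AE[OF fpair_unique_inv[OF fg]] by metis
  obtain g' where "fpair f g'" "sqint g' \<le> sqint f" using fpair_exists[OF fpair_L2(1)[OF fg]] by blast
  then show "sqint g \<le> sqint f" using sqint_cong_AE[OF fpair_unique[OF fg]] by metis
qed

lemma fourier_modulate: "fourier (\<lambda>x. cis (x \<bullet> h) * f x) \<xi> = fourier f (\<xi> - h)"
proof -
  have "cis (- (x \<bullet> \<xi>)) * (cis (x \<bullet> h) * f x) = cis (- (x \<bullet> (\<xi> - h))) * f x" for x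
    unfolding mult.assoc[symmetric] cis_mult by (simp add: inner_diff_right)
  then show ?thesis by (simp only: fourier_def)
qed

lemma difference_L2: "f \<in> Lp 2 \<Longrightarrow> difference h f \<in> Lp 2"
proof (rule LpI)
  assume f: "f \<in> Lp 2"
  have "2 * Lp_norm 2 f < top" using Lp_finite[OF f] by (simp add: ennreal_mult_less_top)
  then show "Lp_norm 2 (difference h f) < top"
    using Lp_norm_difference_le[of 2 f h] Lp_measurable[OF f] by (simp add: order_le_less_trans)
qed (auto intro: difference_measurable Lp_measurable)

text \<open>Moving the translation by \<open>h\<close> onto the test function modulates that
  function before it is transformed, which produces the factor on the side of
  \<open>g\<close>.\<close>

lemma fpair_difference:
  fixes f g :: "'a::euclidean_space \<Rightarrow> complex"
  assumes fg: "fpair f g"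
  shows "fpair (difference h f) (\<lambda>x. (cis (x \<bullet> h) - 1) * g x)"
  unfolding fpair_def
proof (intro conjI ballI)
  have f: "f \<in> Lp 2" and g: "g \<in> Lp 2" using fg by (auto simp: fpair_def)
  have [measurable]: "f \<in> borel_measurable borel" by (rule Lp_measurable[OF f])
  show "difference h f \<in> Lp 2" by (rule difference_L2[OF f])
  have "norm (cis (x \<bullet> h) - 1) \<le> 2" for x :: 'a
    using norm_triangle_ineq4[of "cis (x \<bullet> h)" 1] by simp
  then show "(\<lambda>x. (cis (x \<bullet> h) - 1) * g x) \<in> Lp 2"
    by (intro L2_bounded_mult[OF _ _ g]) auto
  fix \<phi> :: "'a \<Rightarrow> complex" assume \<phi>: "\<phi> \<in> schwartz"
  have c\<phi>: "(\<lambda>x. cis (x \<bullet> h) * \<phi> x) \<in> schwartz" using schwartz_mult_cis[OF \<phi>, of 1 h] by simp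
  have [measurable]: "fourier \<phi> \<in> borel_measurable borel" using fourier_schwartz[OF \<phi>] by measurable
  have tF: "(\<lambda>x. fourier \<phi> (x - h)) \<in> schwartz" using schwartz_translate[OF fourier_schwartz[OF \<phi>], of "- h"] by simp
  have i: "integrable lborel (\<lambda>x. f x * fourier \<phi> (x - h))" "integrable lborel (\<lambda>x. f x * fourier \<phi> x)"
    by (rule L2_mult_schwartz[OF f tF], rule L2_mult_schwartz[OF f fourier_schwartz[OF \<phi>]])
  have "(\<integral>x. difference h f x * fourier \<phi> x \<partial>lborel) =
      (\<integral>x. f (x + h) * fourier \<phi> (x + h - h) - f x * fourier \<phi> x \<partial>lborel)"
    by (simp add: difference_def left_diff_distrib)
  also have "\<dots> = (\<integral>x. f (x + h) * fourier \<phi> (x + h - h) \<partial>lborel) - (\<integral>x. f x * fourier \<phi> x \<partial>lborel)"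
    by (intro Bochner_Integration.integral_diff i(2)) (rule lborel_integrable_translate[OF i(1), of h])
  also have "(\<integral>x. f (x + h) * fourier \<phi> (x + h - h) \<partial>lborel) = (\<integral>x. f x * fourier \<phi> (x - h) \<partial>lborel)"
    by (rule lborel_integral_translate[of "\<lambda>x. f x * fourier \<phi> (x - h)"]) measurable
  also have "\<dots> = (\<integral>x. g x * (cis (x \<bullet> h) * \<phi> x) \<partial>lborel)"
    using fg c\<phi> by (simp add: fpair_def fourier_modulate[symmetric])
  also have "(\<integral>x. f x * fourier \<phi> x \<partial>lborel) = (\<integral>x. g x * \<phi> x \<partial>lborel)"
    using fg \<phi> by (simp add: fpair_def)
  also have "(\<integral>x. g x * (cis (x \<bullet> h) * \<phi> x) \<partial>lborel) - (\<integral>x. g x * \<phi> x \<partial>lborel) =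
      (\<integral>x. g x * (cis (x \<bullet> h) * \<phi> x) - g x * \<phi> x \<partial>lborel)"
    by (intro Bochner_Integration.integral_diff[symmetric] L2_mult_schwartz g c\<phi> \<phi>)
  also have "\<dots> = (\<integral>x. (cis (x \<bullet> h) - 1) * g x * \<phi> x \<partial>lborel)"
    by (intro Bochner_Integration.integral_cong refl) (simp add: algebra_simps)
  finally show "(\<integral>x. difference h f x * fourier \<phi> x \<partial>lborel) = (\<integral>x. (cis (x \<bullet> h) - 1) * g x * \<phi> x \<partial>lborel)" .
qed

lemma fpair_difference_power:
  "fpair f g \<Longrightarrow> fpair ((difference h ^^ k) f) (\<lambda>x. (cis (x \<bullet> h) - 1) ^ k * g x)"
proof (induction k)
  case (Suc k)
  from fpair_difference[OF Suc.IH[OF Suc.prems], of h] show ?case by (simp add: mult_ac)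
qed simp

subsection \<open>Distributions and dyadic blocks\<close>

lemma regular_distr_apply: "\<phi> \<in> schwartz \<Longrightarrow> regular_distr f \<phi> = (\<integral>x. f x * \<phi> x \<partial>lborel)"
  by (simp add: regular_distr_def)

lemma regular_distr_eq_AE:
  "f \<in> Lp 2 \<Longrightarrow> g \<in> Lp 2 \<Longrightarrow> regular_distr f = regular_distr g \<Longrightarrow> AE x in lborel. f x = g x"
  by (rule L2_eq_AE) (simp_all only: regular_distr_apply[symmetric])

lemma regular_distr_eqI:
  "(\<And>\<phi>. \<phi> \<in> schwartz \<Longrightarrow> (\<integral>x. f x * \<phi> x \<partial>lborel) = u \<phi>) \<Longrightarrow> u \<in> extensional schwartz \<Longrightarrow> regular_distr f = u"
  by (rule extensionalityI[of _ schwartz]) (auto simp: regular_distr_def)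

text \<open>Schwartz functions separate L_2, so all representing functions agree almost everywhere
  and the infimum runs over a single value.\<close>

lemma distr_Lp_norm_regular:
  assumes f: "f \<in> Lp 2"
  shows "distr_Lp_norm 2 (regular_distr f) = Lp_norm 2 f"
proof -
  have eq: "Lp_norm 2 g = Lp_norm 2 f" if "g \<in> {g \<in> Lp 2. regular_distr g = regular_distr f}" for g
    by (rule Lp_norm_cong_AE, rule regular_distr_eq_AE) (use that f in simp_all)
  show ?thesis unfolding distr_Lp_norm_def
  proof (rule antisym)
    show "(INF g\<in>{g \<in> Lp 2. regular_distr g = regular_distr f}. Lp_norm 2 g) \<le> Lp_norm 2 f"
      by (rule INF_lower) (use f in simp)
    show "Lp_norm 2 f \<le> (INF g\<in>{g \<in> Lp 2. regular_distr g = regular_distr f}. Lp_norm 2 g)"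
      by (rule INF_greatest) (simp only: eq)
  qed
qed

lemma distr_Lp_norm_top_iff: "distr_Lp_norm p u < top \<Longrightarrow> \<exists>f\<in>Lp p. regular_distr f = u"
  unfolding distr_Lp_norm_def by (auto simp: INF_less_iff)

lemma inv_fourier_fourier_distr: "u \<in> extensional schwartz \<Longrightarrow> inv_fourier_distr (fourier_distr u) = u"
  by (rule extensionalityI[of _ schwartz])
     (auto simp: inv_fourier_distr_def fourier_distr_def inv_fourier_schwartz fourier_inversion')

lemma fpair_fourier_distr: "fpair f g \<Longrightarrow> fourier_distr (regular_distr f) = regular_distr g"
  by (rule extensionalityI[of _ schwartz])
     (auto simp: fourier_distr_def regular_distr_def fourier_schwartz fpair_def)

lemma fpair_inv_fourier_distr: "fpair f g \<Longrightarrow> inv_fourier_distr (regular_distr g) = regular_distr f"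
  using fpair_fourier_distr[of f g] inv_fourier_fourier_distr[of "regular_distr f"]
  by (simp add: regular_distr_def)

section \<open>The dyadic resolution of unity\<close>

lemma dyadic_0: "dyadic \<phi>0 0 = \<phi>0"
  by (simp add: dyadic_def)

lemma dyadic_Suc: "dyadic \<phi>0 (Suc j) x = \<phi>0 ((1 / 2 ^ Suc j) *\<^sub>R x) - \<phi>0 ((1 / 2 ^ j) *\<^sub>R x)"
proof -
  have *: "2 powr (- real n) = (1 / 2 ^ n :: real)" for n
    by (simp add: powr_minus powr_realpow divide_inverse)
  have **: "- real (Suc j) + 1 = - real j" by simp
  show ?thesis
    unfolding dyadic_def * ** by simp
qed

text \<open>The sum telescopes; this is the source of both the partition of unity and the
  identification of partial sums with smooth cutoffs.\<close>

lemma sum_dyadic: "(\<Sum>i\<le>j. dyadic \<phi>0 i x) = \<phi>0 ((1 / 2 ^ j) *\<^sub>R x)"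
  by (induction j) (simp_all add: dyadic_0 dyadic_Suc)

context
  fixes \<phi>0 :: "'a::euclidean_space \<Rightarrow> complex"
  assumes \<phi>0: "lp_cutoff \<phi>0"
begin

lemma cutoff_schwartz: "\<phi>0 \<in> schwartz"
  using \<phi>0 by (simp add: lp_cutoff_def)

lemma cutoff_eq_1: "norm x \<le> 1 \<Longrightarrow> \<phi>0 x = 1"
  using \<phi>0 by (simp add: lp_cutoff_def)

lemma cutoff_eq_0: "2 < norm x \<Longrightarrow> \<phi>0 x = 0"
  using \<phi>0 closure_subset[of "{x. \<phi>0 x \<noteq> 0}"] unfolding lp_cutoff_def by fastforce

lemma dyadic_schwartz: "dyadic \<phi>0 j \<in> schwartz"
proof (cases j)
  case 0
  then show ?thesis by (simp add: dyadic_0 cutoff_schwartz)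
next
  case (Suc i)
  have "(\<lambda>x. \<phi>0 ((1 / 2 ^ Suc i) *\<^sub>R x + 0) - \<phi>0 ((1 / 2 ^ i) *\<^sub>R x + 0)) \<in> schwartz"
    by (intro schwartz_diff schwartz_affine cutoff_schwartz) auto
  then show ?thesis by (simp add: Suc dyadic_Suc[abs_def])
qed

lemma dyadic_measurable [measurable]: "dyadic \<phi>0 j \<in> borel_measurable borel"
  using dyadic_schwartz by measurable

lemma dyadic_bounded: obtains C where "0 \<le> C" "\<And>j x. norm (dyadic \<phi>0 j x) \<le> C"
proof -
  obtain C where C: "0 \<le> C" "\<And>x. norm (\<phi>0 x) \<le> C" using schwartz_bounded[OF cutoff_schwartz] by blast
  have "norm (dyadic \<phi>0 j x) \<le> C + C" for j x
  proof (cases j)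
    case (Suc i)
    then show ?thesis
      using norm_triangle_ineq4[of "\<phi>0 ((1 / 2 ^ Suc i) *\<^sub>R x)" "\<phi>0 ((1 / 2 ^ i) *\<^sub>R x)"]
        C(2)[of "(1 / 2 ^ Suc i) *\<^sub>R x"] C(2)[of "(1 / 2 ^ i) *\<^sub>R x"]
      by (simp only: dyadic_Suc)
  next
    case 0
    then show ?thesis using C(1) C(2)[of x] by (simp add: dyadic_0)
  qed
  then show ?thesis using C that[of "C + C"] by auto
qed

lemma dyadic_eq_0_high: "2 ^ (j + 1) < norm x \<Longrightarrow> dyadic \<phi>0 j x = 0"
proof (cases j)
  case (Suc i)
  assume x: "2 ^ (j + 1) < norm x"
  have "(0::real) < 2 ^ i" by simp
  moreover have "4 * 2 ^ i < norm x" using x Suc by simp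
  ultimately have "2 * 2 ^ i < norm x" "4 * 2 ^ i < norm x" "(0::real) < 2 ^ i" by linarith+
  then have "2 < norm ((1 / 2 ^ Suc i) *\<^sub>R x)" "2 < norm ((1 / 2 ^ i) *\<^sub>R x)"
    by (simp_all only: norm_scaleR abs_of_pos divide_pos_pos zero_less_one zero_less_power zero_less_numeral
        power_Suc times_divide_eq_left mult_1 pos_less_divide_eq mult_pos_pos)
  then have "\<phi>0 ((1 / 2 ^ Suc i) *\<^sub>R x) = 0" "\<phi>0 ((1 / 2 ^ i) *\<^sub>R x) = 0"
    by (blast intro: cutoff_eq_0)+
  then show ?thesis by (simp only: Suc dyadic_Suc) simp
qed (auto simp: dyadic_0 intro: cutoff_eq_0)

lemma dyadic_eq_0_low: "norm x \<le> 2 ^ j \<Longrightarrow> dyadic \<phi>0 (Suc j) x = 0"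
proof -
  assume x: "norm x \<le> 2 ^ j"
  have "(0::real) < 2 ^ j" by simp
  then have "norm x \<le> 2 * 2 ^ j" using x by linarith
  then have "\<phi>0 ((1 / 2 ^ Suc j) *\<^sub>R x) = 1" "\<phi>0 ((1 / 2 ^ j) *\<^sub>R x) = 1"
    using x by (auto intro!: cutoff_eq_1 simp: field_simps)
  then show ?thesis by (simp only: dyadic_Suc) simp
qed

text \<open>At the least \<open>j\<close> with \<open>norm x \<le> 2 ^ j\<close> the partial sum
  equals 1. All but its last two terms vanish, so one of these has modulus at least 1/2.\<close>

lemma dyadic_ge_half: obtains j where "1 / 2 \<le> norm (dyadic \<phi>0 j x)" "norm x \<le> 2 ^ (j + 1)"
proof -
  obtain n :: nat where "norm x < 2 ^ n" using real_arch_pow[of 2 "norm x"] by auto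
  then have ex: "\<exists>n. norm x \<le> 2 ^ n" by (auto intro: less_imp_le)
  define j where "j = (LEAST n. norm x \<le> 2 ^ n)"
  have j: "norm x \<le> 2 ^ j" unfolding j_def by (rule LeastI_ex[OF ex])
  have s: "(\<Sum>i\<le>j. dyadic \<phi>0 i x) = 1"
    using j by (simp add: sum_dyadic cutoff_eq_1 field_simps)
  show ?thesis
  proof (cases j)
    case 0
    then show ?thesis using s j that[of 0] by auto
  next
    case (Suc i)
    have "\<not> norm x \<le> 2 ^ i" using not_less_Least[of i "\<lambda>n. norm x \<le> 2 ^ n"] Suc by (simp add: j_def)
    then have i: "2 ^ i < norm x" by simp
    have z: "dyadic \<phi>0 l x = 0" if "l < i" for l
    proof (rule dyadic_eq_0_high)
      have "(2::real) ^ (l + 1) \<le> 2 ^ i" using that by (intro power_increasing) auto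
      then show "2 ^ (l + 1) < norm x" using i by simp
    qed
    have "(\<Sum>l\<le>j. dyadic \<phi>0 l x) = (\<Sum>l<i. dyadic \<phi>0 l x) + dyadic \<phi>0 i x + dyadic \<phi>0 j x"
      by (simp add: Suc lessThan_Suc_atMost[symmetric])
    then have "dyadic \<phi>0 i x + dyadic \<phi>0 j x = 1" using s z by simp
    then have "1 \<le> norm (dyadic \<phi>0 i x) + norm (dyadic \<phi>0 j x)"
      using norm_triangle_ineq[of "dyadic \<phi>0 i x" "dyadic \<phi>0 j x"] by simp
    then consider "1 / 2 \<le> norm (dyadic \<phi>0 i x)" | "1 / 2 \<le> norm (dyadic \<phi>0 j x)" by linarith
    then show ?thesis
    proof cases
      case 1
      then show ?thesis using j Suc by (intro that[of i]) auto
    next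
      case 2
      have "(2::real) ^ j \<le> 2 ^ (j + 1)" by simp
      then show ?thesis using j 2 by (intro that[of j]) linarith+
    qed
  qed
qed

lemma lp_block_apply:
  "\<phi> \<in> schwartz \<Longrightarrow> lp_block \<phi>0 j u \<phi> = u (fourier (\<lambda>x. dyadic \<phi>0 j x * inv_fourier \<phi> x))"
  by (simp add: lp_block_def inv_fourier_distr_def mult_distr_def fourier_distr_def inv_fourier_schwartz
      schwartz_mult slow_schwartz dyadic_schwartz)

text \<open>On the Fourier side a block is multiplication by a bounded function, so Plancherel
  transports its norm.\<close>

lemma lp_block_L2:
  assumes fg: "fpair f g"
  shows "distr_Lp_norm 2 (lp_block \<phi>0 j (regular_distr f)) = Lp_norm 2 (\<lambda>x. dyadic \<phi>0 j x * g x)"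
proof -
  obtain C where C: "0 \<le> C" "\<And>j x. norm (dyadic \<phi>0 j x) \<le> C" by (rule dyadic_bounded) blast
  have g: "g \<in> Lp 2" using fg by (simp add: fpair_def)
  have dg: "(\<lambda>x. dyadic \<phi>0 j x * g x) \<in> Lp 2" by (rule L2_bounded_mult[OF _ C(2) g]) measurable
  then obtain fj where fj: "fpair fj (\<lambda>x. dyadic \<phi>0 j x * g x)" using fpair_exists_inv by blast
  have "mult_distr (dyadic \<phi>0 j) (regular_distr g) = regular_distr (\<lambda>x. dyadic \<phi>0 j x * g x)"
    by (rule extensionalityI[of _ schwartz])
       (auto simp: mult_distr_def regular_distr_def schwartz_mult slow_schwartz dyadic_schwartz mult_ac)
  then have "lp_block \<phi>0 j (regular_distr f) = regular_distr fj"
    by (simp add: lp_block_def fpair_fourier_distr[OF fg] fpair_inv_fourier_distr[OF fj])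
  then show ?thesis
    using fj distr_Lp_norm_regular[of fj] plancherel[OF fj] by (simp add: Lp_norm_2 fpair_def)
qed

end

section \<open>Estimates for tempered distributions\<close>

lemma schwartz_seminorm_upper:
  assumes \<phi>: "\<phi> \<in> schwartz" and vs: "set vs \<subseteq> Basis" "length vs \<le> N"
  shows "(1 + norm x) ^ N * norm (iter_partial vs \<phi> x) \<le> schwartz_seminorm N \<phi>"
proof -
  obtain C where C: "\<And>vs x. set vs \<subseteq> Basis \<Longrightarrow> length vs \<le> N \<Longrightarrow> (1 + norm x) ^ N * norm (iter_partial vs \<phi> x) \<le> C"
    using \<phi> unfolding schwartz_iff sbdd_def by (metis singletonI)
  show ?thesis unfolding schwartz_seminorm_def
    by (rule cSUP_upper2[where x = "(vs, x)"]) (use vs C in \<open>auto intro!: bdd_aboveI2\<close>)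
qed

lemma tempered_bounded:
  fixes u :: "'a::euclidean_space distr"
  assumes u: "u \<in> tempered_distr" and B: "sbdd B"
  obtains C where "\<And>\<phi>. \<phi> \<in> B \<Longrightarrow> norm (u \<phi>) \<le> C"
proof -
  obtain N C where C: "\<And>\<phi>. \<phi> \<in> schwartz \<Longrightarrow> norm (u \<phi>) \<le> C * schwartz_seminorm N \<phi>"
    using u unfolding tempered_distr_def by blast
  obtain D where D: "\<And>f vs x. f \<in> B \<Longrightarrow> set vs \<subseteq> Basis \<Longrightarrow> length vs \<le> N \<Longrightarrow> (1 + norm x) ^ N * norm (iter_partial vs f x) \<le> D"
    using B unfolding sbdd_def by meson
  \<comment> \<open>The constant in the definition of \<open>tempered_distr\<close> may be negative,
    hence the absolute value.\<close>
  have "norm (u \<phi>) \<le> \<bar>C\<bar> * D" if \<phi>: "\<phi> \<in> B" for \<phi>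
  proof -
    have s: "\<phi> \<in> schwartz" by (rule sbdd_imp_schwartz[OF B \<phi>])
    have "schwartz_seminorm N \<phi> \<le> D" unfolding schwartz_seminorm_def
      by (rule cSUP_least) (use D[OF \<phi>] in \<open>auto intro: exI[of _ "[]"]\<close>)
    moreover have "0 \<le> schwartz_seminorm N \<phi>"
      by (rule order_trans[OF _ schwartz_seminorm_upper[OF s, of "[]"]]) auto
    ultimately have "\<bar>C\<bar> * schwartz_seminorm N \<phi> \<le> \<bar>C\<bar> * D" "C * schwartz_seminorm N \<phi> \<le> \<bar>C\<bar> * schwartz_seminorm N \<phi>"
      by (auto intro: mult_left_mono mult_right_mono)
    then show ?thesis using C[OF s] by linarith
  qed
  then show ?thesis by (rule that)
qed

lemma regular_distr_tempered:
  fixes f :: "'a::euclidean_space \<Rightarrow> complex"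
  assumes f: "f \<in> Lp 2"
  shows "regular_distr f \<in> tempered_distr"
  unfolding tempered_distr_def
proof (intro CollectI conjI ballI allI)
  show "regular_distr f \<in> extensional schwartz" by (simp add: regular_distr_def)
  show "regular_distr f (\<lambda>x. \<phi> x + \<psi> x) = regular_distr f \<phi> + regular_distr f \<psi>"
    if "\<phi> \<in> schwartz" "\<psi> \<in> schwartz" for \<phi> \<psi>
    using that by (simp add: regular_distr_apply schwartz_add distrib_left L2_mult_schwartz f)
  show "regular_distr f (\<lambda>x. c * \<phi> x) = c * regular_distr f \<phi>" if "\<phi> \<in> schwartz" for \<phi> c
    using that by (simp add: regular_distr_apply schwartz_cmult mult.left_commute[of _ c])
  obtain a where a: "0 \<le> a" "Lp_norm 2 f = ennreal a" using Lp_finite[OF f] by (cases "Lp_norm 2 f") auto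
  let ?N = "2 * DIM('a)" and ?I = "(\<integral>x. 1 / (1 + norm (x::'a)) ^ (2 * DIM('a)) \<partial>lborel) powr (1 / 2)"
  have "norm (regular_distr f \<phi>) \<le> (a * ?I) * schwartz_seminorm ?N \<phi>" if \<phi>: "\<phi> \<in> schwartz" for \<phi>
  proof -
    have up: "(1 + norm x) ^ ?N * norm (\<phi> x) \<le> schwartz_seminorm ?N \<phi>" for x
      using schwartz_seminorm_upper[OF \<phi>, of "[]" ?N x] by simp
    have "norm (\<phi> x) \<le> schwartz_seminorm ?N \<phi> / (1 + norm x) ^ ?N" for x
      using up[of x] zero_less_power[OF one_plus_norm_pos[of x], of ?N] by (simp add: field_simps)
    moreover have s0: "0 \<le> schwartz_seminorm ?N \<phi>" by (rule order_trans[OF _ up[of 0]]) auto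
    ultimately have "Lp_norm 2 \<phi> \<le> ennreal (schwartz_seminorm ?N \<phi> * ?I)"
      by (intro decay_Lp_bound) auto
    then have "norm (\<integral>x. f x * \<phi> x \<partial>lborel) \<le> a * (schwartz_seminorm ?N \<phi> * ?I)"
      using a s0 Lp_measurable[OF f] schwartz_measurable[OF \<phi>]
      by (intro hoelder_integral(2)[of 2 2]) auto
    then show ?thesis using \<phi> by (simp add: regular_distr_apply mult_ac)
  qed
  then show "\<exists>N C. \<forall>\<phi>\<in>schwartz. norm (regular_distr f \<phi>) \<le> C * schwartz_seminorm N \<phi>" by blast
qed

text \<open>The functions are (1 - \<phi>0(s x)) / s. They vanish where s * norm x \<le> 1, and
  elsewhere 1/s is at most \<open>norm x\<close>, so they grow linearly, uniformly in
  \<open>s\<close>. A derivative of positive order carries a factor \<open>s\<close> that cancels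
  the denominator.\<close>

lemma slow_cutoff_quotient:
  fixes \<phi>0 :: "'a::euclidean_space \<Rightarrow> complex"
  assumes \<phi>0: "lp_cutoff \<phi>0"
  shows "slow {\<lambda>x. of_real (1 / s) * 1 + of_real (- 1 / s) * \<phi>0 (s *\<^sub>R x + 0) |s. 0 < s \<and> s \<le> 1}"
  unfolding slow_def
proof (intro conjI allI)
  note sm = schwartz_smooth[OF cutoff_schwartz[OF \<phi>0]]
  show "\<forall>f\<in>{\<lambda>x. of_real (1 / s) * 1 + of_real (- 1 / s) * \<phi>0 (s *\<^sub>R x + 0) |s. 0 < s \<and> s \<le> 1}. smooth f"
    by (clarify, intro smooth_add smooth_mult smooth_const smooth_affine sm)
  fix n
  obtain C where C: "0 \<le> C" "\<And>vs x. set vs \<subseteq> Basis \<Longrightarrow> length vs \<le> n \<Longrightarrow> norm (iter_partial vs \<phi>0 x) \<le> C / (1 + norm x) ^ n"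
    using sbddD[of "{\<phi>0}" n] cutoff_schwartz[OF \<phi>0] unfolding schwartz_iff by (metis singletonI)
  have C': "norm (iter_partial vs \<phi>0 x) \<le> C" if "set vs \<subseteq> Basis" "length vs \<le> n" for vs x
  proof -
    have "C / (1 + norm x) ^ n \<le> C / 1"
      by (intro divide_left_mono C one_le_power) (auto simp: one_plus_norm_pos)
    then show ?thesis using C(2)[OF that, of x] by simp
  qed
  have "norm (iter_partial vs (\<lambda>x. of_real (1 / s) * 1 + of_real (- 1 / s) * \<phi>0 (s *\<^sub>R x + 0)) x) \<le> (1 + C) * (1 + norm x) ^ 1"
    if s: "0 < s" "s \<le> 1" and vs: "set vs \<subseteq> Basis" "length vs \<le> n" for s vs x
  proof -
    have eq: "iter_partial vs (\<lambda>x. of_real (1 / s) * 1 + of_real (- 1 / s) * \<phi>0 (s *\<^sub>R x + 0)) x =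
        iter_partial vs (\<lambda>x. of_real (1 / s) * 1) x + of_real (- 1 / s) * (of_real s ^ length vs * iter_partial vs \<phi>0 (s *\<^sub>R x + 0))"
      by (subst iter_partial_add[OF smooth_const smooth_mult[OF smooth_const smooth_affine[OF sm]] vs(1)])
         (simp only: iter_partial_cmult[OF smooth_affine[OF sm] vs(1)] iter_partial_affine[OF sm vs(1)])
    show ?thesis
    proof (cases "vs = []")
      case True
      have "norm (of_real (1 / s) * 1 + of_real (- 1 / s) * \<phi>0 (s *\<^sub>R x)) = norm (1 - \<phi>0 (s *\<^sub>R x)) / s"
      proof -
        have "of_real (1 / s) * 1 + of_real (- 1 / s) * \<phi>0 (s *\<^sub>R x) = of_real (1 / s) * (1 - \<phi>0 (s *\<^sub>R x))"
          by (simp add: algebra_simps)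
        then show ?thesis using s by (simp only: norm_mult norm_of_real) simp
      qed
      also have "\<dots> \<le> (1 + C) * norm x"
      proof (cases "s * norm x \<le> 1")
        case True
        then have "\<phi>0 (s *\<^sub>R x) = 1" using s by (intro cutoff_eq_1[OF \<phi>0]) simp
        then show ?thesis using C by simp
      next
        case False
        have "norm (1 - \<phi>0 (s *\<^sub>R x)) \<le> 1 + C"
          using norm_triangle_ineq4[of 1 "\<phi>0 (s *\<^sub>R x)"] C'[of "[]" "s *\<^sub>R x"] by simp
        also have "\<dots> \<le> (1 + C) * (s * norm x)" using False C by (simp add: mult_le_cancel_left1)
        finally show ?thesis using s by (simp add: pos_divide_le_eq mult_ac)
      qed
      also have "\<dots> \<le> (1 + C) * (1 + norm x) ^ 1" using C by (intro mult_left_mono) auto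
      finally show ?thesis using True by simp
    next
      case False
      then obtain m where m: "length vs = Suc m" by (cases vs) auto
      have "norm (of_real (- 1 / s) * (of_real s ^ length vs * iter_partial vs \<phi>0 (s *\<^sub>R x + 0))) =
          s ^ m * norm (iter_partial vs \<phi>0 (s *\<^sub>R x + 0))"
        using s by (simp add: m norm_mult norm_divide norm_power)
      also have "\<dots> \<le> 1 * C" using s vs by (intro mult_mono power_le_one C') auto
      also have "\<dots> \<le> (1 + C) * (1 + norm x) ^ 1" using C by (simp add: algebra_simps add_increasing)
      finally show ?thesis unfolding eq iter_partial_const[OF False] by simp
    qed
  qed
  then show "\<exists>C N. \<forall>f\<in>{\<lambda>x. of_real (1 / s) * 1 + of_real (- 1 / s) * \<phi>0 (s *\<^sub>R x + 0) |s. 0 < s \<and> s \<le> 1}.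
      \<forall>vs x. set vs \<subseteq> Basis \<longrightarrow> length vs \<le> n \<longrightarrow> norm (iter_partial vs f x) \<le> C * (1 + norm x) ^ N"
    by blast
qed

text \<open>By \<open>slow_cutoff_quotient\<close> the cutoff changes \<open>\<phi>\<close> by
  \<open>s\<close> times an element of one bounded set. A tempered distribution is bounded on the
  transform of that set, so the error is O(s) with s = 1 / 2 ^ n.\<close>

lemma tempered_cutoff_tendsto:
  fixes u :: "'a::euclidean_space distr"
  assumes \<phi>0: "lp_cutoff \<phi>0" and u: "u \<in> tempered_distr" and \<phi>: "\<phi> \<in> schwartz"
  shows "(\<lambda>n. u (fourier (\<lambda>x. \<phi>0 ((1 / 2 ^ n) *\<^sub>R x) * \<phi> x))) \<longlonglongrightarrow> u (fourier \<phi>)"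
proof -
  let ?m = "\<lambda>s x. of_real (1 / s) * 1 + of_real (- 1 / s) * \<phi>0 (s *\<^sub>R x + 0)"
  define A where "A = {?m s |s. 0 < s \<and> s \<le> 1}"
  have slA: "slow A" unfolding A_def by (rule slow_cutoff_quotient[OF \<phi>0])
  have sb: "sbdd {\<lambda>x. f x * g x |f g. f \<in> A \<and> g \<in> {\<phi>}}"
    by (rule sbdd_mult[OF slA]) (use \<phi> in \<open>simp add: schwartz_iff\<close>)
  obtain C where C: "\<And>\<psi>. \<psi> \<in> fourier ` {\<lambda>x. f x * g x |f g. f \<in> A \<and> g \<in> {\<phi>}} \<Longrightarrow> norm (u \<psi>) \<le> C"
    using tempered_bounded[OF u sbdd_fourier[OF sb]] by blast
  have u_add: "\<And>\<phi> \<psi>. \<phi> \<in> schwartz \<Longrightarrow> \<psi> \<in> schwartz \<Longrightarrow> u (\<lambda>x. \<phi> x + \<psi> x) = u \<phi> + u \<psi>"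
    and u_mult: "\<And>\<phi> c. \<phi> \<in> schwartz \<Longrightarrow> u (\<lambda>x. c * \<phi> x) = c * u \<phi>"
    using u unfolding tempered_distr_def by blast+
  have bd: "norm (u (fourier (\<lambda>x. \<phi>0 (s *\<^sub>R x) * \<phi> x)) - u (fourier \<phi>)) \<le> s * C" if s: "0 < s" "s \<le> 1" for s
  proof -
    have mem: "(\<lambda>x. ?m s x * \<phi> x) \<in> {\<lambda>x. f x * g x |f g. f \<in> A \<and> g \<in> {\<phi>}}"
    proof -
      have "?m s \<in> A" unfolding A_def using s by blast
      then show ?thesis
        by (intro CollectI exI[of _ "?m s"] exI[of _ \<phi>] conjI refl) simp_all
    qed
    have ms: "(\<lambda>x. ?m s x * \<phi> x) \<in> schwartz" by (rule sbdd_imp_schwartz[OF sb mem])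
    have eq: "fourier (\<lambda>x. \<phi>0 (s *\<^sub>R x) * \<phi> x) = (\<lambda>\<xi>. fourier \<phi> \<xi> + of_real (- s) * fourier (\<lambda>x. ?m s x * \<phi> x) \<xi>)"
    proof
      fix \<xi>
      have "(\<lambda>x. \<phi>0 (s *\<^sub>R x) * \<phi> x) = (\<lambda>x. \<phi> x + of_real (- s) * (?m s x * \<phi> x))"
        using s by (simp add: fun_eq_iff field_simps)
      then show "fourier (\<lambda>x. \<phi>0 (s *\<^sub>R x) * \<phi> x) \<xi> = fourier \<phi> \<xi> + of_real (- s) * fourier (\<lambda>x. ?m s x * \<phi> x) \<xi>"
        using fourier_add[OF schwartz_integrable[OF \<phi>] integrable_mult_right[OF schwartz_integrable[OF ms]], of "of_real (- s)" \<xi>]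
        by (simp only: fourier_cmult)
    qed
    have "u (fourier (\<lambda>x. \<phi>0 (s *\<^sub>R x) * \<phi> x)) = u (fourier \<phi>) + of_real (- s) * u (fourier (\<lambda>x. ?m s x * \<phi> x))"
      unfolding eq by (simp only: u_add u_mult fourier_schwartz \<phi> ms schwartz_cmult)
    then have "norm (u (fourier (\<lambda>x. \<phi>0 (s *\<^sub>R x) * \<phi> x)) - u (fourier \<phi>)) = s * norm (u (fourier (\<lambda>x. ?m s x * \<phi> x)))"
      using s by (simp add: norm_mult)
    also have "\<dots> \<le> s * C" using s C mem by (intro mult_left_mono C imageI) auto
    finally show ?thesis .
  qed
  show ?thesis
  proof (rule LIM_zero_cancel, rule Lim_null_comparison)
    show "\<forall>\<^sub>F n in sequentially. norm (u (fourier (\<lambda>x. \<phi>0 ((1 / 2 ^ n) *\<^sub>R x) * \<phi> x)) - u (fourier \<phi>)) \<le> (1 / 2) ^ n * C"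
      using bd[of "1 / 2 ^ n" for n] by (intro always_eventually allI) (simp add: power_one_over)
    have "(\<lambda>n. (1 / 2) ^ n * C) \<longlonglongrightarrow> 0 * C" by (intro tendsto_mult tendsto_const LIMSEQ_realpow_zero) auto
    then show "(\<lambda>n. (1 / 2) ^ n * C) \<longlonglongrightarrow> 0" by simp
  qed
qed

subsection \<open>Weighted sequence quasi-norms\<close>

definition qnorm :: "ereal \<Rightarrow> (nat \<Rightarrow> ennreal) \<Rightarrow> ennreal" where
  "qnorm q a = (if q = \<infinity> then SUP j. a j
     else epowr (\<Sum>j. epowr (a j) (real_of_ereal q)) (1 / real_of_ereal q))"

text \<open>The exponent 1/q with the convention 1/\<infinity> = 0: a block of n entries equal to 1
  has quasi-norm n powr \<open>rq q\<close>, in both cases of \<open>qnorm\<close>.\<close>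

definition rq :: "ereal \<Rightarrow> real" where
  "rq q = (if q = \<infinity> then 0 else 1 / real_of_ereal q)"

lemma besov_norm_qnorm:
  "besov_norm \<phi>0 s b p q u = qnorm q (\<lambda>j. ennreal (2 powr (real j * s) * (1 + real j) powr b) *
     distr_Lp_norm p (lp_block \<phi>0 j u))"
  by (simp add: besov_norm_def qnorm_def Let_def)

lemma pos_ereal_cases: "0 < (q::ereal) \<Longrightarrow> q = \<infinity> \<or> (\<exists>r>0. q = ereal r)"
  by (cases q) auto

lemma rq_bound:
  assumes q: "0 < q" and b: "- (1 / q) < ereal b"
  shows "- rq q < b"
  using pos_ereal_cases[OF q] b by (auto simp: rq_def one_ereal_def divide_ereal_def inverse_eq_divide)

lemma qnorm_mono:
  assumes q: "0 < q" and ab: "\<And>j. a j \<le> b j"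
  shows "qnorm q a \<le> qnorm q b"
  using pos_ereal_cases[OF q]
  by (auto simp: qnorm_def intro!: SUP_mono epowr_mono suminf_le ab intro: exI ab)

lemma qnorm_cmult:
  assumes q: "0 < q"
  shows "qnorm q (\<lambda>j. c * a j) = c * qnorm q a"
  using pos_ereal_cases[OF q]
proof
  assume "q = \<infinity>"
  then show ?thesis by (simp add: qnorm_def SUP_mult_left_ennreal)
next
  assume "\<exists>r>0. q = ereal r"
  then obtain r where r: "0 < r" "q = ereal r" by blast
  then show ?thesis by (simp add: qnorm_def epowr_mult epowr_epowr)
qed

lemma qnorm_block_upper:
  assumes q: "0 < q" and J: "finite J" and a: "\<And>j. j \<in> J \<Longrightarrow> a j \<le> c" "\<And>j. j \<notin> J \<Longrightarrow> a j = 0"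
  shows "qnorm q a \<le> c * ennreal (real (card J) powr rq q)"
proof (cases "J = {}")
  case True
  then have "a = (\<lambda>j. 0)" using a by auto
  then show ?thesis using pos_ereal_cases[OF q] by (auto simp: qnorm_def)
next
  case False
  then have cJ: "0 < card J" using J by (simp add: card_gt_0_iff)
  from pos_ereal_cases[OF q] show ?thesis
  proof
    assume i: "q = \<infinity>"
    have "a j \<le> c" for j using a by (cases "j \<in> J") auto
    then show ?thesis using i cJ by (auto simp: qnorm_def rq_def intro!: SUP_least)
  next
    assume "\<exists>r>0. q = ereal r"
    then obtain r where r: "0 < r" "q = ereal r" by blast
    have "(\<Sum>j. epowr (a j) r) = (\<Sum>j\<in>J. epowr (a j) r)"
      by (rule suminf_finite[OF J]) (simp add: a)
    also have "\<dots> \<le> (\<Sum>j\<in>J. epowr c r)" using r by (intro sum_mono epowr_mono a) auto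
    also have "\<dots> = epowr c r * ennreal (real (card J))" by (simp add: mult.commute ennreal_of_nat_eq_real_of_nat)
    finally have "qnorm q a \<le> epowr (epowr c r * ennreal (real (card J))) (1 / r)"
      using r by (simp add: qnorm_def epowr_mono)
    also have "\<dots> = c * ennreal (real (card J) powr rq q)"
      using r by (simp add: epowr_mult epowr_epowr rq_def epowr_ennreal)
    finally show ?thesis .
  qed
qed

lemma qnorm_block_lower:
  assumes q: "0 < q" and J: "finite J" "J \<noteq> {}" and a: "\<And>j. j \<in> J \<Longrightarrow> c \<le> a j"
  shows "c * ennreal (real (card J) powr rq q) \<le> qnorm q a"
  using pos_ereal_cases[OF q]
proof
  assume i: "q = \<infinity>"
  obtain j where "j \<in> J" using J by blast
  then have "c \<le> (SUP j. a j)" using a by (meson SUP_upper2 UNIV_I)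
  then show ?thesis using i J by (simp add: qnorm_def rq_def card_gt_0_iff)
next
  assume "\<exists>r>0. q = ereal r"
  then obtain r where r: "0 < r" "q = ereal r" by blast
  have "epowr c r * ennreal (real (card J)) = (\<Sum>j\<in>J. epowr c r)"
    by (simp add: mult.commute ennreal_of_nat_eq_real_of_nat)
  also have "\<dots> \<le> (\<Sum>j\<in>J. epowr (a j) r)" using r by (intro sum_mono epowr_mono a) auto
  also have "\<dots> \<le> (\<Sum>j. epowr (a j) r)" by (intro sum_le_suminf J) auto
  finally have "epowr (epowr c r * ennreal (real (card J))) (1 / r) \<le> qnorm q a"
    using r by (simp add: qnorm_def epowr_mono)
  then show ?thesis using r by (simp add: epowr_mult epowr_epowr rq_def epowr_ennreal)
qed

text \<open>For negative \<open>s\<close> the mean value theorem bounds each term by an increment of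
  (1 + n) powr (s + 1), and the increments telescope. With s = b q the assumption on
  \<open>s\<close> is the condition b > -1/q.\<close>

lemma sum_powr_upper:
  assumes s: "-1 < (s::real)"
  obtains C where "0 < C" "\<And>M::nat. (\<Sum>n\<le>M. (1 + real n) powr s) \<le> C * (1 + real M) powr (s + 1)"
proof (cases "0 \<le> s")
  case True
  have "(\<Sum>n\<le>M. (1 + real n) powr s) \<le> 1 * (1 + real M) powr (s + 1)" for M :: nat
  proof -
    have "(\<Sum>n\<le>M. (1 + real n) powr s) \<le> (\<Sum>n\<le>M. (1 + real M) powr s)"
      using True by (intro sum_mono powr_mono2) auto
    then show ?thesis by (simp add: powr_add mult.commute)
  qed
  then show ?thesis using that[of 1] by simp
next
  case False
  have step: "(s + 1) * (1 + real n) powr s \<le> (1 + real n) powr (s + 1) - real n powr (s + 1)" for n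
  proof (cases "n = 0")
    case True
    then show ?thesis using False s by simp
  next
    case n: False
    have "\<exists>z>real n. z < 1 + real n \<and> (1 + real n) powr (s + 1) - real n powr (s + 1) = (1 + real n - real n) * ((s + 1) * z powr (s + 1 - 1))"
      using n by (intro MVT2) (auto intro!: derivative_eq_intros)
    then obtain z where z: "real n < z" "z < 1 + real n"
      "(1 + real n) powr (s + 1) - real n powr (s + 1) = (s + 1) * z powr s" by auto
    have "(1 + real n) powr s \<le> z powr s"
      using z False n by (intro powr_mono2') auto
    then show ?thesis using z s by (auto intro!: mult_left_mono)
  qed
  have "(\<Sum>n\<le>M. (1 + real n) powr s) \<le> 1 / (s + 1) * (1 + real M) powr (s + 1)" for M :: nat
  proof -
    have "(s + 1) * (\<Sum>n\<le>M. (1 + real n) powr s) \<le> (1 + real M) powr (s + 1)"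
    proof (induction M)
      case 0
      then show ?case using step[of 0] by simp
    next
      case (Suc M)
      then show ?case using step[of "Suc M"] by (simp add: distrib_left algebra_simps)
    qed
    then show ?thesis using s by (simp add: field_simps)
  qed
  then show ?thesis using that[of "1 / (s + 1)"] s by simp
qed

text \<open>For \<open>s \<le> 0\<close> the last term is the smallest. Otherwise the upper half of
  the range has at least (1 + M)/2 terms, each at least ((1 + M)/2) powr s.\<close>

lemma sum_powr_lower:
  fixes s :: real
  obtains c where "0 < c" "\<And>M::nat. c * (1 + real M) powr (s + 1) \<le> (\<Sum>n\<le>M. (1 + real n) powr s)"
proof (cases "s \<le> 0")
  case True
  have "1 * (1 + real M) powr (s + 1) \<le> (\<Sum>n\<le>M. (1 + real n) powr s)" for M :: nat
  proof -
    have "(\<Sum>n\<le>M. (1 + real M) powr s) \<le> (\<Sum>n\<le>M. (1 + real n) powr s)"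
      using True by (intro sum_mono powr_mono2') auto
    then show ?thesis by (simp add: powr_add mult.commute)
  qed
  then show ?thesis using that[of 1] by simp
next
  case False
  have "(1 / 2) powr (s + 1) * (1 + real M) powr (s + 1) \<le> (\<Sum>n\<le>M. (1 + real n) powr s)" for M :: nat
  proof -
    have "M \<le> 2 * (M div 2) + 1" by simp
    then have "real M \<le> real (2 * (M div 2) + 1)" by (rule of_nat_mono)
    then have h: "(1 + real M) / 2 \<le> 1 + real (M div 2)" by simp
    have "(1 / 2) powr (s + 1) * (1 + real M) powr (s + 1) = ((1 + real M) / 2) powr (s + 1)"
      by (simp add: powr_mult[symmetric])
    also have "\<dots> = ((1 + real M) / 2) * ((1 + real M) / 2) powr s" by (simp add: powr_add mult.commute)
    also have "\<dots> \<le> real (card {M div 2..M}) * ((1 + real M) / 2) powr s"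
    proof (rule mult_right_mono)
      have "M + 1 \<le> 2 * card {M div 2..M}" by simp
      then have "real (M + 1) \<le> real (2 * card {M div 2..M})" by (rule of_nat_mono)
      then show "(1 + real M) / 2 \<le> real (card {M div 2..M})" by (simp del: card_atLeastAtMost)
    qed simp
    also have "\<dots> = (\<Sum>n\<in>{M div 2..M}. ((1 + real M) / 2) powr s)" by simp
    also have "\<dots> \<le> (\<Sum>n\<in>{M div 2..M}. (1 + real n) powr s)"
    proof (intro sum_mono powr_mono2)
      fix n assume "n \<in> {M div 2..M}"
      then have "real (M div 2) \<le> real n" by simp
      then show "(1 + real M) / 2 \<le> 1 + real n" using h by linarith
    qed (use False in auto)
    also have "\<dots> \<le> (\<Sum>n\<le>M. (1 + real n) powr s)"
      by (intro sum_mono2) auto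
    finally show ?thesis .
  qed
  then show ?thesis using that[of "(1 / 2) powr (s + 1)"] by simp
qed

lemma powr_geometric_bounded:
  fixes s r :: real
  assumes r: "0 < r" "r < 1"
  obtains C where "0 < C" "\<And>i::nat. (1 + real i) powr s * r ^ i \<le> C"
proof -
  have "(\<lambda>i::nat. (1 + real i) powr s * r ^ i) \<longlonglongrightarrow> 0"
    using r by real_asymp
  then have "Bseq (\<lambda>i::nat. (1 + real i) powr s * r ^ i)" by (rule convergentI[THEN convergent_imp_Bseq])
  then obtain C where "0 < C" "\<And>i. norm ((1 + real i) powr s * r ^ i) \<le> C" by (auto elim: BseqE)
  then show ?thesis using that r by (auto simp: abs_mult)
qed

lemma powr_geometric_summable:
  fixes s r :: real
  assumes r: "0 < r" "r < 1"
  shows "summable (\<lambda>i::nat. (1 + real i) powr s * r ^ i)"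
proof -
  have q: "0 < sqrt r" "sqrt r < 1" using r by auto
  obtain C where C: "\<And>i::nat. (1 + real i) powr s * sqrt r ^ i \<le> C" using powr_geometric_bounded[OF q] by metis
  show ?thesis
  proof (rule summable_comparison_test'[where g = "\<lambda>i. C * sqrt r ^ i" and N = 0])
    show "summable (\<lambda>i. C * sqrt r ^ i)" using q by (intro summable_mult summable_geometric) auto
    fix i :: nat
    \<comment> \<open>One square root absorbs the power weight, the other leaves a convergent
      geometric series.\<close>
    have "r ^ i = sqrt r ^ i * sqrt r ^ i" using r by (simp add: power_mult_distrib[symmetric])
    then have "(1 + real i) powr s * r ^ i = ((1 + real i) powr s * sqrt r ^ i) * sqrt r ^ i" by simp
    also have "\<dots> \<le> C * sqrt r ^ i" using q by (intro mult_right_mono C) auto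
    finally show "norm ((1 + real i) powr s * r ^ i) \<le> C * sqrt r ^ i" using r by (simp add: abs_mult)
  qed
qed

text \<open>A discrete Peetre inequality: the weight is moved from \<open>i + M\<close> to
  \<open>M\<close> at a cost depending on \<open>i\<close> only, for either sign of
  \<open>s\<close>.\<close>

lemma powr_shift_le: "(1 + (real i + real M)) powr s \<le> (1 + real M) powr s * (1 + real i) powr \<bar>s\<bar>"
proof (cases "0 \<le> s")
  case True
  have "1 + (real i + real M) \<le> (1 + real M) * (1 + real i)" by (simp add: algebra_simps)
  then have "(1 + (real i + real M)) powr s \<le> ((1 + real M) * (1 + real i)) powr s"
    using True by (intro powr_mono2) auto
  then show ?thesis using True by (simp add: powr_mult)
next
  case False
  have "(1 + (real i + real M)) powr s \<le> (1 + real M) powr s * 1"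
    using False by (simp add: powr_mono2')
  also have "\<dots> \<le> (1 + real M) powr s * (1 + real i) powr \<bar>s\<bar>"
    by (intro mult_left_mono ge_one_powr_ge_zero) auto
  finally show ?thesis .
qed

text \<open>The hypotheses describe the modulus of smoothness of a function with frequencies up to
  about 2 ^ M: bounded at coarse scales, geometrically small at finer ones. The indices below
  \<open>M\<close> give the main term, finite growth b + 1/q > 0; the rest is a convergent tail of
  the same order at most.\<close>

lemma weighted_qnorm_upper:
  assumes q: "0 < q" and b: "- rq q < b"
  obtains C where "0 < C" "\<forall>M A a. (\<forall>n. a n \<le> A) \<longrightarrow> (\<forall>i. a (i + M) \<le> A * ennreal ((1 / 2) ^ i)) \<longrightarrow>
    qnorm q (\<lambda>n. ennreal ((1 + real n) powr b) * a n) \<le> ennreal (C * (1 + real M) powr (b + rq q)) * A"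
  using pos_ereal_cases[OF q]
proof
  assume i: "q = \<infinity>"
  then have b0: "0 < b" using b by (simp add: rq_def)
  obtain C where C: "0 < C" "\<And>i::nat. (1 + real i) powr b * (1 / 2) ^ i \<le> C"
    using powr_geometric_bounded[of "1 / 2" b] by auto
  have main: "qnorm q (\<lambda>n. ennreal ((1 + real n) powr b) * a n) \<le> ennreal ((C + 1) * (1 + real M) powr (b + rq q)) * A"
    if a: "\<And>n. a n \<le> A" "\<And>i. a (i + M) \<le> A * ennreal ((1 / 2) ^ i)" for M A a
  proof -
    have "ennreal ((1 + real n) powr b) * a n \<le> ennreal ((C + 1) * (1 + real M) powr b) * A" for n
    proof (cases "n \<le> M")
      case True
      have "(1 + real n) powr b \<le> 1 * (1 + real M) powr b" using True b0 by (simp add: powr_mono2)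
      also have "\<dots> \<le> (C + 1) * (1 + real M) powr b" using C by (intro mult_right_mono) auto
      finally show ?thesis using a(1)[of n] by (intro mult_mono ennreal_leI) auto
    next
      case False
      then obtain i where n: "n = i + M" by (metis le_add_diff_inverse2 nat_le_linear)
      have "ennreal ((1 + real n) powr b) * a n \<le> ennreal ((1 + real n) powr b) * (A * ennreal ((1 / 2) ^ i))"
        unfolding n by (intro mult_left_mono a) auto
      also have "\<dots> = ennreal ((1 + real n) powr b * (1 / 2) ^ i) * A" by (simp add: ennreal_mult mult_ac)
      also have "\<dots> \<le> ennreal ((C + 1) * (1 + real M) powr b) * A"
      proof (intro mult_right_mono ennreal_leI)
        have "(1 + real n) powr b * (1 / 2) ^ i \<le> ((1 + real M) powr b * (1 + real i) powr b) * (1 / 2) ^ i"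
          using powr_shift_le[of i M b] b0 by (intro mult_right_mono) (auto simp: n)
        also have "\<dots> \<le> (1 + real M) powr b * C"
          unfolding mult.assoc by (intro mult_left_mono C) auto
        also have "\<dots> \<le> (C + 1) * (1 + real M) powr b" by (simp add: algebra_simps)
        finally show "(1 + real n) powr b * (1 / 2) ^ i \<le> (C + 1) * (1 + real M) powr b" .
      qed auto
      finally show ?thesis .
    qed
    then show ?thesis using i by (auto simp: qnorm_def rq_def intro!: SUP_least)
  qed
  show ?thesis
  proof (rule that[of "C + 1"])
    show "0 < C + 1" using C(1) by simp
  qed (blast intro: main)
next
  assume "\<exists>r>0. q = ereal r"
  then obtain r where r: "0 < r" "q = ereal r" by blast
  define s where "s = b * r"
  define z where "z = (1 / 2) powr r"
  have z: "0 < z" "z < 1" using r powr_less_mono2[of r "1 / 2" 1] by (auto simp: z_def)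
  have s: "-1 < s" using b r by (simp add: rq_def s_def field_simps)
  obtain C1 where C1: "0 < C1" "\<And>M::nat. (\<Sum>n\<le>M. (1 + real n) powr s) \<le> C1 * (1 + real M) powr (s + 1)"
    using sum_powr_upper[OF s] by metis
  define C2 where "C2 = (\<Sum>i. (1 + real i) powr \<bar>s\<bar> * z ^ i)"
  have sm: "summable (\<lambda>i. (1 + real i) powr \<bar>s\<bar> * z ^ i)" by (rule powr_geometric_summable[OF z])
  have C2: "0 \<le> C2" unfolding C2_def using z by (intro suminf_nonneg sm) auto
  have main: "qnorm q (\<lambda>n. ennreal ((1 + real n) powr b) * a n) \<le> ennreal ((C1 + C2) powr (1 / r) * (1 + real M) powr (b + rq q)) * A"
    if a: "\<And>n. a n \<le> A" "\<And>i. a (i + M) \<le> A * ennreal ((1 / 2) ^ i)" for M A a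
  proof -
    \<comment> \<open>The q-th power of the weight, extended by the geometric decay from index
      \<open>M\<close> on, where \<open>z\<close> is the q-th power of 1/2.\<close>
    define w where "w n = (1 + real n) powr s * (if n < M then 1 else z ^ (n - M))" for n
    have w0: "0 \<le> w n" for n using z by (simp add: w_def)
    have shift: "w (i + M) \<le> (1 + real M) powr s * ((1 + real i) powr \<bar>s\<bar> * z ^ i)" for i
      using powr_shift_le[of i M s] z unfolding w_def mult.assoc[symmetric]
      by (auto intro!: mult_right_mono)
    have ws: "summable (\<lambda>i. w (i + M))"
      by (rule summable_comparison_test'[OF summable_mult[OF sm], of 0]) (use shift w0 in auto)
    then have ws': "summable w" by (simp add: summable_iff_shift)
    have "(\<Sum>n. w n) = (\<Sum>i. w (i + M)) + (\<Sum>n<M. w n)" by (rule suminf_split_initial_segment[OF ws'])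
    also have "\<dots> \<le> (1 + real M) powr s * C2 + C1 * (1 + real M) powr (s + 1)"
    proof (rule add_mono)
      show "(\<Sum>i. w (i + M)) \<le> (1 + real M) powr s * C2"
        unfolding C2_def suminf_mult[OF sm, symmetric] by (intro suminf_le shift ws summable_mult sm)
      have "(\<Sum>n<M. w n) = (\<Sum>n<M. (1 + real n) powr s)" by (rule sum.cong) (auto simp: w_def)
      also have "\<dots> \<le> (\<Sum>n\<le>M. (1 + real n) powr s)" by (rule sum_mono2) auto
      also note C1(2)
      finally show "(\<Sum>n<M. w n) \<le> C1 * (1 + real M) powr (s + 1)" .
    qed
    also have "\<dots> \<le> (1 + real M) powr (s + 1) * C2 + C1 * (1 + real M) powr (s + 1)"
      using C2 by (intro add_mono mult_right_mono powr_mono) auto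
    finally have wsum: "(\<Sum>n. w n) \<le> (C1 + C2) * (1 + real M) powr (s + 1)" by (simp add: algebra_simps)
    have term_le: "epowr (ennreal ((1 + real n) powr b) * a n) r \<le> ennreal (w n) * epowr A r" for n
    proof (cases "n < M")
      case True
      have "epowr (ennreal ((1 + real n) powr b) * a n) r \<le> epowr (ennreal ((1 + real n) powr b) * A) r"
        using r by (intro epowr_mono mult_left_mono a) auto
      then show ?thesis using True r by (simp add: epowr_mult epowr_ennreal powr_powr w_def s_def)
    next
      case False
      then obtain i where n: "n = i + M" by (metis le_add_diff_inverse2 not_less)
      have "epowr (ennreal ((1 + real n) powr b) * a n) r \<le> epowr (ennreal ((1 + real n) powr b) * (A * ennreal ((1 / 2) ^ i))) r"
        unfolding n using r by (intro epowr_mono mult_left_mono a) auto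
      also have "\<dots> = ennreal ((1 + real n) powr s) * (epowr A r * ennreal (((1 / 2) ^ i) powr r))"
        using r by (simp add: epowr_mult epowr_ennreal powr_powr s_def)
      also have "((1 / 2) ^ i) powr r = z ^ i"
        by (simp add: z_def powr_realpow[symmetric] powr_powr mult.commute)
      finally show ?thesis using z by (simp add: w_def n ennreal_mult mult_ac)
    qed
    have "(\<Sum>n. epowr (ennreal ((1 + real n) powr b) * a n) r) \<le> (\<Sum>n. ennreal (w n) * epowr A r)"
      by (intro suminf_le term_le) auto
    also have "\<dots> = ennreal (\<Sum>n. w n) * epowr A r"
      using w0 by (simp add: suminf_ennreal2[OF _ ws'])
    also have "\<dots> \<le> ennreal ((C1 + C2) * (1 + real M) powr (s + 1)) * epowr A r"
      by (intro mult_right_mono ennreal_leI wsum) auto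
    finally have "qnorm q (\<lambda>n. ennreal ((1 + real n) powr b) * a n) \<le>
        epowr (ennreal ((C1 + C2) * (1 + real M) powr (s + 1)) * epowr A r) (1 / r)"
      using r by (simp add: qnorm_def epowr_mono)
    also have "\<dots> = ennreal ((C1 + C2) powr (1 / r) * (1 + real M) powr ((s + 1) / r)) * A"
      using r C1 C2 by (simp add: epowr_mult epowr_epowr epowr_ennreal powr_mult powr_powr)
    also have "(s + 1) / r = b + rq q" using r by (simp add: s_def rq_def field_simps)
    finally show ?thesis .
  qed
  show ?thesis
  proof (rule that[of "(C1 + C2) powr (1 / r)"])
    show "0 < (C1 + C2) powr (1 / r)" using C1(1) C2 by simp
  qed (blast intro: main)
qed

text \<open>Keeps the first M + 1 entries, whose weights sum to the right order by
  \<open>sum_powr_lower\<close>; for an infinite exponent the entry with index \<open>M\<close> is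
  enough.\<close>

lemma weighted_qnorm_lower:
  assumes q: "0 < q"
  obtains c where "0 < c" "\<forall>M A a. (\<forall>n\<le>M. A \<le> a n) \<longrightarrow>
    ennreal (c * (1 + real M) powr (b + rq q)) * A \<le> qnorm q (\<lambda>n. ennreal ((1 + real n) powr b) * a n)"
  using pos_ereal_cases[OF q]
proof
  assume i: "q = \<infinity>"
  have main: "ennreal (1 * (1 + real M) powr (b + rq q)) * A \<le> qnorm q (\<lambda>n. ennreal ((1 + real n) powr b) * a n)"
    if a: "\<And>n. n \<le> M \<Longrightarrow> A \<le> a n" for M A a
  proof -
    have "ennreal ((1 + real M) powr b) * A \<le> ennreal ((1 + real M) powr b) * a M"
      by (intro mult_left_mono a) auto
    then show ?thesis using i by (simp add: qnorm_def rq_def) (meson SUP_upper2 UNIV_I)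
  qed
  show ?thesis by (rule that[of 1, OF zero_less_one]) (blast intro: main)
next
  assume "\<exists>r>0. q = ereal r"
  then obtain r where r: "0 < r" "q = ereal r" by blast
  define s where "s = b * r"
  obtain c where c: "0 < c" "\<And>M::nat. c * (1 + real M) powr (s + 1) \<le> (\<Sum>n\<le>M. (1 + real n) powr s)"
    using sum_powr_lower[of s] by metis
  have main: "ennreal (c powr (1 / r) * (1 + real M) powr (b + rq q)) * A \<le> qnorm q (\<lambda>n. ennreal ((1 + real n) powr b) * a n)"
    if a: "\<And>n. n \<le> M \<Longrightarrow> A \<le> a n" for M A a
  proof -
    have "ennreal (c * (1 + real M) powr (s + 1)) * epowr A r \<le> ennreal (\<Sum>n\<le>M. (1 + real n) powr s) * epowr A r"
      by (intro mult_right_mono ennreal_leI c) auto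
    also have "\<dots> = (\<Sum>n\<le>M. ennreal ((1 + real n) powr s) * epowr A r)"
      unfolding sum_distrib_right[symmetric] by (subst sum_ennreal) auto
    also have "\<dots> \<le> (\<Sum>n\<le>M. epowr (ennreal ((1 + real n) powr b) * a n) r)"
    proof (rule sum_mono)
      fix n assume "n \<in> {..M}"
      then have "epowr (ennreal ((1 + real n) powr b) * A) r \<le> epowr (ennreal ((1 + real n) powr b) * a n) r"
        using r by (intro epowr_mono mult_left_mono a) auto
      then show "ennreal ((1 + real n) powr s) * epowr A r \<le> epowr (ennreal ((1 + real n) powr b) * a n) r"
        using r by (simp add: epowr_mult epowr_ennreal powr_powr s_def)
    qed
    also have "\<dots> \<le> (\<Sum>n. epowr (ennreal ((1 + real n) powr b) * a n) r)" by (intro sum_le_suminf) auto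
    finally have "epowr (ennreal (c * (1 + real M) powr (s + 1)) * epowr A r) (1 / r) \<le>
        qnorm q (\<lambda>n. ennreal ((1 + real n) powr b) * a n)"
      using r by (simp add: qnorm_def epowr_mono)
    moreover have "epowr (ennreal (c * (1 + real M) powr (s + 1)) * epowr A r) (1 / r) =
        ennreal (c powr (1 / r) * (1 + real M) powr ((s + 1) / r)) * A"
      using r c by (simp add: epowr_mult epowr_epowr epowr_ennreal powr_mult powr_powr)
    moreover have "(s + 1) / r = b + rq q" using r by (simp add: s_def rq_def field_simps)
    ultimately show ?thesis by simp
  qed
  show ?thesis
  proof (rule that[of "c powr (1 / r)"])
    show "0 < c powr (1 / r)" using c(1) by simp
  qed (blast intro: main)
qed

subsection \<open>Dyadic form of the quasi-norm defined by differences\<close>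

lemma modulus_mono: "s \<le> t \<Longrightarrow> modulus k p f s \<le> modulus k p f t"
  unfolding modulus_def by (rule SUP_subset_mono) auto

lemma dyadic_interval_ex:
  assumes t: "0 < t" "t < (1::real)"
  shows "\<exists>n::nat. t \<in> {(1 / 2) ^ (n + 1)..<(1 / 2) ^ n}"
proof -
  obtain m :: nat where "(1 / 2) ^ m < t" using real_arch_pow_inv[of t "1 / 2"] t by auto
  then have ex: "\<exists>m. (1 / 2) ^ m \<le> t" by (auto intro: less_imp_le)
  define m where "m = (LEAST m. (1 / 2) ^ m \<le> t)"
  have m: "(1 / 2) ^ m \<le> t" unfolding m_def by (rule LeastI_ex[OF ex])
  then obtain n where n: "m = Suc n" using t by (cases m) auto
  have "\<not> (1 / 2) ^ n \<le> t" using not_less_Least[of n "\<lambda>m. (1 / 2) ^ m \<le> t"] n by (simp add: m_def)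
  then show ?thesis using m n by auto
qed

lemma dyadic_interval_disjoint: "disjoint_family (\<lambda>n. {(1 / 2) ^ (n + 1)..<(1 / 2) ^ n :: real})"
proof -
  have "{(1 / 2) ^ (m + 1)..<(1 / 2) ^ m} \<inter> {(1 / 2) ^ (n + 1)..<(1 / 2) ^ n :: real} = {}" if "m < n" for m n :: nat
  proof -
    have "(1 / 2) ^ n \<le> ((1 / 2) ^ (m + 1) :: real)" using that by (intro power_decreasing) auto
    then show ?thesis by auto
  qed
  then show ?thesis unfolding disjoint_family_on_def by (metis Int_commute linorder_neqE_nat)
qed

lemma dyadic_interval_log:
  assumes t: "t \<in> {(1 / 2) ^ (n + 1)..<(1 / 2) ^ n :: real}"
  shows "(1 + real n) / 2 \<le> 1 - ln t" "1 - ln t \<le> 2 * (1 + real n)"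
proof -
  have t0: "0 < t" using t by (auto intro: less_le_trans[rotated])
  have "ln t \<le> ln ((1 / 2) ^ n)" using t t0 by simp
  then have u: "ln t \<le> - real n * ln 2" by (simp add: ln_realpow ln_div)
  have "ln ((1 / 2) ^ (n + 1)) \<le> ln t" using t t0 by (intro ln_mono) auto
  then have l: "- (real n + 1) * ln 2 \<le> ln t" by (simp add: ln_realpow ln_div algebra_simps)
  \<comment> \<open>That ln 2 lies between 1/2 and 1 is what allows the factor 2 in both
    bounds.\<close>
  have e: "1 / 2 \<le> ln (2::real)" "ln (2::real) \<le> 1"
    using ln_2_less_1 ln_add_one_self_le_self2[of "-1/2"] by (simp_all add: ln_div)
  have "real n * (1 / 2) \<le> real n * ln 2" "(real n + 1) * ln 2 \<le> (real n + 1) * 1"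
    using e by (intro mult_left_mono; simp)+
  note m = this
  have "- ln t \<le> (real n + 1) * ln 2" using l by (simp add: algebra_simps)
  then have b: "- ln t \<le> real n + 1" using m(2) by (simp only: mult_1_right)
  have a: "real n / 2 \<le> - ln t" using u m(1) by simp
  show "(1 + real n) / 2 \<le> 1 - ln t" using a by (simp add: add_divide_distrib)
  show "1 - ln t \<le> 2 * (1 + real n)" using b by simp
qed

lemma dyadic_interval_weight:
  assumes t: "t \<in> {(1 / 2) ^ (n + 1)..<(1 / 2) ^ n :: real}"
  shows "(1 - ln t) powr b \<le> 2 powr \<bar>b\<bar> * (1 + real n) powr b"
    "(1 + real n) powr b \<le> 2 powr \<bar>b\<bar> * (1 - ln t) powr b"
proof -
  have gen: "y powr b \<le> 2 powr \<bar>b\<bar> * x powr b" if xy: "0 < x" "0 < y" "y \<le> 2 * x" "x \<le> 2 * y" for x y :: real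
  proof (cases "0 \<le> b")
    case True
    then have "y powr b \<le> (2 * x) powr b" using xy by (intro powr_mono2) auto
    then show ?thesis using True xy by (simp add: powr_mult)
  next
    case False
    then have "y powr b \<le> (x / 2) powr b" using xy by (intro powr_mono2') auto
    then show ?thesis using False xy by (simp add: powr_divide powr_minus field_simps)
  qed
  note l = dyadic_interval_log[OF t]
  have "0 < 1 - ln t" by (rule less_le_trans[OF _ l(1)]) simp
  then show "(1 - ln t) powr b \<le> 2 powr \<bar>b\<bar> * (1 + real n) powr b"
    "(1 + real n) powr b \<le> 2 powr \<bar>b\<bar> * (1 - ln t) powr b"
    using l by (auto intro!: gen)
qed

definition wmod :: "nat \<Rightarrow> real \<Rightarrow> ('a::euclidean_space \<Rightarrow> complex) \<Rightarrow> nat \<Rightarrow> ennreal" where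
  "wmod k p f n = modulus k p f ((1 / 2) ^ n)"

text \<open>On a dyadic interval the modulus is at most its value at the right end point and 1/t is
  at most 2 ^ (n + 1), so the interval has mass at most 1 in this bound and the integral becomes a
  sum.\<close>

lemma diff_besov_upper:
  assumes q: "0 < q"
  shows "diff_besov_norm k b p q f \<le> Lp_norm p f +
    ennreal (2 powr \<bar>b\<bar>) * qnorm q (\<lambda>n. ennreal ((1 + real n) powr b) * wmod k p f n)"
proof -
  let ?I = "\<lambda>n. {(1 / 2) ^ (n + 1)..<(1 / 2) ^ n :: real}"
  let ?a = "\<lambda>n. ennreal (2 powr \<bar>b\<bar>) * (ennreal ((1 + real n) powr b) * wmod k p f n)"
  have le: "ennreal ((1 - ln t) powr b) * modulus k p f t \<le> ?a n" if t: "t \<in> ?I n" for t n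
  proof -
    have "ennreal ((1 - ln t) powr b) * modulus k p f t \<le>
        ennreal (2 powr \<bar>b\<bar> * (1 + real n) powr b) * wmod k p f n"
      unfolding wmod_def using t by (intro mult_mono ennreal_leI dyadic_interval_weight modulus_mono) auto
    then show ?thesis by (simp add: ennreal_mult mult_ac)
  qed
  from pos_ereal_cases[OF q] show ?thesis
  proof
    assume i: "q = \<infinity>"
    have "(SUP t\<in>{0<..<1}. ennreal ((1 - ln t) powr b) * modulus k p f t) \<le> (SUP n. ?a n)"
    proof (rule SUP_least)
      fix t :: real assume "t \<in> {0<..<1}"
      then obtain n where "t \<in> ?I n" using dyadic_interval_ex by force
      from le[OF this] show "ennreal ((1 - ln t) powr b) * modulus k p f t \<le> (SUP n. ?a n)"
        by (meson SUP_upper2 UNIV_I)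
    qed
    then show ?thesis using i by (simp add: diff_besov_norm_def qnorm_def SUP_mult_left_ennreal add_left_mono)
  next
    assume "\<exists>r>0. q = ereal r"
    then obtain r where r: "0 < r" "q = ereal r" by blast
    let ?c = "\<lambda>n. epowr (?a n) r * ennreal (2 ^ (n + 1))"
    have "(\<integral>\<^sup>+t\<in>{0<..<1}. epowr (ennreal ((1 - ln t) powr b) * modulus k p f t) r * ennreal (1 / t) \<partial>lborel) \<le>
        (\<integral>\<^sup>+t. (\<Sum>n. ?c n * indicator (?I n) t) \<partial>lborel)"
    proof (rule nn_integral_mono)
      fix t :: real
      show "epowr (ennreal ((1 - ln t) powr b) * modulus k p f t) r * ennreal (1 / t) * indicator {0<..<1} t \<le>
        (\<Sum>n. ?c n * indicator (?I n) t)"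
      proof (cases "t \<in> {0<..<1}")
        case True
        then obtain n where n: "t \<in> ?I n" using dyadic_interval_ex by force
        have "1 / t \<le> 1 / (1 / 2) ^ (n + 1)" using n True by (intro divide_left_mono mult_pos_pos) auto
        then have "1 / t \<le> 2 ^ (n + 1)" by (simp add: power_one_over)
        then have "epowr (ennreal ((1 - ln t) powr b) * modulus k p f t) r * ennreal (1 / t) \<le> ?c n"
          using r by (intro mult_mono[OF epowr_mono[OF le[OF n]] ennreal_leI]) auto
        also have "\<dots> = (\<Sum>n. ?c n * indicator (?I n) t)"
          by (rule suminf_cmult_indicator[OF dyadic_interval_disjoint n, symmetric])
        finally show ?thesis using True by simp
      qed simp
    qed
    also have "\<dots> = (\<Sum>n. \<integral>\<^sup>+t. ?c n * indicator (?I n) t \<partial>lborel)" by (rule nn_integral_suminf) auto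
    also have "\<dots> = (\<Sum>n. epowr (?a n) r)"
    proof (intro suminf_cong)
      fix n
      have "emeasure lborel (?I n) = ennreal ((1 / 2) ^ n - (1 / 2) ^ (n + 1))"
        by (subst emeasure_lborel_Ico) (auto intro: power_decreasing)
      also have "(1 / 2) ^ n - (1 / 2) ^ (n + 1) = (1 / 2 ^ (n + 1) :: real)"
        by (simp add: power_one_over field_simps)
      finally have E: "emeasure lborel (?I n) = ennreal (1 / 2 ^ (n + 1))" .
      have "(\<integral>\<^sup>+t. ?c n * indicator (?I n) t \<partial>lborel) = ?c n * ennreal (1 / 2 ^ (n + 1))"
        unfolding E[symmetric] by (rule nn_integral_cmult_indicator) simp
      also have "\<dots> = epowr (?a n) r * (ennreal (2 ^ (n + 1)) * ennreal (1 / 2 ^ (n + 1)))" by (simp only: mult.assoc)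
      also have "ennreal (2 ^ (n + 1)) * ennreal (1 / 2 ^ (n + 1)) = 1"
        by (subst ennreal_mult[symmetric]) auto
      finally show "(\<integral>\<^sup>+t. ?c n * indicator (?I n) t \<partial>lborel) = epowr (?a n) r" by simp
    qed
    finally have "diff_besov_norm k b p q f \<le> Lp_norm p f + qnorm q ?a"
      using r by (simp add: diff_besov_norm_def qnorm_def add_left_mono epowr_mono)
    then show ?thesis unfolding qnorm_cmult[OF q] .
  qed
qed

text \<open>On a dyadic interval the modulus is at least its value at the left end point, which
  shifts the index to \<open>Suc n\<close>. Bounding 1/t below by 2 ^ n leaves mass 1/2, whence the
  extra factor 2 powr (1/r) for finite exponents.\<close>

lemma diff_besov_lower:
  assumes q: "0 < q"
  obtains C where "0 < C" "\<And>k p f. qnorm q (\<lambda>n. ennreal ((1 + real n) powr b) * wmod k p f (Suc n)) \<le>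
    ennreal C * diff_besov_norm k b p q f"
proof -
  let ?I = "\<lambda>n. {(1 / 2) ^ (n + 1)..<(1 / 2) ^ n :: real}"
  have le: "ennreal ((1 + real n) powr b) * wmod k p f (Suc n) \<le>
      ennreal (2 powr \<bar>b\<bar>) * (ennreal ((1 - ln t) powr b) * modulus k p f t)" if t: "t \<in> ?I n" for t n k p f
  proof -
    have "ennreal ((1 + real n) powr b) * wmod k p f (Suc n) \<le>
        ennreal (2 powr \<bar>b\<bar> * (1 - ln t) powr b) * modulus k p f t"
      unfolding wmod_def using t by (intro mult_mono ennreal_leI dyadic_interval_weight modulus_mono) auto
    then show ?thesis by (simp add: ennreal_mult mult_ac)
  qed
  from pos_ereal_cases[OF q] show ?thesis
  proof
    assume i: "q = \<infinity>"
    show ?thesis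
    proof (rule that[of "2 powr \<bar>b\<bar>"])
      fix k p f
      have "(SUP n. ennreal ((1 + real n) powr b) * wmod k p f (Suc n)) \<le>
        ennreal (2 powr \<bar>b\<bar>) * (SUP t\<in>{0<..<1}. ennreal ((1 - ln t) powr b) * modulus k p f t)"
      proof (rule SUP_least)
        fix n
        have "(1 / 2) ^ (n + 1) < ((1 / 2) ^ 0 :: real)" by (intro power_strict_decreasing) auto
        then have t: "(1 / 2) ^ (n + 1) \<in> ?I n" "(1 / 2) ^ (n + 1) \<in> {0<..<1::real}" by auto
        note le[OF t(1), of k p f]
        also have "ennreal (2 powr \<bar>b\<bar>) * (ennreal ((1 - ln ((1 / 2) ^ (n + 1))) powr b) * modulus k p f ((1 / 2) ^ (n + 1))) \<le>
           ennreal (2 powr \<bar>b\<bar>) * (SUP t\<in>{0<..<1}. ennreal ((1 - ln t) powr b) * modulus k p f t)"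
          by (intro mult_left_mono SUP_upper t(2)) auto
        finally show "ennreal ((1 + real n) powr b) * wmod k p f (Suc n) \<le>
           ennreal (2 powr \<bar>b\<bar>) * (SUP t\<in>{0<..<1}. ennreal ((1 - ln t) powr b) * modulus k p f t)" .
      qed
      also have "\<dots> \<le> ennreal (2 powr \<bar>b\<bar>) * diff_besov_norm k b p q f"
        using i by (intro mult_left_mono) (auto simp: diff_besov_norm_def add_increasing)
      finally show "qnorm q (\<lambda>n. ennreal ((1 + real n) powr b) * wmod k p f (Suc n)) \<le>
          ennreal (2 powr \<bar>b\<bar>) * diff_besov_norm k b p q f"
        using i by (simp add: qnorm_def)
    qed simp
  next
    assume "\<exists>r>0. q = ereal r"
    then obtain r where r: "0 < r" "q = ereal r" by blast
    show ?thesis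
    proof (rule that[of "2 powr \<bar>b\<bar> * 2 powr (1 / r)"])
      fix k p and f :: "'a \<Rightarrow> complex"
      let ?a = "\<lambda>n. ennreal ((1 + real n) powr b) * wmod k p f (Suc n)"
      define a where "a n = ennreal (1 / 2 powr \<bar>b\<bar>) * ?a n" for n
      let ?c = "\<lambda>n. epowr (a n) r * ennreal (2 ^ n)"
      let ?F = "\<lambda>t. epowr (ennreal ((1 - ln t) powr b) * modulus k p f t) r * ennreal (1 / t)"
      have inv: "ennreal (1 / 2 powr \<bar>b\<bar>) * ennreal (2 powr \<bar>b\<bar>) = 1"
        by (subst ennreal_mult[symmetric]) auto
      have le': "a n \<le> ennreal ((1 - ln t) powr b) * modulus k p f t" if t: "t \<in> ?I n" for t n
      proof -
        have "a n \<le> ennreal (1 / 2 powr \<bar>b\<bar>) * (ennreal (2 powr \<bar>b\<bar>) * (ennreal ((1 - ln t) powr b) * modulus k p f t))"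
          unfolding a_def by (intro mult_left_mono le[OF t]) auto
        then show ?thesis unfolding mult.assoc[symmetric] inv by simp
      qed
      have "(\<Sum>n. epowr (a n) r) * ennreal (1 / 2) = (\<Sum>n. \<integral>\<^sup>+t. ?c n * indicator (?I n) t \<partial>lborel)"
        unfolding ennreal_suminf_multc[symmetric]
      proof (intro suminf_cong)
        fix n
        have "emeasure lborel (?I n) = ennreal ((1 / 2) ^ n - (1 / 2) ^ (n + 1))"
          by (subst emeasure_lborel_Ico) (auto intro: power_decreasing)
        also have "(1 / 2) ^ n - (1 / 2) ^ (n + 1) = (1 / 2 ^ (n + 1) :: real)"
          by (simp add: power_one_over field_simps)
        finally have E: "emeasure lborel (?I n) = ennreal (1 / 2 ^ (n + 1))" .
        have "(\<integral>\<^sup>+t. ?c n * indicator (?I n) t \<partial>lborel) = ?c n * ennreal (1 / 2 ^ (n + 1))"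
          unfolding E[symmetric] by (rule nn_integral_cmult_indicator) simp
        also have "\<dots> = epowr (a n) r * (ennreal (2 ^ n) * ennreal (1 / 2 ^ (n + 1)))" by (simp only: mult.assoc)
        also have "ennreal (2 ^ n) * ennreal (1 / 2 ^ (n + 1)) = ennreal (1 / 2)"
          by (subst ennreal_mult[symmetric]) auto
        finally show "epowr (a n) r * ennreal (1 / 2) = (\<integral>\<^sup>+t. ?c n * indicator (?I n) t \<partial>lborel)" by simp
      qed
      also have "\<dots> = (\<integral>\<^sup>+t. (\<Sum>n. ?c n * indicator (?I n) t) \<partial>lborel)" by (rule nn_integral_suminf[symmetric]) auto
      also have "\<dots> \<le> (\<integral>\<^sup>+t. ?F t * indicator {0<..<1} t \<partial>lborel)"
      proof (rule nn_integral_mono)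
        fix t :: real
        show "(\<Sum>n. ?c n * indicator (?I n) t) \<le> ?F t * indicator {0<..<1} t"
        proof (cases "t \<in> {0<..<1}")
          case True
          then obtain n where n: "t \<in> ?I n" using dyadic_interval_ex by force
          have "1 / (1 / 2) ^ n \<le> 1 / t" using n True by (intro divide_left_mono mult_pos_pos) auto
          then have t: "2 ^ n \<le> 1 / t" by (simp add: power_one_over)
          have "(\<Sum>n. ?c n * indicator (?I n) t) = ?c n"
            by (rule suminf_cmult_indicator[OF dyadic_interval_disjoint n])
          also have "\<dots> \<le> ?F t"
            using r t by (intro mult_mono[OF epowr_mono[OF le'[OF n]] ennreal_leI]) auto
          finally show ?thesis using True by simp
        next
          case False
          have "t \<notin> ?I n" for n
          proof
            assume t: "t \<in> ?I n"
            have "(0::real) < (1 / 2) ^ (n + 1)" "(1 / 2) ^ n \<le> (1::real)" by (auto intro: power_le_one)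
            then show False using t False by auto
          qed
          then show ?thesis by simp
        qed
      qed
      finally have *: "(\<Sum>n. epowr (a n) r) * ennreal (1 / 2) \<le> (\<integral>\<^sup>+t. ?F t * indicator {0<..<1} t \<partial>lborel)" .
      have e2: "ennreal 2 * ennreal (1 / 2) = 1" by (subst ennreal_mult[symmetric]) auto
      have "(\<Sum>n. epowr (a n) r) = (ennreal 2 * ennreal (1 / 2)) * (\<Sum>n. epowr (a n) r)" unfolding e2 by simp
      also have "\<dots> = ennreal 2 * ((\<Sum>n. epowr (a n) r) * ennreal (1 / 2))" by (simp only: mult_ac)
      also have "\<dots> \<le> ennreal 2 * (\<integral>\<^sup>+t. ?F t * indicator {0<..<1} t \<partial>lborel)"
        by (intro mult_left_mono *) auto
      finally have "qnorm q a \<le> epowr (ennreal 2 * (\<integral>\<^sup>+t. ?F t * indicator {0<..<1} t \<partial>lborel)) (1 / r)"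
        using r by (simp add: qnorm_def epowr_mono)
      also have "\<dots> = ennreal (2 powr (1 / r)) * epowr (\<integral>\<^sup>+t. ?F t * indicator {0<..<1} t \<partial>lborel) (1 / r)"
      proof -
        have "0 < 1 / r" using r by simp
        from epowr_mult[OF this] show ?thesis by (simp only: epowr_ennreal zero_le_numeral)
      qed
      also have "\<dots> \<le> ennreal (2 powr (1 / r)) * diff_besov_norm k b p q f"
        using r by (intro mult_left_mono) (auto simp: diff_besov_norm_def add_increasing)
      finally have fin: "qnorm q a \<le> ennreal (2 powr (1 / r)) * diff_besov_norm k b p q f" .
      have "qnorm q ?a = (ennreal (2 powr \<bar>b\<bar>) * ennreal (1 / 2 powr \<bar>b\<bar>)) * qnorm q ?a"
        using inv by (simp only: mult.commute[of "ennreal (2 powr _)"] mult_1)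
      also have "\<dots> = ennreal (2 powr \<bar>b\<bar>) * qnorm q a"
        unfolding a_def[abs_def] qnorm_cmult[OF q] by (simp only: mult.assoc)
      also have "\<dots> \<le> ennreal (2 powr \<bar>b\<bar>) * (ennreal (2 powr (1 / r)) * diff_besov_norm k b p q f)"
        by (intro mult_left_mono fin) auto
      finally show "qnorm q ?a \<le> ennreal (2 powr \<bar>b\<bar> * 2 powr (1 / r)) * diff_besov_norm k b p q f"
        by (simp add: ennreal_mult mult.assoc)
    qed simp
  qed
qed

subsection \<open>The Hilbert space case\<close>

lemma qnorm_2: "qnorm 2 a = epowr (\<Sum>j. (a j)\<^sup>2) (1 / 2)"
  by (simp add: qnorm_def epowr_2)

lemma rq_2: "rq 2 = 1 / 2"
  by (simp add: rq_def)

lemma epowr_half_power2: "(epowr x (1 / 2))\<^sup>2 = x"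
  using epowr_inverse(2)[of 2 x] by (simp add: epowr_2)

lemma epowr_half_le_iff: "epowr x (1 / 2) \<le> y \<longleftrightarrow> x \<le> y\<^sup>2"
proof
  assume "epowr x (1 / 2) \<le> y"
  then have "(epowr x (1 / 2))\<^sup>2 \<le> y\<^sup>2" by (rule power_mono) simp
  then show "x \<le> y\<^sup>2" by (simp add: epowr_half_power2)
next
  assume "x \<le> y\<^sup>2"
  then have "epowr x (1 / 2) \<le> epowr (epowr y 2) (1 / 2)" by (simp add: epowr_mono epowr_2)
  then show "epowr x (1 / 2) \<le> y" by (simp add: epowr_inverse)
qed

lemma epowr_half_cmult_sq: "0 \<le> c \<Longrightarrow> epowr (ennreal (c\<^sup>2) * x) (1 / 2) = ennreal c * epowr x (1 / 2)"
  using epowr_mult[of "1 / 2" "ennreal (c\<^sup>2)" x] by (simp add: epowr_ennreal powr_half_sqrt)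

lemma norm_cis_minus_1: "norm (cis t - 1) \<le> \<bar>t\<bar>" "norm (cis t - 1) \<le> 2" "(norm (cis t - 1))\<^sup>2 = 2 - 2 * cos t"
proof -
  have "norm (iexp t - (\<Sum>k\<le>0. (\<i> * of_real t) ^ k / fact k)) \<le> \<bar>t\<bar> ^ (Suc 0) / fact (Suc 0)"
    by (rule iexp_approx1)
  then show "norm (cis t - 1) \<le> \<bar>t\<bar>" by (simp add: cis_conv_exp)
  show "norm (cis t - 1) \<le> 2" using norm_triangle_ineq4[of "cis t" 1] by simp
  have "(norm (cis t - 1))\<^sup>2 = (cos t - 1)\<^sup>2 + (sin t)\<^sup>2" by (simp add: cmod_power2)
  also have "\<dots> = 2 - 2 * cos t" using sin_cos_squared_add[of t] by (simp add: power2_diff)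
  finally show "(norm (cis t - 1))\<^sup>2 = 2 - 2 * cos t" .
qed

text \<open>Averaging over the step is what makes the lower bound uniform in the frequency:
  the integrand itself vanishes for arbitrarily large \<open>y\<close>.\<close>

lemma average_cis_power:
  assumes y: "2 \<le> \<bar>y\<bar>"
  shows "1 \<le> (\<integral>\<^sup>+s. ennreal ((2 - 2 * cos (s * y)) ^ k) * indicator {0..1} s \<partial>lborel)"
proof -
  let ?z = "\<lambda>s. 2 - 2 * cos (s * y)" and ?G = "\<lambda>s. 1 + real k * (1 - 2 * cos (s * y))"
  let ?F = "\<lambda>s. s + real k * (s - 2 * sin (s * y) / y)"
  have y0: "y \<noteq> 0" using y by auto
  have z0: "0 \<le> ?z s" for s using cos_le_one[of "s * y"] by linarith
  have GF: "(\<integral>s. ?G s * indicator {0..1} s \<partial>lborel) = ?F 1 - ?F 0"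
    by (rule integral_FTC_Icc_real) (use y0 in \<open>auto intro!: derivative_eq_intros simp: field_simps\<close>)
  have iG: "integrable lborel (\<lambda>s. ?G s * indicator {0..1} s)" and iz: "integrable lborel (\<lambda>s. ?z s ^ k * indicator {0..1} s)"
  proof -
    have "continuous_on {0..1} ?G" "continuous_on {0..1} (\<lambda>s. ?z s ^ k)" by (intro continuous_intros)+
    from this[THEN borel_integrable_atLeastAtMost']
    show "integrable lborel (\<lambda>s. ?G s * indicator {0..1} s)" "integrable lborel (\<lambda>s. ?z s ^ k * indicator {0..1} s)"
      by (simp_all add: set_integrable_def mult.commute)
  qed
  have "\<bar>sin y / y\<bar> \<le> 1 / 2"
  proof -
    have "\<bar>sin y\<bar> / \<bar>y\<bar> \<le> 1 / 2" using y by (intro frac_le) auto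
    then show ?thesis by simp
  qed
  then have "sin y / y \<le> 1 / 2" by (rule abs_le_D1)
  then have "0 \<le> 1 - 2 * sin y / y" unfolding times_divide_eq_right[symmetric] by linarith
  then have "0 \<le> real k * (1 - 2 * sin y / y)" by (intro mult_nonneg_nonneg) auto
  then have "1 \<le> ?F 1 - ?F 0" by simp
  also have "\<dots> = (\<integral>s. ?G s * indicator {0..1} s \<partial>lborel)" by (rule GF[symmetric])
  also have "\<dots> \<le> (\<integral>s. ?z s ^ k * indicator {0..1} s \<partial>lborel)"
  proof (intro integral_mono iG iz mult_right_mono)
    fix s
    have "1 + real k * (?z s - 1) \<le> (1 + (?z s - 1)) ^ k" by (rule Bernoulli_inequality) (use z0[of s] in linarith)
    then show "?G s \<le> ?z s ^ k" by simp
  qed auto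
  finally have "1 \<le> (\<integral>s. ?z s ^ k * indicator {0..1} s \<partial>lborel)" .
  then have "ennreal 1 \<le> ennreal (\<integral>s. ?z s ^ k * indicator {0..1} s \<partial>lborel)" by (rule ennreal_leI)
  also have "\<dots> = (\<integral>\<^sup>+s. ennreal (?z s ^ k * indicator {0..1} s) \<partial>lborel)"
    by (rule nn_integral_eq_integral[symmetric, OF iz]) (use z0 in \<open>auto simp: indicator_def\<close>)
  also have "\<dots> = (\<integral>\<^sup>+s. ennreal (?z s ^ k) * indicator {0..1} s \<partial>lborel)"
    by (intro nn_integral_cong) (auto simp: indicator_def)
  finally show ?thesis by simp
qed

lemma Lp_norm_2_power2: "(Lp_norm 2 f)\<^sup>2 = sqint f"
  by (simp add: Lp_norm_2 epowr_half_power2)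

lemma fpair_difference_norm:
  assumes "fpair f g"
  shows "(Lp_norm 2 ((difference h ^^ k) f))\<^sup>2 = (\<integral>\<^sup>+x. ennreal ((2 - 2 * cos (x \<bullet> h)) ^ k) * ennreal ((norm (g x))\<^sup>2) \<partial>lborel)"
proof -
  have "(Lp_norm 2 ((difference h ^^ k) f))\<^sup>2 = sqint (\<lambda>x. (cis (x \<bullet> h) - 1) ^ k * g x)"
    using plancherel[OF fpair_difference_power[OF assms]] by (simp add: Lp_norm_2_power2)
  also have "\<dots> = (\<integral>\<^sup>+x. ennreal ((2 - 2 * cos (x \<bullet> h)) ^ k) * ennreal ((norm (g x))\<^sup>2) \<partial>lborel)"
    unfolding sqint_def
  proof (rule nn_integral_cong)
    fix x
    have "(norm ((cis (x \<bullet> h) - 1) ^ k * g x))\<^sup>2 = ((norm (cis (x \<bullet> h) - 1))\<^sup>2) ^ k * (norm (g x))\<^sup>2"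
      by (simp add: norm_mult norm_power power_mult_distrib power_mult[symmetric] mult.commute)
    then show "ennreal ((norm ((cis (x \<bullet> h) - 1) ^ k * g x))\<^sup>2) = ennreal ((2 - 2 * cos (x \<bullet> h)) ^ k) * ennreal ((norm (g x))\<^sup>2)"
      by (simp only: norm_cis_minus_1(3)) (simp add: ennreal_mult)
  qed
  finally show ?thesis .
qed

text \<open>The supremum over steps dominates the average over steps s 2 ^ (-n) b with s in [0, 1],
  and by \<open>average_cis_power\<close> this average is at least 1 once |x \<bullet> b| \<ge> 2 *
  2 ^ n. A vector of norm at least 2 d 2 ^ n satisfies that for some basis vector \<open>b\<close>,
  so summing over the basis suffices.\<close>

lemma wmod_lower:
  fixes f g :: "'a::euclidean_space \<Rightarrow> complex"
  assumes fg: "fpair f g"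
  shows "(\<integral>\<^sup>+x. ennreal ((norm (g x))\<^sup>2) * indicator {x. 2 * DIM('a) * 2 ^ n \<le> norm x} x \<partial>lborel) \<le> of_nat DIM('a) * (wmod k 2 f n)\<^sup>2"
proof -
  let ?M = "\<lambda>x. ennreal ((norm (g x))\<^sup>2)" and ?t = "(1 / 2) ^ n :: real"
  have [measurable]: "g \<in> borel_measurable borel" using fpair_L2(2)[OF fg] by (rule Lp_measurable)
  have axis: "(\<integral>\<^sup>+x. ?M x * indicator {x. 2 \<le> \<bar>?t * (x \<bullet> b)\<bar>} x \<partial>lborel) \<le> (wmod k 2 f n)\<^sup>2" if b: "b \<in> Basis" for b :: 'a
  proof -
    let ?A = "\<lambda>s x. ennreal ((2 - 2 * cos (s * (?t * (x \<bullet> b)))) ^ k) * indicator {0..1} s"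
    have "(\<integral>\<^sup>+x. ?M x * indicator {x. 2 \<le> \<bar>?t * (x \<bullet> b)\<bar>} x \<partial>lborel) \<le>
        (\<integral>\<^sup>+x. (\<integral>\<^sup>+s. ?M x * (?A s x) \<partial>lborel) \<partial>lborel)"
    proof (rule nn_integral_mono)
      fix x
      show "?M x * indicator {x. 2 \<le> \<bar>?t * (x \<bullet> b)\<bar>} x \<le> (\<integral>\<^sup>+s. ?M x * (?A s x) \<partial>lborel)"
      proof (cases "2 \<le> \<bar>?t * (x \<bullet> b)\<bar>")
        case True
        then have ix: "indicator {x. 2 \<le> \<bar>?t * (x \<bullet> b)\<bar>} x = (1::ennreal)" by (intro indicator_simps(1)) simp
        have e: "(\<integral>\<^sup>+s. ?M x * (?A s x) \<partial>lborel) =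
            ?M x * (\<integral>\<^sup>+s. ?A s x \<partial>lborel)"
          by (rule nn_integral_cmult) measurable
        show ?thesis unfolding ix e by (rule mult_left_mono[OF average_cis_power[OF True]]) simp
      qed simp
    qed
    also have "\<dots> = (\<integral>\<^sup>+s. (\<integral>\<^sup>+x. ?M x * (?A s x) \<partial>lborel) \<partial>lborel)"
      by (rule pair_sigma_finite.Fubini'[OF pair_sigma_finite.intro[OF sigma_finite_lborel sigma_finite_lborel], symmetric]) measurable
    also have "\<dots> \<le> (\<integral>\<^sup>+s. (wmod k 2 f n)\<^sup>2 * indicator {0..1::real} s \<partial>lborel)"
    proof (rule nn_integral_mono)
      fix s :: real
      show "(\<integral>\<^sup>+x. ?M x * (?A s x) \<partial>lborel) \<le> (wmod k 2 f n)\<^sup>2 * indicator {0..1} s"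
      proof (cases "s \<in> {0..1}")
        case True
        let ?h = "(s * ?t) *\<^sub>R b"
        have "(\<integral>\<^sup>+x. ?M x * (?A s x) \<partial>lborel) =
            (Lp_norm 2 ((difference ?h ^^ k) f))\<^sup>2"
          unfolding fpair_difference_norm[OF fg] using True
          by (intro nn_integral_cong) (simp add: mult_ac)
        also have "\<dots> \<le> (wmod k 2 f n)\<^sup>2"
        proof (rule power_mono)
          have "s * ?t \<le> 1 * ?t" using True by (intro mult_right_mono) auto
          then have "norm ?h \<le> ?t" using True b by simp
          then show "Lp_norm 2 ((difference ?h ^^ k) f) \<le> wmod k 2 f n"
            unfolding wmod_def modulus_def by (intro SUP_upper) simp
        qed simp
        finally show ?thesis using True by simp
      qed simp
    qed
    also have "\<dots> = (wmod k 2 f n)\<^sup>2" by (subst nn_integral_cmult_indicator) auto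
    finally show ?thesis .
  qed
  have "(\<integral>\<^sup>+x. ?M x * indicator {x. 2 * DIM('a) * 2 ^ n \<le> norm x} x \<partial>lborel) \<le>
      (\<integral>\<^sup>+x. (\<Sum>b\<in>Basis. ?M x * indicator {x. 2 \<le> \<bar>?t * (x \<bullet> b)\<bar>} x) \<partial>lborel)"
  proof (rule nn_integral_mono)
    fix x :: 'a
    show "?M x * indicator {x. 2 * DIM('a) * 2 ^ n \<le> norm x} x \<le> (\<Sum>b\<in>Basis. ?M x * indicator {x. 2 \<le> \<bar>?t * (x \<bullet> b)\<bar>} x)"
    proof (cases "2 * DIM('a) * 2 ^ n \<le> norm x")
      case True
      have "\<exists>b\<in>Basis. 2 \<le> \<bar>?t * (x \<bullet> b)\<bar>"
      proof (rule ccontr)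
        assume "\<not> ?thesis"
        then have "\<bar>x \<bullet> b\<bar> < 2 * 2 ^ n" if "b \<in> Basis" for b
          using that by (auto simp: not_le abs_mult power_one_over field_simps)
        then have "(\<Sum>b\<in>(Basis::'a set). \<bar>x \<bullet> b\<bar>) < (\<Sum>b\<in>(Basis::'a set). 2 * 2 ^ n)"
          by (intro sum_strict_mono) auto
        then show False using norm_le_l1[of x] True by simp
      qed
      then obtain b where b: "b \<in> Basis" "2 \<le> \<bar>?t * (x \<bullet> b)\<bar>" by blast
      have "?M x * indicator {x. 2 \<le> \<bar>?t * (x \<bullet> b)\<bar>} x \<le> (\<Sum>b\<in>Basis. ?M x * indicator {x. 2 \<le> \<bar>?t * (x \<bullet> b)\<bar>} x)"
        by (rule member_le_sum[OF b(1)]) auto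
      then show ?thesis using b(2) True by simp
    qed simp
  qed
  also have "\<dots> = (\<Sum>b\<in>Basis. \<integral>\<^sup>+x. ?M x * indicator {x. 2 \<le> \<bar>?t * (x \<bullet> b)\<bar>} x \<partial>lborel)"
    by (rule nn_integral_sum) measurable
  also have "\<dots> \<le> (\<Sum>b\<in>(Basis::'a set). (wmod k 2 f n)\<^sup>2)" by (intro sum_mono axis)
  finally show ?thesis by simp
qed

section \<open>The two quasi-norms as weighted integrals over frequency\<close>

context
  fixes \<phi>0 :: "'a::euclidean_space \<Rightarrow> complex" and b :: real
  assumes \<phi>0: "lp_cutoff \<phi>0" and b: "- 1 / 2 < b"
begin

text \<open>The exponent 2 b + 1 is twice the smoothness index b + 1/2, since the Besov quasi-norm
  is squared.\<close>

definition bweight :: "'a \<Rightarrow> ennreal" where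
  "bweight x = (\<Sum>j. ennreal ((1 + real j) powr (2 * b + 1) * (norm (dyadic \<phi>0 j x))\<^sup>2))"

lemma besov_norm_fpair:
  assumes fg: "fpair f g"
  shows "besov_norm \<phi>0 0 (b + 1 / 2) 2 2 (regular_distr f) =
    epowr (\<integral>\<^sup>+x. bweight x * ennreal ((norm (g x))\<^sup>2) \<partial>lborel) (1 / 2)"
proof -
  have [measurable]: "g \<in> borel_measurable borel" using fpair_L2(2)[OF fg] by (rule Lp_measurable)
  note [measurable] = dyadic_measurable[OF \<phi>0]
  let ?w = "\<lambda>j x. (1 + real j) powr (2 * b + 1) * (norm (dyadic \<phi>0 j x))\<^sup>2"
  have "(ennreal (2 powr (real j * 0) * (1 + real j) powr (b + 1 / 2)) * distr_Lp_norm 2 (lp_block \<phi>0 j (regular_distr f)))\<^sup>2 =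
      (\<integral>\<^sup>+x. ennreal (?w j x) * ennreal ((norm (g x))\<^sup>2) \<partial>lborel)" for j
  proof -
    have p: "((1 + real j) powr (b + 1 / 2))\<^sup>2 = (1 + real j) powr (2 * b + 1)"
      by (simp add: power2_eq_square powr_add[symmetric])
    have "(ennreal (2 powr (real j * 0) * (1 + real j) powr (b + 1 / 2)) * distr_Lp_norm 2 (lp_block \<phi>0 j (regular_distr f)))\<^sup>2 =
        ennreal ((1 + real j) powr (2 * b + 1)) * sqint (\<lambda>x. dyadic \<phi>0 j x * g x)"
      by (simp add: lp_block_L2[OF \<phi>0 fg] power_mult_distrib Lp_norm_2_power2 ennreal_power p)
    also have "\<dots> = (\<integral>\<^sup>+x. ennreal (?w j x) * ennreal ((norm (g x))\<^sup>2) \<partial>lborel)"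
      unfolding sqint_def
      by (subst nn_integral_cmult[symmetric]) (auto simp: norm_mult power_mult_distrib ennreal_mult mult.assoc)
    finally show ?thesis .
  qed
  then have "besov_norm \<phi>0 0 (b + 1 / 2) 2 2 (regular_distr f) =
      epowr (\<Sum>j. \<integral>\<^sup>+x. ennreal (?w j x) * ennreal ((norm (g x))\<^sup>2) \<partial>lborel) (1 / 2)"
    by (simp only: besov_norm_qnorm qnorm_2)
  also have "(\<Sum>j. \<integral>\<^sup>+x. ennreal (?w j x) * ennreal ((norm (g x))\<^sup>2) \<partial>lborel) =
      (\<integral>\<^sup>+x. bweight x * ennreal ((norm (g x))\<^sup>2) \<partial>lborel)"
    unfolding bweight_def ennreal_suminf_multc[symmetric] by (rule nn_integral_suminf[symmetric]) measurable
  finally show ?thesis .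
qed

lemma bweight_lower: obtains j where "norm x \<le> 2 ^ (j + 1)" "ennreal ((1 + real j) powr (2 * b + 1)) \<le> ennreal 4 * bweight x"
proof -
  obtain j where j: "1 / 2 \<le> norm (dyadic \<phi>0 j x)" "norm x \<le> 2 ^ (j + 1)" by (rule dyadic_ge_half[OF \<phi>0])
  have "(1 / 2)\<^sup>2 \<le> (norm (dyadic \<phi>0 j x))\<^sup>2" using j by (intro power_mono) auto
  then have "1 \<le> 4 * (norm (dyadic \<phi>0 j x))\<^sup>2" by (simp add: power2_eq_square)
  then have "(1 + real j) powr (2 * b + 1) * 1 \<le> (1 + real j) powr (2 * b + 1) * (4 * (norm (dyadic \<phi>0 j x))\<^sup>2)"
    by (rule mult_left_mono) simp
  then have "ennreal ((1 + real j) powr (2 * b + 1)) \<le> ennreal (4 * ((1 + real j) powr (2 * b + 1) * (norm (dyadic \<phi>0 j x))\<^sup>2))"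
    by (intro ennreal_leI) simp
  also have "\<dots> = ennreal 4 * ennreal ((1 + real j) powr (2 * b + 1) * (norm (dyadic \<phi>0 j x))\<^sup>2)"
    by (rule ennreal_mult) auto
  also have "\<dots> \<le> ennreal 4 * bweight x"
  proof (rule mult_left_mono)
    let ?f = "\<lambda>j. ennreal ((1 + real j) powr (2 * b + 1) * (norm (dyadic \<phi>0 j x))\<^sup>2)"
    have "sum ?f {j} \<le> suminf ?f" by (rule sum_le_suminf) auto
    then show "?f j \<le> bweight x" by (simp only: bweight_def sum.insert_if finite.emptyI empty_iff if_False sum.empty add_0_right)
  qed simp
  finally show ?thesis using j(2) that by blast
qed

text \<open>The symbol of one difference is bounded both by 2 and by the phase, which is at most
  norm x * norm h. The resulting bound no longer depends on the step, so the supremum can be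
  taken.\<close>

lemma wmod_upper:
  fixes f g :: "'a \<Rightarrow> complex"
  assumes fg: "fpair f g"
  shows "(wmod k 2 f n)\<^sup>2 \<le> (\<integral>\<^sup>+x. (ennreal (min 2 ((1 / 2) ^ n * norm x) ^ k))\<^sup>2 * ennreal ((norm (g x))\<^sup>2) \<partial>lborel)"
proof -
  let ?R = "\<integral>\<^sup>+x. (ennreal (min 2 ((1 / 2) ^ n * norm x) ^ k))\<^sup>2 * ennreal ((norm (g x))\<^sup>2) \<partial>lborel"
  have "wmod k 2 f n \<le> epowr ?R (1 / 2)"
    unfolding wmod_def modulus_def
  proof (rule SUP_least)
    fix h :: 'a assume "h \<in> {h. norm h \<le> (1 / 2) ^ n}"
    then have h: "norm h \<le> (1 / 2) ^ n" by simp
    have "(Lp_norm 2 ((difference h ^^ k) f))\<^sup>2 \<le> ?R"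
      unfolding fpair_difference_norm[OF fg]
    proof (intro nn_integral_mono mult_right_mono)
      fix x :: 'a
      have "\<bar>x \<bullet> h\<bar> \<le> norm x * norm h" by (rule Cauchy_Schwarz_ineq2)
      also have "\<dots> \<le> norm x * (1 / 2) ^ n" by (intro mult_left_mono h) auto
      finally have "norm (cis (x \<bullet> h) - 1) \<le> min 2 ((1 / 2) ^ n * norm x)"
        using norm_cis_minus_1(1,2)[of "x \<bullet> h"] by (simp add: mult.commute)
      then have "(norm (cis (x \<bullet> h) - 1))\<^sup>2 \<le> (min 2 ((1 / 2) ^ n * norm x))\<^sup>2" by (intro power_mono) auto
      then have "(2 - 2 * cos (x \<bullet> h)) ^ k \<le> ((min 2 ((1 / 2) ^ n * norm x))\<^sup>2) ^ k"
        unfolding norm_cis_minus_1(3) by (intro power_mono) auto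
      also have "\<dots> = (min 2 ((1 / 2) ^ n * norm x) ^ k)\<^sup>2" by (simp add: power_mult[symmetric] mult.commute)
      finally show "ennreal ((2 - 2 * cos (x \<bullet> h)) ^ k) \<le> (ennreal (min 2 ((1 / 2) ^ n * norm x) ^ k))\<^sup>2"
        by (simp add: ennreal_power ennreal_leI)
    qed simp
    then have "epowr ((Lp_norm 2 ((difference h ^^ k) f))\<^sup>2) (1 / 2) \<le> epowr ?R (1 / 2)" by (intro epowr_mono) auto
    then show "Lp_norm 2 ((difference h ^^ k) f) \<le> epowr ?R (1 / 2)"
      using epowr_inverse(1)[of 2 "Lp_norm 2 ((difference h ^^ k) f)"] by (simp add: epowr_2)
  qed
  from power_mono[OF this, of 2] show ?thesis by (simp add: epowr_half_power2)
qed

lemma bweight_measurable [measurable]: "bweight \<in> borel_measurable borel"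
proof -
  note [measurable] = dyadic_measurable[OF \<phi>0]
  show ?thesis unfolding bweight_def[abs_def] by measurable
qed

text \<open>For a fixed frequency of size at most 2 ^ (j + 1) the bound of
  \<open>wmod_upper\<close>, as a sequence in \<open>n\<close>, has the shape required by
  \<open>weighted_qnorm_upper\<close> with M = j. Sum and integral commute because both are of
  squares, so the pointwise estimate can be integrated.\<close>

lemma diff_le_besov:
  assumes k: "1 \<le> k"
  obtains C where "0 < C" "\<And>f g. fpair f g \<Longrightarrow>
    diff_besov_norm k b 2 2 f \<le> ennreal C * besov_norm \<phi>0 0 (b + 1 / 2) 2 2 (regular_distr f)"
proof -
  have q: "(0::ereal) < 2" by simp
  obtain C where C: "0 < C" "\<forall>M A a. (\<forall>n. a n \<le> A) \<longrightarrow> (\<forall>i. a (i + M) \<le> A * ennreal ((1 / 2) ^ i)) \<longrightarrow>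
    qnorm 2 (\<lambda>n. ennreal ((1 + real n) powr b) * a n) \<le> ennreal (C * (1 + real M) powr (b + rq 2)) * A"
  proof -
    have br: "- rq 2 < b" unfolding rq_2 using b by simp
    show ?thesis by (rule weighted_qnorm_upper[OF q br]) (rule that)
  qed
  let ?B = "\<lambda>f. besov_norm \<phi>0 0 (b + 1 / 2) 2 2 (regular_distr f)"
  \<comment> \<open>The last factor is the root of the 4 in \<open>bweight_lower\<close>.\<close>
  define K where "K = C * 2 ^ k * 2"
  have K: "0 < K" using C by (simp add: K_def)
  have "diff_besov_norm k b 2 2 f \<le> ennreal (2 + 2 powr \<bar>b\<bar> * K) * ?B f" if fg: "fpair f g" for f g
  proof -
    have [measurable]: "g \<in> borel_measurable borel" using fpair_L2(2)[OF fg] by (rule Lp_measurable)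
    let ?M = "\<lambda>x. ennreal ((norm (g x))\<^sup>2)"
    let ?a = "\<lambda>n x. ennreal (min 2 ((1 / 2) ^ n * norm (x::'a)) ^ k)"
    have pt: "(\<Sum>n. (ennreal ((1 + real n) powr b) * ?a n x)\<^sup>2) \<le> ennreal (K\<^sup>2) * bweight x" for x
    proof -
      obtain j where j: "norm x \<le> 2 ^ (j + 1)" "ennreal ((1 + real j) powr (2 * b + 1)) \<le> ennreal 4 * bweight x"
        by (rule bweight_lower)
      have "qnorm 2 (\<lambda>n. ennreal ((1 + real n) powr b) * ?a n x) \<le> ennreal (C * (1 + real j) powr (b + rq 2)) * ennreal (2 ^ k)"
      proof (rule C(2)[rule_format])
        show "?a n x \<le> ennreal (2 ^ k)" for n by (intro ennreal_leI power_mono) auto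
        fix i
        have "(1 / 2) ^ (i + j) * norm x \<le> (1 / 2) ^ (i + j) * 2 ^ (j + 1)" by (intro mult_left_mono j) auto
        also have "\<dots> = 2 * (1 / 2) ^ i" by (simp add: power_add power_one_over)
        finally have "min 2 ((1 / 2) ^ (i + j) * norm x) ^ k \<le> (2 * (1 / 2) ^ i) ^ k"
          by (intro power_mono) auto
        also have "\<dots> = 2 ^ k * ((1 / 2) ^ i) ^ k" by (simp only: power_mult_distrib)
        \<comment> \<open>Here \<open>k \<ge> 1\<close> is used: a difference of any positive order
          decays at least as fast as the first.\<close>
        also have "\<dots> \<le> 2 ^ k * ((1 / 2) ^ i) ^ (1::nat)"
          using k by (intro mult_left_mono power_decreasing) (auto simp: power_le_one)
        finally have "min 2 ((1 / 2) ^ (i + j) * norm x) ^ k \<le> 2 ^ k * (1 / 2) ^ i" by simp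
        then show "?a (i + j) x \<le> ennreal (2 ^ k) * ennreal ((1 / 2) ^ i)"
          by (subst ennreal_mult[symmetric]) (auto intro: ennreal_leI)
      qed
      then have "(\<Sum>n. (ennreal ((1 + real n) powr b) * ?a n x)\<^sup>2) \<le> (ennreal (C * (1 + real j) powr (b + rq 2)) * ennreal (2 ^ k))\<^sup>2"
        unfolding qnorm_2 epowr_half_le_iff .
      also have "\<dots> = ennreal ((C * 2 ^ k)\<^sup>2) * ennreal ((1 + real j) powr (2 * b + 1))"
      proof -
        have "((1 + real j) powr (b + 1 / 2))\<^sup>2 = (1 + real j) powr (2 * b + 1)"
          by (simp add: power2_eq_square powr_add[symmetric])
        then have "(C * (1 + real j) powr (b + 1 / 2) * 2 ^ k)\<^sup>2 = (C * 2 ^ k)\<^sup>2 * (1 + real j) powr (2 * b + 1)"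
          by (simp add: power_mult_distrib)
        then show ?thesis using C by (simp only: rq_2) (simp add: ennreal_mult[symmetric] ennreal_power del: ennreal_mult)
      qed
      also have "\<dots> \<le> ennreal ((C * 2 ^ k)\<^sup>2) * (ennreal 4 * bweight x)" by (intro mult_left_mono j) auto
      also have "\<dots> = ennreal (K\<^sup>2) * bweight x"
        unfolding mult.assoc[symmetric] by (subst ennreal_mult[symmetric]) (auto simp: K_def power_mult_distrib)
      finally show ?thesis .
    qed
    have "(\<Sum>n. (ennreal ((1 + real n) powr b) * wmod k 2 f n)\<^sup>2) \<le>
        (\<Sum>n. \<integral>\<^sup>+x. (ennreal ((1 + real n) powr b) * ?a n x)\<^sup>2 * ?M x \<partial>lborel)"
    proof (intro suminf_le)
      fix n
      have "(ennreal ((1 + real n) powr b) * wmod k 2 f n)\<^sup>2 \<le> (ennreal ((1 + real n) powr b))\<^sup>2 * (\<integral>\<^sup>+x. (?a n x)\<^sup>2 * ?M x \<partial>lborel)"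
        unfolding power_mult_distrib by (intro mult_left_mono wmod_upper[OF fg]) auto
      also have "\<dots> = (\<integral>\<^sup>+x. (ennreal ((1 + real n) powr b) * ?a n x)\<^sup>2 * ?M x \<partial>lborel)"
        by (subst nn_integral_cmult[symmetric]) (auto simp: power_mult_distrib mult.assoc)
      finally show "(ennreal ((1 + real n) powr b) * wmod k 2 f n)\<^sup>2 \<le> (\<integral>\<^sup>+x. (ennreal ((1 + real n) powr b) * ?a n x)\<^sup>2 * ?M x \<partial>lborel)" .
    qed auto
    also have "\<dots> = (\<integral>\<^sup>+x. (\<Sum>n. (ennreal ((1 + real n) powr b) * ?a n x)\<^sup>2) * ?M x \<partial>lborel)"
      unfolding ennreal_suminf_multc[symmetric] by (rule nn_integral_suminf[symmetric]) measurable
    also have "\<dots> \<le> (\<integral>\<^sup>+x. ennreal (K\<^sup>2) * (bweight x * ?M x) \<partial>lborel)"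
      unfolding mult.assoc[symmetric] by (intro nn_integral_mono mult_right_mono pt) auto
    also have "\<dots> = ennreal (K\<^sup>2) * (\<integral>\<^sup>+x. bweight x * ?M x \<partial>lborel)" by (rule nn_integral_cmult) measurable
    finally have "qnorm 2 (\<lambda>n. ennreal ((1 + real n) powr b) * wmod k 2 f n) \<le>
        epowr (ennreal (K\<^sup>2) * (\<integral>\<^sup>+x. bweight x * ?M x \<partial>lborel)) (1 / 2)"
      unfolding qnorm_2 by (intro epowr_mono) auto
    also have "\<dots> = ennreal K * ?B f"
      unfolding besov_norm_fpair[OF fg] by (rule epowr_half_cmult_sq) (use K in simp)
    finally have qn: "qnorm 2 (\<lambda>n. ennreal ((1 + real n) powr b) * wmod k 2 f n) \<le> ennreal K * ?B f" .
    have "sqint g \<le> (\<integral>\<^sup>+x. ennreal (2\<^sup>2) * (bweight x * ?M x) \<partial>lborel)"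
      unfolding sqint_def
    proof (rule nn_integral_mono)
      fix x
      obtain j where j: "ennreal ((1 + real j) powr (2 * b + 1)) \<le> ennreal 4 * bweight x" using bweight_lower[of x] by blast
      have "ennreal 1 \<le> ennreal ((1 + real j) powr (2 * b + 1))"
        using b by (intro ennreal_leI ge_one_powr_ge_zero) auto
      also note j
      finally have "ennreal 1 * ?M x \<le> (ennreal 4 * bweight x) * ?M x" by (rule mult_right_mono) simp
      then show "?M x \<le> ennreal (2\<^sup>2) * (bweight x * ?M x)" by (simp add: mult.assoc)
    qed
    also have "\<dots> = ennreal (2\<^sup>2) * (\<integral>\<^sup>+x. bweight x * ?M x \<partial>lborel)" by (rule nn_integral_cmult) measurable
    finally have "epowr (sqint g) (1 / 2) \<le> epowr (ennreal (2\<^sup>2) * (\<integral>\<^sup>+x. bweight x * ?M x \<partial>lborel)) (1 / 2)"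
      by (rule epowr_mono) simp
    also have "\<dots> = ennreal 2 * ?B f"
      unfolding besov_norm_fpair[OF fg] by (rule epowr_half_cmult_sq) simp
    finally have "Lp_norm 2 f \<le> ennreal 2 * ?B f" by (simp add: Lp_norm_2 plancherel[OF fg])
    then have "Lp_norm 2 f + ennreal (2 powr \<bar>b\<bar>) * qnorm 2 (\<lambda>n. ennreal ((1 + real n) powr b) * wmod k 2 f n) \<le>
        ennreal 2 * ?B f + ennreal (2 powr \<bar>b\<bar>) * (ennreal K * ?B f)"
      by (intro add_mono mult_left_mono qn) auto
    also have "\<dots> = ennreal (2 + 2 powr \<bar>b\<bar> * K) * ?B f"
      using K by (simp add: ennreal_plus ennreal_mult distrib_right mult.assoc del: ennreal_numeral)
    finally show ?thesis using diff_besov_upper[OF q, of k b 2 f] by (rule order_trans[rotated])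
  qed
  moreover have "0 < 2 + 2 powr \<bar>b\<bar> * K" using K by (simp add: add_pos_nonneg)
  ultimately show ?thesis using that by blast
qed

lemma dyadic_overlap:
  assumes "dyadic \<phi>0 i x \<noteq> 0" "dyadic \<phi>0 j x \<noteq> 0" shows "i \<le> j + 1"
proof (cases i)
  case (Suc m)
  have "2 ^ m < norm x" using assms(1) dyadic_eq_0_low[OF \<phi>0, of x m] Suc by (meson not_le)
  also have "norm x \<le> 2 ^ (j + 1)" using assms(2) dyadic_eq_0_high[OF \<phi>0, of j x] by (meson not_le)
  finally have "m < j + 1" by (rule power_less_imp_less_exp[rotated]) simp
  then show ?thesis using Suc by simp
qed simp

text \<open>A frequency in the j-th annulus lies above the threshold of \<open>wmod_lower\<close>
  for all scales up to j minus a constant. By \<open>sum_powr_lower\<close> the weights (1 + n) powr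
  (2 b) over these scales sum to the order of (1 + j) powr (2 b + 1); the summand 1 takes care of
  low frequencies.\<close>

lemma bweight_upper:
  obtains C where "0 < C" "\<And>x. bweight x \<le> ennreal C * (1 + (\<Sum>n. ennreal ((1 + real n) powr (2 * b)) *
    indicator {x. 2 * DIM('a) * 2 ^ (n + 1) \<le> norm x} x))"
proof -
  \<comment> \<open>The offset \<open>D\<close> converts the dimensional factor 4 d of the threshold
    into a fixed number of dyadic scales.\<close>
  obtain D :: nat where D: "real (4 * DIM('a)) < 2 ^ D" using real_arch_pow[of 2] by auto
  obtain c where c: "0 < c" "\<And>M::nat. c * (1 + real M) powr (2 * b + 1) \<le> (\<Sum>n\<le>M. (1 + real n) powr (2 * b))"
    using sum_powr_lower[of "2 * b"] by metis
  obtain C0 where C0: "0 \<le> C0" "\<And>j x. norm (dyadic \<phi>0 j x) \<le> C0" by (rule dyadic_bounded[OF \<phi>0]) blast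
  define E where "E = (2 + real D) powr (2 * b + 1) * (1 + 1 / c)"
  have E: "0 < E" using c by (auto simp: E_def intro!: mult_pos_pos add_pos_pos)
  let ?T = "\<lambda>x. (\<Sum>n. ennreal ((1 + real n) powr (2 * b)) * indicator {x. 2 * DIM('a) * 2 ^ (n + 1) \<le> norm x} x)"
  have one: "ennreal ((1 + real j) powr (2 * b + 1)) \<le> ennreal E * (1 + ?T x)" if j: "dyadic \<phi>0 j x \<noteq> 0" for j x
  proof (cases "j \<le> D")
    case True
    have "(1 + real j) powr (2 * b + 1) \<le> (2 + real D) powr (2 * b + 1) * 1"
      using True b by (auto intro!: powr_mono2)
    also have "\<dots> \<le> E" unfolding E_def using c by (intro mult_left_mono) auto
    finally have "ennreal ((1 + real j) powr (2 * b + 1)) \<le> ennreal E * 1" by (simp add: ennreal_leI)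
    also have "\<dots> \<le> ennreal E * (1 + ?T x)" by (intro mult_left_mono) auto
    finally show ?thesis .
  next
    case False
    define m where "m = j - 1 - D"
    have jm: "j = Suc (m + D)" using False by (simp add: m_def)
    have x: "2 ^ (m + D) < norm x" using j dyadic_eq_0_low[OF \<phi>0, of x "m + D"] jm by (meson not_le)
    have n: "2 * DIM('a) * 2 ^ (n + 1) \<le> norm x" if "n \<le> m" for n
    proof -
      have "real (2 * DIM('a) * 2 ^ (n + 1)) = real (4 * DIM('a)) * 2 ^ n" by simp
      also have "\<dots> \<le> 2 ^ D * 2 ^ n" using D by (intro mult_right_mono) auto
      also have "\<dots> \<le> 2 ^ D * 2 ^ m" using that by (intro mult_left_mono power_increasing) auto
      finally show ?thesis using x by (simp add: power_add mult.commute)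
    qed
    have "c * (1 + real m) powr (2 * b + 1) \<le> (\<Sum>n\<le>m. (1 + real n) powr (2 * b))" by (rule c(2))
    then have "ennreal (c * (1 + real m) powr (2 * b + 1)) \<le> (\<Sum>n\<le>m. ennreal ((1 + real n) powr (2 * b)))"
      by (subst sum_ennreal) (auto intro: ennreal_leI)
    also have "\<dots> = (\<Sum>n\<le>m. ennreal ((1 + real n) powr (2 * b)) * indicator {x. 2 * DIM('a) * 2 ^ (n + 1) \<le> norm x} x)"
      by (intro sum.cong refl) (use n in auto)
    also have "\<dots> \<le> ?T x" by (intro sum_le_suminf) auto
    finally have cT: "ennreal (c * (1 + real m) powr (2 * b + 1)) \<le> ?T x" .
    have "1 + real j \<le> (2 + real D) * (1 + real m)" by (simp add: jm algebra_simps)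
    then have "(1 + real j) powr (2 * b + 1) \<le> ((2 + real D) * (1 + real m)) powr (2 * b + 1)"
      using b by (intro powr_mono2) auto
    also have "\<dots> = ((2 + real D) powr (2 * b + 1) * (1 / c)) * (c * (1 + real m) powr (2 * b + 1))"
      using c by (simp add: powr_mult)
    also have "\<dots> \<le> E * (c * (1 + real m) powr (2 * b + 1))"
      unfolding E_def using c by (intro mult_right_mono mult_left_mono) auto
    finally have "ennreal ((1 + real j) powr (2 * b + 1)) \<le> ennreal E * ennreal (c * (1 + real m) powr (2 * b + 1))"
      using c E by (subst ennreal_mult[symmetric]) (auto intro: ennreal_leI)
    also have "\<dots> \<le> ennreal E * (1 + ?T x)" by (intro mult_left_mono order_trans[OF cT]) (auto simp: add_increasing)
    finally show ?thesis .
  qed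
  \<comment> \<open>At most two neighbouring dyadic functions are nonzero at a point, hence the 2;
    adding 1 makes the constant positive.\<close>
  define K where "K = 2 * (C0\<^sup>2 * E) + 1"
  have "bweight x \<le> ennreal K * (1 + ?T x)" for x
  proof (cases "\<exists>j. dyadic \<phi>0 j x \<noteq> 0")
    case True
    then have ex: "\<exists>j. dyadic \<phi>0 j x \<noteq> 0" by blast
    define j where "j = (LEAST j. dyadic \<phi>0 j x \<noteq> 0)"
    have jx: "dyadic \<phi>0 j x \<noteq> 0" unfolding j_def by (rule LeastI_ex[OF ex])
    have z: "dyadic \<phi>0 i x = 0" if "i \<notin> {j, j + 1}" for i
    proof (rule ccontr)
      assume i: "dyadic \<phi>0 i x \<noteq> 0"
      have "j \<le> i" unfolding j_def by (rule Least_le[of "\<lambda>j. dyadic \<phi>0 j x \<noteq> 0", OF i])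
      moreover have "i \<le> j + 1" by (rule dyadic_overlap[OF i jx])
      ultimately show False using that by auto
    qed
    have le: "ennreal ((1 + real i) powr (2 * b + 1) * (norm (dyadic \<phi>0 i x))\<^sup>2) \<le> ennreal (C0\<^sup>2 * E) * (1 + ?T x)" for i
    proof (cases "dyadic \<phi>0 i x = 0")
      case False
      have "(norm (dyadic \<phi>0 i x))\<^sup>2 \<le> C0\<^sup>2" by (intro power_mono C0) auto
      then have "ennreal ((1 + real i) powr (2 * b + 1) * (norm (dyadic \<phi>0 i x))\<^sup>2) \<le> ennreal (C0\<^sup>2 * (1 + real i) powr (2 * b + 1))"
        by (intro ennreal_leI) (simp add: mult.commute mult_right_mono)
      also have "\<dots> = ennreal (C0\<^sup>2) * ennreal ((1 + real i) powr (2 * b + 1))" by (simp add: ennreal_mult)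
      also have "\<dots> \<le> ennreal (C0\<^sup>2) * (ennreal E * (1 + ?T x))" by (intro mult_left_mono one False) auto
      finally show ?thesis using E by (simp add: ennreal_mult mult.assoc)
    qed simp
    have "bweight x = (\<Sum>i\<in>{j, j + 1}. ennreal ((1 + real i) powr (2 * b + 1) * (norm (dyadic \<phi>0 i x))\<^sup>2))"
      unfolding bweight_def by (rule suminf_finite) (use z in auto)
    also have "\<dots> \<le> (\<Sum>i\<in>{j, j + 1}. ennreal (C0\<^sup>2 * E) * (1 + ?T x))" by (intro sum_mono le)
    also have "\<dots> = ennreal (2 * (C0\<^sup>2 * E)) * (1 + ?T x)"
      using E by (simp add: ennreal_mult mult.assoc)
    also have "\<dots> \<le> ennreal K * (1 + ?T x)" by (intro mult_right_mono ennreal_leI) (auto simp: K_def)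
    finally show ?thesis .
  qed (simp add: bweight_def)
  moreover have "0 < K" using E by (simp add: K_def add_nonneg_pos)
  ultimately show ?thesis using that by blast
qed

text \<open>The pointwise bound of \<open>bweight_upper\<close> is integrated against the energy
  density of the transform. The constant term gives the L_2 norm, and each threshold term is a
  squared modulus by \<open>wmod_lower\<close>.\<close>

lemma besov_le_diff:
  obtains C where "0 < C" "\<And>f g. fpair f g \<Longrightarrow>
    besov_norm \<phi>0 0 (b + 1 / 2) 2 2 (regular_distr f) \<le> ennreal C * diff_besov_norm k b 2 2 f"
proof -
  have q: "(0::ereal) < 2" by simp
  let ?D = "\<lambda>f::'a \<Rightarrow> complex. diff_besov_norm k b 2 2 f"
  let ?T = "\<lambda>x. (\<Sum>n. ennreal ((1 + real n) powr (2 * b)) * indicator {x::'a. 2 * DIM('a) * 2 ^ (n + 1) \<le> norm x} x)"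
  obtain C1 where C1: "0 < C1" "\<And>x. bweight x \<le> ennreal C1 * (1 + ?T x)" using bweight_upper by blast
  obtain C2 where C2: "0 < C2" "\<And>k p f. qnorm 2 (\<lambda>n. ennreal ((1 + real n) powr b) * wmod k p (f :: 'a \<Rightarrow> complex) (Suc n)) \<le>
    ennreal C2 * diff_besov_norm k b p 2 f"
    using diff_besov_lower[OF q, of b] by metis
  define K where "K = C1 * (1 + DIM('a) * C2\<^sup>2)"
  have K: "0 < K" using C1 by (auto simp: K_def intro!: mult_pos_pos add_pos_nonneg)
  have "besov_norm \<phi>0 0 (b + 1 / 2) 2 2 (regular_distr f) \<le> ennreal (sqrt K) * ?D f" if fg: "fpair f g" for f g
  proof -
    have [measurable]: "g \<in> borel_measurable borel" using fpair_L2(2)[OF fg] by (rule Lp_measurable)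
    let ?M = "\<lambda>x. ennreal ((norm (g x))\<^sup>2)"
    have f1: "(\<integral>\<^sup>+x. ?M x \<partial>lborel) \<le> (?D f)\<^sup>2"
    proof -
      have "Lp_norm 2 f \<le> ?D f" unfolding diff_besov_norm_def by simp
      then have "(Lp_norm 2 f)\<^sup>2 \<le> (?D f)\<^sup>2" by (rule power_mono) simp
      then show ?thesis using plancherel[OF fg] by (simp add: Lp_norm_2_power2 sqint_def)
    qed
    have "(\<integral>\<^sup>+x. ?T x * ?M x \<partial>lborel) = (\<Sum>n. \<integral>\<^sup>+x. ennreal ((1 + real n) powr (2 * b)) *
        (?M x * indicator {x. 2 * DIM('a) * 2 ^ (n + 1) \<le> norm x} x) \<partial>lborel)"
    proof -
      have "(\<integral>\<^sup>+x. ?T x * ?M x \<partial>lborel) = (\<integral>\<^sup>+x. (\<Sum>n. ennreal ((1 + real n) powr (2 * b)) *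
        (?M x * indicator {x. 2 * DIM('a) * 2 ^ (n + 1) \<le> norm x} x)) \<partial>lborel)"
        unfolding ennreal_suminf_multc[symmetric] mult.assoc mult.commute[of "indicator _ _"] ..
      also have "\<dots> = (\<Sum>n. \<integral>\<^sup>+x. ennreal ((1 + real n) powr (2 * b)) *
        (?M x * indicator {x. 2 * DIM('a) * 2 ^ (n + 1) \<le> norm x} x) \<partial>lborel)"
        by (rule nn_integral_suminf) measurable
      finally show ?thesis .
    qed
    also have "\<dots> \<le> (\<Sum>n. of_nat DIM('a) * (ennreal ((1 + real n) powr b) * wmod k 2 f (Suc n))\<^sup>2)"
    proof (intro suminf_le)
      fix n
      have p: "((1 + real n) powr b)\<^sup>2 = (1 + real n) powr (2 * b)" by (simp add: power2_eq_square powr_add[symmetric])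
      have "(\<integral>\<^sup>+x. ennreal ((1 + real n) powr (2 * b)) * (?M x * indicator {x. 2 * DIM('a) * 2 ^ (n + 1) \<le> norm x} x) \<partial>lborel) =
         ennreal ((1 + real n) powr (2 * b)) * (\<integral>\<^sup>+x. ?M x * indicator {x. 2 * DIM('a) * 2 ^ (n + 1) \<le> norm x} x \<partial>lborel)"
        by (rule nn_integral_cmult) measurable
      also have "\<dots> \<le> ennreal ((1 + real n) powr (2 * b)) * (of_nat DIM('a) * (wmod k 2 f (n + 1))\<^sup>2)"
        by (intro mult_left_mono wmod_lower[OF fg]) auto
      also have "\<dots> = of_nat DIM('a) * (ennreal ((1 + real n) powr b) * wmod k 2 f (Suc n))\<^sup>2"
        by (simp add: power_mult_distrib ennreal_power p mult_ac)
      finally show "(\<integral>\<^sup>+x. ennreal ((1 + real n) powr (2 * b)) * (?M x * indicator {x. 2 * DIM('a) * 2 ^ (n + 1) \<le> norm x} x) \<partial>lborel) \<le>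
        of_nat DIM('a) * (ennreal ((1 + real n) powr b) * wmod k 2 f (Suc n))\<^sup>2" .
    qed auto
    also have "\<dots> = of_nat DIM('a) * (\<Sum>n. (ennreal ((1 + real n) powr b) * wmod k 2 f (Suc n))\<^sup>2)" by simp
    also have "\<dots> \<le> of_nat DIM('a) * (ennreal C2 * ?D f)\<^sup>2"
      by (intro mult_left_mono C2(2)[of k 2 f, unfolded qnorm_2 epowr_half_le_iff]) simp
    finally have f2: "(\<integral>\<^sup>+x. ?T x * ?M x \<partial>lborel) \<le> of_nat DIM('a) * (ennreal C2 * ?D f)\<^sup>2" .
    have "(\<integral>\<^sup>+x. bweight x * ?M x \<partial>lborel) \<le> (\<integral>\<^sup>+x. ennreal C1 * (?M x + ?T x * ?M x) \<partial>lborel)"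
    proof (rule nn_integral_mono)
      fix x
      have "bweight x * ?M x \<le> (ennreal C1 * (1 + ?T x)) * ?M x" by (intro mult_right_mono C1) auto
      then show "bweight x * ?M x \<le> ennreal C1 * (?M x + ?T x * ?M x)" by (simp add: mult.assoc distrib_right)
    qed
    also have "\<dots> = ennreal C1 * ((\<integral>\<^sup>+x. ?M x \<partial>lborel) + (\<integral>\<^sup>+x. ?T x * ?M x \<partial>lborel))"
      by (subst nn_integral_cmult) (auto simp: nn_integral_add)
    also have "\<dots> \<le> ennreal C1 * ((?D f)\<^sup>2 + of_nat DIM('a) * (ennreal C2 * ?D f)\<^sup>2)"
      by (intro mult_left_mono add_mono f1 f2) auto
    also have "\<dots> = ennreal ((sqrt K)\<^sup>2) * (?D f)\<^sup>2"
    proof -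
      have "ennreal ((sqrt K)\<^sup>2) = ennreal C1 * (1 + of_nat DIM('a) * ennreal (C2\<^sup>2))"
        using K C1 by (simp add: K_def ennreal_mult ennreal_plus ennreal_of_nat_eq_real_of_nat)
      then show ?thesis using C2 by (simp add: power_mult_distrib ennreal_power distrib_left distrib_right mult.assoc)
    qed
    finally show ?thesis unfolding besov_norm_fpair[OF fg] epowr_half_le_iff
      using K by (simp add: power_mult_distrib ennreal_power)
  qed
  moreover have "0 < sqrt K" using K by simp
  ultimately show ?thesis using that by blast
qed

end

text \<open>A wider cutoff that equals 1 on the support of the j-th dyadic function. For index
  \<open>Suc i\<close> its first term is 1 up to radius 2 ^ (i + 2) and its second term vanishes
  beyond radius 2 ^ i.\<close>

definition fat_dyadic :: "('a::euclidean_space \<Rightarrow> complex) \<Rightarrow> nat \<Rightarrow> 'a \<Rightarrow> complex" where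
  "fat_dyadic \<phi>0 j = (case j of 0 \<Rightarrow> (\<lambda>x. \<phi>0 ((1 / 2) *\<^sub>R x))
     | Suc i \<Rightarrow> (\<lambda>x. \<phi>0 ((1 / 2 ^ (i + 2)) *\<^sub>R x) - \<phi>0 ((2 / 2 ^ i) *\<^sub>R x)))"

context
  fixes \<phi>0 :: "'a::euclidean_space \<Rightarrow> complex"
  assumes \<phi>0: "lp_cutoff \<phi>0"
begin

lemma fat_dyadic_schwartz: "fat_dyadic \<phi>0 j \<in> schwartz"
proof (cases j)
  case 0
  then show ?thesis using schwartz_affine[OF cutoff_schwartz[OF \<phi>0], of "1 / 2" 0] by (simp add: fat_dyadic_def)
next
  case (Suc i)
  have "(\<lambda>x. \<phi>0 ((1 / 2 ^ (i + 2)) *\<^sub>R x + 0) - \<phi>0 ((2 / 2 ^ i) *\<^sub>R x + 0)) \<in> schwartz"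
    by (intro schwartz_diff schwartz_affine cutoff_schwartz[OF \<phi>0]) auto
  then show ?thesis by (simp add: Suc fat_dyadic_def)
qed

lemma fat_dyadic_bounded: obtains C where "0 \<le> C" "\<And>j x. norm (fat_dyadic \<phi>0 j x) \<le> C"
proof -
  obtain C where C: "0 \<le> C" "\<And>x. norm (\<phi>0 x) \<le> C" using schwartz_bounded[OF cutoff_schwartz[OF \<phi>0]] by blast
  have "norm (fat_dyadic \<phi>0 j x) \<le> C + C" for j x
  proof (cases j)
    case 0
    then show ?thesis using C(1) C(2)[of "(1 / 2) *\<^sub>R x"] by (simp add: fat_dyadic_def)
  next
    case (Suc i)
    have "norm (\<phi>0 ((1 / 2 ^ (i + 2)) *\<^sub>R x) - \<phi>0 ((2 / 2 ^ i) *\<^sub>R x)) \<le> C + C"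
      by (intro order_trans[OF norm_triangle_ineq4] add_mono C)
    then show ?thesis by (simp add: fat_dyadic_def Suc)
  qed
  then show ?thesis using C that[of "C + C"] by auto
qed

lemma fat_dyadic_mult: "dyadic \<phi>0 j x * fat_dyadic \<phi>0 j x = dyadic \<phi>0 j x"
proof (cases "dyadic \<phi>0 j x = 0")
  case False
  then have h: "norm x \<le> 2 ^ (j + 1)" using dyadic_eq_0_high[OF \<phi>0, of j x] by (meson not_le)
  have "fat_dyadic \<phi>0 j x = 1"
  proof (cases j)
    case 0
    then show ?thesis using h by (simp add: fat_dyadic_def cutoff_eq_1[OF \<phi>0])
  next
    case (Suc i)
    have "2 ^ i < norm x" using False dyadic_eq_0_low[OF \<phi>0, of x i] Suc by (meson not_le)
    moreover have pos: "(0::real) < 2 ^ i" by simp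
    ultimately have "2 < norm ((2 / 2 ^ i) *\<^sub>R x)"
      by (simp add: pos_less_divide_eq)
    moreover have "norm ((1 / 2 ^ (i + 2)) *\<^sub>R x) \<le> 1"
      using h Suc by (simp add: field_simps)
    ultimately show ?thesis using Suc by (simp add: fat_dyadic_def cutoff_eq_1[OF \<phi>0] cutoff_eq_0[OF \<phi>0])
  qed
  then show ?thesis by simp
qed simp

lemma fat_dyadic_overlap:
  assumes i: "fat_dyadic \<phi>0 i x \<noteq> 0" and j: "fat_dyadic \<phi>0 j x \<noteq> 0"
  shows "i \<le> j + 3"
proof (cases i)
  case (Suc m)
  have l: "2 ^ m < 2 * norm x"
  proof (rule ccontr)
    assume "\<not> ?thesis"
    then have n: "2 * norm x \<le> 2 ^ m" by simp
    have p: "(0::real) < 2 ^ m" by simp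
    have "norm ((2 / 2 ^ m) *\<^sub>R x) \<le> 1" using n p by (simp add: pos_divide_le_eq)
    moreover have "norm ((1 / 2 ^ (m + 2)) *\<^sub>R x) \<le> 1"
    proof -
      have "norm x \<le> 4 * 2 ^ m" using n p norm_ge_zero[of x] by linarith
      then have "norm x \<le> 2 ^ (m + 2)" by simp
      then show ?thesis by (simp add: pos_divide_le_eq)
    qed
    ultimately show False using i Suc by (simp add: fat_dyadic_def cutoff_eq_1[OF \<phi>0])
  qed
  have u: "norm x \<le> 2 ^ (j + 2)"
  proof (rule ccontr)
    assume "\<not> ?thesis"
    then have n: "2 ^ (j + 2) < norm x" by simp
    show False
    proof (cases j)
      case 0
      then show ?thesis using n j by (simp add: fat_dyadic_def cutoff_eq_0[OF \<phi>0])
    next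
      case (Suc l)
      have p: "(0::real) < 2 ^ l" by simp
      have n': "8 * 2 ^ l < norm x" using n Suc by simp
      have "2 < norm ((1 / 2 ^ (l + 2)) *\<^sub>R x)" using n' by (simp add: pos_less_divide_eq)
      moreover have "2 < norm ((2 / 2 ^ l) *\<^sub>R x)"
      proof -
        have "2 * 2 ^ l < 2 * norm x" using n' p by linarith
        then show ?thesis using p by (simp add: pos_less_divide_eq)
      qed
      ultimately show ?thesis using j Suc by (simp add: fat_dyadic_def cutoff_eq_0[OF \<phi>0])
    qed
  qed
  have "(2::real) ^ m < 2 * 2 ^ (j + 2)" using l u by linarith
  also have "\<dots> = 2 ^ (j + 3)" by (simp add: power_add)
  finally have "(2::real) ^ m < 2 ^ (j + 3)" .
  then have "m < j + 3" by (rule power_less_imp_less_exp[rotated]) simp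
  then show ?thesis using Suc by simp
qed simp

text \<open>Each block is an L_2 function, and the transforms of the blocks have boundedly
  overlapping supports. Their sum is thus in L_2, and testing it against Schwartz functions, with
  the partial sums recognised as smooth cutoffs, shows that it is the transform of
  \<open>u\<close>.\<close>

lemma besov_imp_L2:
  fixes u :: "'a distr"
  assumes \<xi>: "0 \<le> \<xi>" and u: "u \<in> besov \<phi>0 0 \<xi> 2 2"
  shows "\<exists>f\<in>Lp 2. regular_distr f = u"
proof -
  have ut: "u \<in> tempered_distr" and un: "besov_norm \<phi>0 0 \<xi> 2 2 u < top" using u by (auto simp: besov_def)
  have ue: "u \<in> extensional schwartz" using ut by (simp add: tempered_distr_def)
  have u_add: "\<And>\<phi> \<psi>. \<phi> \<in> schwartz \<Longrightarrow> \<psi> \<in> schwartz \<Longrightarrow> u (\<lambda>x. \<phi> x + \<psi> x) = u \<phi> + u \<psi>"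
    using ut unfolding tempered_distr_def by blast
  let ?n = "\<lambda>j. distr_Lp_norm 2 (lp_block \<phi>0 j u)"
  have nsum: "(\<Sum>j. (?n j)\<^sup>2) < top"
  proof -
    have "(\<Sum>j. (?n j)\<^sup>2) \<le> (\<Sum>j. (ennreal (2 powr (real j * 0) * (1 + real j) powr \<xi>) * ?n j)\<^sup>2)"
    proof (intro suminf_le power_mono)
      fix j
      \<comment> \<open>For \<open>\<xi> \<ge> 0\<close> the weights are at least 1, so the
        unweighted block norms are square summable.\<close>
      have "ennreal 1 \<le> ennreal (2 powr (real j * 0) * (1 + real j) powr \<xi>)"
        using \<xi> by (intro ennreal_leI) (simp add: ge_one_powr_ge_zero)
      from mult_right_mono[OF this, of "?n j"]
      show "?n j \<le> ennreal (2 powr (real j * 0) * (1 + real j) powr \<xi>) * ?n j" by simp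
    qed auto
    also have "\<dots> < top" using un unfolding besov_norm_qnorm qnorm_2 by (simp only: epowr_less_top_iff)
    finally show ?thesis .
  qed
  have nfin: "?n j < top" for j
  proof -
    have "sum (\<lambda>j. (?n j)\<^sup>2) {j} \<le> (\<Sum>j. (?n j)\<^sup>2)" by (rule sum_le_suminf) auto
    then have "(?n j)\<^sup>2 < top" using nsum by (simp add: order_le_less_trans)
    then show ?thesis by (simp add: power_less_top_ennreal)
  qed
  have "\<exists>f g. fpair f g \<and> regular_distr f = lp_block \<phi>0 j u \<and> sqint g = (?n j)\<^sup>2" for j
  proof -
    obtain f where f: "f \<in> Lp 2" "regular_distr f = lp_block \<phi>0 j u" using distr_Lp_norm_top_iff[OF nfin] by blast
    obtain g where g: "fpair f g" using fpair_exists[OF f(1)] by blast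
    have "sqint g = (?n j)\<^sup>2"
      using plancherel[OF g] distr_Lp_norm_regular[OF f(1)] f(2) by (metis Lp_norm_2_power2)
    then show ?thesis using f g by blast
  qed
  then obtain F g where F: "\<And>j. fpair (F j) (g j)" "\<And>j. regular_distr (F j) = lp_block \<phi>0 j u"
    "\<And>j. sqint (g j) = (?n j)\<^sup>2" by metis
  have sl: "slow {dyadic \<phi>0 j}" "slow {fat_dyadic \<phi>0 j}" for j
    by (intro slow_schwartz dyadic_schwartz[OF \<phi>0] fat_dyadic_schwartz)+
  have g_test: "(\<integral>x. g j x * \<phi> x \<partial>lborel) = u (fourier (\<lambda>x. dyadic \<phi>0 j x * \<phi> x))" if \<phi>: "\<phi> \<in> schwartz" for j \<phi>
  proof -
    have "(\<integral>x. g j x * \<phi> x \<partial>lborel) = regular_distr (F j) (fourier \<phi>)"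
      using fpair_eq[OF F(1) \<phi>] by (simp add: regular_distr_apply fourier_schwartz \<phi>)
    also have "\<dots> = u (fourier (\<lambda>x. dyadic \<phi>0 j x * inv_fourier (fourier \<phi>) x))"
      unfolding F(2) by (rule lp_block_apply[OF \<phi>0 fourier_schwartz[OF \<phi>]])
    finally show ?thesis by (simp only: fourier_inversion[OF \<phi>])
  qed
  \<comment> \<open>The function \<open>g j\<close> is determined by its pairings only almost
    everywhere. Multiplying by the wider cutoff forces the support condition at every point and, by
    \<open>fat_dyadic_mult\<close>, leaves the pairings unchanged.\<close>
  define a where "a j = (\<lambda>x. fat_dyadic \<phi>0 j x * g j x)" for j
  have gm: "g j \<in> borel_measurable borel" for j using fpair_L2(2)[OF F(1)] by (rule Lp_measurable)
  have fm: "fat_dyadic \<phi>0 j \<in> borel_measurable borel" for j using fat_dyadic_schwartz by (rule schwartz_measurable)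
  have am [measurable]: "a j \<in> borel_measurable borel" for j unfolding a_def using gm fm by measurable
  obtain C where C: "0 \<le> C" "\<And>j x. norm (fat_dyadic \<phi>0 j x) \<le> C" by (rule fat_dyadic_bounded) blast
  have a_sq: "sqint (a j) \<le> ennreal (C\<^sup>2) * (?n j)\<^sup>2" for j
    unfolding a_def F(3)[symmetric] by (rule sqint_bounded_mult[OF C gm])
  have aL: "a j \<in> Lp 2" for j
    unfolding a_def by (rule L2_bounded_mult[OF fm C(2) fpair_L2(2)[OF F(1)]])
  have a_test: "(\<integral>x. a j x * \<phi> x \<partial>lborel) = u (fourier (\<lambda>x. dyadic \<phi>0 j x * \<phi> x))" if \<phi>: "\<phi> \<in> schwartz" for j \<phi>
  proof -
    have "(\<integral>x. a j x * \<phi> x \<partial>lborel) = (\<integral>x. g j x * (fat_dyadic \<phi>0 j x * \<phi> x) \<partial>lborel)" by (simp add: a_def mult_ac)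
    also have "\<dots> = u (fourier (\<lambda>x. dyadic \<phi>0 j x * (fat_dyadic \<phi>0 j x * \<phi> x)))"
      by (rule g_test[OF schwartz_mult[OF sl(2) \<phi>]])
    finally show ?thesis by (simp only: mult.assoc[symmetric] fat_dyadic_mult)
  qed
  have a0: "\<exists>J. finite J \<and> card J \<le> 4 \<and> (\<forall>j. j \<notin> J \<longrightarrow> a j x = 0)" for x
  proof (cases "\<exists>j. fat_dyadic \<phi>0 j x \<noteq> 0")
    case True
    define j where "j = (LEAST j. fat_dyadic \<phi>0 j x \<noteq> 0)"
    have jx: "fat_dyadic \<phi>0 j x \<noteq> 0" unfolding j_def by (rule LeastI_ex[OF True])
    have "a i x = 0" if "i \<notin> {j..j + 3}" for i
    proof (rule ccontr)
      assume "a i x \<noteq> 0"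
      then have i: "fat_dyadic \<phi>0 i x \<noteq> 0" by (auto simp: a_def)
      have "j \<le> i" unfolding j_def by (rule Least_le[of "\<lambda>j. fat_dyadic \<phi>0 j x \<noteq> 0", OF i])
      moreover have "i \<le> j + 3" by (rule fat_dyadic_overlap[OF i jx])
      ultimately show False using that by auto
    qed
    then show ?thesis by (intro exI[of _ "{j..j + 3}"]) simp
  qed (auto simp: a_def intro: exI[of _ "{}"])
  define H where "H x = (\<Sum>j. ennreal ((norm (a j x))\<^sup>2))" for x
  have [measurable]: "H \<in> borel_measurable borel" unfolding H_def[abs_def] by measurable
  have Hint: "(\<integral>\<^sup>+x. H x \<partial>lborel) < top"
  proof -
    have "(\<integral>\<^sup>+x. H x \<partial>lborel) = (\<Sum>j. sqint (a j))"
      unfolding H_def sqint_def by (rule nn_integral_suminf) measurable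
    also have "\<dots> \<le> (\<Sum>j. ennreal (C\<^sup>2) * (?n j)\<^sup>2)" by (intro suminf_le a_sq) auto
    also have "\<dots> = ennreal (C\<^sup>2) * (\<Sum>j. (?n j)\<^sup>2)" by simp
    also have "\<dots> < top" using nsum by (simp add: ennreal_mult_less_top)
    finally show ?thesis .
  qed
  \<comment> \<open>At most four terms are nonzero at a point, so Cauchy-Schwarz gives the factor 4,
    uniformly over all finite index sets.\<close>
  have Hsum: "ennreal ((norm (\<Sum>j\<in>I. a j x))\<^sup>2) \<le> ennreal 4 * H x" if I: "finite I" for I x
  proof -
    obtain J where J: "finite J" "card J \<le> 4" "\<And>j. j \<notin> J \<Longrightarrow> a j x = 0" using a0[of x] by blast
    have "(\<Sum>j\<in>I. a j x) = (\<Sum>j\<in>I \<inter> J. a j x)" using J I by (intro sum.mono_neutral_right) auto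
    then have "(norm (\<Sum>j\<in>I. a j x))\<^sup>2 \<le> (\<Sum>j\<in>I \<inter> J. norm (a j x))\<^sup>2" by (intro power_mono) (auto intro: norm_sum)
    also have "\<dots> \<le> real (card (I \<inter> J)) * (\<Sum>j\<in>I \<inter> J. (norm (a j x))\<^sup>2)"
      using sum_squared_le_sum_of_squares[of "\<lambda>j. norm (a j x)" "I \<inter> J"] by (simp add: mult.commute)
    also have "\<dots> \<le> 4 * (\<Sum>j\<in>I \<inter> J. (norm (a j x))\<^sup>2)"
    proof (rule mult_right_mono)
      have "card (I \<inter> J) \<le> 4" using J card_mono[of J "I \<inter> J"] by auto
      then show "real (card (I \<inter> J)) \<le> 4" by simp
    qed (auto intro: sum_nonneg)
    finally have "ennreal ((norm (\<Sum>j\<in>I. a j x))\<^sup>2) \<le> ennreal (4 * (\<Sum>j\<in>I \<inter> J. (norm (a j x))\<^sup>2))" by (rule ennreal_leI)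
    also have "\<dots> = ennreal 4 * (\<Sum>j\<in>I \<inter> J. ennreal ((norm (a j x))\<^sup>2))"
      by (subst ennreal_mult) (auto intro: sum_nonneg)
    also have "\<dots> \<le> ennreal 4 * H x" unfolding H_def using I by (intro mult_left_mono sum_le_suminf) auto
    finally show ?thesis .
  qed
  define G where "G x = (\<Sum>j. a j x)" for x
  have [measurable]: "G \<in> borel_measurable borel" unfolding G_def[abs_def] by measurable
  have Glim: "(\<lambda>n. \<Sum>j\<le>n. a j x) \<longlonglongrightarrow> G x" for x
  proof -
    obtain J where J: "finite J" "\<And>j. j \<notin> J \<Longrightarrow> a j x = 0" using a0[of x] by blast
    have "summable (\<lambda>j. a j x)" by (rule summable_finite[OF J]) auto
    then show ?thesis unfolding G_def by (rule summable_LIMSEQ')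
  qed
  have GH: "ennreal ((norm (G x))\<^sup>2) \<le> ennreal 4 * H x" for x
  proof -
    obtain J where J: "finite J" "\<And>j. j \<notin> J \<Longrightarrow> a j x = 0" using a0[of x] by blast
    have "G x = (\<Sum>j\<in>J. a j x)" unfolding G_def by (rule suminf_finite[OF J]) auto
    then show ?thesis using Hsum[OF J(1)] by simp
  qed
  have GL: "G \<in> Lp 2"
  proof -
    have "sqint G \<le> (\<integral>\<^sup>+x. ennreal 4 * H x \<partial>lborel)" unfolding sqint_def by (intro nn_integral_mono GH)
    also have "\<dots> = ennreal 4 * (\<integral>\<^sup>+x. H x \<partial>lborel)" by (rule nn_integral_cmult) measurable
    also have "\<dots> < top" using Hint by (simp add: ennreal_mult_less_top)
    finally show ?thesis by (simp add: L2_iff)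
  qed
  have G_test: "(\<integral>x. G x * \<phi> x \<partial>lborel) = u (fourier \<phi>)" if \<phi>: "\<phi> \<in> schwartz" for \<phi>
  proof -
    have [measurable]: "\<phi> \<in> borel_measurable borel" using \<phi> by (rule schwartz_measurable)
    obtain D where D: "0 \<le> D" "\<And>x. norm (\<phi> x) \<le> D" using schwartz_bounded[OF \<phi>] by blast
    have Hae: "AE x in lborel. H x \<noteq> \<infinity>"
      by (rule nn_integral_PInf_AE) (use Hint in auto)
    have "(\<lambda>n. \<integral>x. (\<Sum>j\<le>n. a j x) * \<phi> x \<partial>lborel) \<longlonglongrightarrow> (\<integral>x. G x * \<phi> x \<partial>lborel)"
    proof (rule Bochner_Integration.integral_dominated_convergence[where w = "\<lambda>x. (1 + 4 * enn2real (H x)) * norm (\<phi> x)"])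
      have i1: "integrable lborel (\<lambda>x. enn2real (H x))"
      proof (rule integrableI_bounded)
        have "(\<integral>\<^sup>+x. ennreal (norm (enn2real (H x))) \<partial>lborel) \<le> (\<integral>\<^sup>+x. H x \<partial>lborel)"
          by (intro nn_integral_mono) (simp add: ennreal_enn2real_if)
        then show "(\<integral>\<^sup>+x. ennreal (norm (enn2real (H x))) \<partial>lborel) < \<infinity>" using Hint by (simp add: order_le_less_trans)
      qed measurable
      have "integrable lborel (\<lambda>x. \<phi> x * complex_of_real (enn2real (H x)))"
        by (rule integrable_bounded_mult[OF integrable_of_real[OF i1] _ D(2)]) simp
      from integrable_norm[OF this] have i2: "integrable lborel (\<lambda>x. norm (\<phi> x) * enn2real (H x))"
        by (simp add: norm_mult)
      have "integrable lborel (\<lambda>x. norm (\<phi> x) + 4 * (norm (\<phi> x) * enn2real (H x)))"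
        by (intro Bochner_Integration.integrable_add integrable_mult_right i2 integrable_norm schwartz_integrable \<phi>)
      then show "integrable lborel (\<lambda>x. (1 + 4 * enn2real (H x)) * norm (\<phi> x))"
        by (simp add: algebra_simps)
      show "AE x in lborel. (\<lambda>n. (\<Sum>j\<le>n. a j x) * \<phi> x) \<longlonglongrightarrow> G x * \<phi> x"
        by (intro AE_I2 tendsto_mult tendsto_const Glim)
      show "AE x in lborel. norm ((\<Sum>j\<le>n. a j x) * \<phi> x) \<le> (1 + 4 * enn2real (H x)) * norm (\<phi> x)" for n
        using Hae
      proof eventually_elim
        case (elim x)
        let ?t = "norm (\<Sum>j\<le>n. a j x)"
        obtain h where h: "0 \<le> h" "H x = ennreal h" using elim by (cases "H x") auto
        have "ennreal (?t\<^sup>2) \<le> ennreal (4 * h)" using Hsum[of "{..n}" x] h by (simp add: ennreal_mult)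
        then have "?t\<^sup>2 \<le> 4 * h" using h by simp
        moreover have "?t \<le> 1 + ?t\<^sup>2"
        proof -
          have "y \<le> 1 + y\<^sup>2" if "0 \<le> y" for y :: real
            using that zero_le_power2[of "y - 1"] unfolding power2_diff by simp
          then show ?thesis by simp
        qed
        ultimately have "?t \<le> 1 + 4 * enn2real (H x)" using h by simp
        then show ?case unfolding norm_mult by (rule mult_right_mono) simp
      qed
    qed measurable
    \<comment> \<open>By linearity of \<open>u\<close> the blocks add up, and the dyadic functions
      telescope to a dilated cutoff, to which \<open>tempered_cutoff_tendsto\<close>
      applies.\<close>
    moreover have "(\<integral>x. (\<Sum>j\<le>n. a j x) * \<phi> x \<partial>lborel) = u (fourier (\<lambda>x. \<phi>0 ((1 / 2 ^ n) *\<^sub>R x) * \<phi> x))" for n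
    proof -
      have "(\<integral>x. (\<Sum>j\<le>n. a j x) * \<phi> x \<partial>lborel) = (\<Sum>j\<le>n. \<integral>x. a j x * \<phi> x \<partial>lborel)"
        unfolding sum_distrib_right
        by (rule Bochner_Integration.integral_sum) (rule L2_mult_schwartz[OF aL \<phi>])
      also have "\<dots> = (\<Sum>j\<le>n. u (fourier (\<lambda>x. dyadic \<phi>0 j x * \<phi> x)))" by (simp only: a_test[OF \<phi>])
      also have "\<dots> = u (fourier (\<lambda>x. (\<Sum>j\<le>n. dyadic \<phi>0 j x) * \<phi> x))"
      proof (induction n)
        case (Suc n)
        let ?A = "\<lambda>x. (\<Sum>j\<le>n. dyadic \<phi>0 j x) * \<phi> x" and ?B = "\<lambda>x. dyadic \<phi>0 (Suc n) x * \<phi> x"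
        have A: "?A \<in> schwartz" unfolding sum_distrib_right by (intro schwartz_sum schwartz_mult sl \<phi>)
        have B: "?B \<in> schwartz" by (intro schwartz_mult sl \<phi>)
        have "fourier (\<lambda>x. (\<Sum>j\<le>Suc n. dyadic \<phi>0 j x) * \<phi> x) = (\<lambda>\<xi>. fourier ?A \<xi> + fourier ?B \<xi>)"
          by (simp add: distrib_right fun_eq_iff fourier_add schwartz_integrable A B)
        then show ?case using Suc by (simp add: u_add fourier_schwartz A B)
      qed simp
      finally show ?thesis by (simp only: sum_dyadic)
    qed
    ultimately have "(\<lambda>n. u (fourier (\<lambda>x. \<phi>0 ((1 / 2 ^ n) *\<^sub>R x) * \<phi> x))) \<longlonglongrightarrow> (\<integral>x. G x * \<phi> x \<partial>lborel)" by simp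
    then show ?thesis by (rule LIMSEQ_unique[OF _ tempered_cutoff_tendsto[OF \<phi>0 ut \<phi>]])
  qed
  have G_reg: "regular_distr G = fourier_distr u"
    by (rule regular_distr_eqI) (auto simp: G_test fourier_distr_def)
  obtain f where f: "fpair f G" using fpair_exists_inv[OF GL] by blast
  have "regular_distr f = u"
    using fpair_inv_fourier_distr[OF f] inv_fourier_fourier_distr[OF ue] unfolding G_reg by simp
  then show ?thesis using fpair_L2(1)[OF f] by blast
qed

theorem spaces_eq_hilbert:
  assumes b: "- 1 / 2 < b" and k: "1 \<le> k"
  shows "spaces_eq (diff_besov k b 2 2) (diff_besov_norm k b 2 2)
    (besov \<phi>0 0 (b + 1 / 2) 2 2) (besov_norm \<phi>0 0 (b + 1 / 2) 2 2)"
proof -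
  let ?B = "besov_norm \<phi>0 0 (b + 1 / 2) 2 2" and ?D = "diff_besov_norm k b 2 2 :: ('a \<Rightarrow> complex) \<Rightarrow> ennreal"
  obtain C1 where C1: "0 < C1" "\<And>f g. fpair f g \<Longrightarrow> ?D f \<le> ennreal C1 * ?B (regular_distr f)"
    by (rule diff_le_besov[OF \<phi>0 b k]) blast
  obtain C2 where C2: "0 < C2" "\<And>f g. fpair f g \<Longrightarrow> ?B (regular_distr f) \<le> ennreal C2 * ?D f"
    by (rule besov_le_diff[OF \<phi>0 b]) blast
  have DB: "?D f \<le> ennreal C1 * ?B (regular_distr f)" "?B (regular_distr f) \<le> ennreal C2 * ?D f" if f: "f \<in> Lp 2" for f
  proof -
    obtain g where "fpair f g" using fpair_exists[OF f] by blast
    then show "?D f \<le> ennreal C1 * ?B (regular_distr f)" "?B (regular_distr f) \<le> ennreal C2 * ?D f"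
      using C1(2) C2(2) by blast+
  qed
  have "regular_distr ` diff_besov k b 2 2 = besov \<phi>0 0 (b + 1 / 2) 2 2"
  proof (intro equalityI subsetI)
    fix u assume "u \<in> regular_distr ` (diff_besov k b 2 2 :: ('a \<Rightarrow> complex) set)"
    then obtain f where f: "f \<in> Lp 2" "?D f < top" "u = regular_distr f" by (auto simp: diff_besov_def)
    have "?B u \<le> ennreal C2 * ?D f" using DB(2)[OF f(1)] f(3) by simp
    also have "\<dots> < top" using f(2) by (simp add: ennreal_mult_less_top)
    finally show "u \<in> besov \<phi>0 0 (b + 1 / 2) 2 2" using regular_distr_tempered[OF f(1)] f(3) by (simp add: besov_def)
  next
    fix u assume u: "u \<in> besov \<phi>0 0 (b + 1 / 2) 2 2"
    \<comment> \<open>The lower bound on \<open>b\<close> makes the smoothness index nonnegative, as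
      \<open>besov_imp_L2\<close> demands.\<close>
    have "0 \<le> b + 1 / 2" using b by simp
    from besov_imp_L2[OF this u] obtain f where f: "f \<in> Lp 2" "regular_distr f = u" by blast
    have "?D f \<le> ennreal C1 * ?B u" using DB(1)[OF f(1)] f(2) by simp
    also have "\<dots> < top" using u by (simp add: besov_def ennreal_mult_less_top)
    finally show "u \<in> regular_distr ` diff_besov k b 2 2" using f by (auto simp: diff_besov_def)
  qed
  moreover have "ennreal (1 / C1) * ?D f \<le> ?B (regular_distr f)" if f: "f \<in> Lp 2" for f
  proof -
    have "ennreal (1 / C1) * ?D f \<le> ennreal (1 / C1) * (ennreal C1 * ?B (regular_distr f))"
      by (intro mult_left_mono DB f) auto
    also have "\<dots> = (ennreal (1 / C1) * ennreal C1) * ?B (regular_distr f)" by (simp only: mult.assoc)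
    also have "ennreal (1 / C1) * ennreal C1 = 1" using C1 by (subst ennreal_mult[symmetric]) auto
    finally show ?thesis by simp
  qed
  ultimately show ?thesis unfolding spaces_eq_def using C1(1) C2(1) DB(2)
    by (intro conjI exI[of _ "1 / C1"] exI[of _ C2]) (auto simp: diff_besov_def)
qed

end

subsection \<open>Packets of frequency-localised waves\<close>

lemma fourier_translate:
  assumes [measurable]: "f \<in> borel_measurable borel"
  shows "fourier (\<lambda>x. f (x - y)) \<xi> = cis (- (y \<bullet> \<xi>)) * fourier f \<xi>"
proof -
  have "(\<integral>x. cis (- (x \<bullet> \<xi>)) * f (x - y) \<partial>lborel) = (\<integral>x. cis (- ((x + y) \<bullet> \<xi>)) * f x \<partial>lborel)"
    using lborel_integral_translate[of "\<lambda>x. cis (- (x \<bullet> \<xi>)) * f (x - y)" y] by simp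
  also have "\<dots> = (\<integral>x. cis (- (y \<bullet> \<xi>)) * (cis (- (x \<bullet> \<xi>)) * f x) \<partial>lborel)"
    by (rule Bochner_Integration.integral_cong) (simp_all add: inner_add_left cis_mult add.commute flip: mult.assoc)
  finally show ?thesis by (simp add: fourier_def)
qed

text \<open>The radius 2 is that of the support of \<open>\<phi>0\<close>. The spectrum is required
  to vanish on an open set, which makes the notion stable under differentiation of the
  transform.\<close>

definition bandlimited :: "('a::euclidean_space \<Rightarrow> complex) \<Rightarrow> bool" where
  "bandlimited G \<longleftrightarrow> G \<in> schwartz \<and> (\<forall>\<eta>. 2 < norm \<eta> \<longrightarrow> fourier G \<eta> = 0)"

lemma bandlimited_schwartz: "bandlimited G \<Longrightarrow> G \<in> schwartz"
  by (simp add: bandlimited_def)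

lemma bandlimited_translate: "bandlimited G \<Longrightarrow> bandlimited (\<lambda>x. G (x - y))"
  using schwartz_translate[of G "- y"]
  by (auto simp: bandlimited_def fourier_translate schwartz_measurable)

lemma bandlimited_cmult: "bandlimited G \<Longrightarrow> bandlimited (\<lambda>x. c * G x)"
  by (simp add: bandlimited_def schwartz_cmult fourier_cmult)

lemma bandlimited_sum: "(\<And>i. i \<in> I \<Longrightarrow> bandlimited (G i)) \<Longrightarrow> bandlimited (\<lambda>x. \<Sum>i\<in>I. G i x)"
  by (simp add: bandlimited_def schwartz_sum fourier_sum schwartz_integrable)

lemma bandlimited_add: "bandlimited G \<Longrightarrow> bandlimited H \<Longrightarrow> bandlimited (\<lambda>x. G x + H x)"
  by (simp add: bandlimited_def schwartz_add fourier_add schwartz_integrable)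

text \<open>Multiplication by a coordinate is differentiation of the transform, and a function that
  vanishes on an open set has zero derivative there.\<close>

lemma bandlimited_mult_inner:
  assumes G: "bandlimited G"
  shows "bandlimited (\<lambda>x. of_real (x \<bullet> b) * G x)"
proof -
  note Gs = bandlimited_schwartz[OF G]
  have "fourier (\<lambda>x. - \<i> * of_real (x \<bullet> b) * G x) \<eta> = 0" if \<eta>: "2 < norm \<eta>" for \<eta>
  proof -
    have "open {\<eta>::'a. 2 < norm \<eta>}" by (intro open_Collect_less continuous_intros)
    then have "(fourier G has_derivative (\<lambda>v. 0)) (at \<eta>)"
      by (rule has_derivative_transform_within_open[OF has_derivative_const[of 0]])
        (use G \<eta> in \<open>auto simp: bandlimited_def\<close>)
    then show ?thesis by (simp only: partial_deriv_fourier[OF Gs, symmetric] partial_deriv_eq)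
  qed
  then have "bandlimited (\<lambda>x. - \<i> * of_real (x \<bullet> b) * G x)"
    by (simp only: bandlimited_def schwartz_mult_inner[OF Gs] simp_thms) simp
  from bandlimited_cmult[OF this, of \<i>] show ?thesis by (simp flip: mult.assoc)
qed

text \<open>A polynomial weight is used because, unlike powers of 1 + norm x, it leaves the spectrum
  in the same ball. It expands into squares of coordinates.\<close>

lemma bandlimited_weight:
  assumes G: "bandlimited G"
  shows "bandlimited (\<lambda>x::'a::euclidean_space. of_real ((1 + x \<bullet> x) ^ K) * G x)"
proof (induction K)
  case (Suc K)
  let ?H = "\<lambda>x::'a. of_real ((1 + x \<bullet> x) ^ K) * G x"
  have "bandlimited (\<lambda>x. ?H x + (\<Sum>b\<in>Basis. of_real (x \<bullet> b) * (of_real (x \<bullet> b) * ?H x)))"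
    by (intro bandlimited_add bandlimited_sum bandlimited_mult_inner Suc)
  moreover have "?H x + (\<Sum>b\<in>Basis. of_real (x \<bullet> b) * (of_real (x \<bullet> b) * ?H x)) = of_real ((1 + x \<bullet> x) ^ Suc K) * G x" for x
  proof -
    have "(\<Sum>b\<in>Basis. of_real (x \<bullet> b) * (of_real (x \<bullet> b) * ?H x)) = of_real (\<Sum>b\<in>Basis. (x \<bullet> b) * (x \<bullet> b)) * ?H x"
      by (simp add: sum_distrib_right mult.assoc)
    also have "(\<Sum>b\<in>Basis. (x \<bullet> b) * (x \<bullet> b)) = x \<bullet> x" by (rule euclidean_inner[symmetric])
    finally show ?thesis by (simp add: algebra_simps)
  qed
  ultimately show ?case by simp
qed (use G in simp)

text \<open>
  The ball of radius 2 about a vector of length \<open>lam N i\<close> lies in a single dyadic annulus, and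
  \<open>lam N i\<close> is an odd multiple of \<open>2 ^ N\<close>.
\<close>

definition lam :: "nat \<Rightarrow> nat \<Rightarrow> real" where
  "lam N i = 2 ^ N * (3 * 2 ^ (2 * i + 1) + 1)"

lemma lam_bounds:
  assumes "2 \<le> N"
  shows "2 ^ (N + 2 * i + 2) < lam N i - 2" "lam N i + 2 < 2 ^ (N + 2 * i + 3)" "1 \<le> lam N i"
proof -
  have "(2::real) ^ 2 \<le> 2 ^ N" using assms by (intro power_increasing) auto
  then have N: "4 \<le> (2::real) ^ N" by simp
  have i: "1 \<le> (2::real) ^ (2 * i)" by (rule one_le_power) simp
  have "(2::real) ^ N * 1 \<le> 2 ^ N * 2 ^ (2 * i)" by (intro mult_left_mono i) simp
  then have "(2::real) ^ N \<le> 2 ^ (N + 2 * i)" by (simp add: power_add)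
  moreover have "lam N i = 6 * 2 ^ (N + 2 * i) + 2 ^ N" by (simp add: lam_def power_add algebra_simps)
  moreover have "2 ^ (N + 2 * i + 2) = (4::real) * 2 ^ (N + 2 * i)" "2 ^ (N + 2 * i + 3) = (8::real) * 2 ^ (N + 2 * i)"
    by (simp_all add: power_add)
  ultimately show "2 ^ (N + 2 * i + 2) < lam N i - 2" "lam N i + 2 < 2 ^ (N + 2 * i + 3)" "1 \<le> lam N i"
    using N by linarith+
qed

text \<open>The envelopes are a parameter so that orthogonality applies both to a packet and to the
  same packet multiplied by a weight.\<close>

definition packet :: "'a::euclidean_space \<Rightarrow> nat \<Rightarrow> nat \<Rightarrow> (nat \<Rightarrow> 'a \<Rightarrow> complex) \<Rightarrow> 'a \<Rightarrow> complex" where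
  "packet e N m G x = (\<Sum>i<m. cis (lam N i * (x \<bullet> e)) * G i x)"

lemma packet_schwartz: "(\<And>i. G i \<in> schwartz) \<Longrightarrow> packet e N m G \<in> schwartz"
  unfolding packet_def[abs_def] by (intro schwartz_sum schwartz_mult_cis)

lemma fourier_wave: "fourier (\<lambda>x. cis (l * (x \<bullet> e)) * G x) \<xi> = fourier G (\<xi> - l *\<^sub>R e)"
  using fourier_modulate[of "l *\<^sub>R e" G \<xi>] by simp

lemma fourier_packet:
  "(\<And>i. G i \<in> schwartz) \<Longrightarrow> fourier (packet e N m G) \<xi> = (\<Sum>i<m. fourier (G i) (\<xi> - lam N i *\<^sub>R e))"
  unfolding packet_def[abs_def]
  by (subst fourier_sum) (simp_all add: fourier_wave schwartz_integrable schwartz_mult_cis)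

lemma wave_support:
  assumes e: "norm e = 1" and G: "bandlimited G" and N: "2 \<le> N"
    and nz: "fourier G (\<xi> - lam N i *\<^sub>R e) \<noteq> 0"
  shows "2 ^ (N + 2 * i + 2) < norm \<xi>" "norm \<xi> < 2 ^ (N + 2 * i + 3)"
proof -
  have n: "norm (\<xi> - lam N i *\<^sub>R e) \<le> 2" using G nz unfolding bandlimited_def by (meson not_le)
  have "norm (lam N i *\<^sub>R e) = lam N i" using e lam_bounds(3)[OF N, of i] by simp
  then have "\<bar>norm \<xi> - lam N i\<bar> \<le> 2" using n norm_triangle_ineq3[of \<xi> "lam N i *\<^sub>R e"] by linarith
  then show "2 ^ (N + 2 * i + 2) < norm \<xi>" "norm \<xi> < 2 ^ (N + 2 * i + 3)"
    using lam_bounds[OF N, of i] by linarith+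
qed

lemma annulus_unique:
  assumes "2 ^ (N + 2 * i + 2) < (r::real)" "r < 2 ^ (N + 2 * j + 3)"
  shows "i \<le> j"
proof -
  have "(2::real) ^ (N + 2 * i + 2) < 2 ^ (N + 2 * j + 3)" using assms by linarith
  then have "N + 2 * i + 2 < N + 2 * j + 3" by (rule power_less_imp_less_exp[rotated]) simp
  then show ?thesis by linarith
qed

text \<open>The modulated envelopes have transforms in disjoint annuli, so all mixed terms vanish
  after Parseval, whatever the envelopes are.\<close>

lemma packet_orthogonal:
  assumes e: "norm e = 1" and G: "\<And>i. bandlimited (G i)" and N: "2 \<le> N"
  shows "(\<integral>x. packet e N m G x * cnj (packet e N m G x) \<partial>lborel) = (\<Sum>i<m. \<integral>x. G i x * cnj (G i x) \<partial>lborel)"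
proof -
  let ?F = "\<lambda>i \<xi>. fourier (G i) (\<xi> - lam N i *\<^sub>R e)"
  note Gs = bandlimited_schwartz[OF G]
  have W: "(\<lambda>x. cis (lam N i * (x \<bullet> e)) * G i x) \<in> schwartz" for i by (rule schwartz_mult_cis[OF Gs])
  have FW: "?F i = fourier (\<lambda>x. cis (lam N i * (x \<bullet> e)) * G i x)" for i by (rule ext) (rule fourier_wave[symmetric])
  have one: "(\<integral>\<xi>. ?F i \<xi> * cnj (?F i \<xi>) \<partial>lborel) = (\<integral>x. G i x * cnj (G i x) \<partial>lborel)" for i
  proof -
    have c: "(cis t * z) * cnj (cis t * z) = z * cnj z" for t z
      by (simp only: complex_norm_square[symmetric] norm_mult norm_cis mult_1)
    have "(\<integral>x. G i x * cnj (G i x) \<partial>lborel) =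
        (\<integral>x. (cis (lam N i * (x \<bullet> e)) * G i x) * cnj (cis (lam N i * (x \<bullet> e)) * G i x) \<partial>lborel)"
      by (rule Bochner_Integration.integral_cong[OF refl c[symmetric]])
    also note parseval[OF W W, symmetric]
    finally show ?thesis by (simp only: fourier_wave)
  qed
  have int: "integrable lborel (\<lambda>\<xi>. ?F i \<xi> * cnj (?F i \<xi>))" for i
  proof -
    have "?F i \<in> schwartz" unfolding FW by (rule fourier_schwartz[OF W])
    then show ?thesis by (intro schwartz_integrable schwartz_mult[OF slow_schwartz] schwartz_cnj)
  qed
  have dis: "?F i \<xi> * cnj (?F j \<xi>) = 0" if "i \<noteq> j" for i j \<xi>
  proof (rule ccontr)
    assume "\<not> ?thesis"
    then have "?F i \<xi> \<noteq> 0" "?F j \<xi> \<noteq> 0" by auto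
    from wave_support[OF e G N this(1)] wave_support[OF e G N this(2)]
    have "i \<le> j" "j \<le> i" using annulus_unique by blast+
    then show False using that by simp
  qed
  have "(\<integral>x. packet e N m G x * cnj (packet e N m G x) \<partial>lborel) =
      (\<integral>\<xi>. (\<Sum>i<m. ?F i \<xi>) * cnj (\<Sum>i<m. ?F i \<xi>) \<partial>lborel)"
    unfolding parseval[OF packet_schwartz[OF Gs] packet_schwartz[OF Gs], symmetric] fourier_packet[OF Gs] ..
  also have "(\<lambda>\<xi>. (\<Sum>i<m. ?F i \<xi>) * cnj (\<Sum>i<m. ?F i \<xi>)) = (\<lambda>\<xi>. \<Sum>i<m. ?F i \<xi> * cnj (?F i \<xi>))"
  proof
    fix \<xi>
    have "(\<Sum>i<m. ?F i \<xi>) * cnj (\<Sum>i<m. ?F i \<xi>) = (\<Sum>i<m. \<Sum>j<m. ?F i \<xi> * cnj (?F j \<xi>))"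
      by (simp only: cnj_sum sum_product)
    also have "\<dots> = (\<Sum>i<m. \<Sum>j<m. if i = j then ?F i \<xi> * cnj (?F i \<xi>) else 0)"
      by (intro sum.cong refl) (use dis in auto)
    finally show "(\<Sum>i<m. ?F i \<xi>) * cnj (\<Sum>i<m. ?F i \<xi>) = (\<Sum>i<m. ?F i \<xi> * cnj (?F i \<xi>))" by simp
  qed
  also have "(\<integral>\<xi>. (\<Sum>i<m. ?F i \<xi> * cnj (?F i \<xi>)) \<partial>lborel) = (\<Sum>i<m. \<integral>x. G i x * cnj (G i x) \<partial>lborel)"
    using int by (simp add: one)
  finally show ?thesis .
qed

lemma schwartz_square_integrable:
  assumes f: "f \<in> schwartz" shows "integrable lborel (\<lambda>x. (norm (f x))\<^sup>2)"
proof -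
  have "integrable lborel (\<lambda>x. norm (f x * cnj (f x)))"
    by (intro integrable_norm schwartz_integrable schwartz_mult[OF slow_schwartz] schwartz_cnj f)
  then show ?thesis by (simp add: norm_mult power2_eq_square)
qed

lemma packet_sqint:
  assumes "norm e = 1" "\<And>i. bandlimited (G i)" "2 \<le> N"
    and G: "\<And>i. (\<integral>x. (norm (G i x))\<^sup>2 \<partial>lborel) = \<kappa>"
  shows "(\<integral>\<^sup>+x. ennreal ((norm (packet e N m G x))\<^sup>2) \<partial>lborel) = ennreal (real m * \<kappa>)"
    "(\<integral>x. packet e N m G x * cnj (packet e N m G x) \<partial>lborel) = of_real (real m * \<kappa>)"
proof -
  have sq: "(\<integral>x. h x * cnj (h x) \<partial>lborel) = of_real (\<integral>x. (norm (h x))\<^sup>2 \<partial>lborel)" for h :: "'a \<Rightarrow> complex"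
    by (simp add: complex_norm_square[symmetric] del: of_real_power)
  let ?f = "packet e N m G"
  show f: "(\<integral>x. ?f x * cnj (?f x) \<partial>lborel) = of_real (real m * \<kappa>)"
    unfolding packet_orthogonal[OF assms(1-3)] sq[of "G _"] G by simp
  then have "(\<integral>x. (norm (?f x))\<^sup>2 \<partial>lborel) = real m * \<kappa>" unfolding sq by (simp only: of_real_eq_iff)
  moreover have "integrable lborel (\<lambda>x. (norm (?f x))\<^sup>2)"
    by (intro schwartz_square_integrable packet_schwartz bandlimited_schwartz assms(2))
  ultimately show "(\<integral>\<^sup>+x. ennreal ((norm (?f x))\<^sup>2) \<partial>lborel) = ennreal (real m * \<kappa>)"
    by (simp add: nn_integral_eq_integral)
qed

subsection \<open>Lebesgue norms of packets\<close>

lemma Lp_norm_leI: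
  assumes "0 < p" "0 \<le> A" "(\<integral>\<^sup>+x. ennreal (norm (f x) powr p) \<partial>lborel) \<le> ennreal A"
  shows "Lp_norm p f \<le> ennreal (A powr (1 / p))"
  using assms by (subst Lp_norm_le_iff) (auto simp: powr_powr)

text \<open>Since all envelopes coincide, the polynomial weight \<open>w\<close> can be pulled into
  them, and orthogonality computes the L_2 norm of w f as well. For \<open>r \<le> 2\<close> this
  weighted L_2 bound controls the L_r norm, as \<open>w\<close> grows fast enough to be integrable
  when inverted.\<close>

lemma packet_centered_upper:
  fixes e :: "'a::euclidean_space"
  assumes e: "norm e = 1" and g: "bandlimited g" and r: "1 \<le> r" "r \<le> 2"
  obtains C where "0 < C" "\<And>N m. 2 \<le> N \<Longrightarrow> 1 \<le> m \<Longrightarrow> Lp_norm r (packet e N m (\<lambda>i. g)) \<le> ennreal (C * real m powr (1 / 2))"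
proof -
  define w :: "'a \<Rightarrow> real" where "w = (\<lambda>x. (1 + x \<bullet> x) ^ DIM('a))"
  define G where "G = (\<lambda>x. of_real (w x) * g x)"
  have G: "bandlimited G" unfolding G_def w_def by (rule bandlimited_weight[OF g])
  define \<kappa> where "\<kappa> = (\<integral>x. (norm (G x))\<^sup>2 \<partial>lborel)"
  have \<kappa>: "0 \<le> \<kappa>" unfolding \<kappa>_def by (rule Bochner_Integration.integral_nonneg) simp
  let ?v = "\<lambda>x::'a. 1 / (1 + norm x) ^ (2 * DIM('a))"
  define I where "I = (\<integral>x. ?v x \<partial>lborel)"
  have I: "0 \<le> I" unfolding I_def by (rule Bochner_Integration.integral_nonneg) (simp add: one_plus_norm_pos less_imp_le)
  define D where "D = (2::real) ^ DIM('a)"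
  have D: "0 < D" by (simp add: D_def)
  have w1: "1 \<le> w x" for x unfolding w_def by (rule one_le_power) simp
  have wv: "w x powr (- r) \<le> D * ?v x" for x
  proof -
    have "w x powr (- r) \<le> w x powr (- 1)" using w1 r by (intro powr_mono) auto
    also have "\<dots> = 1 / w x" using w1[of x] by (simp add: powr_minus divide_inverse)
    also have "\<dots> \<le> D * ?v x"
    proof -
      have "(1 + norm x)\<^sup>2 \<le> 2 * (1 + x \<bullet> x)"
        using zero_le_power2[of "1 - norm x"] by (simp add: power2_norm_eq_inner[symmetric] power2_eq_square algebra_simps)
      then have "((1 + norm x)\<^sup>2) ^ DIM('a) \<le> (2 * (1 + x \<bullet> x)) ^ DIM('a)" by (rule power_mono) simp
      then have "(1 + norm x) ^ (2 * DIM('a)) \<le> D * w x" by (simp only: D_def w_def power_mult power_mult_distrib)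
      then show ?thesis using w1[of x] one_plus_norm_pos[of x] by (simp add: field_simps)
    qed
    finally show ?thesis .
  qed
  have main: "Lp_norm r (packet e N m (\<lambda>i. g)) \<le> ennreal ((\<kappa> + D * I + 1) powr (1 / r) * real m powr (1 / 2))"
    if N: "2 \<le> N" and m: "1 \<le> m" for N m
  proof -
    define f where "f = packet e N m (\<lambda>i. g)"
    have fs: "f \<in> schwartz" unfolding f_def by (rule packet_schwartz) (rule bandlimited_schwartz[OF g])
    note [measurable] = schwartz_measurable[OF fs]
    \<comment> \<open>The expected size of the packet; with this choice both parts of the splitting
      below contribute t powr r.\<close>
    define t where "t = real m powr (1 / 2)"
    have t: "0 < t" using m by (simp add: t_def)
    have t2: "t powr (r - 2) * real m = t powr r"
    proof -
      have "t powr 2 = real m" using m by (simp add: t_def powr_powr)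
      then have "t powr (r - 2) * real m = t powr (r - 2) * t powr 2" by simp
      then show ?thesis by (simp flip: powr_add)
    qed
    have fG: "packet e N m (\<lambda>i. G) x = of_real (w x) * f x" for x
      by (simp add: f_def packet_def G_def sum_distrib_left mult_ac)
    \<comment> \<open>Where |f| \<le> t / w the decay of \<open>w\<close> alone suffices. Elsewhere
      the nonpositive power r - 2 of |f| is at most that of t / w, which leaves the square of w
      f.\<close>
    have pt: "norm (f x) powr r \<le> t powr (r - 2) * (norm (packet e N m (\<lambda>i. G) x))\<^sup>2 + t powr r * (D * ?v x)" for x
    proof (cases "norm (f x) \<le> t / w x")
      case True
      have "norm (f x) powr r \<le> (t / w x) powr r" using True r by (intro powr_mono2) auto
      also have "\<dots> = t powr r / w x powr r" using w1[of x] t by (simp add: powr_divide)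
      also have "\<dots> = t powr r * w x powr (- r)" by (simp only: powr_minus divide_inverse)
      also have "\<dots> \<le> t powr r * (D * ?v x)" by (intro mult_left_mono wv) auto
      finally show ?thesis by (simp add: add_increasing)
    next
      case False
      have wp: "0 < w x" using w1[of x] by linarith
      then have tw: "0 < t / w x" using t by simp
      then have f0: "0 < norm (f x)" using False by linarith
      have "norm (f x) powr r = norm (f x) powr (r - 2) * (norm (f x))\<^sup>2"
        using powr_add[of "norm (f x)" "r - 2" 2] f0 by (simp add: powr_2_norm)
      also have "\<dots> \<le> (t / w x) powr (r - 2) * (norm (f x))\<^sup>2"
        using False tw r by (intro mult_right_mono powr_mono2') auto
      also have "(t / w x) powr (r - 2) = t powr (r - 2) * w x powr (2 - r)"
        using wp t by (simp add: powr_divide powr_diff)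
      also have "\<dots> \<le> t powr (r - 2) * w x powr 2" using w1 r by (intro mult_left_mono powr_mono) auto
      also have "w x powr 2 = (w x)\<^sup>2" using wp by simp
      finally have "norm (f x) powr r \<le> t powr (r - 2) * (w x)\<^sup>2 * (norm (f x))\<^sup>2" by (simp add: mult_right_mono)
      also have "\<dots> = t powr (r - 2) * (norm (packet e N m (\<lambda>i. G) x))\<^sup>2"
        using wp by (simp add: fG norm_mult power_mult_distrib)
      finally show ?thesis using D t one_plus_norm_pos[of x] by (intro add_increasing2) auto
    qed
    have Gm: "packet e N m (\<lambda>i. G) \<in> borel_measurable borel"
      by (rule schwartz_measurable) (rule packet_schwartz, rule bandlimited_schwartz[OF G])
    note [measurable] = Gm
    have "(\<integral>\<^sup>+x. ennreal (norm (f x) powr r) \<partial>lborel) \<le>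
        (\<integral>\<^sup>+x. ennreal (t powr (r - 2)) * ennreal ((norm (packet e N m (\<lambda>i. G) x))\<^sup>2) + ennreal (t powr r * D) * ennreal (?v x) \<partial>lborel)"
    proof (rule nn_integral_mono)
      fix x
      have "ennreal (norm (f x) powr r) \<le> ennreal (t powr (r - 2) * (norm (packet e N m (\<lambda>i. G) x))\<^sup>2 + t powr r * (D * ?v x))"
        by (rule ennreal_leI[OF pt])
      also have "\<dots> = ennreal (t powr (r - 2)) * ennreal ((norm (packet e N m (\<lambda>i. G) x))\<^sup>2) + ennreal (t powr r * D) * ennreal (?v x)"
        using D one_plus_norm_pos[of x] by (subst ennreal_plus) (auto simp: ennreal_mult[symmetric] mult.assoc)
      finally show "ennreal (norm (f x) powr r) \<le> \<dots>" .
    qed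
    also have "\<dots> = ennreal (t powr (r - 2)) * ennreal (real m * \<kappa>) + ennreal (t powr r * D) * ennreal I"
    proof -
      have "(\<integral>\<^sup>+x. ennreal (?v x) \<partial>lborel) = ennreal I"
        unfolding I_def by (rule nn_integral_eq_integral[OF integrable_decay]) (auto simp: one_plus_norm_pos less_imp_le)
      moreover have "(\<integral>\<^sup>+x. ennreal ((norm (packet e N m (\<lambda>i. G) x))\<^sup>2) \<partial>lborel) = ennreal (real m * \<kappa>)"
        by (rule packet_sqint(1)[OF e G N]) (simp add: \<kappa>_def)
      ultimately show ?thesis by (simp add: nn_integral_add nn_integral_cmult)
    qed
    also have "\<dots> = ennreal (t powr r * (\<kappa> + D * I))"
    proof -
      have "ennreal (t powr (r - 2)) * ennreal (real m * \<kappa>) = ennreal (t powr r * \<kappa>)"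
        using \<kappa> by (simp add: ennreal_mult[symmetric] t2[symmetric] mult.assoc)
      then show ?thesis using \<kappa> I D by (simp add: ennreal_mult[symmetric] ennreal_plus[symmetric] algebra_simps del: ennreal_plus)
    qed
    also have "\<dots> \<le> ennreal (t powr r * (\<kappa> + D * I + 1))" by (intro ennreal_leI mult_left_mono) auto
    finally have "Lp_norm r f \<le> ennreal ((t powr r * (\<kappa> + D * I + 1)) powr (1 / r))"
      using r \<kappa> I D by (intro Lp_norm_leI) auto
    also have "(t powr r * (\<kappa> + D * I + 1)) powr (1 / r) = (\<kappa> + D * I + 1) powr (1 / r) * t"
      using r t \<kappa> I D by (simp add: powr_mult powr_powr)
    finally show ?thesis unfolding f_def t_def .
  qed
  have "0 < \<kappa> + D * I + 1" using \<kappa> I D by (simp add: add_nonneg_pos)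
  then have "0 < (\<kappa> + D * I + 1) powr (1 / r)" by simp
  then show ?thesis using main that by blast
qed

text \<open>Each term is at most twice an increment of arctan over a unit interval, by the mean
  value theorem; the increments telescope. The bound is uniform in \<open>t\<close> and
  \<open>m\<close>.\<close>

lemma sum_inverse_square_le: "(\<Sum>i<m. 1 / (1 + \<bar>t - real i\<bar>)\<^sup>2) \<le> 2 * pi"
proof -
  have "1 / (1 + \<bar>s\<bar>)\<^sup>2 \<le> 2 * (arctan s - arctan (s - 1))" for s
  proof -
    obtain z where z: "s - 1 < z" "z < s" "arctan s - arctan (s - 1) = (s - (s - 1)) * inverse (1 + z\<^sup>2)"
      using MVT2[of "s - 1" s arctan "\<lambda>x. inverse (1 + x\<^sup>2)"] DERIV_arctan by auto
    have "\<bar>z\<bar> \<le> 1 + \<bar>s\<bar>" using z by linarith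
    then have "z\<^sup>2 \<le> (1 + \<bar>s\<bar>)\<^sup>2" by (simp add: abs_le_square_iff[symmetric])
    moreover have "1 \<le> (1 + \<bar>s\<bar>)\<^sup>2" by (rule one_le_power) simp
    ultimately have "1 + z\<^sup>2 \<le> 2 * (1 + \<bar>s\<bar>)\<^sup>2" by linarith
    moreover have "0 < 1 + z\<^sup>2" by (simp add: add_pos_nonneg)
    ultimately have "1 / (2 * (1 + \<bar>s\<bar>)\<^sup>2) \<le> 1 / (1 + z\<^sup>2)" by (intro divide_left_mono mult_pos_pos) auto
    then show ?thesis using z(3) by (simp add: inverse_eq_divide)
  qed
  then have "(\<Sum>i<m. 1 / (1 + \<bar>t - real i\<bar>)\<^sup>2) \<le> (\<Sum>i<m. 2 * (arctan (t - real i) - arctan (t - real i - 1)))"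
    by (intro sum_mono)
  also have "\<dots> = 2 * (arctan t - arctan (t - real m))"
    by (induction m) (simp_all add: algebra_simps)
  also have "\<dots> \<le> 2 * pi" using arctan_ubound[of t] arctan_lbound[of "t - real m"] by simp
  finally show ?thesis .
qed

text \<open>Projected to the direction \<open>e\<close>, the centres are the integers, so the
  absolute values of the translates add up to at most a constant \<open>B\<close> everywhere. Hence
  |f|^r is at most B powr (r - 1) times their sum, and the integral grows linearly in
  \<open>m\<close>.\<close>

lemma packet_spread_upper:
  fixes e :: "'a::euclidean_space"
  assumes e: "norm e = 1" and g: "g \<in> schwartz" and r: "1 \<le> r"
  obtains C where "0 < C" "\<And>N m. Lp_norm r (packet e N m (\<lambda>i x. g (x - real i *\<^sub>R e))) \<le> ennreal (C * real m powr (1 / r))"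
proof -
  obtain C0 where C0: "0 \<le> C0" "\<And>x. norm (g x) \<le> C0 / (1 + norm x) ^ 2" by (rule schwartz_decay[OF g]) blast
  define B where "B = C0 * (2 * pi)"
  have B: "0 \<le> B" using C0 by (simp add: B_def)
  note gm [measurable] = schwartz_measurable[OF g]
  define I where "I = (\<integral>x. norm (g x) \<partial>lborel)"
  have I: "0 \<le> I" unfolding I_def by (rule Bochner_Integration.integral_nonneg) simp
  have Sb: "(\<Sum>i<m. norm (g (x - real i *\<^sub>R e))) \<le> B" for m x
  proof -
    have "norm (g (x - real i *\<^sub>R e)) \<le> C0 * (1 / (1 + \<bar>x \<bullet> e - real i\<bar>)\<^sup>2)" for i
    proof -
      have "(x - real i *\<^sub>R e) \<bullet> e = x \<bullet> e - real i" using e by (simp add: inner_diff_left norm_eq_1)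
      then have "\<bar>x \<bullet> e - real i\<bar> \<le> norm (x - real i *\<^sub>R e)"
        using Cauchy_Schwarz_ineq2[of "x - real i *\<^sub>R e" e] e by simp
      then have "(1 + \<bar>x \<bullet> e - real i\<bar>)\<^sup>2 \<le> (1 + norm (x - real i *\<^sub>R e))\<^sup>2" by (intro power_mono) auto
      then have "C0 / (1 + norm (x - real i *\<^sub>R e))\<^sup>2 \<le> C0 / (1 + \<bar>x \<bullet> e - real i\<bar>)\<^sup>2"
        using C0(1) one_plus_norm_pos[of "x - real i *\<^sub>R e"] by (intro divide_left_mono mult_pos_pos) auto
      then show ?thesis using C0(2)[of "x - real i *\<^sub>R e"] by simp
    qed
    then have "(\<Sum>i<m. norm (g (x - real i *\<^sub>R e))) \<le> C0 * (\<Sum>i<m. 1 / (1 + \<bar>x \<bullet> e - real i\<bar>)\<^sup>2)"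
      unfolding sum_distrib_left by (intro sum_mono)
    also have "\<dots> \<le> B" unfolding B_def by (intro mult_left_mono sum_inverse_square_le C0)
    finally show ?thesis .
  qed
  have "Lp_norm r (packet e N m (\<lambda>i x. g (x - real i *\<^sub>R e))) \<le> ennreal ((B powr (r - 1) * I + 1) powr (1 / r) * real m powr (1 / r))" for N m
  proof -
    let ?f = "packet e N m (\<lambda>i x. g (x - real i *\<^sub>R e))" and ?S = "\<lambda>x. \<Sum>i<m. norm (g (x - real i *\<^sub>R e))"
    have pt: "norm (?f x) powr r \<le> B powr (r - 1) * ?S x" for x
    proof -
      have S0: "0 \<le> ?S x" by (intro sum_nonneg) simp
      have "norm (?f x) \<le> ?S x" unfolding packet_def by (rule order_trans[OF norm_sum]) (simp add: norm_mult)
      then have "norm (?f x) powr r \<le> ?S x powr r" using r by (intro powr_mono2) auto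
      also have "\<dots> = ?S x powr (r - 1) * ?S x"
        using S0 by (cases "?S x = 0") (simp_all add: powr_diff)
      also have "\<dots> \<le> B powr (r - 1) * ?S x" using r S0 Sb by (intro mult_right_mono powr_mono2) auto
      finally show ?thesis .
    qed
    have gI: "(\<integral>\<^sup>+x. ennreal (norm (g (x - real i *\<^sub>R e))) \<partial>lborel) = ennreal I" for i
      using lborel_nn_integral_translate[of "\<lambda>x. ennreal (norm (g x))" "- (real i *\<^sub>R e)"]
        nn_integral_eq_integral[OF integrable_norm[OF schwartz_integrable[OF g]]]
      by (simp add: I_def)
    have "(\<integral>\<^sup>+x. ennreal (norm (?f x) powr r) \<partial>lborel) \<le> (\<integral>\<^sup>+x. ennreal (B powr (r - 1)) * (\<Sum>i<m. ennreal (norm (g (x - real i *\<^sub>R e)))) \<partial>lborel)"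
      by (intro nn_integral_mono order_trans[OF ennreal_leI[OF pt]]) (simp add: ennreal_mult sum_nonneg)
    also have "\<dots> = ennreal (B powr (r - 1)) * (\<Sum>i<m. \<integral>\<^sup>+x. ennreal (norm (g (x - real i *\<^sub>R e))) \<partial>lborel)"
      by (subst nn_integral_cmult) (simp_all add: nn_integral_sum del: sum_ennreal)
    also have "\<dots> = ennreal (B powr (r - 1)) * (\<Sum>i<m. ennreal I)" by (simp only: gI)
    also have "\<dots> \<le> ennreal ((B powr (r - 1) * I + 1) * real m)"
      using I by (simp add: ennreal_of_nat_eq_real_of_nat ennreal_mult[symmetric] algebra_simps)
    finally have "Lp_norm r ?f \<le> ennreal (((B powr (r - 1) * I + 1) * real m) powr (1 / r))"
      using r I by (intro Lp_norm_leI) auto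
    then show ?thesis using I by (simp add: powr_mult)
  qed
  moreover have "0 < B powr (r - 1) * I + 1" using I by (simp add: add_nonneg_pos)
  then have "0 < (B powr (r - 1) * I + 1) powr (1 / r)" by simp
  ultimately show ?thesis using that by blast
qed

text \<open>The packet is paired with its own conjugate: the pairing is the energy m \<kappa>, and
  Hoelder compares it with the product of the norms for conjugate exponents.\<close>

lemma packet_lower:
  fixes e :: "'a::euclidean_space"
  assumes e: "norm e = 1" and G: "\<And>i. bandlimited (G i)" and N: "2 \<le> N"
    and \<kappa>: "\<And>i. (\<integral>x. (norm (G i x))\<^sup>2 \<partial>lborel) = \<kappa>" "0 \<le> \<kappa>"
    and p: "1 < p" "1 < p'" "1 / p + 1 / p' = 1"
    and B: "0 < B" "Lp_norm p' (packet e N m G) \<le> ennreal B"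
  shows "ennreal (real m * \<kappa> / B) \<le> Lp_norm p (packet e N m G)"
proof (cases "Lp_norm p (packet e N m G)")
  case (real A)
  let ?f = "packet e N m G"
  have fs: "?f \<in> schwartz" by (rule packet_schwartz) (rule bandlimited_schwartz[OF G])
  note [measurable] = schwartz_measurable[OF fs]
  have "norm (\<integral>x. ?f x * cnj (?f x) \<partial>lborel) \<le> A * B"
    by (rule hoelder_integral(2)[OF p real(1)]) (use real B in \<open>simp_all add: Lp_norm_def\<close>)
  then have "real m * \<kappa> \<le> A * B" unfolding packet_sqint(2)[OF e G N \<kappa>(1)] norm_of_real using \<kappa>(2) by simp
  then have "real m * \<kappa> / B \<le> A" using B(1) by (simp add: pos_divide_le_eq)
  then show ?thesis unfolding real(2) by (rule ennreal_leI)
qed simp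

subsection \<open>Besov norms of packets\<close>

lemma distr_Lp_norm_regular_le:
  assumes "1 \<le> p" "f \<in> schwartz"
  shows "distr_Lp_norm p (regular_distr f) \<le> Lp_norm p f"
  unfolding distr_Lp_norm_def by (rule INF_lower) (simp add: schwartz_Lp assms)

text \<open>Hoelder bounds the norm of every representing function from below by the same number,
  which therefore bounds the infimum; if there is none, the infimum is infinite.\<close>

lemma distr_Lp_norm_dual:
  assumes p: "1 < p" "1 < p'" "1 / p + 1 / p' = 1" and \<phi>: "\<phi> \<in> schwartz"
    and B: "0 < B" "Lp_norm p' \<phi> \<le> ennreal B"
  shows "ennreal (norm (u \<phi>) / B) \<le> distr_Lp_norm p u"
  unfolding distr_Lp_norm_def
proof (rule INF_greatest)
  fix f assume "f \<in> {f \<in> Lp p. regular_distr f = u}"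
  then have f: "f \<in> Lp p" "regular_distr f = u" by auto
  note [measurable] = Lp_measurable[OF f(1)] schwartz_measurable[OF \<phi>]
  obtain A where A: "0 \<le> A" "Lp_norm p f = ennreal A" using Lp_finite[OF f(1)] by (cases "Lp_norm p f") auto
  have "norm (\<integral>x. f x * \<phi> x \<partial>lborel) \<le> A * B"
    by (rule hoelder_integral(2)[OF p A(1)]) (use A B in simp_all)
  moreover have "u \<phi> = (\<integral>x. f x * \<phi> x \<partial>lborel)" by (simp only: f(2)[symmetric] regular_distr_apply[OF \<phi>])
  ultimately have "norm (u \<phi>) / B \<le> A" using B(1) by (simp add: pos_divide_le_eq)
  then show "ennreal (norm (u \<phi>) / B) \<le> Lp_norm p f" unfolding A(2) by (rule ennreal_leI)
qed

lemma pointwise_op_mem: "f \<in> A \<Longrightarrow> g \<in> B \<Longrightarrow> (\<lambda>x. F (f x) (g x)) \<in> {\<lambda>x. F (f x) (g x) |f g. f \<in> A \<and> g \<in> B}"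
  by blast

lemma Lp_norm_wave: "Lp_norm p (\<lambda>x. cis (l * (x \<bullet> e)) * G x) = Lp_norm p G"
  by (simp add: Lp_norm_def norm_mult)

text \<open>Applied to 1 + j for block indices j \<le> 3 N + 1, which is at most 4 N for N \<ge> 2.
  Taking absolute values of \<open>\<xi>\<close> treats both signs alike.\<close>

lemma powr_weight_comparable:
  assumes N: "0 < N" and j: "N \<le> j" "j \<le> 4 * (N::real)"
  shows "4 powr (- \<bar>\<xi>\<bar>) * N powr \<xi> \<le> j powr \<xi>" "j powr \<xi> \<le> 4 powr \<bar>\<xi>\<bar> * N powr \<xi>"
proof -
  define s where "s = j / N"
  have s: "1 \<le> s" "s \<le> 4" using N j by (auto simp: s_def field_simps)
  have j': "j powr \<xi> = s powr \<xi> * N powr \<xi>" using N s by (simp add: s_def flip: powr_mult)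
  have "s powr \<xi> \<le> s powr \<bar>\<xi>\<bar>" "s powr (- \<bar>\<xi>\<bar>) \<le> s powr \<xi>" using s by (auto intro!: powr_mono)
  moreover have "s powr \<bar>\<xi>\<bar> \<le> 4 powr \<bar>\<xi>\<bar>" by (rule powr_mono2) (use s in auto)
  moreover have "4 powr (- \<bar>\<xi>\<bar>) \<le> s powr (- \<bar>\<xi>\<bar>)" by (rule powr_mono2') (use s in auto)
  ultimately have "4 powr (- \<bar>\<xi>\<bar>) \<le> s powr \<xi>" "s powr \<xi> \<le> 4 powr \<bar>\<xi>\<bar>" by linarith+
  then show "4 powr (- \<bar>\<xi>\<bar>) * N powr \<xi> \<le> j powr \<xi>" "j powr \<xi> \<le> 4 powr \<bar>\<xi>\<bar> * N powr \<xi>"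
    unfolding j' by (auto intro!: mult_right_mono)
qed

section \<open>Dyadic blocks of packets of translated bumps\<close>

context
  fixes \<phi>0 :: "'a::euclidean_space \<Rightarrow> complex"
  assumes \<phi>0: "lp_cutoff \<phi>0"
begin

text \<open>For Schwartz \<open>f\<close> the multiplication formula moves the distributional
  transforms back onto functions, so that recognising a block reduces to an identity between Fourier
  transforms.\<close>

lemma lp_block_regular:
  assumes f: "f \<in> schwartz" and R: "R \<in> schwartz" "\<And>\<xi>. fourier R \<xi> = dyadic \<phi>0 j \<xi> * fourier f \<xi>"
  shows "lp_block \<phi>0 j (regular_distr f) = regular_distr R"
proof (rule extensionalityI[of _ schwartz])
  show "lp_block \<phi>0 j (regular_distr f) \<in> extensional schwartz" by (simp add: lp_block_def inv_fourier_distr_def)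
  show "regular_distr R \<in> extensional schwartz" by (simp add: regular_distr_def)
  fix \<phi> :: "'a \<Rightarrow> complex" assume \<phi>: "\<phi> \<in> schwartz"
  define \<psi> where "\<psi> = (\<lambda>x. dyadic \<phi>0 j x * inv_fourier \<phi> x)"
  have \<psi>: "\<psi> \<in> schwartz"
    unfolding \<psi>_def by (intro schwartz_mult slow_schwartz dyadic_schwartz[OF \<phi>0] inv_fourier_schwartz \<phi>)
  have "lp_block \<phi>0 j (regular_distr f) \<phi> = (\<integral>x. f x * fourier \<psi> x \<partial>lborel)"
    by (simp add: lp_block_apply[OF \<phi>0 \<phi>] \<psi>_def[symmetric] regular_distr_apply fourier_schwartz \<psi>)
  also have "\<dots> = (\<integral>x. fourier f x * \<psi> x \<partial>lborel)"
    by (rule fourier_mult_formula) (simp_all add: schwartz_integrable f \<psi>)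
  also have "\<dots> = (\<integral>x. fourier R x * inv_fourier \<phi> x \<partial>lborel)" by (simp add: \<psi>_def R(2) mult_ac)
  also have "\<dots> = (\<integral>x. R x * fourier (inv_fourier \<phi>) x \<partial>lborel)"
    by (rule fourier_mult_formula[symmetric]) (simp_all add: schwartz_integrable R inv_fourier_schwartz \<phi>)
  also have "\<dots> = regular_distr R \<phi>" by (simp add: fourier_inversion'[OF \<phi>] regular_distr_apply[OF \<phi>])
  finally show "lp_block \<phi>0 j (regular_distr f) \<phi> = regular_distr R \<phi>" .
qed

lemma bandlimited_inv_cutoff: "bandlimited (inv_fourier \<phi>0)"
  by (simp add: bandlimited_def inv_fourier_schwartz fourier_inversion' cutoff_schwartz[OF \<phi>0] cutoff_eq_0[OF \<phi>0])

text \<open>If the energy were zero, the function would vanish almost everywhere and so would its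
  transform at 0, where \<open>\<phi>0\<close> equals 1.\<close>

lemma inv_cutoff_energy_pos: "0 < (\<integral>x. (norm (inv_fourier \<phi>0 x))\<^sup>2 \<partial>lborel)"
proof -
  let ?g = "inv_fourier \<phi>0"
  have gs: "?g \<in> schwartz" by (rule inv_fourier_schwartz[OF cutoff_schwartz[OF \<phi>0]])
  note int = schwartz_square_integrable[OF gs]
  have "(\<integral>x. (norm (?g x))\<^sup>2 \<partial>lborel) \<noteq> 0"
  proof
    assume "(\<integral>x. (norm (?g x))\<^sup>2 \<partial>lborel) = 0"
    then have "AE x in lborel. ?g x = 0"
      using integral_nonneg_eq_0_iff_AE[OF int] by simp
    then have "(\<integral>x. cis (- (x \<bullet> 0)) * ?g x \<partial>lborel) = 0" by (intro integral_eq_zero_AE) auto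
    then have "fourier ?g 0 = 0" by (simp add: fourier_def)
    then show False
      by (simp add: fourier_inversion'[OF cutoff_schwartz[OF \<phi>0]] cutoff_eq_1[OF \<phi>0])
  qed
  moreover have "0 \<le> (\<integral>x. (norm (?g x))\<^sup>2 \<partial>lborel)" by (rule Bochner_Integration.integral_nonneg) simp
  ultimately show ?thesis by linarith
qed

definition bump :: "'a \<Rightarrow> 'a \<Rightarrow> complex" where
  "bump y x = inv_fourier \<phi>0 (x - y)"

lemma bump_bandlimited: "bandlimited (bump y)"
  unfolding bump_def[abs_def] by (rule bandlimited_translate[OF bandlimited_inv_cutoff])

lemma fourier_bump: "fourier (bump y) \<xi> = cis (- (y \<bullet> \<xi>)) * \<phi>0 \<xi>"
  unfolding bump_def[abs_def]
  by (subst fourier_translate)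
    (simp_all add: schwartz_measurable inv_fourier_schwartz fourier_inversion' cutoff_schwartz[OF \<phi>0])

lemma Lp_norm_bump: "Lp_norm p (bump y) = Lp_norm p (inv_fourier \<phi>0)"
  unfolding bump_def[abs_def]
  using Lp_norm_translate[of "inv_fourier \<phi>0" p "- y"]
  by (simp add: schwartz_measurable inv_fourier_schwartz cutoff_schwartz[OF \<phi>0])

lemma bump_energy: "(\<integral>x. (norm (bump y x))\<^sup>2 \<partial>lborel) = (\<integral>x. (norm (inv_fourier \<phi>0 x))\<^sup>2 \<partial>lborel)"
proof -
  have [measurable]: "inv_fourier \<phi>0 \<in> borel_measurable borel"
    by (intro schwartz_measurable inv_fourier_schwartz cutoff_schwartz[OF \<phi>0])
  show ?thesis unfolding bump_def
    using lborel_integral_translate[of "\<lambda>x. (norm (inv_fourier \<phi>0 x))\<^sup>2" "- y"] by simp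
qed

lemma shifted_dyadic_schwartz: "(\<lambda>\<eta>. dyadic \<phi>0 j (\<eta> + h) * \<phi>0 \<eta>) \<in> schwartz"
  by (intro schwartz_mult slow_schwartz schwartz_translate dyadic_schwartz[OF \<phi>0] cutoff_schwartz[OF \<phi>0])

context
  fixes e :: 'a
  assumes e: "norm e = 1"
begin

text \<open>The i-th wave lives strictly between the radii 2 ^ s and 2 ^ (s + 1) with s = N + 2 i +
  2, and only the dyadic functions with indices s and s + 1 reach into that annulus. Advancing by
  two indices per wave keeps the pairs of different waves disjoint.\<close>

lemma dyadic_wave:
  assumes G: "bandlimited G" and N: "2 \<le> N"
    and nz: "dyadic \<phi>0 j \<xi> \<noteq> 0" "fourier G (\<xi> - lam N i *\<^sub>R e) \<noteq> 0"
  shows "j = N + 2 * i + 2 \<or> j = N + 2 * i + 3"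
proof -
  note s = wave_support[OF e G N nz(2)]
  have "norm \<xi> \<le> 2 ^ (j + 1)" using dyadic_eq_0_high[OF \<phi>0, of j \<xi>] nz(1) by (meson not_le)
  then have "(2::real) ^ (N + 2 * i + 2) < 2 ^ (j + 1)" using s(1) by linarith
  then have l: "N + 2 * i + 2 < j + 1" by (rule power_less_imp_less_exp[rotated]) simp
  then obtain k where k: "j = Suc k" by (cases j) auto
  have "2 ^ k < norm \<xi>" using dyadic_eq_0_low[OF \<phi>0, of \<xi> k] nz(1) k by (meson not_le)
  then have "(2::real) ^ k < 2 ^ (N + 2 * i + 3)" using s(2) by linarith
  then have "k < N + 2 * i + 3" by (rule power_less_imp_less_exp[rotated]) simp
  then show ?thesis using l k by linarith
qed

text \<open>On the annulus of the wave the partial sum up to the larger index is a dilated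
  \<open>\<phi>0\<close> at a point of norm at most 1, and only the last two summands
  survive.\<close>

lemma dyadic_wave_sum:
  assumes G: "bandlimited G" and N: "2 \<le> N"
  shows "(dyadic \<phi>0 (N + 2 * i + 2) \<xi> + dyadic \<phi>0 (N + 2 * i + 3) \<xi>) * fourier G (\<xi> - lam N i *\<^sub>R e) =
    fourier G (\<xi> - lam N i *\<^sub>R e)"
proof (cases "fourier G (\<xi> - lam N i *\<^sub>R e) = 0")
  case False
  let ?s = "N + 2 * i + 2"
  have s1: "?s + 1 = N + 2 * i + 3" by simp
  have n: "norm \<xi> < 2 ^ (?s + 1)" unfolding s1 by (rule wave_support(2)[OF e G N False])
  have "(\<Sum>j\<le>?s + 1. dyadic \<phi>0 j \<xi>) = (\<Sum>j\<in>{?s, ?s + 1}. dyadic \<phi>0 j \<xi>)"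
    by (rule sum.mono_neutral_right) (use dyadic_wave[OF G N _ False] in force)+
  also have "\<dots> = dyadic \<phi>0 (N + 2 * i + 2) \<xi> + dyadic \<phi>0 (N + 2 * i + 3) \<xi>"
    by (simp add: numeral_3_eq_3)
  also have "(\<Sum>j\<le>?s + 1. dyadic \<phi>0 j \<xi>) = 1"
    unfolding sum_dyadic using n by (intro cutoff_eq_1[OF \<phi>0]) (simp add: divide_le_eq)
  finally show ?thesis by simp
qed simp

text \<open>The j-th block of the i-th wave. Writing it as a modulation of an inverse transform
  centred at the origin shows that its L_p norm sees the frequency only through the shift of the
  dyadic symbol.\<close>

definition piece :: "nat \<Rightarrow> nat \<Rightarrow> nat \<Rightarrow> 'a \<Rightarrow> 'a \<Rightarrow> complex" where
  "piece N i j y x = cis (lam N i * (x \<bullet> e)) *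
     inv_fourier (\<lambda>\<eta>. dyadic \<phi>0 j (\<eta> + lam N i *\<^sub>R e) * \<phi>0 \<eta>) (x - y)"

lemma piece_schwartz: "piece N i j y \<in> schwartz"
  unfolding piece_def[abs_def] diff_conv_add_uminus[of _ y]
  by (intro schwartz_mult_cis schwartz_translate inv_fourier_schwartz shifted_dyadic_schwartz)

lemma fourier_piece:
  "fourier (piece N i j y) \<xi> = dyadic \<phi>0 j \<xi> * fourier (bump y) (\<xi> - lam N i *\<^sub>R e)"
  unfolding piece_def[abs_def] fourier_wave
  by (subst fourier_translate)
    (simp_all add: schwartz_measurable inv_fourier_schwartz fourier_inversion' shifted_dyadic_schwartz fourier_bump)

text \<open>For positive \<open>j\<close> the shifted dyadic symbol is a difference of two copies of
  \<open>\<phi>0\<close>, dilated by at most 1 and arbitrarily shifted. Such differences form one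
  slow family, so their products with \<open>\<phi>0\<close> lie in one bounded set of Schwartz
  functions, and so do the inverse transforms.\<close>

lemma Lp_norm_piece_bound:
  assumes p: "1 \<le> p"
  obtains C where "0 < C" "\<And>N i j y. 0 < j \<Longrightarrow> Lp_norm p (piece N i j y) \<le> ennreal C"
proof -
  let ?A = "{\<lambda>x. \<phi>0 (s *\<^sub>R x + y) |s y. \<bar>s\<bar> \<le> 1}"
  let ?M = "{\<lambda>x. f x * g x |f g. f \<in> {\<lambda>x. - 1} \<and> g \<in> ?A}"
  let ?P = "{\<lambda>x. f x + g x |f g. f \<in> ?A \<and> g \<in> ?M}"
  have A: "slow ?A" by (rule slow_scaled_schwartz[OF cutoff_schwartz[OF \<phi>0]])
  have P: "slow ?P" by (intro slow_add slow_mult A slow_const)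
  have S: "sbdd {\<lambda>x. f x * g x |f g. f \<in> ?P \<and> g \<in> {\<phi>0}}" (is "sbdd ?B")
    using cutoff_schwartz[OF \<phi>0] by (intro sbdd_mult P) (simp add: schwartz_iff)
  obtain C where C: "0 \<le> C" "\<And>f. f \<in> inv_fourier ` ?B \<Longrightarrow> Lp_norm p f \<le> ennreal C"
    by (rule sbdd_Lp_bound[OF p sbdd_inv_fourier[OF S]]) blast
  have "Lp_norm p (piece N i j y) \<le> ennreal (C + 1)" if j: "0 < j" for N i j y
  proof -
    obtain k where k: "j = Suc k" using j by (cases j) auto
    let ?h = "lam N i *\<^sub>R e" and ?f = "\<lambda>n x. \<phi>0 ((1 / 2 ^ n) *\<^sub>R x + (1 / 2 ^ n) *\<^sub>R (lam N i *\<^sub>R e))"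
    let ?V = "\<lambda>\<eta>. dyadic \<phi>0 j (\<eta> + ?h) * \<phi>0 \<eta>"
    have fA: "?f n \<in> ?A" for n
    proof -
      \<comment> \<open>The dilation is admissible; the shift, which contains the large frequency,
        is unrestricted.\<close>
      have "\<bar>1 / 2 ^ n :: real\<bar> \<le> 1" by (simp add: one_le_power)
      then show ?thesis by blast
    qed
    have "(\<lambda>x. (- 1) * ?f k x) \<in> ?M" by (rule pointwise_op_mem[OF singletonI fA])
    from pointwise_op_mem[OF fA[of "Suc k"] this]
    have "(\<lambda>x. ?f (Suc k) x + (- 1) * ?f k x) \<in> ?P" .
    from pointwise_op_mem[OF this singletonI]
    have "(\<lambda>x. (?f (Suc k) x + (- 1) * ?f k x) * \<phi>0 x) \<in> ?B" .
    moreover have "?V = (\<lambda>x. (?f (Suc k) x + (- 1) * ?f k x) * \<phi>0 x)"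
      unfolding k dyadic_Suc by (simp only: scaleR_add_right) simp
    ultimately have "inv_fourier ?V \<in> inv_fourier ` ?B" by (simp only: imageI)
    from C(2)[OF this] have V: "Lp_norm p (inv_fourier ?V) \<le> ennreal C" .
    have "Lp_norm p (piece N i j y) = Lp_norm p (\<lambda>x. inv_fourier ?V (x - y))"
      unfolding piece_def[abs_def] by (rule Lp_norm_wave)
    also have "\<dots> = Lp_norm p (inv_fourier ?V)"
      using Lp_norm_translate[of "inv_fourier ?V" p "- y"]
      by (simp add: schwartz_measurable inv_fourier_schwartz shifted_dyadic_schwartz)
    also have "\<dots> \<le> ennreal (C + 1)" by (rule order_trans[OF V]) (simp add: ennreal_leI)
    finally show ?thesis .
  qed
  then show ?thesis using C(1) that[of "C + 1"] by simp
qed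

private abbreviation bumps where
  "bumps N m y \<equiv> packet e N m (\<lambda>i. bump (y i))"

lemma packet_bump_schwartz: "bumps N m y \<in> schwartz"
  by (rule packet_schwartz) (rule bandlimited_schwartz[OF bump_bandlimited])

lemma fourier_packet_bump:
  "fourier (bumps N m y) \<xi> = (\<Sum>i<m. fourier (bump (y i)) (\<xi> - lam N i *\<^sub>R e))"
  by (rule fourier_packet) (rule bandlimited_schwartz[OF bump_bandlimited])

lemma packet_block_eq:
  assumes N: "2 \<le> N" and i: "i < m" and j: "j = N + 2 * i + 2 \<or> j = N + 2 * i + 3"
  shows "lp_block \<phi>0 j (regular_distr (bumps N m y)) = regular_distr (piece N i j (y i))"
proof (rule lp_block_regular[OF packet_bump_schwartz piece_schwartz])
  fix \<xi>
  let ?F = "\<lambda>i. fourier (bump (y i)) (\<xi> - lam N i *\<^sub>R e)"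
  have "dyadic \<phi>0 j \<xi> * ?F l = 0" if "l \<noteq> i" for l
  proof (rule ccontr)
    assume "dyadic \<phi>0 j \<xi> * ?F l \<noteq> 0"
    then have "dyadic \<phi>0 j \<xi> \<noteq> 0" "?F l \<noteq> 0" by auto
    from dyadic_wave[OF bump_bandlimited N this] j show False using that by presburger
  qed
  then have "(\<Sum>l<m. dyadic \<phi>0 j \<xi> * ?F l) = (\<Sum>l\<in>{i}. dyadic \<phi>0 j \<xi> * ?F l)"
    using i by (intro sum.mono_neutral_right) auto
  then show "fourier (piece N i j (y i)) \<xi> = dyadic \<phi>0 j \<xi> * fourier (bumps N m y) \<xi>"
    unfolding fourier_packet_bump fourier_piece sum_distrib_left by simp
qed

lemma packet_block_0:
  assumes N: "2 \<le> N" and j: "j \<notin> {N + 2..<N + 2 * m + 2}" and p: "1 \<le> p"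
  shows "distr_Lp_norm p (lp_block \<phi>0 j (regular_distr (bumps N m y))) = 0"
proof -
  have "lp_block \<phi>0 j (regular_distr (bumps N m y)) = regular_distr (\<lambda>x. 0)"
  proof (rule lp_block_regular[OF packet_bump_schwartz schwartz_zero])
    fix \<xi>
    let ?F = "\<lambda>i. fourier (bump (y i)) (\<xi> - lam N i *\<^sub>R e)"
    have "dyadic \<phi>0 j \<xi> * ?F l = 0" if "l < m" for l
    proof (rule ccontr)
      assume "dyadic \<phi>0 j \<xi> * ?F l \<noteq> 0"
      then have "dyadic \<phi>0 j \<xi> \<noteq> 0" "?F l \<noteq> 0" by auto
      from dyadic_wave[OF bump_bandlimited N this] j show False using that by auto
    qed
    then have "(\<Sum>l<m. dyadic \<phi>0 j \<xi> * ?F l) = 0" by (intro sum.neutral) simp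
    moreover have "fourier (\<lambda>x::'a. 0) \<xi> = 0" by (simp add: fourier_def)
    ultimately show "fourier (\<lambda>x. 0) \<xi> = dyadic \<phi>0 j \<xi> * fourier (bumps N m y) \<xi>"
      unfolding fourier_packet_bump sum_distrib_left by (simp only:)
  qed
  then have "distr_Lp_norm p (lp_block \<phi>0 j (regular_distr (bumps N m y))) \<le> Lp_norm p (\<lambda>x::'a. 0)"
    using distr_Lp_norm_regular_le[OF p schwartz_zero] by simp
  then show ?thesis using p by (simp add: Lp_norm_def)
qed

text \<open>The two blocks met by a wave sum to the wave, and the pairing of the wave with its
  conjugate is the energy \<kappa>. Hence one of the two pairings is at least \<kappa> / 2 in
  modulus, and duality turns it into a lower bound for that block. Which of the two it is depends on
  \<open>\<phi>0\<close>, so only existence is claimed.\<close>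

lemma packet_block_lower:
  assumes p: "1 < p"
  obtains c where "0 < c" "\<And>N m i y. 2 \<le> N \<Longrightarrow> i < m \<Longrightarrow> \<exists>j. (j = N + 2 * i + 2 \<or> j = N + 2 * i + 3) \<and>
    ennreal c \<le> distr_Lp_norm p (lp_block \<phi>0 j (regular_distr (bumps N m y)))"
proof -
  define p' where "p' = p / (p - 1)"
  have pp: "1 < p" "1 < p'" "1 / p + 1 / p' = 1" using p by (auto simp: p'_def field_simps)
  have gs: "inv_fourier \<phi>0 \<in> schwartz" by (rule inv_fourier_schwartz[OF cutoff_schwartz[OF \<phi>0]])
  have p1: "1 \<le> p'" using pp by simp
  obtain B0 where B0: "0 \<le> B0" "Lp_norm p' (inv_fourier \<phi>0) = ennreal B0"
    using Lp_finite[OF schwartz_Lp[OF p1 gs]] by (cases "Lp_norm p' (inv_fourier \<phi>0)") auto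
  define B where "B = B0 + 1"
  have B: "0 < B" "Lp_norm p' (inv_fourier \<phi>0) \<le> ennreal B" using B0 by (auto simp: B_def intro!: ennreal_leI)
  define \<kappa> where "\<kappa> = (\<integral>x. (norm (inv_fourier \<phi>0 x))\<^sup>2 \<partial>lborel)"
  have \<kappa>: "0 < \<kappa>" unfolding \<kappa>_def by (rule inv_cutoff_energy_pos)
  show ?thesis
  proof
    show "0 < \<kappa> / 2 / B" using \<kappa> B by simp
    fix N m i :: nat and y :: "nat \<Rightarrow> 'a" assume N: "2 \<le> N" and i: "i < m"
    let ?s = "N + 2 * i + 2" and ?t = "N + 2 * i + 3"
    let ?u = "\<lambda>j. lp_block \<phi>0 j (regular_distr (bumps N m y))"
    define E where "E = (\<lambda>x. cis (lam N i * (x \<bullet> e)) * bump (y i) x)"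
    have Es: "E \<in> schwartz" unfolding E_def by (rule schwartz_mult_cis[OF bandlimited_schwartz[OF bump_bandlimited]])
    let ?\<phi> = "\<lambda>x. cnj (E x)"
    have \<phi>: "?\<phi> \<in> schwartz" by (rule schwartz_cnj[OF Es])
    have \<phi>B: "Lp_norm p' ?\<phi> \<le> ennreal B"
    proof -
      have "Lp_norm p' ?\<phi> = Lp_norm p' E" by (simp add: Lp_norm_def)
      also have "\<dots> = Lp_norm p' (inv_fourier \<phi>0)" unfolding E_def Lp_norm_wave Lp_norm_bump ..
      finally show ?thesis using B by simp
    qed
    have sum: "(\<lambda>x. piece N i ?s (y i) x + piece N i ?t (y i) x) = E" (is "?S = E")
    proof -
      have S: "?S \<in> schwartz" by (intro schwartz_add piece_schwartz)
      have "fourier ?S \<xi> = fourier E \<xi>" for \<xi>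
      proof -
        have "fourier ?S \<xi> = (dyadic \<phi>0 ?s \<xi> + dyadic \<phi>0 ?t \<xi>) * fourier (bump (y i)) (\<xi> - lam N i *\<^sub>R e)"
          by (subst fourier_add) (simp_all add: schwartz_integrable piece_schwartz fourier_piece distrib_right)
        also have "\<dots> = fourier E \<xi>" unfolding dyadic_wave_sum[OF bump_bandlimited N] E_def fourier_wave ..
        finally show ?thesis .
      qed
      \<comment> \<open>Equality is checked on the Fourier side and transported back by
        inversion.\<close>
      then have "inv_fourier (fourier ?S) = inv_fourier (fourier E)" by presburger
      then show ?thesis by (simp only: fourier_inversion[OF S] fourier_inversion[OF Es])
    qed
    have ua: "?u j ?\<phi> = (\<integral>x. piece N i j (y i) x * ?\<phi> x \<partial>lborel)" if "j = ?s \<or> j = ?t" for j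
      by (simp only: packet_block_eq[OF N i that] regular_distr_apply[OF \<phi>])
    have int: "integrable lborel (\<lambda>x. piece N i j (y i) x * ?\<phi> x)" for j
      by (intro schwartz_integrable schwartz_mult slow_schwartz piece_schwartz \<phi>)
    have "?u ?s ?\<phi> + ?u ?t ?\<phi> = (\<integral>x. piece N i ?s (y i) x * ?\<phi> x + piece N i ?t (y i) x * ?\<phi> x \<partial>lborel)"
      using ua[of ?s] ua[of ?t] Bochner_Integration.integral_add[OF int int] by simp
    also have "\<dots> = (\<integral>x. E x * cnj (E x) \<partial>lborel)"
      by (rule Bochner_Integration.integral_cong[OF refl])
        (use sum in \<open>auto simp: fun_eq_iff distrib_right[symmetric]\<close>)
    also have "\<dots> = of_real (\<integral>x. (norm (E x))\<^sup>2 \<partial>lborel)"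
      by (simp add: complex_norm_square[symmetric] del: of_real_power)
    also have "(\<integral>x. (norm (E x))\<^sup>2 \<partial>lborel) = \<kappa>"
      using bump_energy[of "y i"] by (simp add: E_def norm_mult \<kappa>_def)
    finally have "norm (?u ?s ?\<phi> + ?u ?t ?\<phi>) = \<kappa>" using \<kappa> by simp
    then have "\<kappa> / 2 \<le> norm (?u ?s ?\<phi>) \<or> \<kappa> / 2 \<le> norm (?u ?t ?\<phi>)"
      using norm_triangle_ineq[of "?u ?s ?\<phi>" "?u ?t ?\<phi>"] by linarith
    then obtain j where j: "j = ?s \<or> j = ?t" "\<kappa> / 2 \<le> norm (?u j ?\<phi>)" by blast
    have "ennreal (\<kappa> / 2 / B) \<le> ennreal (norm (?u j ?\<phi>) / B)"
      using j(2) B by (intro ennreal_leI divide_right_mono) auto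
    also have "\<dots> \<le> distr_Lp_norm p (?u j)" by (rule distr_Lp_norm_dual[OF pp \<phi> B(1) \<phi>B])
    finally show "\<exists>j. (j = ?s \<or> j = ?t) \<and> ennreal (\<kappa> / 2 / B) \<le> distr_Lp_norm p (?u j)" using j(1) by blast
  qed
qed

text \<open>Every wave has at least one block bounded below and meets two blocks bounded above, so m
  and 2 m blocks count respectively, all with weights comparable to \<open>N powr \<xi>\<close>
  since \<open>m \<le> N\<close>. The constants do not depend on the translations
  \<open>y\<close>.\<close>

lemma packet_besov_bounds:
  assumes p: "1 < p" and q: "0 < q"
  obtains c C where "0 < c" "0 < C"
    "\<And>N m y. 2 \<le> N \<Longrightarrow> 1 \<le> m \<Longrightarrow> m \<le> N \<Longrightarrow>
      ennreal (c * (real N powr \<xi> * real m powr rq q)) \<le>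
        besov_norm \<phi>0 0 \<xi> p q (regular_distr (bumps N m y))"
    "\<And>N m y. 2 \<le> N \<Longrightarrow> 1 \<le> m \<Longrightarrow> m \<le> N \<Longrightarrow>
      besov_norm \<phi>0 0 \<xi> p q (regular_distr (bumps N m y)) \<le>
        ennreal (C * (real N powr \<xi> * real m powr rq q))"
proof -
  obtain c where c: "0 < c" "\<And>N m i y. 2 \<le> N \<Longrightarrow> i < m \<Longrightarrow> \<exists>j. (j = N + 2 * i + 2 \<or> j = N + 2 * i + 3) \<and>
    ennreal c \<le> distr_Lp_norm p (lp_block \<phi>0 j (regular_distr (bumps N m y)))"
    by (rule packet_block_lower[OF p]) blast
  have p1: "1 \<le> p" using p by simp
  obtain C where C: "0 < C" "\<And>N i j y. 0 < j \<Longrightarrow> Lp_norm p (piece N i j y) \<le> ennreal C"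
    by (rule Lp_norm_piece_bound[OF p1]) blast
  have w: "4 powr (- \<bar>\<xi>\<bar>) * real N powr \<xi> \<le> (1 + real j) powr \<xi>" "(1 + real j) powr \<xi> \<le> 4 powr \<bar>\<xi>\<bar> * real N powr \<xi>"
    if "2 \<le> N" "m \<le> N" "j \<in> {N + 2..<N + 2 * m + 2}" for N m j :: nat
    using powr_weight_comparable[of "real N" "1 + real j" \<xi>] that by auto
  show ?thesis
  proof
    show "0 < c * 4 powr (- \<bar>\<xi>\<bar>)" "0 < C * 4 powr \<bar>\<xi>\<bar> * 2 powr rq q" using c C by auto
    fix N m :: nat and y :: "nat \<Rightarrow> 'a" assume N: "2 \<le> N" and m: "1 \<le> m" "m \<le> N"
    let ?u = "\<lambda>j. distr_Lp_norm p (lp_block \<phi>0 j (regular_distr (bumps N m y)))"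
    have bn: "besov_norm \<phi>0 0 \<xi> p q (regular_distr (bumps N m y)) =
        qnorm q (\<lambda>j. ennreal ((1 + real j) powr \<xi>) * ?u j)"
      by (simp add: besov_norm_qnorm)
    from c(2)[OF N] have "\<forall>i. \<exists>j. i < m \<longrightarrow> (j = N + 2 * i + 2 \<or> j = N + 2 * i + 3) \<and> ennreal c \<le> ?u j" by blast
    then obtain t where t: "\<And>i. i < m \<Longrightarrow> (t i = N + 2 * i + 2 \<or> t i = N + 2 * i + 3) \<and> ennreal c \<le> ?u (t i)"
      by metis
    \<comment> \<open>The chosen indices are distinct for different waves, so there are exactly
      \<open>m\<close> of them.\<close>
    have inj: "inj_on t {..<m}"
    proof (rule inj_onI)
      fix i i' assume i: "i \<in> {..<m}" "i' \<in> {..<m}" and eq: "t i = t i'"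
      have "t i = N + 2 * i + 2 \<or> t i = N + 2 * i + 3" "t i' = N + 2 * i' + 2 \<or> t i' = N + 2 * i' + 3"
        using t i by simp_all
      then show "i = i'" using eq by presburger
    qed
    have "ennreal (4 powr (- \<bar>\<xi>\<bar>) * real N powr \<xi> * c) * ennreal (real (card (t ` {..<m})) powr rq q) \<le>
        qnorm q (\<lambda>j. ennreal ((1 + real j) powr \<xi>) * ?u j)"
    proof (rule qnorm_block_lower[OF q])
      have "0 \<in> {..<m}" using m by simp
      then show "t ` {..<m} \<noteq> {}" by blast
      fix j assume "j \<in> t ` {..<m}"
      then obtain i where i: "i < m" "j = t i" by auto
      have "j \<in> {N + 2..<N + 2 * m + 2}" using t[OF i(1)] i by auto
      from w(1)[OF N m(2) this] have "ennreal (4 powr (- \<bar>\<xi>\<bar>) * real N powr \<xi>) * ennreal c \<le> ennreal ((1 + real j) powr \<xi>) * ?u j"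
        using t[OF i(1)] i by (intro mult_mono ennreal_leI) auto
      then show "ennreal (4 powr (- \<bar>\<xi>\<bar>) * real N powr \<xi> * c) \<le> ennreal ((1 + real j) powr \<xi>) * ?u j"
        using c(1) by (simp add: ennreal_mult)
    qed simp
    then show "ennreal (c * 4 powr (- \<bar>\<xi>\<bar>) * (real N powr \<xi> * real m powr rq q)) \<le>
        besov_norm \<phi>0 0 \<xi> p q (regular_distr (bumps N m y))"
      unfolding bn card_image[OF inj] using c(1) by (simp add: ennreal_mult[symmetric] mult_ac)
    have "qnorm q (\<lambda>j. ennreal ((1 + real j) powr \<xi>) * ?u j) \<le>
        ennreal (4 powr \<bar>\<xi>\<bar> * real N powr \<xi> * C) * ennreal (real (card {N + 2..<N + 2 * m + 2}) powr rq q)"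
    proof (rule qnorm_block_upper[OF q])
      fix j assume j: "j \<in> {N + 2..<N + 2 * m + 2}"
      \<comment> \<open>Recovers the wave from the block, since consecutive indices are grouped in
        pairs from N + 2 on.\<close>
      define i where "i = (j - (N + 2)) div 2"
      have i: "i < m" "j = N + 2 * i + 2 \<or> j = N + 2 * i + 3" using j unfolding i_def by auto
      have "?u j \<le> Lp_norm p (piece N i j (y i))"
        unfolding packet_block_eq[OF N i] by (rule distr_Lp_norm_regular_le[OF p1 piece_schwartz])
      also have "\<dots> \<le> ennreal C" using j by (intro C) auto
      finally have "ennreal ((1 + real j) powr \<xi>) * ?u j \<le> ennreal (4 powr \<bar>\<xi>\<bar> * real N powr \<xi>) * ennreal C"
        using w(2)[OF N m(2) j] by (intro mult_mono ennreal_leI) auto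
      then show "ennreal ((1 + real j) powr \<xi>) * ?u j \<le> ennreal (4 powr \<bar>\<xi>\<bar> * real N powr \<xi> * C)"
        using C(1) by (simp add: ennreal_mult)
    qed (simp_all add: packet_block_0[OF N _ p1])
    also have "\<dots> = ennreal (C * 4 powr \<bar>\<xi>\<bar> * 2 powr rq q * (real N powr \<xi> * real m powr rq q))"
      using C(1) by (simp add: ennreal_mult[symmetric] powr_mult mult_ac)
    finally show "besov_norm \<phi>0 0 \<xi> p q (regular_distr (bumps N m y)) \<le>
        ennreal (C * 4 powr \<bar>\<xi>\<bar> * 2 powr rq q * (real N powr \<xi> * real m powr rq q))"
      unfolding bn .
  qed
qed

end

end

subsection \<open>Differences of packets\<close>

text \<open>Separates the variation of the slow envelope, which is small with the step, from the
  rotation of the phase, which gives the factor -2 when the step is an odd number of half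
  periods.\<close>

lemma difference_wave:
  "difference h (\<lambda>x. cis (l * (x \<bullet> e)) * G x) x =
    cis (l * ((x + h) \<bullet> e)) * difference h G x + (cis (l * (h \<bullet> e)) - 1) * (cis (l * (x \<bullet> e)) * G x)"
  by (simp add: difference_def algebra_simps inner_add_left flip: cis_mult)

lemma difference_sum: "difference h (\<lambda>x. \<Sum>i\<in>I. f i x) = (\<lambda>x. \<Sum>i\<in>I. difference h (f i) x)"
  by (simp add: difference_def sum_subtractf)

lemma difference_funpow_linear:
  "(difference h ^^ k) (\<lambda>x. c * f x + r x) = (\<lambda>x. c * (difference h ^^ k) f x + (difference h ^^ k) r x)"
proof (induction k)
  case (Suc k)
  then show ?case by (simp add: difference_def algebra_simps)
qed simp

text \<open>Each further difference multiplies by -2 up to a difference of the remainder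
  \<open>r\<close>, so iterating cannot reduce the norm by more than the accumulated remainders 1 +
  2 + ... + 2 ^ (k - 1).\<close>

lemma Lp_norm_le_difference_power:
  assumes p: "1 \<le> p" and f: "f \<in> borel_measurable borel" and r: "r \<in> borel_measurable borel"
    and eq: "difference h f = (\<lambda>x. - 2 * f x + r x)"
  shows "Lp_norm p f \<le> Lp_norm p ((difference h ^^ k) f) + 2 ^ k * Lp_norm p r"
proof (induction k)
  case (Suc k)
  let ?d = "\<lambda>k. (difference h ^^ k)"
  note [measurable] = difference_funpow_measurable[OF f] difference_funpow_measurable[OF r]
  have "?d (Suc k) f = ?d k (difference h f)" by (simp only: funpow_Suc_right comp_def)
  also have "\<dots> = (\<lambda>x. - 2 * ?d k f x + ?d k r x)" unfolding eq by (rule difference_funpow_linear)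
  finally have s: "?d (Suc k) f = (\<lambda>x. - 2 * ?d k f x + ?d k r x)" .
  \<comment> \<open>The gain by the factor 2 is given away; this keeps the norm of \<open>f\<close>
    with coefficient 1 throughout the induction.\<close>
  have "Lp_norm p (?d k f) \<le> 2 * Lp_norm p (?d k f)" by (simp add: mult_2)
  also have "\<dots> = Lp_norm p (\<lambda>x. - 2 * ?d k f x)" using p by (subst Lp_norm_cmult) auto
  also have "(\<lambda>x. - 2 * ?d k f x) = (\<lambda>x. ?d (Suc k) f x + (- 1) * ?d k r x)" unfolding s by simp
  also have "Lp_norm p \<dots> \<le> Lp_norm p (?d (Suc k) f) + Lp_norm p (\<lambda>x. (- 1) * ?d k r x)"
    using difference_funpow_measurable[OF f, of "Suc k" h] by (intro minkowski[OF p]) auto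
  also have "Lp_norm p (\<lambda>x. (- 1) * ?d k r x) = Lp_norm p (?d k r)" using p by (subst Lp_norm_cmult) auto
  also have "\<dots> \<le> 2 ^ k * Lp_norm p r" by (rule Lp_norm_difference_power_le[OF p r])
  finally have "Lp_norm p (?d k f) \<le> Lp_norm p (?d (Suc k) f) + 2 ^ k * Lp_norm p r"
    by (simp only: add_left_mono)
  then have "Lp_norm p (?d k f) + 2 ^ k * Lp_norm p r \<le> (Lp_norm p (?d (Suc k) f) + 2 ^ k * Lp_norm p r) + 2 ^ k * Lp_norm p r"
    by (rule add_right_mono)
  with Suc have "Lp_norm p f \<le> (Lp_norm p (?d (Suc k) f) + 2 ^ k * Lp_norm p r) + 2 ^ k * Lp_norm p r"
    by (rule order_trans)
  also have "\<dots> = Lp_norm p (?d (Suc k) f) + 2 ^ Suc k * Lp_norm p r" by (simp add: mult_2 add.assoc distrib_right)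
  finally show ?case .
qed simp

lemma sum_lam_le:
  assumes N: "2 \<le> N" shows "(\<Sum>i<m. lam N i) \<le> 2 ^ (N + 2 * m + 3)"
proof (induction m)
  case (Suc m)
  have "(\<Sum>i<Suc m. lam N i) \<le> 2 ^ (N + 2 * m + 3) + 2 ^ (N + 2 * m + 3)"
    using Suc lam_bounds(2)[OF N, of m] by simp
  also have "\<dots> \<le> 2 ^ (N + 2 * Suc m + 3)" by (simp add: power_add)
  finally show ?case .
qed simp

lemma cis_lam: "cis (lam N i * (pi / 2 ^ N)) = - 1"
proof -
  \<comment> \<open>In units of \<open>pi\<close> the phase is an even number plus 1; the summand 1
    in \<open>lam\<close> exists for this purpose.\<close>
  have "lam N i * (pi / 2 ^ N) = 2 * pi * real (3 * 2 ^ (2 * i)) + pi" by (simp add: lam_def field_simps)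
  then have "cis (lam N i * (pi / 2 ^ N)) = cis (2 * pi * real (3 * 2 ^ (2 * i))) * cis pi" by (simp only: cis_mult)
  also have "cis (2 * pi * real (3 * 2 ^ (2 * i))) = 1" by (rule cis_multiple_2pi) (rule Ints_of_nat)
  finally show ?thesis by simp
qed

section \<open>Moduli of smoothness of packets\<close>

context
  fixes \<phi>0 :: "'a::euclidean_space \<Rightarrow> complex" and e :: 'a
  assumes \<phi>0: "lp_cutoff \<phi>0" and e: "norm e = 1"
begin

private abbreviation wave where
  "wave N i y \<equiv> (\<lambda>x. cis (lam N i * (x \<bullet> e)) * bump \<phi>0 y x)"

private abbreviation pack where
  "pack N m y \<equiv> packet e N m (\<lambda>i. bump \<phi>0 (y i))"

private lemma bump_measurable [measurable]: "bump \<phi>0 y \<in> borel_measurable borel"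
  by (rule schwartz_measurable[OF bandlimited_schwartz[OF bump_bandlimited[OF \<phi>0]]])

private lemma pack_measurable [measurable]: "pack N m y \<in> borel_measurable borel"
  by (rule schwartz_measurable[OF packet_bump_schwartz[OF \<phi>0 e]])

lemma bump_difference:
  assumes p: "1 \<le> p"
  obtains C where "0 < C" "\<And>h y. norm h \<le> 1 \<Longrightarrow> Lp_norm p (difference h (bump \<phi>0 y)) \<le> ennreal (C * norm h)"
    "\<And>y. Lp_norm p (bump \<phi>0 y) \<le> ennreal C"
proof -
  let ?g = "inv_fourier \<phi>0"
  have gs: "?g \<in> schwartz" by (rule inv_fourier_schwartz[OF cutoff_schwartz[OF \<phi>0]])
  note [measurable] = schwartz_measurable[OF gs]
  obtain C0 where C0: "0 \<le> C0" "\<And>x h. norm h \<le> 1 \<Longrightarrow> norm (?g (x + h) - ?g x) \<le> C0 * norm h / (1 + norm x) ^ (2 * DIM('a))"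
    by (rule schwartz_shift_decay[OF gs]) blast
  obtain A where A: "0 \<le> A" "Lp_norm p ?g = ennreal A"
    using Lp_finite[OF schwartz_Lp[OF p gs]] by (cases "Lp_norm p ?g") auto
  define I where "I = (\<integral>x. 1 / (1 + norm (x::'a)) ^ (2 * DIM('a)) \<partial>lborel) powr (1 / p)"
  have I: "0 \<le> I" by (simp add: I_def)
  have "Lp_norm p (difference h (bump \<phi>0 y)) \<le> ennreal ((C0 * I + A + 1) * norm h)" if h: "norm h \<le> 1" for h y
  proof -
    have "Lp_norm p (difference h (bump \<phi>0 y)) = Lp_norm p (\<lambda>x. difference h ?g (x + (- y)))"
      by (simp add: difference_def bump_def[OF \<phi>0] algebra_simps)
    also have "\<dots> = Lp_norm p (difference h ?g)" by (rule Lp_norm_translate) measurable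
    also have "\<dots> \<le> ennreal ((C0 * norm h) * I)"
      unfolding I_def by (rule decay_Lp_bound[OF p]) (use C0 h in \<open>auto simp: difference_def\<close>)
    also have "\<dots> \<le> ennreal ((C0 * I + A + 1) * norm h)"
      using A(1) by (intro ennreal_leI) (simp add: algebra_simps)
    finally show ?thesis .
  qed
  moreover have "Lp_norm p (bump \<phi>0 y) \<le> ennreal (C0 * I + A + 1)" for y
    unfolding Lp_norm_bump[OF \<phi>0] A(2) using C0(1) I by (intro ennreal_leI) simp
  moreover have "0 < C0 * I + A + 1" using C0(1) I A(1) by (simp add: add_nonneg_pos)
  ultimately show ?thesis using that by blast
qed

text \<open>The envelope contributes a multiple of norm h and the phase a multiple of lam * norm h;
  as \<open>lam\<close> is at least 1, the second absorbs the first.\<close>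

lemma wave_difference:
  assumes p: "1 \<le> p"
  obtains C where "0 < C" "\<And>N i h y. 2 \<le> N \<Longrightarrow> norm h \<le> 1 \<Longrightarrow> Lp_norm p (difference h (wave N i y)) \<le> ennreal (C * norm h * lam N i)"
proof -
  obtain C where C: "0 < C" "\<And>h y. norm h \<le> 1 \<Longrightarrow> Lp_norm p (difference h (bump \<phi>0 y)) \<le> ennreal (C * norm h)"
    "\<And>y. Lp_norm p (bump \<phi>0 y) \<le> ennreal C"
    by (rule bump_difference[OF p]) blast
  have "Lp_norm p (difference h (wave N i y)) \<le> ennreal (2 * C * norm h * lam N i)" if N: "2 \<le> N" and h: "norm h \<le> 1" for N i h y
  proof -
    let ?l = "lam N i"
    let ?a = "\<lambda>x. cis (?l * ((x + h) \<bullet> e)) * difference h (bump \<phi>0 y) x"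
    have l: "1 \<le> ?l" by (rule lam_bounds(3)[OF N])
    have "Lp_norm p (difference h (wave N i y)) = Lp_norm p (\<lambda>x. ?a x + (cis (?l * (h \<bullet> e)) - 1) * wave N i y x)"
      by (simp only: difference_wave[abs_def])
    also have "\<dots> \<le> Lp_norm p ?a + Lp_norm p (\<lambda>x. (cis (?l * (h \<bullet> e)) - 1) * wave N i y x)"
      by (rule minkowski[OF p]) measurable
    also have "Lp_norm p ?a = Lp_norm p (difference h (bump \<phi>0 y))" by (simp add: Lp_norm_def norm_mult)
    also have "Lp_norm p (\<lambda>x. (cis (?l * (h \<bullet> e)) - 1) * wave N i y x) =
        ennreal (norm (cis (?l * (h \<bullet> e)) - 1)) * Lp_norm p (bump \<phi>0 y)"
      using p by (subst Lp_norm_cmult) (auto simp: Lp_norm_wave)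
    also have "Lp_norm p (difference h (bump \<phi>0 y)) + ennreal (norm (cis (?l * (h \<bullet> e)) - 1)) * Lp_norm p (bump \<phi>0 y) \<le>
        ennreal (C * norm h) + ennreal (?l * norm h) * ennreal C"
    proof (intro add_mono mult_mono C(2)[OF h] C(3) ennreal_leI)
      have "\<bar>h \<bullet> e\<bar> \<le> norm h" using Cauchy_Schwarz_ineq2[of h e] e by simp
      then have "\<bar>?l * (h \<bullet> e)\<bar> \<le> ?l * norm h" using l by (simp add: abs_mult)
      then show "norm (cis (?l * (h \<bullet> e)) - 1) \<le> ?l * norm h" using norm_cis_minus_1(1) order_trans by blast
    qed auto
    also have "\<dots> = ennreal (C * norm h + ?l * norm h * C)"
      using C(1) l by (simp add: ennreal_mult[symmetric] ennreal_plus[symmetric] del: ennreal_plus)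
    also have "\<dots> \<le> ennreal (2 * C * norm h * ?l)"
    proof (rule ennreal_leI)
      have "C * norm h * 1 \<le> C * norm h * ?l" using C(1) l by (intro mult_left_mono) auto
      then show "C * norm h + ?l * norm h * C \<le> 2 * C * norm h * ?l" by (simp add: algebra_simps)
    qed
    finally show ?thesis .
  qed
  then show ?thesis using C(1) that[of "2 * C"] by simp
qed

text \<open>The triangle inequality loses nothing essential here, because the frequencies grow
  geometrically and their sum is comparable with the largest.\<close>

lemma packet_difference:
  assumes p: "1 \<le> p"
  obtains C where "0 < C" "\<And>N m h y. 2 \<le> N \<Longrightarrow> norm h \<le> 1 \<Longrightarrow>
    Lp_norm p (difference h (pack N m y)) \<le> ennreal (C * norm h * 2 ^ (N + 2 * m + 3))"
proof -
  obtain C where C: "0 < C" "\<And>N i h y. 2 \<le> N \<Longrightarrow> norm h \<le> 1 \<Longrightarrow> Lp_norm p (difference h (wave N i y)) \<le> ennreal (C * norm h * lam N i)"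
    by (rule wave_difference[OF p]) blast
  have "Lp_norm p (difference h (pack N m y)) \<le> ennreal (C * norm h * 2 ^ (N + 2 * m + 3))"
    if N: "2 \<le> N" and h: "norm h \<le> 1" for N m h y
  proof -
    have "Lp_norm p (difference h (pack N m y)) = Lp_norm p (\<lambda>x. \<Sum>i<m. difference h (wave N i (y i)) x)"
      unfolding packet_def[abs_def] difference_sum ..
    also have "\<dots> \<le> (\<Sum>i<m. Lp_norm p (difference h (wave N i (y i))))"
      by (rule minkowski_sum[OF p]) measurable
    also have "\<dots> \<le> (\<Sum>i<m. ennreal (C * norm h * lam N i))" by (intro sum_mono C N h)
    also have "\<dots> = ennreal (C * norm h * (\<Sum>i<m. lam N i))"
    proof -
      have "0 \<le> C * norm h * lam N i" for i using C(1) lam_bounds(3)[OF N, of i] by simp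
      then show ?thesis by (simp add: sum_ennreal sum_distrib_left)
    qed
    also have "\<dots> \<le> ennreal (C * norm h * 2 ^ (N + 2 * m + 3))"
      using C(1) by (intro ennreal_leI mult_left_mono sum_lam_le N) auto
    finally show ?thesis .
  qed
  then show ?thesis using C(1) that by blast
qed

text \<open>The modulus is at most a constant times \<open>X\<close> at all scales and decays
  geometrically beyond the scale of the highest frequency, about 2 ^ (N + 2 m + 3). This is the
  situation of \<open>weighted_qnorm_upper\<close>, and the index is O(N) because
  \<open>m \<le> N\<close>.\<close>

lemma packet_diff_upper:
  assumes p: "1 \<le> p" and q: "0 < q" and b: "- rq q < b" and k: "1 \<le> k"
  obtains K where "0 < K" "\<And>N m y X. 2 \<le> N \<Longrightarrow> m \<le> N \<Longrightarrow> 1 \<le> X \<Longrightarrow>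
    Lp_norm p (pack N m y) \<le> ennreal X \<Longrightarrow>
    diff_besov_norm k b p q (pack N m y) \<le> ennreal (K * X * real N powr (b + rq q))"
proof -
  obtain C where C: "0 < C" "\<And>N m h y. 2 \<le> N \<Longrightarrow> norm h \<le> 1 \<Longrightarrow>
    Lp_norm p (difference h (pack N m y)) \<le> ennreal (C * norm h * 2 ^ (N + 2 * m + 3))"
    by (rule packet_difference[OF p]) blast
  obtain Q where Q: "0 < Q" "\<forall>M A a. (\<forall>n. a n \<le> A) \<longrightarrow> (\<forall>i. a (i + M) \<le> A * ennreal ((1 / 2) ^ i)) \<longrightarrow>
    qnorm q (\<lambda>n. ennreal ((1 + real n) powr b) * a n) \<le> ennreal (Q * (1 + real M) powr (b + rq q)) * A"
    by (rule weighted_qnorm_upper[OF q b]) blast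
  define \<beta> where "\<beta> = b + rq q"
  have \<beta>: "0 < \<beta>" using b by (simp add: \<beta>_def)
  define K1 where "K1 = 2 powr \<bar>b\<bar> * (Q * 5 powr \<beta>) * (2 ^ k * (C + 1))"
  have K1: "0 < K1" using Q C by (simp add: K1_def)
  show ?thesis
  proof
    show "0 < 1 + K1" using K1 by simp
    fix N m :: nat and y :: "nat \<Rightarrow> 'a" and X :: real
    assume N: "2 \<le> N" and m: "m \<le> N" and X: "1 \<le> X" and fX: "Lp_norm p (pack N m y) \<le> ennreal X"
    let ?f = "pack N m y" and ?M = "N + 2 * m + 3"
    \<comment> \<open>One constant has to serve coarse and fine scales. The bound for small steps
      does not contain \<open>X\<close> and is absorbed because \<open>X\<close> is at least
      1.\<close>
    define A where "A = 2 ^ k * (C + 1) * X"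
    have A0: "0 \<le> A" using C X by (simp add: A_def)
    have "wmod k p ?f n \<le> ennreal A" for n
      unfolding wmod_def modulus_def
    proof (rule SUP_least)
      fix h
      have "Lp_norm p ((difference h ^^ k) ?f) \<le> 2 ^ k * Lp_norm p ?f"
        by (rule Lp_norm_difference_power_le[OF p pack_measurable])
      also have "\<dots> \<le> ennreal (2 ^ k) * ennreal X" using fX by (intro mult_mono) (auto simp: ennreal_power[symmetric])
      also have "\<dots> \<le> ennreal A"
        using X C by (subst ennreal_mult[symmetric]) (auto simp: A_def intro!: ennreal_leI mult_right_mono)
      finally show "Lp_norm p ((difference h ^^ k) ?f) \<le> ennreal A" .
    qed
    moreover have "wmod k p ?f (i + ?M) \<le> ennreal A * ennreal ((1 / 2) ^ i)" for i
      unfolding wmod_def modulus_def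
    proof (rule SUP_least)
      fix h :: 'a assume "h \<in> {h. norm h \<le> (1 / 2) ^ (i + ?M)}"
      then have h: "norm h \<le> (1 / 2) ^ (i + ?M)" by simp
      also have "\<dots> \<le> 1" by (rule power_le_one) auto
      finally have h1: "norm h \<le> 1" .
      have "(difference h ^^ k) ?f = (difference h ^^ (k - 1)) (difference h ?f)"
        using funpow_Suc_right[of "k - 1" "difference h"] k by simp
      then have "Lp_norm p ((difference h ^^ k) ?f) \<le> 2 ^ (k - 1) * Lp_norm p (difference h ?f)"
        using Lp_norm_difference_power_le[OF p difference_measurable[OF pack_measurable]] by simp
      also have "\<dots> \<le> ennreal (2 ^ (k - 1)) * ennreal (C * norm h * 2 ^ ?M)"
        using C(2)[OF N h1] by (intro mult_mono) (auto simp: ennreal_power[symmetric])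
      also have "\<dots> = ennreal (2 ^ (k - 1) * (C * norm h * 2 ^ ?M))"
        using C by (subst ennreal_mult[symmetric]) auto
      also have "\<dots> \<le> ennreal (A * (1 / 2) ^ i)"
      proof (rule ennreal_leI)
        have "norm h * 2 ^ ?M \<le> (1 / 2) ^ (i + ?M) * 2 ^ ?M" using h by (intro mult_right_mono) auto
        also have "\<dots> = (1 / 2) ^ i" by (simp add: power_add power_divide)
        finally have hM: "norm h * 2 ^ ?M \<le> (1 / 2) ^ i" .
        have "2 ^ (k - 1) * C \<le> 2 ^ k * (C + 1)" using C(1) by (intro mult_mono power_increasing) auto
        also have "\<dots> \<le> A" unfolding A_def using mult_left_mono[of 1 X "2 ^ k * (C + 1)"] C(1) X by simp
        finally have "(2 ^ (k - 1) * C) * (norm h * 2 ^ ?M) \<le> A * (1 / 2) ^ i" using hM A0 by (intro mult_mono) auto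
        then show "2 ^ (k - 1) * (C * norm h * 2 ^ ?M) \<le> A * (1 / 2) ^ i" by (simp only: mult.assoc)
      qed
      also have "\<dots> = ennreal A * ennreal ((1 / 2) ^ i)" using A0 by (intro ennreal_mult) auto
      finally show "Lp_norm p ((difference h ^^ k) ?f) \<le> ennreal A * ennreal ((1 / 2) ^ i)" .
    qed
    ultimately have "qnorm q (\<lambda>n. ennreal ((1 + real n) powr b) * wmod k p ?f n) \<le> ennreal (Q * (1 + real ?M) powr \<beta>) * ennreal A"
      unfolding \<beta>_def by (intro Q(2)[rule_format])
    also have "\<dots> \<le> ennreal (Q * (5 powr \<beta> * real N powr \<beta>)) * ennreal A"
    proof (intro mult_right_mono ennreal_leI mult_left_mono)
      \<comment> \<open>The factor 5 comes from N + 2 m + 4 \<le> 3 N + 4 \<le> 5 N for N \<ge>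
        2.\<close>
      have "(1 + real ?M) powr \<beta> \<le> (5 * real N) powr \<beta>" using N m \<beta> by (intro powr_mono2) auto
      then show "(1 + real ?M) powr \<beta> \<le> 5 powr \<beta> * real N powr \<beta>" by (simp add: powr_mult)
    qed (use Q in auto)
    finally have qn: "qnorm q (\<lambda>n. ennreal ((1 + real n) powr b) * wmod k p ?f n) \<le>
      ennreal (Q * (5 powr \<beta> * real N powr \<beta>)) * ennreal A" .
    have "diff_besov_norm k b p q ?f \<le> Lp_norm p ?f +
        ennreal (2 powr \<bar>b\<bar>) * qnorm q (\<lambda>n. ennreal ((1 + real n) powr b) * wmod k p ?f n)"
      by (rule diff_besov_upper[OF q])
    also have "\<dots> \<le> ennreal X + ennreal (2 powr \<bar>b\<bar>) * (ennreal (Q * (5 powr \<beta> * real N powr \<beta>)) * ennreal A)"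
      by (intro add_mono mult_left_mono fX qn) auto
    also have "\<dots> = ennreal (X + 2 powr \<bar>b\<bar> * (Q * (5 powr \<beta> * real N powr \<beta>) * A))"
      using Q A0 X by (simp add: ennreal_mult[symmetric] ennreal_plus[symmetric] del: ennreal_plus)
    also have "\<dots> \<le> ennreal ((1 + K1) * X * real N powr \<beta>)"
    proof (rule ennreal_leI)
      have "1 \<le> real N powr \<beta>" using N \<beta> by (intro ge_one_powr_ge_zero) auto
      then have "X * 1 \<le> X * real N powr \<beta>" using X by (intro mult_left_mono) auto
      then show "X + 2 powr \<bar>b\<bar> * (Q * (5 powr \<beta> * real N powr \<beta>) * A) \<le> (1 + K1) * X * real N powr \<beta>"
        by (simp add: K1_def A_def algebra_simps)
    qed
    finally show "diff_besov_norm k b p q ?f \<le> ennreal ((1 + K1) * X * real N powr (b + rq q))" unfolding \<beta>_def .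
  qed
qed

text \<open>One step of length pi / 2 ^ N almost reverses the sign of every wave simultaneously, so
  the k-th difference is at least as large as the packet up to the small envelope error. The step is
  admissible at all scales up to about \<open>N\<close>, and the weights over these scales sum to
  the power b + 1/q.\<close>

lemma packet_diff_lower:
  assumes p: "1 \<le> p" and q: "0 < q" and b: "- rq q < b"
  obtains c K where "0 < c" "0 < K" "\<And>N m y L. 3 \<le> N \<Longrightarrow> ennreal L \<le> Lp_norm p (pack N m y) \<Longrightarrow>
    ennreal (c * real N powr (b + rq q) * (L - K * real m * (1 / 2) ^ N)) \<le> diff_besov_norm k b p q (pack N m y)"
proof -
  obtain C where C: "0 < C" "\<And>h y. norm h \<le> 1 \<Longrightarrow> Lp_norm p (difference h (bump \<phi>0 y)) \<le> ennreal (C * norm h)"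
    by (rule bump_difference[OF p]) blast
  obtain c0 where c0: "0 < c0" "\<forall>M A a. (\<forall>n\<le>M. A \<le> a n) \<longrightarrow>
    ennreal (c0 * (1 + real M) powr (b + rq q)) * A \<le> qnorm q (\<lambda>n. ennreal ((1 + real n) powr b) * a n)"
    by (rule weighted_qnorm_lower[OF q]) blast
  obtain D where D: "0 < D" "\<And>k p (f::'a \<Rightarrow> complex). qnorm q (\<lambda>n. ennreal ((1 + real n) powr b) * wmod k p f (Suc n)) \<le>
    ennreal D * diff_besov_norm k b p q f"
    by (rule diff_besov_lower[OF q]) blast
  define \<beta> where "\<beta> = b + rq q"
  have \<beta>: "0 < \<beta>" using b by (simp add: \<beta>_def)
  show ?thesis
  proof
    show "0 < c0 * (1 / 3) powr \<beta> / D" "0 < 2 ^ k * C * 4" using c0 C D by auto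
    fix N m :: nat and y :: "nat \<Rightarrow> 'a" and L :: real
    assume N: "3 \<le> N" and L: "ennreal L \<le> Lp_norm p (pack N m y)"
    let ?f = "pack N m y"
    let ?R = "2 ^ k * C * 4 * real m * (1 / 2) ^ N"
    \<comment> \<open>In the direction \<open>e\<close> the frequencies are odd multiples of 2 ^ N,
      so this is a half-integral number of periods for all of them.\<close>
    define h where "h = (pi / 2 ^ N) *\<^sub>R e"
    have "norm h = pi * (1 / 2) ^ N" using e by (simp add: h_def power_divide)
    also have "\<dots> \<le> 4 * (1 / 2) ^ N" using pi_less_4 by (intro mult_right_mono) auto
    finally have hN: "norm h \<le> 4 * (1 / 2) ^ N" .
    \<comment> \<open>Estimating pi by 4 places the step below a dyadic scale.\<close>
    have "4 * (1 / 2) ^ N = ((1 / 2) ^ (N - 2) :: real)"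
    proof -
      obtain n where "N = n + 2" using N by (metis add.commute le_Suc_ex numeral_3_eq_3 Suc_leD numeral_2_eq_2)
      then show ?thesis by (simp add: power_add power2_eq_square)
    qed
    with hN have h2: "norm h \<le> (1 / 2) ^ (N - 2)" by simp
    also have "\<dots> \<le> 1" by (rule power_le_one) auto
    finally have h1: "norm h \<le> 1" .
    define r where "r = (\<lambda>x. \<Sum>i<m. cis (lam N i * ((x + h) \<bullet> e)) * difference h (bump \<phi>0 (y i)) x)"
    have he: "h \<bullet> e = pi / 2 ^ N" using e by (simp add: h_def norm_eq_1)
    have w: "difference h (wave N i z) x = cis (lam N i * ((x + h) \<bullet> e)) * difference h (bump \<phi>0 z) x + - 2 * wave N i z x" for i z x
      unfolding difference_wave he cis_lam by simp
    have fr: "difference h ?f = (\<lambda>x. - 2 * ?f x + r x)"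
    proof
      fix x
      have "difference h ?f x = (\<Sum>i<m. difference h (wave N i (y i)) x)"
        unfolding packet_def[abs_def] difference_sum ..
      also have "\<dots> = r x + - 2 * ?f x"
        unfolding w r_def packet_def sum.distrib sum_distrib_left ..
      finally show "difference h ?f x = - 2 * ?f x + r x" by (simp add: add.commute)
    qed
    have rm: "r \<in> borel_measurable borel" unfolding r_def by measurable
    have "Lp_norm p r \<le> (\<Sum>i<m. Lp_norm p (\<lambda>x. cis (lam N i * ((x + h) \<bullet> e)) * difference h (bump \<phi>0 (y i)) x))"
      unfolding r_def by (rule minkowski_sum[OF p]) measurable
    also have "\<dots> = (\<Sum>i<m. Lp_norm p (difference h (bump \<phi>0 (y i))))" by (simp add: Lp_norm_def norm_mult)
    also have "\<dots> \<le> (\<Sum>i<m. ennreal (C * (4 * (1 / 2) ^ N)))"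
      using C(1) hN by (intro sum_mono order_trans[OF C(2)[OF h1]] ennreal_leI mult_left_mono) auto
    also have "\<dots> = ennreal (real m * (C * (4 * (1 / 2) ^ N)))"
      using C(1) by (simp add: ennreal_of_nat_eq_real_of_nat ennreal_mult)
    finally have r: "Lp_norm p r \<le> ennreal (real m * (C * (4 * (1 / 2) ^ N)))" .
    let ?d = "Lp_norm p ((difference h ^^ k) ?f)"
    have "ennreal L \<le> ?d + 2 ^ k * Lp_norm p r"
      using L Lp_norm_le_difference_power[OF p pack_measurable rm fr] by (rule order_trans)
    also have "\<dots> \<le> ?d + ennreal (2 ^ k) * ennreal (real m * (C * (4 * (1 / 2) ^ N)))"
      using r by (intro add_left_mono mult_mono) (auto simp: ennreal_power[symmetric])
    also have "\<dots> = ?d + ennreal ?R"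
      using C(1) by (subst ennreal_mult[symmetric]) (auto simp: mult_ac)
    finally have Ld: "ennreal L \<le> ?d + ennreal ?R" .
    have d: "ennreal (L - ?R) \<le> ?d"
    proof (cases ?d)
      case (real x)
      then have "ennreal L \<le> ennreal (x + ?R)" using Ld C(1) by (simp add: ennreal_plus)
      then have "L \<le> x + ?R" using real C(1) by (subst (asm) ennreal_le_iff) auto
      then show ?thesis unfolding real by (intro ennreal_leI) simp
    qed simp
    \<comment> \<open>The step is at most (1/2) ^ (N - 2) and the lower bound of the integral uses
      the index \<open>Suc n\<close>, so \<open>n\<close> runs up to N - 3.\<close>
    have "ennreal (L - ?R) \<le> wmod k p ?f (Suc n)" if n: "n \<le> N - 3" for n
    proof -
      have "norm h \<le> (1 / 2) ^ (N - 2)" by (rule h2)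
      also have "\<dots> \<le> (1 / 2) ^ Suc n" using n N by (intro power_decreasing) auto
      finally have "?d \<le> wmod k p ?f (Suc n)" unfolding wmod_def modulus_def by (intro SUP_upper) simp
      with d show ?thesis by (rule order_trans)
    qed
    then have "ennreal (c0 * (1 + real (N - 3)) powr \<beta>) * ennreal (L - ?R) \<le>
        qnorm q (\<lambda>n. ennreal ((1 + real n) powr b) * wmod k p ?f (Suc n))"
      unfolding \<beta>_def by (intro c0(2)[rule_format])
    also have "\<dots> \<le> ennreal D * diff_besov_norm k b p q ?f" by (rule D(2))
    finally have *: "ennreal (c0 * (1 + real (N - 3)) powr \<beta>) * ennreal (L - ?R) \<le> ennreal D * diff_besov_norm k b p q ?f" .
    \<comment> \<open>The difference \<open>L - ?R\<close> may be negative and is then truncated to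
      0 by \<open>ennreal\<close>; factoring out the other, nonnegative constants remains
      valid.\<close>
    have "ennreal (c0 * (1 / 3) powr \<beta> / D * real N powr \<beta> * (L - ?R)) =
        ennreal (1 / D) * (ennreal (c0 * ((1 / 3) powr \<beta> * real N powr \<beta>)) * ennreal (L - ?R))"
      using c0(1) D(1) by (simp add: ennreal_mult'[symmetric] mult_ac)
    also have "\<dots> \<le> ennreal (1 / D) * (ennreal (c0 * (1 + real (N - 3)) powr \<beta>) * ennreal (L - ?R))"
    proof (intro mult_left_mono mult_right_mono ennreal_leI)
      \<comment> \<open>For N \<ge> 3 the number N - 2 of available scales is at least N /
        3.\<close>
      have "(1 / 3 * real N) powr \<beta> \<le> (1 + real (N - 3)) powr \<beta>" using N \<beta> by (intro powr_mono2) auto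
      then show "(1 / 3) powr \<beta> * real N powr \<beta> \<le> (1 + real (N - 3)) powr \<beta>" by (simp only: powr_mult)
    qed (use c0 in auto)
    also have "\<dots> \<le> ennreal (1 / D) * (ennreal D * diff_besov_norm k b p q ?f)" by (intro mult_left_mono *) auto
    also have "\<dots> = (ennreal (1 / D) * ennreal D) * diff_besov_norm k b p q ?f" by (simp only: mult.assoc)
    also have "ennreal (1 / D) * ennreal D = 1" using D(1) by (subst ennreal_mult[symmetric]) auto
    finally show "ennreal (c0 * (1 / 3) powr \<beta> / D * real N powr (b + rq q) * (L - ?R)) \<le> diff_besov_norm k b p q ?f"
      unfolding \<beta>_def by simp
  qed
qed

end

subsection \<open>Comparison of the two scales\<close>

text \<open>Otherwise N powr (a - b) would stay below \<open>C\<close>; the witness is chosen so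
  that this power is at least C + 1.\<close>

lemma powr_growth_le:
  assumes C: "0 < C" and le: "\<And>N. n0 \<le> N \<Longrightarrow> real N powr a \<le> C * real N powr b"
  shows "a \<le> b"
proof (rule ccontr)
  assume "\<not> a \<le> b"
  then have d: "0 < a - b" by simp
  define N where "N = n0 + 1 + nat \<lceil>(C + 1) powr (1 / (a - b))\<rceil>"
  have N: "n0 \<le> N" "1 \<le> N" "(C + 1) powr (1 / (a - b)) \<le> real N" unfolding N_def by linarith+
  have "C + 1 = ((C + 1) powr (1 / (a - b))) powr (a - b)" using C d by (simp add: powr_powr)
  also have "\<dots> \<le> real N powr (a - b)" using N d by (intro powr_mono2) auto
  also have "\<dots> = real N powr a / real N powr b" by (rule powr_diff)
  also have "\<dots> \<le> C" using le[OF N(1)] N(2) by (simp add: divide_le_eq)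
  finally show False by simp
qed

text \<open>For m = 1 the powers of \<open>m\<close> disappear and both inequalities compare
  \<open>\<xi>\<close> with \<open>\<beta>\<close>. For m = N the total exponents are compared, and
  the common part cancels.\<close>

lemma scale_exponents:
  assumes C: "0 < C" and c: "0 < c" and K: "0 < K" and \<gamma>: "0 \<le> \<gamma>"
    and U: "\<And>N m. 3 \<le> N \<Longrightarrow> 1 \<le> m \<Longrightarrow> m \<le> N \<Longrightarrow> real N powr \<xi> * real m powr s \<le> C * (real N powr \<beta> * real m powr \<alpha>)"
    and L: "\<And>N m. 3 \<le> N \<Longrightarrow> 1 \<le> m \<Longrightarrow> m \<le> N \<Longrightarrow>
      real N powr \<beta> * (c * real m powr \<gamma> - K * real m * (1 / 2) ^ N) \<le> C * (real N powr \<xi> * real m powr s)"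
  shows "\<xi> = \<beta>" "s \<le> \<alpha>" "\<gamma> \<le> s"
proof -
  \<comment> \<open>Since m \<le> N, the error is eventually at most c / 2, hence at most half of
    the main term, which is at least \<open>c\<close> because
    \<open>\<gamma> \<ge> 0\<close>.\<close>
  have "(\<lambda>N::nat. real N * (1 / 2) ^ N) \<longlonglongrightarrow> 0" by real_asymp
  then have "eventually (\<lambda>N::nat. real N * (1 / 2) ^ N < c / (2 * K)) sequentially"
    using c K by (intro order_tendstoD) auto
  then obtain n1 where n1: "\<And>N. n1 \<le> N \<Longrightarrow> real N * (1 / 2) ^ N < c / (2 * K)"
    unfolding eventually_sequentially by blast
  define n0 where "n0 = max 3 n1"
  have L': "real N powr \<beta> * real m powr \<gamma> \<le> 2 * C / c * (real N powr \<xi> * real m powr s)"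
    if N: "n0 \<le> N" and m: "1 \<le> m" "m \<le> N" for N m
  proof -
    have "real m * (1 / 2) ^ N \<le> real N * (1 / 2) ^ N" using m by (intro mult_right_mono) auto
    also have "\<dots> \<le> c / (2 * K)" using n1[of N] N by (simp add: n0_def)
    finally have "K * (real m * (1 / 2) ^ N) \<le> K * (c / (2 * K))" using K by (intro mult_left_mono) auto
    then have "K * real m * (1 / 2) ^ N \<le> c / 2" using K by (simp add: mult.assoc)
    moreover have "1 \<le> real m powr \<gamma>" using m \<gamma> by (intro ge_one_powr_ge_zero) auto
    then have "c / 2 * 1 \<le> c / 2 * real m powr \<gamma>" using c by (intro mult_left_mono) auto
    ultimately have "c / 2 * real m powr \<gamma> \<le> c * real m powr \<gamma> - K * real m * (1 / 2) ^ N" by linarith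
    then have "real N powr \<beta> * (c / 2 * real m powr \<gamma>) \<le> real N powr \<beta> * (c * real m powr \<gamma> - K * real m * (1 / 2) ^ N)"
      by (intro mult_left_mono) auto
    also have "\<dots> \<le> C * (real N powr \<xi> * real m powr s)" using N m by (intro L) (auto simp: n0_def)
    finally show ?thesis using c by (simp add: field_simps)
  qed
  have 3: "3 \<le> N" "1 \<le> N" if "n0 \<le> N" for N using that by (auto simp: n0_def)
  have C2: "0 < 2 * C / c" using C c by simp
  have "\<xi> \<le> \<beta>" by (rule powr_growth_le[OF C, of 3]) (use U[of _ 1] in simp)
  moreover have "\<beta> \<le> \<xi>" by (rule powr_growth_le[OF C2, of n0]) (use L'[of _ 1] 3 in simp)
  ultimately show eq: "\<xi> = \<beta>" by simp
  have "\<xi> + s \<le> \<beta> + \<alpha>"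
    by (rule powr_growth_le[OF C, of 3]) (use U in \<open>simp add: powr_add\<close>)
  then show "s \<le> \<alpha>" using eq by simp
  have "\<beta> + \<gamma> \<le> \<xi> + s"
    by (rule powr_growth_le[OF C2, of n0]) (use L' 3 in \<open>simp add: powr_add\<close>)
  then show "\<gamma> \<le> s" using eq by simp
qed

context
  fixes \<phi>0 :: "'a::euclidean_space \<Rightarrow> complex" and e :: 'a
  assumes \<phi>0: "lp_cutoff \<phi>0" and e: "norm e = 1"
begin

text \<open>Two arrangements are allowed: \<open>y\<close> with a small L_p norm tests one half of
  the equivalence, \<open>z\<close> with a large one tests the other. They can be mixed freely
  because the Besov bounds are the same for both.\<close>

lemma spaces_eq_exponents:
  fixes y z :: "nat \<Rightarrow> 'a"
  assumes eq: "spaces_eq (diff_besov k b p q) (diff_besov_norm k b p q) (besov \<phi>0 0 \<xi> p q) (besov_norm \<phi>0 0 \<xi> p q)"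
    and p: "1 < p" and q: "0 < q" and b: "- rq q < b" and k: "1 \<le> k" and \<alpha>: "0 \<le> \<alpha>" and \<gamma>: "0 \<le> \<gamma>"
    and up: "0 < A" "\<And>N m. 2 \<le> N \<Longrightarrow> 1 \<le> m \<Longrightarrow> Lp_norm p (packet e N m (\<lambda>i. bump \<phi>0 (y i))) \<le> ennreal (A * real m powr \<alpha>)"
    and low: "0 < B" "\<And>N m. 2 \<le> N \<Longrightarrow> 1 \<le> m \<Longrightarrow> ennreal (B * real m powr \<gamma>) \<le> Lp_norm p (packet e N m (\<lambda>i. bump \<phi>0 (z i)))"
  shows "\<xi> = b + rq q" "rq q \<le> \<alpha>" "\<gamma> \<le> rq q"
proof -
  let ?f = "\<lambda>y N m. packet e N m (\<lambda>i. bump \<phi>0 (y i))"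
  let ?D = "diff_besov_norm k b p q" and ?Y = "\<lambda>f. besov_norm \<phi>0 0 \<xi> p q (regular_distr f)"
  define \<beta> where "\<beta> = b + rq q"
  have p1: "1 \<le> p" using p by simp
  obtain c1 C1 where c1: "0 < c1" "0 < C1"
      "\<And>f. f \<in> diff_besov k b p q \<Longrightarrow> ennreal c1 * ?D f \<le> ?Y f \<and> ?Y f \<le> ennreal C1 * ?D f"
    using eq unfolding spaces_eq_def by blast
  obtain c2 C2 where c2: "0 < c2" "0 < C2"
    "\<And>N m y. 2 \<le> N \<Longrightarrow> 1 \<le> m \<Longrightarrow> m \<le> N \<Longrightarrow> ennreal (c2 * (real N powr \<xi> * real m powr rq q)) \<le> ?Y (?f y N m)"
    "\<And>N m y. 2 \<le> N \<Longrightarrow> 1 \<le> m \<Longrightarrow> m \<le> N \<Longrightarrow> ?Y (?f y N m) \<le> ennreal (C2 * (real N powr \<xi> * real m powr rq q))"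
    by (rule packet_besov_bounds[OF \<phi>0 e p q, of \<xi>]) blast
  obtain K1 where K1: "0 < K1" "\<And>N m y X. 2 \<le> N \<Longrightarrow> m \<le> N \<Longrightarrow> 1 \<le> X \<Longrightarrow> Lp_norm p (?f y N m) \<le> ennreal X \<Longrightarrow>
    ?D (?f y N m) \<le> ennreal (K1 * X * real N powr (b + rq q))"
    by (rule packet_diff_upper[OF \<phi>0 e p1 q b k]) blast
  obtain c3 K3 where c3: "0 < c3" "0 < K3" "\<And>N m y L. 3 \<le> N \<Longrightarrow> ennreal L \<le> Lp_norm p (?f y N m) \<Longrightarrow>
    ennreal (c3 * real N powr (b + rq q) * (L - K3 * real m * (1 / 2) ^ N)) \<le> ?D (?f y N m)"
    by (rule packet_diff_lower[OF \<phi>0 e p1 q b]) blast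
  \<comment> \<open>The equivalence of quasi-norms is available only for members of the space, so
    finiteness for packets comes first.\<close>
  have mem: "?f y N m \<in> diff_besov k b p q" if "2 \<le> N" "m \<le> N" for N m and y :: "nat \<Rightarrow> 'a"
  proof -
    have L: "?f y N m \<in> Lp p" by (rule schwartz_Lp[OF p1 packet_bump_schwartz[OF \<phi>0 e]])
    obtain x where x: "0 \<le> x" "Lp_norm p (?f y N m) = ennreal x" using Lp_finite[OF L] by (cases "Lp_norm p (?f y N m)") auto
    have "Lp_norm p (?f y N m) \<le> ennreal (1 + x)" unfolding x(2) by (rule ennreal_leI) simp
    then have "?D (?f y N m) \<le> ennreal (K1 * (1 + x) * real N powr (b + rq q))" using that x(1) by (intro K1) auto
    then have "?D (?f y N m) < \<infinity>" by (rule order_le_less_trans) simp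
    with L show ?thesis by (simp add: diff_besov_def)
  qed
  \<comment> \<open>\<open>U\<close> and \<open>V\<close> are the constants of the two inequalities;
    their sum serves both, as \<open>scale_exponents\<close> takes a single constant.\<close>
  define U where "U = C1 * K1 * (1 + A) / c2"
  define V where "V = C2 / (c1 * c3)"
  have UV: "0 < U" "0 < V" using c1 c2 c3 K1 up(1) by (simp_all add: U_def V_def)
  have 1: "real N powr \<xi> * real m powr rq q \<le> (U + V) * (real N powr \<beta> * real m powr \<alpha>)"
    if N: "3 \<le> N" and m: "1 \<le> m" "m \<le> N" for N m
  proof -
    have N2: "2 \<le> N" using N by simp
    have m1: "1 \<le> real m powr \<alpha>" using m \<alpha> by (intro ge_one_powr_ge_zero) auto
    \<comment> \<open>Enlarged from \<open>A\<close> so that it is at least 1, as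
      \<open>packet_diff_upper\<close> requires.\<close>
    let ?X = "(1 + A) * real m powr \<alpha>"
    have X: "1 \<le> ?X" using mult_mono[of 1 "1 + A" 1 "real m powr \<alpha>"] m1 up(1) by simp
    have "Lp_norm p (?f y N m) \<le> ennreal ?X"
      by (rule order_trans[OF up(2)[OF N2 m(1)]]) (intro ennreal_leI mult_right_mono, auto)
    from K1(2)[OF N2 m(2) X this] have D: "?D (?f y N m) \<le> ennreal (K1 * ?X * real N powr \<beta>)" unfolding \<beta>_def .
    have "ennreal (c2 * (real N powr \<xi> * real m powr rq q)) \<le> ?Y (?f y N m)" by (rule c2(3)[OF N2 m])
    also have "\<dots> \<le> ennreal C1 * ?D (?f y N m)" using c1(3)[OF mem[OF N2 m(2)]] by blast
    also have "\<dots> \<le> ennreal C1 * ennreal (K1 * ?X * real N powr \<beta>)" by (intro mult_left_mono D) simp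
    also have "\<dots> = ennreal (C1 * (K1 * ?X * real N powr \<beta>))" using c1(2) by (intro ennreal_mult'[symmetric]) simp
    finally have "c2 * (real N powr \<xi> * real m powr rq q) \<le> C1 * (K1 * ?X * real N powr \<beta>)"
      using c1(2) K1(1) up(1) by (subst (asm) ennreal_le_iff) auto
    then have "real N powr \<xi> * real m powr rq q \<le> U * (real N powr \<beta> * real m powr \<alpha>)"
      using c2(1) by (simp add: U_def field_simps)
    also have "\<dots> \<le> (U + V) * (real N powr \<beta> * real m powr \<alpha>)" using UV by (intro mult_right_mono) auto
    finally show ?thesis .
  qed
  have 2: "real N powr \<beta> * (B * real m powr \<gamma> - K3 * real m * (1 / 2) ^ N) \<le> (U + V) * (real N powr \<xi> * real m powr rq q)"
    if N: "3 \<le> N" and m: "1 \<le> m" "m \<le> N" for N m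
  proof -
    have N2: "2 \<le> N" using N by simp
    let ?E = "B * real m powr \<gamma> - K3 * real m * (1 / 2) ^ N"
    have "ennreal (c1 * (c3 * real N powr \<beta> * ?E)) = ennreal c1 * ennreal (c3 * real N powr \<beta> * ?E)"
      using c1(1) by (intro ennreal_mult') simp
    also have "\<dots> \<le> ennreal c1 * ?D (?f z N m)"
      unfolding \<beta>_def by (intro mult_left_mono c3(3)[OF N low(2)[OF N2 m(1)]]) simp
    also have "\<dots> \<le> ?Y (?f z N m)" using c1(3)[OF mem[OF N2 m(2)]] by blast
    also have "\<dots> \<le> ennreal (C2 * (real N powr \<xi> * real m powr rq q))" by (rule c2(4)[OF N2 m])
    finally have "c1 * (c3 * real N powr \<beta> * ?E) \<le> C2 * (real N powr \<xi> * real m powr rq q)"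
      using c2(2) by (subst (asm) ennreal_le_iff) auto
    then have "(c1 * c3) * (real N powr \<beta> * ?E) \<le> C2 * (real N powr \<xi> * real m powr rq q)" by (simp only: mult.assoc)
    then have "real N powr \<beta> * ?E \<le> C2 * (real N powr \<xi> * real m powr rq q) / (c1 * c3)"
      using mult_pos_pos[OF c1(1) c3(1)] by (simp only: pos_le_divide_eq mult.commute)
    also have "\<dots> = V * (real N powr \<xi> * real m powr rq q)" by (simp add: V_def)
    also have "\<dots> \<le> (U + V) * (real N powr \<xi> * real m powr rq q)" using UV by (intro mult_right_mono) auto
    finally show ?thesis .
  qed
  have UV0: "0 < U + V" using UV by simp
  note r = scale_exponents[OF UV0 low(1) c3(2) \<gamma> 1 2]
  show "\<xi> = b + rq q" "rq q \<le> \<alpha>" "\<gamma> \<le> rq q" using r unfolding \<beta>_def by blast+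
qed

text \<open>On either side of 2 the available norm bounds trap 1/q between 1/p and 1/2 in the order
  opposite to the true one, which forces p = 2; at p = 2 the same bounds give the value of
  1/q.\<close>

lemma spaces_eq_imp:
  assumes eq: "spaces_eq (diff_besov k b p q) (diff_besov_norm k b p q) (besov \<phi>0 0 \<xi> p q) (besov_norm \<phi>0 0 \<xi> p q)"
    and p: "1 < p" and q: "0 < q" and b: "- rq q < b" and k: "1 \<le> k"
  shows "p = 2" "rq q = 1 / 2" "\<xi> = b + rq q"
proof -
  define p' where "p' = p / (p - 1)"
  have pp: "1 < p'" "1 / p + 1 / p' = 1" using p by (auto simp: p'_def field_simps)
  define \<kappa> where "\<kappa> = (\<integral>x. (norm (inv_fourier \<phi>0 x))\<^sup>2 \<partial>lborel)"
  have \<kappa>: "0 < \<kappa>" unfolding \<kappa>_def by (rule inv_cutoff_energy_pos[OF \<phi>0])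
  have en: "(\<integral>x. (norm (bump \<phi>0 y x))\<^sup>2 \<partial>lborel) = \<kappa>" for y
    unfolding \<kappa>_def by (rule bump_energy[OF \<phi>0])
  let ?c = "\<lambda>N m. packet e N m (\<lambda>i. bump \<phi>0 0)" and ?s = "\<lambda>N m. packet e N m (\<lambda>i. bump \<phi>0 (real i *\<^sub>R e))"
  \<comment> \<open>An upper bound for the conjugate exponent with growth \<open>\<alpha>\<close>
    gives, by pairing with the energy, a lower bound with growth 1 -
    \<open>\<alpha>\<close>.\<close>
  have lower: "ennreal (\<kappa> / B * real m powr (1 - \<alpha>)) \<le> Lp_norm p (packet e N m (\<lambda>i. bump \<phi>0 (y i)))"
    if N: "2 \<le> N" and m: "1 \<le> m" and B: "0 < B"
      and u: "Lp_norm p' (packet e N m (\<lambda>i. bump \<phi>0 (y i))) \<le> ennreal (B * real m powr \<alpha>)" for N m B \<alpha> y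
  proof -
    have "ennreal (real m * \<kappa> / (B * real m powr \<alpha>)) \<le> Lp_norm p (packet e N m (\<lambda>i. bump \<phi>0 (y i)))"
      using B m \<kappa> by (intro packet_lower[OF e bump_bandlimited[OF \<phi>0] N en _ p pp _ u]) auto
    also have "real m * \<kappa> / (B * real m powr \<alpha>) = \<kappa> / B * real m powr (1 - \<alpha>)"
      using m by (simp add: powr_diff)
    finally show ?thesis .
  qed
  have cu: "\<exists>C>0. \<forall>N m. 2 \<le> N \<longrightarrow> 1 \<le> m \<longrightarrow> Lp_norm r (?c N m) \<le> ennreal (C * real m powr (1 / 2))"
    if "1 \<le> r" "r \<le> 2" for r
    by (rule packet_centered_upper[OF e bump_bandlimited[OF \<phi>0, of 0] that]) blast
  have su: "\<exists>C>0. \<forall>N m. Lp_norm r (?s N m) \<le> ennreal (C * real m powr (1 / r))" if r: "1 \<le> r" for r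
  proof -
    have gs: "inv_fourier \<phi>0 \<in> schwartz" by (rule inv_fourier_schwartz[OF cutoff_schwartz[OF \<phi>0]])
    show ?thesis
      unfolding bump_def[OF \<phi>0, abs_def] by (rule packet_spread_upper[OF e gs r]) blast
  qed
  \<comment> \<open>Coinciding translates give the upper bound with growth 1/2, and spread ones the
    lower bound with growth 1 - 1/p' = 1/p.\<close>
  have main: "1 / p \<le> rq q \<and> rq q \<le> 1 / 2 \<and> \<xi> = b + rq q" if p2: "p \<le> 2"
  proof -
    obtain A where A: "0 < A" "\<And>N m. 2 \<le> N \<Longrightarrow> 1 \<le> m \<Longrightarrow> Lp_norm p (?c N m) \<le> ennreal (A * real m powr (1 / 2))"
      using cu[of p] p p2 by auto
    obtain B where B: "0 < B" "\<And>N m. Lp_norm p' (?s N m) \<le> ennreal (B * real m powr (1 / p'))"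
      using su[of p'] pp by auto
    have "0 < \<kappa> / B" using \<kappa> B by simp
    moreover have "1 / p = 1 - 1 / p'" using pp by simp
    then have "ennreal (\<kappa> / B * real m powr (1 / p)) \<le> Lp_norm p (?s N m)" if "2 \<le> N" "1 \<le> m" for N m
      using lower[OF that B] by simp
    ultimately show ?thesis
      using spaces_eq_exponents[OF eq p q b k, of "1 / 2" "1 / p" A "\<lambda>i. 0" "\<kappa> / B" "\<lambda>i. real i *\<^sub>R e"] A p
      by simp
  qed
  \<comment> \<open>Now p' \<le> 2, so the centred bound is available for the conjugate exponent:
    spread translates give the upper bound, coinciding ones the lower bound with growth 1/2.\<close>
  have main': "1 / 2 \<le> rq q \<and> rq q \<le> 1 / p" if p2: "2 \<le> p"
  proof -
    have p'2: "p' \<le> 2" using p p2 by (simp add: p'_def divide_le_eq)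
    obtain A where A: "0 < A" "\<And>N m. Lp_norm p (?s N m) \<le> ennreal (A * real m powr (1 / p))"
      using su[of p] p by auto
    obtain B where B: "0 < B" "\<And>N m. 2 \<le> N \<Longrightarrow> 1 \<le> m \<Longrightarrow> Lp_norm p' (?c N m) \<le> ennreal (B * real m powr (1 / 2))"
      using cu[of p'] pp p'2 by auto
    have "0 < \<kappa> / B" using \<kappa> B by simp
    moreover have "ennreal (\<kappa> / B * real m powr (1 / 2)) \<le> Lp_norm p (?c N m)" if "2 \<le> N" "1 \<le> m" for N m
      using lower[OF that B(1) B(2)[OF that]] by simp
    ultimately show ?thesis
      using spaces_eq_exponents[OF eq p q b k, of "1 / p" "1 / 2" A "\<lambda>i. real i *\<^sub>R e" "\<kappa> / B" "\<lambda>i. 0"] A p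
      by simp
  qed
  have "\<not> p < 2"
  proof
    assume "p < 2"
    then have "p \<le> 2" "1 / 2 < 1 / p" using p by (auto simp: field_simps)
    then show False using main by linarith
  qed
  moreover have "\<not> 2 < p"
  proof
    assume "2 < p"
    then have "2 \<le> p" "1 / p < 1 / 2" by (auto simp: field_simps)
    then show False using main' by linarith
  qed
  ultimately show p2: "p = 2" by simp
  show "rq q = 1 / 2" "\<xi> = b + rq q" using main main' p2 by auto
qed

end

theorem theorem9p6:
  fixes p b \<xi> :: real and q :: ereal and k :: nat
    and \<phi>0 :: "real ^ 'd \<Rightarrow> complex"
  assumes p: "2 * real CARD('d) / (real CARD('d) + 1) < p"
    and q: "0 < q"
    and b: "- (1 / q) < ereal b"
    and k: "1 \<le> k"
    and \<phi>0: "lp_cutoff \<phi>0"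
  shows "spaces_eq
           (diff_besov k b p q) (diff_besov_norm k b p q)
           (besov \<phi>0 0 \<xi> p q) (besov_norm \<phi>0 0 \<xi> p q)
         \<longleftrightarrow> p = 2 \<and> q = 2 \<and> \<xi> = b + 1 / 2"
proof
  have "1 \<le> real CARD('d)" by (simp add: Suc_leI)
  \<comment> \<open>The quotient 2 d / (d + 1) is at least 1 for d \<ge> 1, so p > 1 and a conjugate
    exponent exists.\<close>
  then have "1 \<le> 2 * real CARD('d) / (real CARD('d) + 1)" by (simp add: le_divide_eq)
  then have p1: "1 < p" using p by linarith
  have rb: "- rq q < b" by (rule rq_bound[OF q b])
  {
    assume eq: "spaces_eq (diff_besov k b p q) (diff_besov_norm k b p q) (besov \<phi>0 0 \<xi> p q) (besov_norm \<phi>0 0 \<xi> p q)"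
    obtain e :: "real ^ 'd" where "e \<in> Basis" using nonempty_Basis by blast
    then have e: "norm e = 1" by simp
    note r = spaces_eq_imp[OF \<phi>0 e eq p1 q rb k]
    have "q = 2"
      using pos_ereal_cases[OF q] r(2) by (auto simp: rq_def field_simps)
    then show "p = 2 \<and> q = 2 \<and> \<xi> = b + 1 / 2" using r by simp
  }
  assume h: "p = 2 \<and> q = 2 \<and> \<xi> = b + 1 / 2"
  \<comment> \<open>The condition b > -1/q, read at q = 2.\<close>
  then have "- 1 / 2 < b" using rb by (auto simp: rq_def)
  then show "spaces_eq (diff_besov k b p q) (diff_besov_norm k b p q) (besov \<phi>0 0 \<xi> p q) (besov_norm \<phi>0 0 \<xi> p q)"
    using spaces_eq_hilbert[OF \<phi>0 _ k, of b] h by simp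
qed

end
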